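(* Let $\mathbb{F}$ be a field, let $m$, $n$, $r\le\min\{m,n\}$ be positive integers and $d$ a non negative integer. Let $\alpha_1(s)\mid\dots\mid\alpha_r(s)$ be monic polynomials in $\mathbb{F}[s]$ and let $(f_r,\dots,f_1)$, $(k_1,\dots,k_r)$, $(\ell_1,\dots,\ell_r)$, $(d_1,\dots,d_{n-r})$, $(v_1,\dots,v_{m-r})$ be partitions of non negative integers. Let $g_1\ge\dots\ge g_r$ be the decreasing reordering of $k_r+\ell_1,\,k_{r-1}+\ell_2,\dots,k_1+\ell_r$. Consider the conditions (a) $\sum_{i=1}^{m-r}v_i=\sum_{i=1}^r k_i$ and $\sum_{i=1}^{n-r}d_i=\sum_{i=1}^r\ell_i$; (b) $f_1=0$; (c) $(d-g_r,\dots,d-g_1)\prec(\deg(\alpha_r)+f_r,\dots,\deg(\alpha_1)+f_1)$. (Necessity, arbitrary field.) If $A(s)\in\mathbb{F}[s]^{m\times n}$ is a polynomial matrix with $\operatorname{rank}(A(s))=r$, $\deg(A(s))=d$, $\alpha_1(s),\dots,\alpha_r(s)$ as invariant factors, $f_1,\dots,f_r$ as partial multiplicities of $\infty$, $k_1,\dots,k_r$ as col-span minimal indices, $\ell_1,\dots,\ell_r$ as row-span minimal indices, and $d_1,\dots,d_{n-r}$ and $v_1,\dots,v_{m-r}$ as right and left minimal indices, respectively, then (a), (b) and (c) hold. (Sufficiency.) Conversely, if $\mathbb{F}$ is algebraically closed, conditions (a), (b) and (c) are sufficient for the existence of a polynomial matrix $A(s)\in\mathbb{F}[s]^{m\times n}$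 with $\operatorname{rank}(A(s))=r$, $\deg(A(s))=d$, $\alpha_1(s),\dots,\alpha_r(s)$ as invariant factors, $f_1,\dots,f_r$ as partial multiplicities of $\infty$, $k_1,\dots,k_r$ as col-span minimal indices, $\ell_1,\dots,\ell_r$ as row-span minimal indices, and $d_1,\dots,d_{n-r}$ and $v_1,\dots,v_{m-r}$ as right and left minimal indices, respectively.
   Context: $\mathbb{F}[s]$ is the ring of polynomials and $\mathbb{F}(s)$ its field of fractions. The rank of a polynomial matrix is its rank over $\mathbb{F}(s)$. The degree of a polynomial matrix is the highest degree of its entries ($-\infty$ for the zero matrix). Empty sums are $0$. Invariant factors: a polynomial matrix $P(s)\in\mathbb{F}[s]^{m\times n}$ of rank $r$ can be written $U(s)P(s)V(s)=\begin{bmatrix}\operatorname{diag}(\alpha_1(s),\dots,\alpha_r(s))&0\\0&0\end{bmatrix}$ (Smith form), with $U,V$ unimodular (square polynomial matrices with polynomial inverse) and $\alpha_1(s)\mid\dots\mid\alpha_r(s)$ monic; the $\alpha_i$ are uniquely determined and are the invariant factors of $P(s)$. Partial multiplicities of $\infty$: if $\deg(P(s))=d$, put $\operatorname{rev}P(t)=t^dP(1/t)$. The partial multiplicities of $\infty$ in $P(s)$ are the integers $0\le f_1\le\dots\le f_r$ where $f_i$ is the exponent of $t$ in the $i$-th invariant factor of $\operatorname{rev}P(t)$ (zero exponents included). For $P(s)\in\mathbb{F}(s)^{m\times n}$, $\mathcal{R}(P(s))\subseteq\mathbb{F}(s)^m$ is the $\mathbb{F}(s)$-subspace spanned by the columns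 of $P(s)$; $\mathcal{N}_r(P(s))=\{x(s)\in\mathbb{F}(s)^n: P(s)x(s)=0\}$ and $\mathcal{N}_\ell(P(s))=\{x(s)\in\mathbb{F}(s)^m: x(s)^TP(s)=0\}$. A polynomial basis of a subspace $\mathcal{V}$ of $\mathbb{F}(s)^p$ is a basis consisting of polynomial vectors; its order is the sum of the degrees of its vectors (degree of a vector = maximum degree of its entries). A minimal basis of $\mathcal{V}$ is a polynomial basis of least order. The decreasingly ordered list of degrees of the vectors is the same for all minimal bases of $\mathcal{V}$; these degrees are the minimal indices of $\mathcal{V}$. The col-span, row-span, right and left minimal indices of $P(s)$ are the minimal indices of $\mathcal{R}(P(s))$, $\mathcal{R}(P(s)^T)$, $\mathcal{N}_r(P(s))$ and $\mathcal{N}_\ell(P(s))$, respectively, each ordered decreasingly. A partition is a non-increasing sequence of non negative integers. For sequences of integers $a_1\ge\dots\ge a_r$ and $b_1\ge\dots\ge b_r$, $(a_1,\dots,a_r)\prec(b_1,\dots,b_r)$ (majorization) means $\sum_{i=1}^k a_i\le\sum_{i=1}^k b_i$ for $1\le k\le r-1$ and $\sum_{i=1}^r a_i=\sum_{i=1}^r b_i$. *)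

theory Defs
  imports
    "Jordan_Normal_Form.DL_Rank"
    "Jordan_Normal_Form.Matrix_Kernel"
    "HOL-Computational_Algebra.Polynomial_Factorial"
begin

section \<open>Polynomial matrices over the field of rational functions\<close>

definition fract_mat :: "'a::field poly mat \<Rightarrow> 'a poly fract mat" where
  "fract_mat P = map_mat to_fract P"

definition fract_vec :: "'a::field poly vec \<Rightarrow> 'a poly fract vec" where
  "fract_vec v = map_vec to_fract v"

definition poly_mat_rank :: "'a::field poly mat \<Rightarrow> nat" where
  "poly_mat_rank P = vec_space.rank (dim_row P) (fract_mat P)"

text \<open>As for \<^const>\<open>degree\<close>, the degree of the zero matrix (or vector) is here 0 instead of minus
  infinity. Nothing below depends on it: the matrices of interest have positive rank, and bases
  contain no zero vector.\<close>

definition mat_degree :: "'a::field poly mat \<Rightarrow> nat" where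
  "mat_degree P = Max (insert 0 (degree ` elements_mat P))"

definition vec_degree :: "'a::field poly vec \<Rightarrow> nat" where
  "vec_degree v = Max (insert 0 (degree ` set\<^sub>v v))"


section \<open>Invariant factors and partial multiplicities of infinity\<close>

text \<open>Over the ring of polynomials, \<^const>\<open>invertible_mat\<close> is unimodularity.
  A list holds the invariant factors in their usual order, each dividing the next one.\<close>

definition has_invariant_factors :: "'a::field poly mat \<Rightarrow> 'a poly list \<Rightarrow> bool" where
  "has_invariant_factors P \<alpha> \<longleftrightarrow>
     length \<alpha> = poly_mat_rank P \<and>
     (\<forall>a\<in>set \<alpha>. lead_coeff a = 1) \<and>
     (\<forall>i. Suc i < length \<alpha> \<longrightarrow> \<alpha> ! i dvd \<alpha> ! Suc i) \<and>
     (\<exists>U V. U \<in> carrier_mat (dim_row P) (dim_row P) \<and> invertible_mat U \<and>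
            V \<in> carrier_mat (dim_col P) (dim_col P) \<and> invertible_mat V \<and>
            U * P * V = mat (dim_row P) (dim_col P)
              (\<lambda>(i, j). if i = j \<and> i < length \<alpha> then \<alpha> ! i else 0))"

text \<open>\<open>rev_poly d p\<close> is \<open>t ^ d * p (1 / t)\<close>, for \<open>p\<close> of degree at most \<open>d\<close>.\<close>

definition rev_poly :: "nat \<Rightarrow> 'a::field poly \<Rightarrow> 'a poly" where
  "rev_poly d p = (\<Sum>i\<le>d. monom (coeff p i) (d - i))"

definition rev_mat :: "'a::field poly mat \<Rightarrow> 'a poly mat" where
  "rev_mat P = map_mat (rev_poly (mat_degree P)) P"

definition has_infinite_partial_multiplicities :: "'a::field poly mat \<Rightarrow> nat list \<Rightarrow> bool" where
  "has_infinite_partial_multiplicities P f \<longleftrightarrow>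
     (\<exists>\<beta>. has_invariant_factors (rev_mat P) \<beta> \<and> f = map (order 0) \<beta>)"


section \<open>Minimal bases and minimal indices\<close>

definition polynomial_basis ::
  "nat \<Rightarrow> 'a::field poly fract vec set \<Rightarrow> 'a poly vec set \<Rightarrow> bool" where
  "polynomial_basis p W B \<longleftrightarrow>
     finite B \<and>
     vectorspace.basis class_ring
       ((module_vec TYPE('a poly fract) p)\<lparr>carrier := W\<rparr>) (fract_vec ` B)"

definition basis_order :: "'a::field poly vec set \<Rightarrow> nat" where
  "basis_order B = (\<Sum>v\<in>B. vec_degree v)"

definition minimal_basis ::
  "nat \<Rightarrow> 'a::field poly fract vec set \<Rightarrow> 'a poly vec set \<Rightarrow> bool" where
  "minimal_basis p W B \<longleftrightarrow>
     polynomial_basis p W B \<and> (\<forall>C. polynomial_basis p W C \<longrightarrow> basis_order B \<le> basis_order C)"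

definition is_partition :: "nat list \<Rightarrow> bool" where
  "is_partition xs \<longleftrightarrow> sorted_wrt (\<ge>) xs"

definition has_minimal_indices ::
  "nat \<Rightarrow> 'a::field poly fract vec set \<Rightarrow> nat list \<Rightarrow> bool" where
  "has_minimal_indices p W ks \<longleftrightarrow>
     is_partition ks \<and>
     (\<exists>B. minimal_basis p W B \<and> mset ks = image_mset vec_degree (mset_set B))"

definition left_kernel :: "'a::field mat \<Rightarrow> 'a vec set" where
  "left_kernel A = {x \<in> carrier_vec (dim_row A). mat_of_row x * A = 0\<^sub>m 1 (dim_col A)}"

definition has_col_span_minimal_indices :: "'a::field poly mat \<Rightarrow> nat list \<Rightarrow> bool" where
  "has_col_span_minimal_indices P ks \<longleftrightarrow>
     has_minimal_indices (dim_row P) (vec_space.col_space (dim_row P) (fract_mat P)) ks"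

definition has_row_span_minimal_indices :: "'a::field poly mat \<Rightarrow> nat list \<Rightarrow> bool" where
  "has_row_span_minimal_indices P ks \<longleftrightarrow>
     has_minimal_indices (dim_col P) (vec_space.row_space (dim_col P) (fract_mat P)) ks"

definition has_right_minimal_indices :: "'a::field poly mat \<Rightarrow> nat list \<Rightarrow> bool" where
  "has_right_minimal_indices P ks \<longleftrightarrow>
     has_minimal_indices (dim_col P) (mat_kernel (fract_mat P)) ks"

definition has_left_minimal_indices :: "'a::field poly mat \<Rightarrow> nat list \<Rightarrow> bool" where
  "has_left_minimal_indices P ks \<longleftrightarrow>
     has_minimal_indices (dim_row P) (left_kernel (fract_mat P)) ks"


section \<open>Majorization and the prescribed data\<close>

text \<open>Meant for non-increasing lists; it does not reorder them.\<close>

definition majorized_by :: "int list \<Rightarrow> int list \<Rightarrow> bool" where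
  "majorized_by a b \<longleftrightarrow>
     length a = length b \<and>
     (\<forall>k\<in>{1..length a - 1}. sum_list (take k a) \<le> sum_list (take k b)) \<and>
     sum_list a = sum_list b"

definition has_structural_data ::
  "'a::field poly mat \<Rightarrow> nat \<Rightarrow> nat \<Rightarrow> 'a poly list \<Rightarrow> nat list \<Rightarrow>
     nat list \<Rightarrow> nat list \<Rightarrow> nat list \<Rightarrow> nat list \<Rightarrow> bool" where
  "has_structural_data A r d \<alpha> f k l ds vs \<longleftrightarrow>
     poly_mat_rank A = r \<and>
     mat_degree A = d \<and>
     has_invariant_factors A \<alpha> \<and>
     has_infinite_partial_multiplicities A f \<and>
     has_col_span_minimal_indices A k \<and>
     has_row_span_minimal_indices A l \<and>
     has_right_minimal_indices A ds \<and>
     has_left_minimal_indices A vs"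

end

theory Submission
  imports Defs "HOL-Combinatorics.List_Permutation"
begin

text \<open>
  The theorem reduces to square matrices. If \<open>A\<close> has rank \<open>r\<close>, let the columns of \<open>L\<close> and \<open>R\<close> be minimal
  bases of its column space and of its row space. Then \<open>A = L * E * R\<^sup>T\<close> with \<open>E\<close> square of size \<open>r\<close> and
  \<open>det E \<noteq> 0\<close>. Minimal bases have polynomial left inverses, so \<open>E\<close> has the same invariant factors as \<open>A\<close>.
  Their leading column coefficients are independent, so \<open>E\<^sub>i\<^sub>j\<close> has degree at most \<open>d - k\<^sub>i - l\<^sub>j\<close>, and the
  reversal of \<open>A\<close> is \<open>L' * H * R'\<^sup>T\<close>, where \<open>L'\<close> and \<open>R'\<close> reverse each column in its own degree and
  \<open>H\<^sub>i\<^sub>j\<close> is the reversal of \<open>E\<^sub>i\<^sub>j\<close> in degree \<open>d - k\<^sub>i - l\<^sub>j\<close>. The matrices \<open>L'\<close> and \<open>R'\<close> have full rank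
  at \<open>0\<close>, so \<open>H\<close> shows the partial multiplicities of \<open>A\<close> at infinity. All structural data are now carried by a
  square matrix \<open>E\<close> with weights \<open>k\<^sub>i\<close> on its rows and \<open>l\<^sub>j\<close> on its columns.

  Necessity. Condition (a) says that a minimal basis of a space and one of its orthogonal complement have
  the same order; each order bounds the other from below (\<open>minimal_basis_dual_order_le\<close>). Condition (b)
  holds because some entry of \<open>A\<close> attains the degree \<open>d\<close>. For (c), take a nonzero minor of \<open>E\<close> with rows
  \<open>I\<close> and columns \<open>J\<close>. Its degree and the order at \<open>0\<close> of the same minor of \<open>H\<close> add up to the sum of
  \<open>d - k\<^sub>i - l\<^sub>j\<close> over the chosen rows and columns (\<open>degree_det_plus_order\<close>), while the products of the first
  invariant factors divide these minors (\<open>minor_dvd\<close>). The sharp inequality comes from a minor of large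
  weight (\<open>heavy_minor_exists\<close>). It gives one inequality for every set of indices, and the family of all
  these inequalities is the majorization (c) (\<open>majorized_by_sort_iff\<close>).

  Sufficiency. Condition (a) allows the construction of \<open>L\<close> and \<open>R\<close> with the prescribed degrees
  (\<open>dual_bases_exist\<close>), and any \<open>E\<close> with the degree bounds and \<open>det E \<noteq> 0\<close> can be put between them. The
  Smith forms of \<open>E\<close> and of \<open>H\<close> are two affine views of one object on the projective line. Choose a point
  \<open>c\<close> at which no invariant factor vanishes and pass to the coordinate \<open>1 / (s - c)\<close>. In this coordinate
  nothing is left at infinity: finite factors and multiplicities of infinity merge into polynomials
  \<open>\<alpha>'\<^sub>i\<close> of degree \<open>deg \<alpha>\<^sub>i + f\<^sub>i\<close>, and what is needed is a triangular matrix with these invariant factors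
  whose diagonal entries have the degrees \<open>d - k\<^sub>r\<^sub>+\<^sub>1\<^sub>-\<^sub>i - l\<^sub>i\<close>. It exists under (c)
  (\<open>triangular_form_exists\<close>); here algebraic closedness supplies divisors of every degree. Going back to
  the original coordinate and to the one at infinity preserves the Smith form (\<open>homogenized_Smith_form\<close>).
\<close>

section \<open>Divisibility of minors\<close>

text \<open>The \<open>j\<close>-th smallest element of \<open>S\<close>, counted from \<open>0\<close>, is at least \<open>j\<close>, so its factor is divisible by \<open>\<gamma> j\<close>.\<close>

lemma prod_chain_dvd:
  fixes \<gamma> :: "nat \<Rightarrow> 'a::comm_semiring_1"
  assumes chain: "\<And>i. Suc i < r \<Longrightarrow> \<gamma> i dvd \<gamma> (Suc i)" and S: "S \<subseteq> {..<r}"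
  shows "(\<Prod>i<card S. \<gamma> i) dvd (\<Prod>i\<in>S. \<gamma> i)"
  using S
proof (induction "card S" arbitrary: S)
  case 0
  then show ?case by simp
next
  case (Suc j)
  have fin: "finite S" using Suc.prems finite_subset by blast
  have ne: "S \<noteq> {}" using Suc.hyps by auto
  define x where "x = Max S"
  have xS: "x \<in> S" unfolding x_def using fin ne by (rule Max_in)
  have cS: "card (S - {x}) = j" using Suc.hyps(2) xS fin by simp
  have "S \<subseteq> {..x}" unfolding x_def using fin by auto
  hence "card S \<le> Suc x" by (metis card_atMost card_mono finite_atMost)
  hence jx: "j \<le> x" using Suc.hyps by simp
  have xr: "x < r" using xS Suc.prems by auto
  have mono: "\<gamma> j dvd \<gamma> y" if "j \<le> y" "y < r" for y
    using that
  proof (induction y rule: dec_induct)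
    case (step y) then show ?case using chain[of y] dvd_trans by auto
  qed simp
  have "(\<Prod>i<j. \<gamma> i) dvd (\<Prod>i\<in>S-{x}. \<gamma> i)" using Suc.hyps(1)[of "S-{x}"] cS Suc.prems by auto
  then have "(\<Prod>i<j. \<gamma> i) * \<gamma> j dvd (\<Prod>i\<in>S-{x}. \<gamma> i) * \<gamma> x"
    using mono[OF jx xr] by (rule mult_dvd_mono)
  moreover have "(\<Prod>i\<in>S. \<gamma> i) = (\<Prod>i\<in>S-{x}. \<gamma> i) * \<gamma> x"
    using prod.remove[OF fin xS, of \<gamma>] by (simp add: mult.commute)
  ultimately show ?case using Suc.hyps(2)[symmetric] by simp
qed

text \<open>Multilinearity in the rows expands the determinant into terms indexed by maps from the \<open>j\<close> rows to
  \<open>{..<r}\<close>. A term of an injective map contains a product of \<open>j\<close> distinct \<open>\<gamma> i\<close>; the other terms have two equal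
  rows. Through this lemma, invariant factors constrain all minors, and Smith forms are compared.\<close>

lemma minor_dvd:
  fixes \<gamma> :: "nat \<Rightarrow> 'a::comm_ring_1"
  assumes chain: "\<And>i. Suc i < r \<Longrightarrow> \<gamma> i dvd \<gamma> (Suc i)"
    and X: "X \<in> carrier_mat j r" and Y: "Y \<in> carrier_mat r j"
  shows "(\<Prod>i<j. \<gamma> i) dvd det (X * mat_diag r \<gamma> * Y)"
proof -
  let ?a = "\<lambda>i k. (X $$ (i,k) * \<gamma> k) \<cdot>\<^sub>v row Y k"
  have XD: "X * mat_diag r \<gamma> = mat j r (\<lambda>(i,k). X $$ (i,k) * \<gamma> k)"
    using mat_diag_mult_right[OF X, of \<gamma>] by (simp add: mult.commute)
  have "X * mat_diag r \<gamma> * Y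
      = mat\<^sub>r j j (\<lambda>i. finsum_vec TYPE('a) j (\<lambda>k. (X * mat_diag r \<gamma>) $$ (i,k) \<cdot>\<^sub>v row Y k) {0..<r})"
    by (rule mat_mul_finsum_alt) (use X Y in auto)
  also have "\<dots> = mat\<^sub>r j j (\<lambda>i. finsum_vec TYPE('a) j (?a i) {0..<r})"
  proof (rule eq_rowI, goal_cases)
    case (1 i)
    have "finsum_vec TYPE('a) j (\<lambda>k. (X * mat_diag r \<gamma>) $$ (i,k) \<cdot>\<^sub>v row Y k) {0..<r}
       = finsum_vec TYPE('a) j (?a i) {0..<r}"
      unfolding finsum_vec_def
      by (rule comm_monoid.finprod_cong'[OF comm_monoid_vec])
         (use 1 Y XD in \<open>auto simp: monoid_vec_simps\<close>)
    then show ?case using 1 Y by (auto simp: mat_row_carrierI)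
  qed auto
  finally have "det (X * mat_diag r \<gamma> * Y) =
     sum (\<lambda>f. det (mat\<^sub>r j j (\<lambda>i. ?a i (f i)))) {f. (\<forall>i\<in>{0..<j}. f i \<in> {0..<r}) \<and> (\<forall>i. i \<notin> {0..<j} \<longrightarrow> f i = i)}"
    using det_linear_rows_sum[of "{0..<r}" ?a j] Y by auto
  moreover have "(\<Prod>i<j. \<gamma> i) dvd det (mat\<^sub>r j j (\<lambda>i. ?a i (f i)))" if f: "\<forall>i\<in>{0..<j}. f i \<in> {0..<r}" for f
  proof -
    have *: "det (mat\<^sub>r j j (\<lambda>i. ?a i (f i))) = (\<Prod>i=0..<j. X $$ (i,f i) * \<gamma> (f i)) * det (mat\<^sub>r j j (\<lambda>i. row Y (f i)))"
      by (rule det_rows_mul) (use Y f in auto)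
    show ?thesis
    proof (cases "inj_on f {0..<j}")
      case True
      then have "(\<Prod>i=0..<j. \<gamma> (f i)) = prod \<gamma> (f ` {0..<j})" by (simp add: prod.reindex)
      moreover have "(\<Prod>i<card (f ` {0..<j}). \<gamma> i) dvd prod \<gamma> (f ` {0..<j})"
        by (rule prod_chain_dvd[where r = r]) (use f chain in auto)
      ultimately show ?thesis unfolding * using True by (simp add: card_image prod.distrib)
    next
      case False
      then obtain a b where ab: "a \<noteq> b" "a < j" "b < j" "f a = f b" unfolding inj_on_def by auto
      have "det (mat\<^sub>r j j (\<lambda>i. row Y (f i))) = 0"
        by (rule det_identical_rows[OF _ ab(1-3)]) (use Y f ab in auto)
      then show ?thesis unfolding * by simp
    qed
  qed
  ultimately show ?thesis by (auto intro!: dvd_sum)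
qed

section \<open>Unimodular matrices\<close>

text \<open>Associativity with premises on dimensions, which the simplifier can discharge; the dimensions in the carrier
  premises of \<open>assoc_mult_mat\<close> would have to be guessed.\<close>

lemma mult_mat_assoc_dim:
  fixes A :: "'a::semiring_0 mat"
  assumes "dim_col A = dim_row B" "dim_col B = dim_row C"
  shows "(A * B) * C = A * (B * C)"
  by (rule assoc_mult_mat[of _ "dim_row A" "dim_row B" _ "dim_row C" _ "dim_col C"]) (use assms in auto)

definition unimodular :: "nat \<Rightarrow> 'a::comm_ring_1 mat \<Rightarrow> bool" where
  "unimodular n U \<longleftrightarrow> U \<in> carrier_mat n n \<and> (\<exists>V\<in>carrier_mat n n. U * V = 1\<^sub>m n \<and> V * U = 1\<^sub>m n)"

lemma mult_inverse_cancel: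
  fixes A :: "'a::semiring_1 mat"
  assumes "A * B = 1\<^sub>m n" "dim_col A = dim_row B" "dim_col B = dim_row X" "dim_row X = n"
  shows "A * (B * X) = X"
  using assms by (metis left_mult_one_mat mult_mat_assoc_dim carrier_matI)

lemma left_inverse_imp_right_inverse:
  fixes A :: "'a::comm_ring_1 mat"
  assumes A: "A \<in> carrier_mat n n" and B: "B \<in> carrier_mat n n" and AB: "A * B = 1\<^sub>m n"
  shows "B * A = 1\<^sub>m n"
proof -
  let ?C = "det B \<cdot>\<^sub>m adj_mat A"
  have C: "?C \<in> carrier_mat n n" using adj_mat(1)[OF A] by auto
  have d: "det B * det A = 1" using det_mult[OF A B] AB by (simp add: mult.commute)
  have CA: "?C * A = 1\<^sub>m n"
    using adj_mat[OF A] A d by (simp add: mult_smult_assoc_mat) (auto intro!: eq_matI simp: d)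
  have "?C = ?C * (A * B)" unfolding AB by (rule right_mult_one_mat[OF C, symmetric])
  also have "\<dots> = B" using assoc_mult_mat[OF C A B] CA B by simp
  finally show ?thesis using CA by simp
qed

lemma unimodularI:
  assumes "A \<in> carrier_mat n n" "B \<in> carrier_mat n n" "A * B = 1\<^sub>m n"
  shows "unimodular n A"
  unfolding unimodular_def using assms left_inverse_imp_right_inverse by blast

lemma unimodularE:
  assumes "unimodular n U"
  obtains V where "U \<in> carrier_mat n n" "V \<in> carrier_mat n n" "U * V = 1\<^sub>m n" "V * U = 1\<^sub>m n" "unimodular n V"
  using assms unfolding unimodular_def by blast

lemma unimodular_carrier: "unimodular n U \<Longrightarrow> U \<in> carrier_mat n n"
  unfolding unimodular_def by blast

lemma unimodular_iff_invertible_mat: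
  "unimodular n U \<longleftrightarrow> U \<in> carrier_mat n n \<and> invertible_mat U"
proof
  assume "unimodular n U"
  then show "U \<in> carrier_mat n n \<and> invertible_mat U"
    unfolding unimodular_def invertible_mat_def inverts_mat_def square_mat.simps by auto
next
  assume a: "U \<in> carrier_mat n n \<and> invertible_mat U"
  then obtain B where B: "U * B = 1\<^sub>m n" "B * U = 1\<^sub>m (dim_row B)"
    unfolding invertible_mat_def inverts_mat_def by auto
  have "dim_row B = n" using arg_cong[OF B(2), of dim_col] a by auto
  moreover have "dim_col B = n" using arg_cong[OF B(1), of dim_col] by auto
  ultimately show "unimodular n U" using B a unfolding unimodular_def by (metis carrier_matI)
qed

lemma unimodular_one [simp]: "unimodular n (1\<^sub>m n)"
  unfolding unimodular_def by (auto intro: bexI[of _ "1\<^sub>m n"])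

lemma unimodular_mult:
  assumes "unimodular n U" "unimodular n V"
  shows "unimodular n (U * V)"
proof -
  obtain U' where U: "U \<in> carrier_mat n n" "U' \<in> carrier_mat n n" "U * U' = 1\<^sub>m n"
    using assms(1) unfolding unimodular_def by blast
  obtain V' where V: "V \<in> carrier_mat n n" "V' \<in> carrier_mat n n" "V * V' = 1\<^sub>m n"
    using assms(2) unfolding unimodular_def by blast
  have "(U * V) * (V' * U') = 1\<^sub>m n" using U V by (simp add: mult_mat_assoc_dim mult_inverse_cancel del: assoc_mult_mat)
  then show ?thesis using U V by (intro unimodularI[of _ _ "V' * U'"]) (auto simp: mult_mat_assoc_dim mult_inverse_cancel simp del: assoc_mult_mat)
qed

lemma unimodular_transpose:
  assumes "unimodular n U" shows "unimodular n U\<^sup>T"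
proof -
  obtain V where V: "U \<in> carrier_mat n n" "V \<in> carrier_mat n n" "V * U = 1\<^sub>m n"
    using assms unfolding unimodular_def by blast
  have "U\<^sup>T * V\<^sup>T = 1\<^sub>m n" using transpose_mult[OF V(2,1)] V(3) by simp
  then show ?thesis using V by (intro unimodularI[of _ _ "V\<^sup>T"]) auto
qed

lemma unimodular_four_block_diag:
  assumes "unimodular n U" "unimodular m V"
  shows "unimodular (n + m) (four_block_mat U (0\<^sub>m n m) (0\<^sub>m m n) V)"
proof -
  obtain U' where U: "U \<in> carrier_mat n n" "U' \<in> carrier_mat n n" "U * U' = 1\<^sub>m n"
    using assms(1) unfolding unimodular_def by blast
  obtain V' where V: "V \<in> carrier_mat m m" "V' \<in> carrier_mat m m" "V * V' = 1\<^sub>m m"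
    using assms(2) unfolding unimodular_def by blast
  show ?thesis
    by (rule unimodularI[of _ _ "four_block_mat U' (0\<^sub>m n m) (0\<^sub>m m n) V'"])
       (use U V in \<open>auto simp: mult_four_block_mat[of _ n n _ m _ m _ _ n _ m] four_block_one_mat\<close>)
qed

lemma uminus_zero_mat [simp]: "- 0\<^sub>m n m = (0\<^sub>m n m :: 'a::group_add mat)"
  by (intro eq_matI) auto

lemma unimodular_block_lower:
  fixes C :: "'a::comm_ring_1 mat"
  assumes C: "C \<in> carrier_mat m n"
  shows "unimodular (n + m) (four_block_mat (1\<^sub>m n) (0\<^sub>m n m) C (1\<^sub>m m))"
proof (rule unimodularI)
  show "four_block_mat (1\<^sub>m n) (0\<^sub>m n m) (- C) (1\<^sub>m m) \<in> carrier_mat (n + m) (n + m)" using C by auto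
  show "four_block_mat (1\<^sub>m n) (0\<^sub>m n m) C (1\<^sub>m m) * four_block_mat (1\<^sub>m n) (0\<^sub>m n m) (- C) (1\<^sub>m m) = 1\<^sub>m (n + m)"
    by (subst mult_four_block_mat[of _ n n _ m _ m _ _ n _ m]) (use C uminus_l_inv_mat[OF C] in \<open>auto simp: comm_add_mat[of C m n "-C"]\<close>)
qed (use C in auto)

lemma unimodular_block_upper:
  fixes C :: "'a::comm_ring_1 mat"
  assumes C: "C \<in> carrier_mat n m"
  shows "unimodular (n + m) (four_block_mat (1\<^sub>m n) C (0\<^sub>m m n) (1\<^sub>m m))"
proof (rule unimodularI)
  show "four_block_mat (1\<^sub>m n) (- C) (0\<^sub>m m n) (1\<^sub>m m) \<in> carrier_mat (n + m) (n + m)" using C by auto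
  show "four_block_mat (1\<^sub>m n) C (0\<^sub>m m n) (1\<^sub>m m) * four_block_mat (1\<^sub>m n) (- C) (0\<^sub>m m n) (1\<^sub>m m) = 1\<^sub>m (n + m)"
    by (subst mult_four_block_mat[of _ n n _ m _ m _ _ n _ m]) (use C minus_r_inv_mat[OF C] uminus_l_inv_mat[OF C] in \<open>auto simp: comm_add_mat[of C n m "-C"]\<close>)
qed (use C in auto)

lemma unimodular_addrow_mat:
  "k < n \<Longrightarrow> l < n \<Longrightarrow> k \<noteq> l \<Longrightarrow> unimodular n (addrow_mat n (a::'a::comm_ring_1) k l)"
  by (rule unimodularI[of _ _ "addrow_mat n (-a) k l"]) (auto simp: addrow_mat_inv)

lemma unimodular_swaprows_mat:
  "k < n \<Longrightarrow> l < n \<Longrightarrow> unimodular n (swaprows_mat n k l :: 'a::comm_ring_1 mat)"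
  by (rule unimodularI[of _ _ "swaprows_mat n k l"]) (auto simp: swaprows_mat_inv)

lemma unimodular_det_dvd_1:
  assumes "unimodular n U" shows "det U dvd 1"
proof -
  obtain V where V: "U \<in> carrier_mat n n" "V \<in> carrier_mat n n" "U * V = 1\<^sub>m n"
    using assms unfolding unimodular_def by blast
  then have "det U * det V = 1" using det_mult[OF V(1,2)] by simp
  then show ?thesis by (metis dvd_triv_left)
qed

section \<open>Unimodular equivalence and the Smith form\<close>

definition unimodular_equivalent :: "nat \<Rightarrow> nat \<Rightarrow> 'a::comm_ring_1 mat \<Rightarrow> 'a mat \<Rightarrow> bool" where
  "unimodular_equivalent m n A B \<longleftrightarrow> A \<in> carrier_mat m n \<and>
     (\<exists>U V. unimodular m U \<and> unimodular n V \<and> U * A * V = B)"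

lemma unimodular_equivalentI:
  "A \<in> carrier_mat m n \<Longrightarrow> unimodular m U \<Longrightarrow> unimodular n V \<Longrightarrow> U * A * V = B \<Longrightarrow> unimodular_equivalent m n A B"
  unfolding unimodular_equivalent_def by blast

lemma unimodular_equivalent_refl: "A \<in> carrier_mat m n \<Longrightarrow> unimodular_equivalent m n A A"
  by (rule unimodular_equivalentI[where U = "1\<^sub>m m" and V = "1\<^sub>m n"]) auto

lemma unimodular_equivalent_carrier:
  "unimodular_equivalent m n A B \<Longrightarrow> A \<in> carrier_mat m n \<and> B \<in> carrier_mat m n"
  unfolding unimodular_equivalent_def by (auto dest!: unimodular_carrier)

lemma unimodular_equivalent_trans:
  assumes "unimodular_equivalent m n A B" "unimodular_equivalent m n B C"
  shows "unimodular_equivalent m n A C"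
proof -
  obtain U V where UV: "A \<in> carrier_mat m n" "unimodular m U" "unimodular n V" "U * A * V = B"
    using assms(1) unfolding unimodular_equivalent_def by blast
  obtain U' V' where UV': "unimodular m U'" "unimodular n V'" "U' * B * V' = C"
    using assms(2) unfolding unimodular_equivalent_def by blast
  note c = UV(1) UV(2,3)[THEN unimodular_carrier] UV'(1,2)[THEN unimodular_carrier]
  have "(U' * U) * A * (V * V') = U' * (U * A * V) * V'"
    using c by (simp add: mult_mat_assoc_dim del: assoc_mult_mat)
  then show ?thesis using UV UV'
    by (intro unimodular_equivalentI[where U = "U' * U" and V = "V * V'"]) (auto intro: unimodular_mult)
qed

lemma unimodular_equivalent_sym:
  assumes "unimodular_equivalent m n A B"
  shows "unimodular_equivalent m n B A"
proof -
  obtain U V where UV: "A \<in> carrier_mat m n" "unimodular m U" "unimodular n V" "U * A * V = B"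
    using assms(1) unfolding unimodular_equivalent_def by blast
  obtain U' where U: "U \<in> carrier_mat m m" "U' \<in> carrier_mat m m" "U' * U = 1\<^sub>m m" "unimodular m U'"
    using UV(2) by (metis unimodularE)
  obtain V' where V: "V \<in> carrier_mat n n" "V' \<in> carrier_mat n n" "V * V' = 1\<^sub>m n" "unimodular n V'"
    using UV(3) by (metis unimodularE)
  have "U' * B * V' = U' * U * A * (V * V')" unfolding UV(4)[symmetric]
    using U(1,2) V(1,2) UV(1) by (simp add: mult_mat_assoc_dim del: assoc_mult_mat)
  also have "\<dots> = A" proof -
    have "U' * (U * A) = A" by (rule mult_inverse_cancel[OF U(3)]) (use U UV(1) in auto)
    then show ?thesis using U V UV(1) by (simp add: mult_mat_assoc_dim del: assoc_mult_mat)
  qed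
  finally show ?thesis using U V assms
    by (intro unimodular_equivalentI[where U = "U'" and V = "V'"]) (auto dest: unimodular_equivalent_carrier)
qed

lemma unimodular_equivalent_left:
  assumes "A \<in> carrier_mat m n" "unimodular m U"
  shows "unimodular_equivalent m n A (U * A)"
  by (rule unimodular_equivalentI[where U = U and V = "1\<^sub>m n"])
     (use assms unimodular_carrier[OF assms(2)] in auto)

lemma unimodular_equivalent_right:
  assumes "A \<in> carrier_mat m n" "unimodular n V"
  shows "unimodular_equivalent m n A (A * V)"
  by (rule unimodular_equivalentI[where U = "1\<^sub>m m" and V = V])
     (use assms unimodular_carrier[OF assms(2)] in auto)

lemma unimodular_equivalent_transpose:
  assumes "unimodular_equivalent m n A B"
  shows "unimodular_equivalent n m A\<^sup>T B\<^sup>T"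
proof -
  obtain U V where UV: "A \<in> carrier_mat m n" "unimodular m U" "unimodular n V" "U * A * V = B"
    using assms(1) unfolding unimodular_equivalent_def by blast
  note c = UV(1) UV(2,3)[THEN unimodular_carrier]
  have "B\<^sup>T = V\<^sup>T * A\<^sup>T * U\<^sup>T" unfolding UV(4)[symmetric] using c
    by (simp add: mult_mat_assoc_dim transpose_mult[of _ m n _ n] transpose_mult[of _ m m _ n] del: assoc_mult_mat)
  then show ?thesis using UV
    by (intro unimodular_equivalentI[where U = "V\<^sup>T" and V = "U\<^sup>T"]) (auto intro: unimodular_transpose)
qed

definition rect_diag :: "nat \<Rightarrow> nat \<Rightarrow> (nat \<Rightarrow> 'a::zero) \<Rightarrow> 'a mat" where
  "rect_diag m n \<gamma> = mat m n (\<lambda>(i, j). if i = j then \<gamma> i else 0)"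

lemma rect_diag_carrier [simp]: "rect_diag m n \<gamma> \<in> carrier_mat m n"
  unfolding rect_diag_def by simp

text \<open>Euclidean division replaces an elimination algorithm: among all equivalent matrices with nonzero corner,
  one whose corner has least degree has a corner that divides its row and its column.\<close>

definition minimal_corner :: "nat \<Rightarrow> nat \<Rightarrow> 'a::field poly mat \<Rightarrow> bool" where
  "minimal_corner m n A \<longleftrightarrow> A \<in> carrier_mat m n \<and> A $$ (0,0) \<noteq> 0 \<and>
     (\<forall>B. unimodular_equivalent m n A B \<longrightarrow> B $$ (0,0) \<noteq> 0 \<longrightarrow> degree (A $$ (0,0)) \<le> degree (B $$ (0,0)))"

lemma minimal_corner_transpose:
  assumes "minimal_corner m n A" "0 < m" "0 < n"
  shows "minimal_corner n m A\<^sup>T"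
proof -
  have A: "A \<in> carrier_mat m n" using assms(1) unfolding minimal_corner_def by auto
  have "degree (A $$ (0,0)) \<le> degree (B $$ (0,0))"
    if "unimodular_equivalent n m A\<^sup>T B" "B $$ (0,0) \<noteq> 0" for B
  proof -
    have "unimodular_equivalent m n A B\<^sup>T" using unimodular_equivalent_transpose[OF that(1)] by simp
    moreover have "B\<^sup>T $$ (0,0) = B $$ (0,0)"
      using unimodular_equivalent_carrier[OF that(1)] assms by auto
    ultimately show ?thesis using that assms unfolding minimal_corner_def by auto
  qed
  then show ?thesis using A assms unfolding minimal_corner_def by auto
qed

text \<open>Otherwise subtracting a multiple of the first row and swapping two rows would put a nonzero remainder of
  smaller degree into the corner.\<close>

lemma minimal_corner_dvd_column:
  assumes min: "minimal_corner m n A" and i: "i < m" and n: "0 < n"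
  shows "A $$ (0,0) dvd A $$ (i,0)"
proof (rule ccontr)
  assume nd: "\<not> A $$ (0,0) dvd A $$ (i,0)"
  hence i0: "i \<noteq> 0" by (metis dvd_refl)
  have m: "0 < m" using i by simp
  have A: "A \<in> carrier_mat m n" and nz: "A $$ (0,0) \<noteq> 0" using min unfolding minimal_corner_def by auto
  define q where "q = A $$ (i,0) div A $$ (0,0)"
  define B where "B = addrow_mat m (-q) i 0 * A"
  define C where "C = swaprows_mat m 0 i * B"
  have AB: "unimodular_equivalent m n A B" unfolding B_def
    by (rule unimodular_equivalent_left[OF A unimodular_addrow_mat]) (use i i0 in auto)
  have B: "B \<in> carrier_mat m n" using unimodular_equivalent_carrier[OF AB] by auto
  have BC: "unimodular_equivalent m n B C" unfolding C_def
    by (rule unimodular_equivalent_left[OF B unimodular_swaprows_mat]) (use i in auto)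
  have "C $$ (0,0) = B $$ (i,0)" unfolding C_def swaprows_mat[OF B m i, symmetric] using B i m n i0 by auto
  also have "\<dots> = A $$ (i,0) mod A $$ (0,0)"
    unfolding B_def addrow_mat[OF A m, of "-q" i, symmetric] using A i m n i0
    by (auto simp: q_def minus_div_mult_eq_mod[symmetric])
  finally have C00: "C $$ (0,0) = A $$ (i,0) mod A $$ (0,0)" .
  have "C $$ (0,0) \<noteq> 0" unfolding C00 using nd by (simp add: mod_eq_0_iff_dvd)
  moreover from this have "degree (C $$ (0,0)) < degree (A $$ (0,0))"
    unfolding C00 using degree_mod_less[OF nz, of "A $$ (i,0)"] by auto
  ultimately show False using min unimodular_equivalent_trans[OF AB BC] unfolding minimal_corner_def by force
qed

lemma minimal_corner_exists:
  fixes A :: "'a::field poly mat"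
  assumes A: "A \<in> carrier_mat m n" and ij: "i < m" "j < n" "A $$ (i,j) \<noteq> 0"
  obtains B where "unimodular_equivalent m n A B" "minimal_corner m n B"
proof -
  define P where "P k \<longleftrightarrow> (\<exists>B. unimodular_equivalent m n A B \<and> B $$ (0,0) \<noteq> 0 \<and> degree (B $$ (0,0)) = k)" for k
  have m: "0 < m" and n: "0 < n" using ij by auto
  define B where "B = swaprows_mat m 0 i * A"
  have AB: "unimodular_equivalent m n A B" unfolding B_def
    by (rule unimodular_equivalent_left[OF A unimodular_swaprows_mat]) (use ij in auto)
  have B: "B \<in> carrier_mat m n" using unimodular_equivalent_carrier[OF AB] by auto
  have BT: "B\<^sup>T \<in> carrier_mat n m" using B by auto
  have b: "B $$ (0,j) = A $$ (i,j)" unfolding B_def swaprows_mat[OF A m ij(1), symmetric] using A ij m by auto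
  define C where "C = swaprows_mat n 0 j * B\<^sup>T"
  have C: "unimodular_equivalent n m B\<^sup>T C" unfolding C_def
    by (rule unimodular_equivalent_left[OF _ unimodular_swaprows_mat]) (use ij B in auto)
  have "C $$ (0,0) = B\<^sup>T $$ (j,0)" unfolding C_def swaprows_mat[OF BT n ij(2), symmetric] using BT ij m n by auto
  also have "\<dots> = A $$ (i,j)" using B ij m b by auto
  finally have c: "C $$ (0,0) \<noteq> 0" using ij by auto
  have "unimodular_equivalent m n B C\<^sup>T" using unimodular_equivalent_transpose[OF C] by simp
  moreover have "C\<^sup>T $$ (0,0) \<noteq> 0" using unimodular_equivalent_carrier[OF C] c m n by auto
  ultimately have "P (degree (C\<^sup>T $$ (0,0)))" unfolding P_def using unimodular_equivalent_trans[OF AB] by blast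
  then have "P (LEAST k. P k)" by (rule LeastI)
  then obtain D where D: "unimodular_equivalent m n A D" "D $$ (0,0) \<noteq> 0" "degree (D $$ (0,0)) = (LEAST k. P k)"
    unfolding P_def by blast
  have "minimal_corner m n D" unfolding minimal_corner_def
  proof (intro conjI allI impI)
    show "D \<in> carrier_mat m n" using unimodular_equivalent_carrier[OF D(1)] by auto
    fix E assume "unimodular_equivalent m n D E" "E $$ (0,0) \<noteq> 0"
    then have "P (degree (E $$ (0,0)))" unfolding P_def using unimodular_equivalent_trans[OF D(1)] by blast
    then show "degree (D $$ (0,0)) \<le> degree (E $$ (0,0))" unfolding D(3) by (rule Least_le)
  qed (use D in auto)
  then show thesis using that D by blast
qed

lemma dvd_entries_mult:
  fixes A :: "'a::comm_ring_1 mat"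
  assumes U: "U \<in> carrier_mat p m" and A: "A \<in> carrier_mat m n" and V: "V \<in> carrier_mat n q"
    and d: "\<And>i j. i < m \<Longrightarrow> j < n \<Longrightarrow> c dvd A $$ (i,j)" and ij: "i < p" "j < q"
  shows "c dvd (U * A * V) $$ (i,j)"
proof -
  have "(U * A * V) $$ (i,j) = (\<Sum>b<n. (\<Sum>a<m. U $$ (i,a) * A $$ (a,b)) * V $$ (b,j))"
    using U A V ij by (simp add: scalar_prod_def atLeast0LessThan del: assoc_mult_mat)
  also have "c dvd \<dots>" by (intro dvd_sum dvd_mult2 dvd_mult d) auto
  finally show ?thesis .
qed

text \<open>By induction on the number of rows: a minimal corner divides its row and column, which can therefore be
  cleared. It divides the remaining block as well, because adding a row of that block to the first row keeps
  the corner and hence its minimality.\<close>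

lemma Smith_form_exists:
  fixes A :: "'a::field poly mat"
  assumes "A \<in> carrier_mat m n"
  shows "\<exists>\<gamma>. unimodular_equivalent m n A (rect_diag m n \<gamma>) \<and> (\<forall>i. Suc i < min m n \<longrightarrow> \<gamma> i dvd \<gamma> (Suc i))"
  using assms
proof (induction m arbitrary: n A)
  case 0
  then have "A = rect_diag 0 n (\<lambda>_. 0)" by (intro eq_matI) (auto simp: rect_diag_def)
  then show ?case using unimodular_equivalent_refl[OF 0] by auto
next
  case (Suc m)
  show ?case
  proof (cases "\<exists>i j. i < Suc m \<and> j < n \<and> A $$ (i,j) \<noteq> 0")
    case False
    then have "A = rect_diag (Suc m) n (\<lambda>_. 0)" using Suc.prems by (intro eq_matI) (auto simp: rect_diag_def)
    then show ?thesis using unimodular_equivalent_refl[OF Suc.prems] by (intro exI[of _ "\<lambda>_. 0"]) auto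
  next
    case True
    then obtain n' where n: "n = Suc n'" by (metis less_zeroE not0_implies_Suc)
    obtain B where AB: "unimodular_equivalent (Suc m) n A B" and min: "minimal_corner (Suc m) n B"
      using True minimal_corner_exists[OF Suc.prems] by blast
    have Bc: "B \<in> carrier_mat (Suc m) (Suc n')" using unimodular_equivalent_carrier[OF AB] n by auto
    define b where "b = B $$ (0,0)"
    define BR where "BR = mat 1 n' (\<lambda>(i,j). B $$ (0, Suc j))"
    define BC where "BC = mat m 1 (\<lambda>(i,j). B $$ (Suc i, 0))"
    define BD where "BD = mat m n' (\<lambda>(i,j). B $$ (Suc i, Suc j))"
    have Bblk: "B = four_block_mat (mat 1 1 (\<lambda>_. b)) BR BC BD"
      using Bc by (intro eq_matI) (auto simp: b_def BR_def BC_def BD_def)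
    have dc: "b dvd B $$ (i,0)" if "i < Suc m" for i
      using minimal_corner_dvd_column[OF min that] n unfolding b_def by simp
    have minT: "minimal_corner n (Suc m) B\<^sup>T" using minimal_corner_transpose[OF min] n by simp
    have dr: "b dvd B $$ (0,j)" if "j < n" for j
      using minimal_corner_dvd_column[OF minT that] n that Bc unfolding b_def by simp
    define Q where "Q = mat m 1 (\<lambda>(i,j). - (B $$ (Suc i,0) div b))"
    define S where "S = mat 1 n' (\<lambda>(i,j). - (B $$ (0,Suc j) div b))"
    define U where "U = four_block_mat (1\<^sub>m 1) (0\<^sub>m 1 m) Q (1\<^sub>m m)"
    define V where "V = four_block_mat (1\<^sub>m 1) S (0\<^sub>m n' 1) (1\<^sub>m n')"
    define D where "D = Q * BR + BD"
    have cU: "unimodular (Suc m) U" unfolding U_def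
      using unimodular_block_lower[of Q m 1] by (simp add: Q_def)
    have cV: "unimodular (Suc n') V" unfolding V_def
      using unimodular_block_upper[of S 1 n'] by (simp add: S_def)
    have blk: "Q \<in> carrier_mat m 1" "S \<in> carrier_mat 1 n'" "BR \<in> carrier_mat 1 n'"
        "BC \<in> carrier_mat m 1" "BD \<in> carrier_mat m n'"
      by (auto simp: Q_def S_def BR_def BC_def BD_def)
    have Dc: "D \<in> carrier_mat m n'" by (simp add: D_def Q_def BR_def BD_def)
    have q: "Q * mat 1 1 (\<lambda>_. b) + BC = 0\<^sub>m m 1"
      by (intro eq_matI) (use dc in \<open>auto simp: Q_def BC_def scalar_prod_def\<close>)
    have UB: "U * B = four_block_mat (mat 1 1 (\<lambda>_. b)) BR (0\<^sub>m m 1) D"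
      unfolding U_def Bblk
      by (subst mult_four_block_mat[of _ 1 1 _ m _ m _ _ 1 _ n'])
         (use blk in \<open>auto simp: D_def q[simplified]\<close>)
    have s: "mat 1 1 (\<lambda>_. b) * S + BR = 0\<^sub>m 1 n'"
      by (intro eq_matI) (use dr n in \<open>auto simp: S_def BR_def scalar_prod_def\<close>)
    have UBV: "U * B * V = four_block_mat (mat 1 1 (\<lambda>_. b)) (0\<^sub>m 1 n') (0\<^sub>m m 1) D"
      unfolding UB V_def
      by (subst mult_four_block_mat[of _ 1 1 _ n' _ m _ _ 1 _ n'])
         (use Dc blk in \<open>auto simp: s[simplified]\<close>)
    define C where "C = four_block_mat (mat 1 1 (\<lambda>_. b)) (0\<^sub>m 1 n') (0\<^sub>m m 1) D"
    have BCeq: "unimodular_equivalent (Suc m) n B C"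
      using unimodular_equivalentI[OF _ cU cV UBV] Bc n unfolding C_def by auto
    have Cc: "C \<in> carrier_mat (Suc m) n" using unimodular_equivalent_carrier[OF BCeq] by auto
    have bD: "b dvd D $$ (i,j)" if i: "i < m" and j: "j < n'" for i j
    proof -
      define E where "E = addrow_mat (Suc m) 1 0 (Suc i) * C"
      have CE: "unimodular_equivalent (Suc m) n C E" unfolding E_def
        by (rule unimodular_equivalent_left[OF Cc unimodular_addrow_mat]) (use i in auto)
      have E: "E = addrow 1 0 (Suc i) C"
        unfolding E_def by (rule addrow_mat[OF Cc, symmetric]) (use i in auto)
      have Ec: "E \<in> carrier_mat (Suc m) n" using unimodular_equivalent_carrier[OF CE] by auto
      have E00: "E $$ (0,0) = b" and E0j: "E $$ (0,Suc j) = D $$ (i,j)"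
        unfolding E using Cc Dc i j n by (auto simp: C_def)
      have BE: "unimodular_equivalent (Suc m) n B E" using BCeq CE unimodular_equivalent_trans by blast
      have "minimal_corner (Suc m) n E" unfolding minimal_corner_def E00
        using min unimodular_equivalent_trans[OF BE] Ec unfolding minimal_corner_def b_def by blast
      then have "minimal_corner n (Suc m) E\<^sup>T" using minimal_corner_transpose n by blast
      from minimal_corner_dvd_column[OF this, of "Suc j"] show ?thesis using Ec E00 E0j n j by auto
    qed
    obtain \<gamma> where \<gamma>: "unimodular_equivalent m n' D (rect_diag m n' \<gamma>)"
      and ch: "\<forall>i. Suc i < min m n' \<longrightarrow> \<gamma> i dvd \<gamma> (Suc i)" using Suc.IH[OF Dc] by blast
    obtain U' V' where UV': "unimodular m U'" "unimodular n' V'" "U' * D * V' = rect_diag m n' \<gamma>"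
      using \<gamma> unfolding unimodular_equivalent_def by blast
    note c' = UV'(1,2)[THEN unimodular_carrier]
    have b\<gamma>: "b dvd \<gamma> i" if "i < min m n'" for i
      using dvd_entries_mult[OF c'(1) Dc c'(2) bD, of i i] that unfolding UV'(3) by (simp add: rect_diag_def)
    define \<gamma>' where "\<gamma>' i = (case i of 0 \<Rightarrow> b | Suc i \<Rightarrow> \<gamma> i)" for i
    let ?U = "four_block_mat (1\<^sub>m 1) (0\<^sub>m 1 m) (0\<^sub>m m 1) U'"
    let ?V = "four_block_mat (1\<^sub>m 1) (0\<^sub>m 1 n') (0\<^sub>m n' 1) V'"
    have "?U * C * ?V = four_block_mat (mat 1 1 (\<lambda>_. b)) (0\<^sub>m 1 n') (0\<^sub>m m 1) (U' * D * V')"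
      unfolding C_def
      by (subst mult_four_block_mat[of _ 1 1 _ m _ m _ _ 1 _ n'], (use Dc c' in auto)[8],
          subst mult_four_block_mat[of _ 1 1 _ n' _ m _ _ 1 _ n'])
         (use Dc c' in auto)
    also have "\<dots> = rect_diag (Suc m) n \<gamma>'"
      unfolding UV'(3) by (intro eq_matI) (auto simp: rect_diag_def \<gamma>'_def n split: nat.splits)
    finally have "unimodular_equivalent (Suc m) n C (rect_diag (Suc m) n \<gamma>')"
      using unimodular_four_block_diag[OF unimodular_one[of 1] UV'(1)]
        unimodular_four_block_diag[OF unimodular_one[of 1] UV'(2)] Cc n
      by (intro unimodular_equivalentI[where U = ?U and V = ?V]) auto
    then have "unimodular_equivalent (Suc m) n A (rect_diag (Suc m) n \<gamma>')"
      using AB BCeq unimodular_equivalent_trans by blast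
    moreover have "\<forall>i. Suc i < min (Suc m) n \<longrightarrow> \<gamma>' i dvd \<gamma>' (Suc i)"
      using ch b\<gamma> n by (auto simp: \<gamma>'_def split: nat.splits)
    ultimately show ?thesis by blast
  qed
qed

section \<open>Homogenization of polynomials\<close>

text \<open>This is \<open>p\<close> made homogeneous of degree \<open>N\<close> in two variables and evaluated at \<open>(\<mu>, \<nu>)\<close>. The choice
  \<open>\<mu> = 1\<close>, \<open>\<nu> = X\<close> gives the reversal; other linear choices give the remaining changes of coordinate on
  the projective line.\<close>

definition homog :: "'a::field poly \<Rightarrow> 'a poly \<Rightarrow> nat \<Rightarrow> 'a poly \<Rightarrow> 'a poly" where
  "homog \<mu> \<nu> N p = (\<Sum>i\<le>N. Polynomial.smult (coeff p i) (\<mu> ^ i * \<nu> ^ (N - i)))"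

lemma rev_poly_eq_homog: "rev_poly N = homog 1 [:0,1:] N"
  unfolding rev_poly_def homog_def by (simp add: fun_eq_iff monom_altdef)

lemma homog_0 [simp]: "homog \<mu> \<nu> N 0 = 0"
  unfolding homog_def by simp

lemma homog_add: "homog \<mu> \<nu> N (p + q) = homog \<mu> \<nu> N p + homog \<mu> \<nu> N q"
  unfolding homog_def by (simp add: smult_add_left sum.distrib)

lemma homog_smult: "homog \<mu> \<nu> N (Polynomial.smult c p) = Polynomial.smult c (homog \<mu> \<nu> N p)"
  unfolding homog_def using sum_distrib_left[of "[:c:]" "\<lambda>i. Polynomial.smult (coeff p i) (\<mu> ^ i * \<nu> ^ (N - i))" "{..N}"] by (simp add: mult.commute)

lemma homog_uminus: "homog \<mu> \<nu> N (- p) = - homog \<mu> \<nu> N p"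
  unfolding homog_def by (simp add: sum_negf)

lemma homog_sum: "homog \<mu> \<nu> N (sum f A) = (\<Sum>x\<in>A. homog \<mu> \<nu> N (f x))"
  by (induction A rule: infinite_finite_induct) (auto simp: homog_add)

lemma homog_monom:
  assumes "i \<le> N"
  shows "homog \<mu> \<nu> N (monom c i) = Polynomial.smult c (\<mu> ^ i * \<nu> ^ (N - i))"
proof -
  have "homog \<mu> \<nu> N (monom c i) = (\<Sum>j\<le>N. if j = i then Polynomial.smult c (\<mu> ^ i * \<nu> ^ (N - i)) else 0)"
    unfolding homog_def by (intro sum.cong) auto
  then show ?thesis using assms by simp
qed

lemma homog_mult:
  assumes "degree p \<le> N" "degree q \<le> M"
  shows "homog \<mu> \<nu> (N + M) (p * q) = homog \<mu> \<nu> N p * homog \<mu> \<nu> M q"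
proof -
  have "p * q = (\<Sum>i\<le>N. \<Sum>j\<le>M. monom (coeff p i * coeff q j) (i + j))"
  proof -
    have "p * q = (\<Sum>i\<le>N. monom (coeff p i) i) * (\<Sum>j\<le>M. monom (coeff q j) j)"
      by (simp only: poly_as_sum_of_monoms'[OF assms(1)] poly_as_sum_of_monoms'[OF assms(2)])
    then show ?thesis by (simp add: sum_product mult_monom)
  qed
  then have "homog \<mu> \<nu> (N + M) (p * q) =
     (\<Sum>i\<le>N. \<Sum>j\<le>M. Polynomial.smult (coeff p i * coeff q j) (\<mu> ^ (i + j) * \<nu> ^ (N + M - (i + j))))"
    by (simp add: homog_sum homog_monom)
  also have "\<dots> = (\<Sum>i\<le>N. \<Sum>j\<le>M. Polynomial.smult (coeff p i) (\<mu> ^ i * \<nu> ^ (N - i)) * Polynomial.smult (coeff q j) (\<mu> ^ j * \<nu> ^ (M - j)))"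
  proof (intro sum.cong refl)
    fix i j assume "i \<in> {..N}" "j \<in> {..M}"
    then have "N + M - (i + j) = (N - i) + (M - j)" by auto
    then show "Polynomial.smult (coeff p i * coeff q j) (\<mu> ^ (i + j) * \<nu> ^ (N + M - (i + j))) =
       Polynomial.smult (coeff p i) (\<mu> ^ i * \<nu> ^ (N - i)) * Polynomial.smult (coeff q j) (\<mu> ^ j * \<nu> ^ (M - j))"
      by (simp add: power_add mult_ac)
  qed
  also have "\<dots> = homog \<mu> \<nu> N p * homog \<mu> \<nu> M q"
    unfolding homog_def by (rule sum_product[symmetric])
  finally show ?thesis .
qed

lemma homog_1 [simp]: "homog \<mu> \<nu> N 1 = \<nu> ^ N"
  using homog_monom[of 0 N \<mu> \<nu> 1] by (simp add: monom_0 one_pCons[symmetric])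

lemma homog_raise: "degree p \<le> N \<Longrightarrow> homog \<mu> \<nu> (N + M) p = homog \<mu> \<nu> N p * \<nu> ^ M"
  using homog_mult[of p N 1 M \<mu> \<nu>] by simp

lemma homog_prod:
  "(\<And>x. x \<in> A \<Longrightarrow> degree (f x) \<le> N x) \<Longrightarrow>
   homog \<mu> \<nu> (sum N A) (prod f A) = (\<Prod>x\<in>A. homog \<mu> \<nu> (N x) (f x))"
proof (induction A rule: infinite_finite_induct)
  case (insert x A)
  have "degree (prod f A) \<le> sum N A"
    using order.trans[OF degree_prod_sum_le[OF insert.hyps(1), of f] sum_mono[of A "degree \<circ> f" N]] insert.prems by auto
  then show ?case using insert homog_mult[of "f x" "N x" "prod f A" "sum N A"] by simp
qed (auto simp: homog_def)

lemma homog_dvd: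
  assumes "p dvd q" "q \<noteq> 0"
  shows "homog \<mu> \<nu> (degree p) p dvd homog \<mu> \<nu> (degree q) q"
proof -
  obtain w where w: "q = p * w" using assms by blast
  then have "degree q = degree p + degree w" using assms by (simp add: degree_mult_eq)
  then show ?thesis unfolding w using homog_mult[of p "degree p" w "degree w"] w by simp
qed

lemma homog_det:
  assumes A: "A \<in> carrier_mat n n" and deg: "\<And>i j. i < n \<Longrightarrow> j < n \<Longrightarrow> degree (A $$ (i,j)) \<le> N"
  shows "homog \<mu> \<nu> (n * N) (det A) = det (map_mat (homog \<mu> \<nu> N) A)"
proof -
  have p: "homog \<mu> \<nu> (n * N) (\<Prod>i=0..<n. A $$ (i, p i)) = (\<Prod>i=0..<n. homog \<mu> \<nu> N (A $$ (i, p i)))"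
    if "p permutes {0..<n}" for p
    using homog_prod[of "{0..<n}" "\<lambda>i. A $$ (i, p i)" "\<lambda>_. N" \<mu> \<nu>] deg permutes_in_image[OF that] by auto
  have s: "homog \<mu> \<nu> K (signof p * x) = signof p * homog \<mu> \<nu> K x" for K x and p :: "nat \<Rightarrow> nat"
    by (auto simp: sign_def homog_uminus)
  have A': "map_mat (homog \<mu> \<nu> N) A \<in> carrier_mat n n" using A by simp
  show ?thesis unfolding det_def'[OF A] det_def'[OF A'] homog_sum s
    by (intro sum.cong refl arg_cong2[where f = "(*)"])
       (use A p permutes_in_image in \<open>auto intro!: prod.cong\<close>)
qed

lemma homog_mat_mult:
  assumes A: "A \<in> carrier_mat m n" and B: "B \<in> carrier_mat n q"
    and "\<And>i j. i < m \<Longrightarrow> j < n \<Longrightarrow> degree (A $$ (i,j)) \<le> N"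
    and "\<And>i j. i < n \<Longrightarrow> j < q \<Longrightarrow> degree (B $$ (i,j)) \<le> M"
  shows "map_mat (homog \<mu> \<nu> (N + M)) (A * B) = map_mat (homog \<mu> \<nu> N) A * map_mat (homog \<mu> \<nu> M) B"
  by (intro eq_matI) (use assms in \<open>auto simp: scalar_prod_def homog_sum homog_mult\<close>)

lemma mat_degree_bound_exists:
  "\<exists>N. \<forall>i<dim_row A. \<forall>j<dim_col A. degree (A $$ (i,j)) \<le> N"
  for A :: "'a::zero poly mat"
proof -
  have fin: "finite ((\<lambda>(i,j). degree (A $$ (i,j))) ` ({..<dim_row A} \<times> {..<dim_col A}))" by simp
  show ?thesis
    by (rule exI[of _ "Max ((\<lambda>(i,j). degree (A $$ (i,j))) ` ({..<dim_row A} \<times> {..<dim_col A}))"])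
       (auto intro!: Max_ge[OF fin])
qed

section \<open>Reversal and degrees of determinants\<close>

lemma coeff_rev_poly: "coeff (rev_poly N p) k = (if k \<le> N then coeff p (N - k) else 0)"
proof -
  have "coeff (rev_poly N p) k = (\<Sum>i\<le>N. if N - i = k then coeff p i else 0)"
    unfolding rev_poly_def by (simp add: coeff_sum)
  also have "\<dots> = (\<Sum>i\<le>N. if k \<le> N \<and> i = N - k then coeff p i else 0)"
    by (intro sum.cong) auto
  finally show ?thesis by (auto simp: sum.delta)
qed

lemma rev_poly_eq_reflect:
  assumes "degree p \<le> N"
  shows "rev_poly N p = [:0,1:] ^ (N - degree p) * reflect_poly p"
proof -
  have "rev_poly N p = monom 1 (N - degree p) * reflect_poly p"
  proof (rule poly_eqI)
    fix k show "coeff (rev_poly N p) k = coeff (monom 1 (N - degree p) * reflect_poly p) k"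
      using assms by (auto simp: coeff_rev_poly coeff_monom_mult coeff_reflect_poly
          intro!: coeff_eq_0 arg_cong[where f = "coeff p"])
  qed
  then show ?thesis by (simp add: monom_altdef)
qed

lemma rev_poly_eq_0_iff: "degree p \<le> N \<Longrightarrow> rev_poly N p = 0 \<longleftrightarrow> p = 0"
  by (auto simp: rev_poly_eq_reflect)

lemma order_X_power_mult: "q \<noteq> 0 \<Longrightarrow> order 0 ([:0,1:] ^ k * q) = k + order 0 q"
  for q :: "'a::field poly"
  using order_power_n_n[of "0::'a" k] by (subst order_mult) auto

lemma order_rev_poly:
  assumes "degree p \<le> N" "p \<noteq> 0"
  shows "order 0 (rev_poly N p) = N - degree p"
proof -
  have "order 0 (reflect_poly p) = 0" using assms by (intro order_0I) (simp add: poly_0_coeff_0)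
  then show ?thesis using assms by (simp add: rev_poly_eq_reflect order_X_power_mult)
qed

text \<open>If \<open>H\<close> is the reversal of \<open>M\<close> with powers of \<open>X\<close> removed from rows and columns, then the reversal of
  \<open>det M\<close> in degree \<open>n * d\<close> is \<open>det H\<close> times the removed powers. Its order at \<open>0\<close> is \<open>n * d\<close> minus the degree
  of \<open>det M\<close>.\<close>

lemma degree_det_plus_order:
  fixes M :: "'a::field poly mat"
  assumes M: "M \<in> carrier_mat n n" and H: "H \<in> carrier_mat n n"
    and deg: "\<And>i j. i < n \<Longrightarrow> j < n \<Longrightarrow> degree (M $$ (i,j)) \<le> d"
    and rev: "\<And>i j. i < n \<Longrightarrow> j < n \<Longrightarrow> [:0,1:] ^ a i * H $$ (i,j) * [:0,1:] ^ b j = rev_poly d (M $$ (i,j))"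
  shows "det H = 0 \<longleftrightarrow> det M = 0"
    and "det M \<noteq> 0 \<Longrightarrow>
      int (degree (det M)) + int (order 0 (det H)) = (\<Sum>i<n. int d - int (a i) - int (b i))"
proof -
  have D: "mat_diag n (\<lambda>i. [:0,1:] ^ a i) * H * mat_diag n (\<lambda>j. [:0,1:] ^ b j) = map_mat (rev_poly d) M"
    by (subst mat_diag_mult_left[OF H], subst mat_diag_mult_right[of _ n])
       (use H M rev in \<open>auto intro!: eq_matI\<close>)
  have dd: "det (mat_diag n c) = (\<Prod>i<n. c i)" for c :: "nat \<Rightarrow> 'a poly"
    by (subst det_upper_triangular[of _ n]) (auto simp: mat_diag_def diag_mat_def prod.list_conv_set_nth prod_list_diag_prod[of "mat n n _", unfolded diag_mat_def] atLeast0LessThan)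
  have "det (map_mat (rev_poly d) M) = [:0,1:] ^ (\<Sum>i<n. a i) * det H * [:0,1:] ^ (\<Sum>i<n. b i)"
    unfolding D[symmetric] det_mult[OF mult_carrier_mat[OF mat_diag_dim H] mat_diag_dim]
      det_mult[OF mat_diag_dim H] by (simp add: dd power_sum)
  then have eq: "rev_poly (n * d) (det M) = [:0,1:] ^ ((\<Sum>i<n. a i) + (\<Sum>i<n. b i)) * det H"
    using homog_det[OF M deg, of 1 "[:0,1:]"] unfolding rev_poly_eq_homog by (simp add: power_add mult_ac)
  have dM: "degree (det M) \<le> n * d" using degree_det_le[of n M d] deg M by (simp add: mult.commute)
  show iff: "det H = 0 \<longleftrightarrow> det M = 0" using eq rev_poly_eq_0_iff[OF dM] by auto
  assume nz: "det M \<noteq> 0"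
  then have H0: "det H \<noteq> 0" using iff by simp
  have "n * d - degree (det M) = (\<Sum>i<n. a i) + (\<Sum>i<n. b i) + order 0 (det H)"
    using order_rev_poly[OF dM nz] order_X_power_mult[OF H0] eq by simp
  then show "int (degree (det M)) + int (order 0 (det H)) = (\<Sum>i<n. int d - int (a i) - int (b i))"
    using dM by (simp add: sum_subtractf of_nat_diff algebra_simps flip: of_nat_sum of_nat_mult)
qed

text \<open>Its value at \<open>0\<close> is the matrix of the coefficients of degree \<open>k j\<close> in column \<open>j\<close>, that is, the leading
  column coefficient matrix if the \<open>k j\<close> are the column degrees.\<close>

definition col_reversal :: "(nat \<Rightarrow> nat) \<Rightarrow> 'a::field poly mat \<Rightarrow> 'a poly mat" where
  "col_reversal k L = mat (dim_row L) (dim_col L) (\<lambda>(i,j). rev_poly (k j) (L $$ (i,j)))"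

lemma col_reversal_carrier [simp]: "col_reversal k L \<in> carrier_mat p r \<longleftrightarrow> L \<in> carrier_mat p r"
  unfolding col_reversal_def carrier_mat_def by simp

lemma col_reversal_dim [simp]:
  "dim_row (col_reversal k L) = dim_row L" "dim_col (col_reversal k L) = dim_col L"
  unfolding col_reversal_def by simp_all

lemma degree_det_col_reversal:
  fixes N :: "'a::field poly mat"
  assumes N: "N \<in> carrier_mat n n" and deg: "\<And>i j. i < n \<Longrightarrow> j < n \<Longrightarrow> degree (N $$ (i,j)) \<le> k j"
  shows "det (col_reversal k N) = 0 \<longleftrightarrow> det N = 0"
    and "det N \<noteq> 0 \<Longrightarrow> degree (det N) + order 0 (det (col_reversal k N)) = (\<Sum>j<n. k j)"
proof -
  let ?d = "\<Sum>j<n. k j"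
  have kd: "k j \<le> ?d" if "j < n" for j using that by (intro member_le_sum) auto
  have deg': "degree (N $$ (i,j)) \<le> ?d" if "i < n" "j < n" for i j
    using deg[OF that] kd[OF that(2)] by simp
  have rev: "[:0,1:] ^ 0 * col_reversal k N $$ (i,j) * [:0,1:] ^ (?d - k j) = rev_poly ?d (N $$ (i,j))"
    if "i < n" "j < n" for i j
    using homog_raise[OF deg[OF that], of 1 "[:0,1:]" "?d - k j"] kd[OF that(2)] N that
    by (simp add: col_reversal_def rev_poly_eq_homog)
  note * = degree_det_plus_order[where H = "col_reversal k N" and a = "\<lambda>_. 0" and b = "\<lambda>j. ?d - k j", OF N _ deg' rev]
  show "det (col_reversal k N) = 0 \<longleftrightarrow> det N = 0" by (rule *(1)) (use N in auto)
  assume nz: "det N \<noteq> 0"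
  have "int (degree (det N)) + int (order 0 (det (col_reversal k N))) = (\<Sum>i<n. int ?d - int 0 - int (?d - k i))"
    by (rule *(2)) (use N nz in auto)
  also have "\<dots> = (\<Sum>i<n. int (k i))" using kd by (intro sum.cong) (auto simp: of_nat_diff)
  finally show "degree (det N) + order 0 (det (col_reversal k N)) = (\<Sum>j<n. k j)"
    by (simp flip: of_nat_sum of_nat_add)
qed

lemma poly_0_rev_poly: "poly (rev_poly N p) 0 = coeff p N"
  by (simp add: poly_0_coeff_0 coeff_rev_poly)

lemma poly_det: "poly (det A) a = det (map_mat (\<lambda>p. poly p a) A)" for A :: "'a::comm_ring_1 poly mat"
proof -
  interpret comm_ring_hom "\<lambda>p :: 'a poly. poly p a" by unfold_locales auto
  show ?thesis by simp
qed

section \<open>Bases of rational subspaces as polynomial matrices\<close>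

interpretation fract_hom: inj_comm_ring_hom "to_fract :: 'a::idom \<Rightarrow> 'a fract"
  by unfold_locales auto

lemma fract_mat_carrier [simp]: "fract_mat L \<in> carrier_mat p r \<longleftrightarrow> L \<in> carrier_mat p r"
  unfolding fract_mat_def by simp

lemma fract_vec_carrier [simp]: "fract_vec v \<in> carrier_vec p \<longleftrightarrow> v \<in> carrier_vec p"
  unfolding fract_vec_def by simp

lemma fract_mat_dim [simp]: "dim_row (fract_mat L) = dim_row L" "dim_col (fract_mat L) = dim_col L"
  unfolding fract_mat_def by simp_all

lemma fract_mat_mult:
  "A \<in> carrier_mat m n \<Longrightarrow> B \<in> carrier_mat n q \<Longrightarrow> fract_mat (A * B) = fract_mat A * fract_mat B"
  unfolding fract_mat_def by (rule fract_hom.mat_hom_mult)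

lemma fract_mat_mult_vec:
  "A \<in> carrier_mat m n \<Longrightarrow> v \<in> carrier_vec n \<Longrightarrow> fract_vec (A *\<^sub>v v) = fract_mat A *\<^sub>v fract_vec v"
  unfolding fract_mat_def fract_vec_def by (rule fract_hom.mult_mat_vec_hom)

lemma fract_vec_inj: "fract_vec v = fract_vec w \<Longrightarrow> v = w"
  unfolding fract_vec_def by (rule fract_hom.vec_hom_inj)

lemma fract_mat_inj: "fract_mat v = fract_mat w \<Longrightarrow> v = w"
  unfolding fract_mat_def by (rule fract_hom.mat_hom_inj)

lemma fract_mat_one [simp]: "fract_mat (1\<^sub>m n) = 1\<^sub>m n"
  unfolding fract_mat_def by (rule fract_hom.mat_hom_one)

lemma fract_mat_zero [simp]: "fract_mat (0\<^sub>m n m) = 0\<^sub>m n m"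
  unfolding fract_mat_def by (intro eq_matI) auto

lemma fract_vec_zero [simp]: "fract_vec (0\<^sub>v n) = 0\<^sub>v n"
  unfolding fract_vec_def by (intro eq_vecI) auto

lemma fract_mat_transpose [simp]: "fract_mat A\<^sup>T = (fract_mat A)\<^sup>T"
  unfolding fract_mat_def by (intro eq_matI) auto

text \<open>Linear algebra over the rational functions is reduced to polynomial vectors by this common denominator.\<close>

lemma clear_denominators:
  fixes x :: "'a::field poly fract vec"
  assumes "x \<in> carrier_vec r"
  obtains q y where "q \<noteq> 0" "y \<in> carrier_vec r" "to_fract q \<cdot>\<^sub>v x = fract_vec y"
proof -
  have "\<exists>n d. d \<noteq> 0 \<and> x $ i = to_fract n / to_fract d" for i
    by (cases "x $ i") (auto simp: Fract_conv_to_fract)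
  then obtain n d where d: "\<And>i. d i \<noteq> 0" and x: "\<And>i. x $ i = to_fract (n i) / to_fract (d i)" by metis
  define q where "q = (\<Prod>i<r. d i)"
  define y where "y = vec r (\<lambda>i. n i * (\<Prod>j\<in>{..<r}-{i}. d j))"
  have "to_fract q \<cdot>\<^sub>v x = fract_vec y"
  proof (rule eq_vecI)
    fix i assume "i < dim_vec (fract_vec y)"
    then have i: "i < r" by (simp add: y_def fract_vec_def)
    have "q = d i * (\<Prod>j\<in>{..<r}-{i}. d j)" unfolding q_def using i by (intro prod.remove) auto
    then show "(to_fract q \<cdot>\<^sub>v x) $ i = fract_vec y $ i"
      using i assms d[of i] by (auto simp: x y_def fract_vec_def)
  qed (use assms in \<open>simp add: y_def fract_vec_def\<close>)
  moreover have "q \<noteq> 0" unfolding q_def using d by simp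
  moreover have "y \<in> carrier_vec r" by (simp add: y_def)
  ultimately show thesis using that by blast
qed

text \<open>Stated without reference to a field, so that it applies to polynomial matrices and to matrices of rational
  functions; for polynomial matrices both readings agree.\<close>

definition full_col_rank :: "'a::semiring_0 mat \<Rightarrow> bool" where
  "full_col_rank L \<longleftrightarrow> (\<forall>x\<in>carrier_vec (dim_col L). L *\<^sub>v x = 0\<^sub>v (dim_row L) \<longrightarrow> x = 0\<^sub>v (dim_col L))"

definition rational_span :: "'a::field poly mat \<Rightarrow> 'a poly fract vec set" where
  "rational_span L = {fract_mat L *\<^sub>v x |x. x \<in> carrier_vec (dim_col L)}"

lemma full_col_rank_fract_mat [simp]:
  fixes L :: "'a::field poly mat"
  shows "full_col_rank (fract_mat L) \<longleftrightarrow> full_col_rank L"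
proof
  assume f: "full_col_rank (fract_mat L)"
  show "full_col_rank L" unfolding full_col_rank_def
  proof (intro ballI impI)
    fix x assume x: "x \<in> carrier_vec (dim_col L)" and 0: "L *\<^sub>v x = 0\<^sub>v (dim_row L)"
    then have "fract_mat L *\<^sub>v fract_vec x = 0\<^sub>v (dim_row L)"
      using fract_mat_mult_vec[of L "dim_row L" "dim_col L" x] by simp
    then have "fract_vec x = fract_vec (0\<^sub>v (dim_col L))" using f x unfolding full_col_rank_def by auto
    then show "x = 0\<^sub>v (dim_col L)" by (rule fract_vec_inj)
  qed
next
  assume f: "full_col_rank L"
  show "full_col_rank (fract_mat L)" unfolding full_col_rank_def
  proof (intro ballI impI)
    fix x assume x: "x \<in> carrier_vec (dim_col (fract_mat L))"
      and 0: "fract_mat L *\<^sub>v x = 0\<^sub>v (dim_row (fract_mat L))"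
    obtain q y where q: "q \<noteq> 0" "y \<in> carrier_vec (dim_col L)" "to_fract q \<cdot>\<^sub>v x = fract_vec y"
      using clear_denominators[of x "dim_col L"] x by auto
    have "fract_vec (L *\<^sub>v y) = fract_mat L *\<^sub>v (to_fract q \<cdot>\<^sub>v x)"
      using fract_mat_mult_vec[of L _ _ y] q by (metis carrier_mat_triv)
    also have "\<dots> = to_fract q \<cdot>\<^sub>v (fract_mat L *\<^sub>v x)"
      by (rule mult_mat_vec[of _ "dim_row L" "dim_col L"]) (use x in auto)
    also have "\<dots> = fract_vec (0\<^sub>v (dim_row L))" unfolding 0 by (intro eq_vecI) auto
    finally have "L *\<^sub>v y = 0\<^sub>v (dim_row L)" by (rule fract_vec_inj)
    then have "y = 0\<^sub>v (dim_col L)" using f q unfolding full_col_rank_def by auto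
    then have "to_fract q \<cdot>\<^sub>v x = 0\<^sub>v (dim_col L)" using q by simp
    then have "to_fract q * x $ i = 0" if "i < dim_col L" for i
      using that x arg_cong[of _ _ "\<lambda>v. v $ i"] by (metis carrier_vecD fract_mat_dim(2) index_smult_vec(1) index_zero_vec(1))
    then show "x = 0\<^sub>v (dim_col (fract_mat L))" using q x by (intro eq_vecI) auto
  qed
qed

lemma mult_unit_vec:
  fixes A :: "'a::semiring_1 mat"
  assumes "A \<in> carrier_mat p r" "i < r"
  shows "A *\<^sub>v unit_vec r i = col A i"
  by (rule eq_vecI) (use assms in auto)

lemma full_col_rank_distinct:
  fixes A :: "'a::comm_ring_1 mat"
  assumes "full_col_rank A" shows "distinct (cols A)"
proof (rule ccontr)
  assume "\<not> distinct (cols A)"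
  then obtain i j where ij: "i < dim_col A" "j < dim_col A" "i \<noteq> j" "col A i = col A j"
    unfolding distinct_conv_nth by auto
  let ?x = "unit_vec (dim_col A) i - unit_vec (dim_col A) j :: 'a vec"
  have "A *\<^sub>v ?x = A *\<^sub>v unit_vec (dim_col A) i - A *\<^sub>v unit_vec (dim_col A) j"
    by (rule mult_minus_distrib_mat_vec[of _ "dim_row A"]) auto
  also have "\<dots> = 0\<^sub>v (dim_row A)" using ij by (simp add: mult_unit_vec[of _ "dim_row A"])
  finally have "?x = 0\<^sub>v (dim_col A)" using assms unfolding full_col_rank_def by simp
  then have "?x $ i = 0\<^sub>v (dim_col A) $ i" by simp
  then show False using ij by simp
qed

text \<open>The link between bases in the sense of abstract vector spaces and matrices. Distinctness of the columns
  must be added because the set of columns forgets repetitions.\<close>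

lemma basis_cols_iff:
  fixes A :: "'k::field mat"
  assumes A: "A \<in> carrier_mat p r" and W: "submodule class_ring W (module_vec TYPE('k) p)"
  shows "distinct (cols A) \<and> vectorspace.basis class_ring ((module_vec TYPE('k) p)\<lparr>carrier := W\<rparr>) (set (cols A))
    \<longleftrightarrow> full_col_rank A \<and> {A *\<^sub>v x |x. x \<in> carrier_vec r} = W"
proof -
  interpret vec_space "TYPE('k)" p .
  have "vectorspace class_ring (V\<lparr>carrier := W\<rparr>)"
    using W submodule_is_module[OF W] by (simp add: vectorspace_def class_field)
  then interpret w: vectorspace "class_ring :: 'k ring" "V\<lparr>carrier := W\<rparr>" .
  have cA: "set (cols A) \<subseteq> carrier_vec p" using A cols_dim by blast
  have span: "span (set (cols A)) = {A *\<^sub>v x |x. x \<in> carrier_vec r}"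
    using col_space_eq[OF A] A unfolding col_space_def by auto
  have mul: "lincomb_list c (cols A) = A *\<^sub>v vec r c" for c
  proof -
    have "\<forall>w\<in>set (cols A). dim_vec w = p" using cA by auto
    then show ?thesis using lincomb_list_as_mat_mult[of "cols A" c] A mat_of_cols_cols[of A] by auto
  qed
  have indpt: "lin_indpt (set (cols A)) \<longleftrightarrow> full_col_rank A" if d: "distinct (cols A)"
  proof
    assume li: "lin_indpt (set (cols A))"
    show "full_col_rank A" unfolding full_col_rank_def
    proof (intro ballI impI)
      fix x assume x: "x \<in> carrier_vec (dim_col A)" and 0: "A *\<^sub>v x = 0\<^sub>v (dim_row A)"
      define a where "a v = x $ (THE i. i < r \<and> cols A ! i = v)" for v
      have ai: "a (cols A ! i) = x $ i" if "i < r" for i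
      proof -
        have "(THE j. j < r \<and> cols A ! j = cols A ! i) = i"
        proof (rule the_equality)
          fix j assume "j < r \<and> cols A ! j = cols A ! i"
          then show "j = i" using nth_eq_iff_index_eq[OF d, of j i] that A by simp
        qed (use that in simp)
        then show ?thesis unfolding a_def by simp
      qed
      have "lincomb a (set (cols A)) = lincomb_list (\<lambda>i. a (cols A ! i)) (cols A)"
        by (rule lincomb_as_lincomb_list_distinct) (use cA d in auto)
      also have "\<dots> = A *\<^sub>v vec r (\<lambda>i. a (cols A ! i))" by (rule mul)
      also have "vec r (\<lambda>i. a (cols A ! i)) = x"
      proof (rule eq_vecI)
        fix i assume "i < dim_vec x"
        then show "vec r (\<lambda>i. a (cols A ! i)) $ i = x $ i" using x A ai[of i] by simp
      qed (use x A in simp)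
      finally have l0: "lincomb a (set (cols A)) = 0\<^sub>v p" using 0 A by simp
      have "a v = 0" if "v \<in> set (cols A)" for v
        using li l0 that unfolding lin_dep_def by auto
      then have "x $ i = 0" if "i < r" for i using ai[OF that] that A by (metis carrier_matD(2) cols_length nth_mem)
      then show "x = 0\<^sub>v (dim_col A)" using x A by (intro eq_vecI) auto
    qed
  next
    assume f: "full_col_rank A"
    have "\<forall>v\<in>set (cols A). a v = 0" if l0: "lincomb a (set (cols A)) = 0\<^sub>v p" for a
    proof -
      have "lincomb a (set (cols A)) = lincomb_list (\<lambda>i. a (cols A ! i)) (cols A)"
        by (rule lincomb_as_lincomb_list_distinct) (use cA d in auto)
      then have "A *\<^sub>v vec r (\<lambda>i. a (cols A ! i)) = 0\<^sub>v (dim_row A)" using l0 mul A by simp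
      then have z: "vec r (\<lambda>i. a (cols A ! i)) = 0\<^sub>v r" using f A unfolding full_col_rank_def by auto
      show ?thesis
      proof
        fix v assume "v \<in> set (cols A)"
        then obtain i where "i < r" "v = cols A ! i" using A by (metis carrier_matD(2) cols_length in_set_conv_nth)
        then show "a v = 0" using arg_cong[OF z, of "\<lambda>x. x $ i"] by simp
      qed
    qed
    then show "lin_indpt (set (cols A))"
      by (intro finite_lin_indpt2) (use cA in auto)
  qed
  have own: "set (cols A) \<subseteq> span (set (cols A))" using in_own_span cA by simp
  show ?thesis
  proof
    assume l: "distinct (cols A) \<and> w.basis (set (cols A))"
    then have sub: "set (cols A) \<subseteq> W" unfolding w.basis_def by auto
    show "full_col_rank A \<and> {A *\<^sub>v x |x. x \<in> carrier_vec r} = W"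
      using l span indpt span_li_not_depend[OF sub W] unfolding w.basis_def by auto
  next
    assume r: "full_col_rank A \<and> {A *\<^sub>v x |x. x \<in> carrier_vec r} = W"
    then have d: "distinct (cols A)" using full_col_rank_distinct by blast
    have sub: "set (cols A) \<subseteq> W" using own span r by auto
    show "distinct (cols A) \<and> w.basis (set (cols A))"
      using d r span indpt[OF d] span_li_not_depend[OF sub W] sub unfolding w.basis_def by auto
  qed
qed

definition basis_mat :: "nat \<Rightarrow> nat \<Rightarrow> 'a::field poly fract vec set \<Rightarrow> 'a poly mat \<Rightarrow> bool" where
  "basis_mat p r W L \<longleftrightarrow> L \<in> carrier_mat p r \<and> full_col_rank L \<and> rational_span L = W"

lemma cols_fract_mat: "cols (fract_mat L) = map fract_vec (cols L)"
  unfolding cols_def fract_mat_def fract_vec_def by (auto intro!: nth_equalityI eq_vecI)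

lemma polynomial_basis_iff_basis_mat:
  fixes W :: "'a::field poly fract vec set"
  assumes W: "submodule class_ring W (module_vec TYPE('a poly fract) p)" and L: "L \<in> carrier_mat p r"
  shows "distinct (cols L) \<and> polynomial_basis p W (set (cols L)) \<longleftrightarrow> basis_mat p r W L"
proof -
  have "distinct (cols (fract_mat L)) \<longleftrightarrow> distinct (cols L)"
    unfolding cols_fract_mat distinct_map by (auto intro!: inj_onI dest: fract_vec_inj)
  moreover have "set (cols (fract_mat L)) = fract_vec ` set (cols L)" unfolding cols_fract_mat by simp
  ultimately show ?thesis
    using basis_cols_iff[of "fract_mat L" p r W] W L
    unfolding polynomial_basis_def basis_mat_def rational_span_def by auto
qed

lemma basis_mat_unique_dim:
  fixes W :: "'a::field poly fract vec set"
  assumes W: "submodule class_ring W (module_vec TYPE('a poly fract) p)"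
    and L: "basis_mat p r W L"
  shows "vectorspace.dim class_ring ((module_vec TYPE('a poly fract) p)\<lparr>carrier := W\<rparr>) = r"
proof -
  interpret vec_space "TYPE('a poly fract)" p .
  have "vectorspace class_ring (V\<lparr>carrier := W\<rparr>)"
    using W submodule_is_module[OF W] by (simp add: vectorspace_def class_field)
  then interpret w: vectorspace "class_ring :: 'a poly fract ring" "V\<lparr>carrier := W\<rparr>" .
  have Lc: "L \<in> carrier_mat p r" using L unfolding basis_mat_def by auto
  then have b: "distinct (cols (fract_mat L)) \<and> w.basis (set (cols (fract_mat L)))"
    using basis_cols_iff[of "fract_mat L" p r W] W L unfolding basis_mat_def rational_span_def by auto
  then have "w.dim = card (set (cols (fract_mat L)))" by (intro w.dim_basis) auto
  also have "\<dots> = r" using b Lc by (simp add: distinct_card)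
  finally show ?thesis .
qed

lemma vec_degree_le_iff: "vec_degree v \<le> k \<longleftrightarrow> (\<forall>i<dim_vec v. degree (v $ i) \<le> k)"
proof -
  have "finite (degree ` set\<^sub>v v)" by (simp add: vec_set_def)
  then show ?thesis unfolding vec_degree_def by (auto simp: vec_set_def)
qed

lemma mat_degree_le_iff: "mat_degree A \<le> k \<longleftrightarrow> (\<forall>i<dim_row A. \<forall>j<dim_col A. degree (A $$ (i,j)) \<le> k)"
proof -
  have e: "elements_mat A = (\<lambda>(i,j). A $$ (i,j)) ` ({..<dim_row A} \<times> {..<dim_col A})"
    unfolding elements_mat_def by force
  have "finite (elements_mat A)" unfolding e by simp
  then show ?thesis unfolding mat_degree_def by (auto simp: e)
qed

text \<open>The list \<open>ks\<close> records the column degrees in the order of the columns. Only competitors with the same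
  number of columns occur, since all bases of \<open>W\<close> have the same size.\<close>

definition minimal_basis_mat :: "nat \<Rightarrow> 'a::field poly fract vec set \<Rightarrow> nat list \<Rightarrow> 'a poly mat \<Rightarrow> bool" where
  "minimal_basis_mat p W ks L \<longleftrightarrow> basis_mat p (length ks) W L \<and>
     (\<forall>i<length ks. vec_degree (col L i) = ks ! i) \<and>
     (\<forall>M. basis_mat p (length ks) W M \<longrightarrow> sum_list ks \<le> (\<Sum>i<length ks. vec_degree (col M i)))"

lemma mset_eq_image_mset_ex: "mset ks = image_mset f M \<Longrightarrow> \<exists>xs. mset xs = M \<and> map f xs = ks"
proof (induction ks arbitrary: M)
  case (Cons k ks)
  then have "k \<in># image_mset f M" by (metis list.set_intros(1) set_mset_mset)
  then obtain x where x: "x \<in># M" "f x = k" by auto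
  then obtain M' where M: "M = add_mset x M'" by (meson multi_member_split)
  then have "mset ks = image_mset f M'" using Cons.prems x by simp
  then obtain xs where "mset xs = M'" "map f xs = ks" using Cons.IH by blast
  then show ?case using x M by (intro exI[of _ "x # xs"]) auto
qed auto

lemma basis_order_cols:
  assumes "distinct (cols L)"
  shows "basis_order (set (cols L)) = (\<Sum>i<dim_col L. vec_degree (col L i))"
proof -
  have "basis_order (set (cols L)) = sum_list (map vec_degree (cols L))"
    unfolding basis_order_def using assms by (simp add: sum_list_distinct_conv_sum_set)
  also have "\<dots> = (\<Sum>i<dim_col L. vec_degree (col L i))"
    by (simp add: sum_list_sum_nth atLeast0LessThan)
  finally show ?thesis .
qed

text \<open>Conversely to \<open>has_minimal_indicesI\<close>, the elements of a minimal basis can be listed so that their degrees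
  appear in the order of \<open>ks\<close>.\<close>

lemma has_minimal_indicesD:
  fixes W :: "'a::field poly fract vec set"
  assumes W: "submodule class_ring W (module_vec TYPE('a poly fract) p)"
    and h: "has_minimal_indices p W ks"
  obtains L where "minimal_basis_mat p W ks L"
proof -
  obtain B where B: "minimal_basis p W B" and ks: "mset ks = image_mset vec_degree (mset_set B)"
    using h unfolding has_minimal_indices_def by blast
  have pB: "polynomial_basis p W B" using B unfolding minimal_basis_def by auto
  then have finB: "finite B" unfolding polynomial_basis_def by auto
  interpret vec_space "TYPE('a poly fract)" p .
  have "vectorspace class_ring (V\<lparr>carrier := W\<rparr>)"
    using W submodule_is_module[OF W] by (simp add: vectorspace_def class_field)
  then interpret w: vectorspace "class_ring :: 'a poly fract ring" "V\<lparr>carrier := W\<rparr>" .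
  have "fract_vec ` B \<subseteq> W" using pB unfolding polynomial_basis_def w.basis_def by auto
  moreover have "W \<subseteq> carrier_vec p" using W unfolding submodule_def by auto
  ultimately have Bc: "B \<subseteq> carrier_vec p"
  proof (intro subsetI)
    fix v assume "fract_vec ` B \<subseteq> W" "W \<subseteq> carrier_vec p" "v \<in> B"
    then have "fract_vec v \<in> carrier_vec p" by blast
    then show "v \<in> carrier_vec p" by simp
  qed
  obtain xs where xs: "mset xs = mset_set B" "map vec_degree xs = ks"
    using mset_eq_image_mset_ex[OF ks] by blast
  have setx: "set xs = B" using arg_cong[OF xs(1), of set_mset] finB by simp
  have dist: "distinct xs"
    unfolding distinct_count_atmost_1 xs(1) setx using finB by (simp add: count_mset_set')
  define L where "L = mat_of_cols p xs"
  have cL: "cols L = xs" unfolding L_def using Bc setx by (intro cols_mat_of_cols) auto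
  have lk: "length ks = length xs" using xs(2) by auto
  have Lc: "L \<in> carrier_mat p (length ks)" unfolding L_def lk by simp
  have bL: "basis_mat p (length ks) W L"
    using polynomial_basis_iff_basis_mat[OF W Lc] cL dist setx pB by simp
  have deg: "vec_degree (col L i) = ks ! i" if "i < length ks" for i
    using that xs(2) Lc cL lk by (metis carrier_matD(2) cols_nth nth_map)
  have oB: "basis_order B = sum_list ks"
    unfolding basis_order_def xs(2)[symmetric] setx[symmetric] by (rule sum_list_distinct_conv_sum_set[OF dist, symmetric])
  have "sum_list ks \<le> (\<Sum>i<length ks. vec_degree (col M i))" if M: "basis_mat p (length ks) W M" for M
  proof -
    have Mc: "M \<in> carrier_mat p (length ks)" using M unfolding basis_mat_def by auto
    then have "distinct (cols M) \<and> polynomial_basis p W (set (cols M))"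
      using polynomial_basis_iff_basis_mat[OF W Mc] M by simp
    then show ?thesis using B oB basis_order_cols[of M] Mc unfolding minimal_basis_def by auto
  qed
  then show thesis using that[of L] bL deg unfolding minimal_basis_mat_def by blast
qed

lemma has_minimal_indicesI:
  fixes W :: "'a::field poly fract vec set"
  assumes W: "submodule class_ring W (module_vec TYPE('a poly fract) p)"
    and L: "minimal_basis_mat p W ks L" and ks: "is_partition ks"
  shows "has_minimal_indices p W ks"
proof -
  have bL: "basis_mat p (length ks) W L" and Lc: "L \<in> carrier_mat p (length ks)"
    using L unfolding minimal_basis_mat_def basis_mat_def by auto
  have dL: "distinct (cols L)" and pL: "polynomial_basis p W (set (cols L))"
    using polynomial_basis_iff_basis_mat[OF W Lc] bL by auto
  have ksL: "map vec_degree (cols L) = ks"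
    using L Lc unfolding minimal_basis_mat_def by (intro nth_equalityI) auto
  have oL: "basis_order (set (cols L)) = sum_list ks"
    unfolding basis_order_def ksL[symmetric] by (rule sum_list_distinct_conv_sum_set[OF dL, symmetric])
  interpret vec_space "TYPE('a poly fract)" p .
  have "vectorspace class_ring (V\<lparr>carrier := W\<rparr>)"
    using W submodule_is_module[OF W] by (simp add: vectorspace_def class_field)
  then interpret w: vectorspace "class_ring :: 'a poly fract ring" "V\<lparr>carrier := W\<rparr>" .
  have "basis_order (set (cols L)) \<le> basis_order C" if C: "polynomial_basis p W C" for C
  proof -
    have fin: "finite C" using C unfolding polynomial_basis_def by auto
    obtain xs where xs: "set xs = C" "distinct xs" using finite_distinct_list[OF fin] by blast
    have "fract_vec ` C \<subseteq> W" using C unfolding polynomial_basis_def w.basis_def by auto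
    moreover have "W \<subseteq> carrier_vec p" using W unfolding submodule_def by auto
    ultimately have Cc: "C \<subseteq> carrier_vec p"
    proof (intro subsetI)
      fix v assume "fract_vec ` C \<subseteq> W" "W \<subseteq> carrier_vec p" "v \<in> C"
      then have "fract_vec v \<in> carrier_vec p" by blast
      then show "v \<in> carrier_vec p" by simp
    qed
    define M where "M = mat_of_cols p xs"
    have cM: "cols M = xs" unfolding M_def using Cc xs by (intro cols_mat_of_cols) auto
    have Mc: "M \<in> carrier_mat p (length xs)" unfolding M_def by simp
    have bM: "basis_mat p (length xs) W M"
      using polynomial_basis_iff_basis_mat[OF W Mc] cM xs C by simp
    have "length xs = length ks" using basis_mat_unique_dim[OF W bM] basis_mat_unique_dim[OF W bL] by simp
    then have "sum_list ks \<le> (\<Sum>i<length ks. vec_degree (col M i))"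
      using L bM unfolding minimal_basis_mat_def by auto
    also have "\<dots> = basis_order C" using basis_order_cols[of M] cM xs Mc \<open>length xs = length ks\<close> by simp
    finally show ?thesis using oL by simp
  qed
  then have "minimal_basis p W (set (cols L))" using pL unfolding minimal_basis_def by blast
  moreover have "mset ks = image_mset vec_degree (mset_set (set (cols L)))"
    unfolding ksL[symmetric] mset_map mset_set_set[OF dL] ..
  ultimately show ?thesis using ks unfolding has_minimal_indices_def by blast
qed

lemma submodule_mat_kernel:
  fixes A :: "'k::field mat"
  assumes A: "A \<in> carrier_mat m p"
  shows "submodule class_ring (mat_kernel A) (module_vec TYPE('k) p)"
proof -
  interpret vec_space "TYPE('k)" p .
  show ?thesis
    by unfold_locales
      (insert A mult_add_distrib_mat_vec[OF A] mult_mat_vec[OF A] mat_kernel[OF A], auto simp: class_ring_simps)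
qed

lemma submodule_col_space:
  fixes A :: "'k::field mat"
  assumes A: "A \<in> carrier_mat p r"
  shows "submodule class_ring (vec_space.col_space p A) (module_vec TYPE('k) p)"
proof -
  interpret vec_space "TYPE('k)" p .
  have "set (cols A) \<subseteq> carrier V" using A cols_dim[of A] by auto
  then show ?thesis unfolding col_space_def using span_is_submodule[of "set (cols A)"] by simp
qed

lemma col_space_fract_mat:
  fixes A :: "'a::field poly mat"
  assumes A: "A \<in> carrier_mat p r"
  shows "vec_space.col_space p (fract_mat A) = rational_span A"
proof -
  interpret vec_space "TYPE('a poly fract)" p .
  show ?thesis using col_space_eq[of "fract_mat A" r] A unfolding rational_span_def by auto
qed

lemma left_kernel_eq: "left_kernel A = mat_kernel A\<^sup>T" for A :: "'k::field mat"
proof -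
  have "mat_of_row x * A = 0\<^sub>m 1 (dim_col A) \<longleftrightarrow> A\<^sup>T *\<^sub>v x = 0\<^sub>v (dim_col A)"
    if x: "x \<in> carrier_vec (dim_row A)" for x
  proof -
    have e: "(mat_of_row x * A) $$ (0,j) = (A\<^sup>T *\<^sub>v x) $ j" if "j < dim_col A" for j
      using that x by (simp add: comm_scalar_prod[of x "dim_row A"])
    show ?thesis
    proof
      assume "mat_of_row x * A = 0\<^sub>m 1 (dim_col A)"
      then show "A\<^sup>T *\<^sub>v x = 0\<^sub>v (dim_col A)" using e by (intro eq_vecI) auto
    next
      assume "A\<^sup>T *\<^sub>v x = 0\<^sub>v (dim_col A)"
      then show "mat_of_row x * A = 0\<^sub>m 1 (dim_col A)" using e by (intro eq_matI) auto
    qed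
  qed
  then show ?thesis unfolding left_kernel_def mat_kernel_def by auto
qed

lemma poly_mat_rank_eq:
  assumes A: "A \<in> carrier_mat p n" and L: "basis_mat p r (rational_span A) L"
  shows "poly_mat_rank A = r"
proof -
  interpret vec_space "TYPE('a poly fract)" p .
  have fA: "fract_mat A \<in> carrier_mat p n" using A by simp
  have "poly_mat_rank A = vectorspace.dim class_ring (V\<lparr>carrier := rational_span A\<rparr>)"
    using A col_space_fract_mat[OF A] unfolding poly_mat_rank_def col_space_def by (simp add: rank_def)
  also have "\<dots> = r"
    by (rule basis_mat_unique_dim[OF _ L]) (use submodule_col_space[OF fA] col_space_fract_mat[OF A] in simp)
  finally show ?thesis .
qed

section \<open>Minimal bases\<close>

lemma mult_mat_vec_zero: "A \<in> carrier_mat p r \<Longrightarrow> A *\<^sub>v 0\<^sub>v r = 0\<^sub>v p"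
  for A :: "'a::semiring_0 mat"
  by (intro eq_vecI) auto

lemma mult_mat_smult_vec:
  "A \<in> carrier_mat p r \<Longrightarrow> v \<in> carrier_vec r \<Longrightarrow> A *\<^sub>v (c \<cdot>\<^sub>v v) = c \<cdot>\<^sub>v (A *\<^sub>v v)"
  for A :: "'a::comm_semiring_0 mat"
  by (intro eq_vecI) (auto simp: scalar_prod_def sum_distrib_left mult_ac)

lemma full_col_rank_left_inverse:
  fixes L :: "'a::comm_ring_1 mat"
  assumes "L \<in> carrier_mat p r" "Y \<in> carrier_mat r p" "Y * L = 1\<^sub>m r"
  shows "full_col_rank L"
  unfolding full_col_rank_def
proof (intro ballI impI)
  fix x assume x: "x \<in> carrier_vec (dim_col L)" and 0: "L *\<^sub>v x = 0\<^sub>v (dim_row L)"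
  then have "(Y * L) *\<^sub>v x = Y *\<^sub>v (0\<^sub>v p)" using assms by (metis assoc_mult_mat_vec carrier_matD)
  then show "x = 0\<^sub>v (dim_col L)" using assms x by (simp add: mult_mat_vec_zero)
qed

text \<open>A polynomial left inverse makes the coordinates of polynomial vectors polynomial.\<close>

lemma rational_span_coordinates:
  fixes L :: "'a::field poly mat"
  assumes L: "L \<in> carrier_mat p r" and Y: "Y \<in> carrier_mat r p" "Y * L = 1\<^sub>m r"
    and M: "M \<in> carrier_mat p n" and sub: "\<And>j. j < n \<Longrightarrow> fract_vec (col M j) \<in> rational_span L"
  shows "M = L * (Y * M)"
proof (rule eq_matI)
  fix i j assume "i < dim_row (L * (Y * M))" "j < dim_col (L * (Y * M))"
  then have i: "i < p" and j: "j < n" using L M by auto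
  obtain x where x: "x \<in> carrier_vec r" "fract_vec (col M j) = fract_mat L *\<^sub>v x"
    using sub[OF j] L unfolding rational_span_def by auto
  have c: "col M j \<in> carrier_vec p" using M by auto
  have "fract_vec (Y *\<^sub>v col M j) = fract_mat Y *\<^sub>v (fract_mat L *\<^sub>v x)"
    using fract_mat_mult_vec[OF Y(1) c] x by simp
  also have "\<dots> = fract_mat (Y * L) *\<^sub>v x"
    using fract_mat_mult[OF Y(1) L] assoc_mult_mat_vec[of "fract_mat Y" r p "fract_mat L" r x] x L Y by simp
  also have "\<dots> = x" using Y(2) x by simp
  finally have "fract_vec (L *\<^sub>v (Y *\<^sub>v col M j)) = fract_vec (col M j)"
    using fract_mat_mult_vec[OF L mult_mat_vec_carrier[OF Y(1) c]] x by simp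
  then have "L *\<^sub>v (Y *\<^sub>v col M j) = col M j" by (rule fract_vec_inj)
  moreover have "col (L * (Y * M)) j = L *\<^sub>v (Y *\<^sub>v col M j)"
    using L Y M j by (simp add: col_mult2[of _ p r _ n] col_mult2[of _ r p _ n] del: col_mult)
  ultimately have "col (L * (Y * M)) j $ i = col M j $ i" by simp
  then show "M $$ (i,j) = (L * (Y * M)) $$ (i,j)" using i j L M by simp
qed (use L M in auto)

lemma rational_span_col:
  assumes "M \<in> carrier_mat p n" "j < n"
  shows "fract_vec (col M j) \<in> rational_span M"
proof -
  have "fract_vec (col M j) = fract_mat M *\<^sub>v fract_vec (unit_vec n j)"
    using fract_mat_mult_vec[OF assms(1), of "unit_vec n j"] mult_unit_vec[OF assms] by simp
  then show ?thesis unfolding rational_span_def using assms by force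
qed

lemma rational_span_mult_subset:
  assumes "L \<in> carrier_mat p r" "G \<in> carrier_mat r n"
  shows "rational_span (L * G) \<subseteq> rational_span L"
proof
  fix y assume "y \<in> rational_span (L * G)"
  then obtain x where x: "x \<in> carrier_vec n" "y = fract_mat (L * G) *\<^sub>v x"
    unfolding rational_span_def using assms by auto
  then have "y = fract_mat L *\<^sub>v (fract_mat G *\<^sub>v x)"
    using fract_mat_mult[OF assms] assms by (simp add: assoc_mult_mat_vec[of _ p r _ n])
  then show "y \<in> rational_span L" unfolding rational_span_def using assms x by auto
qed

lemma degree_sum_mult_le:
  fixes x :: "nat \<Rightarrow> 'a::field poly"
  assumes "\<And>j. j \<in> J \<Longrightarrow> x j \<noteq> 0 \<Longrightarrow> y j \<noteq> 0 \<Longrightarrow> degree (x j) + degree (y j) \<le> D"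
  shows "degree (\<Sum>j\<in>J. x j * y j) \<le> D"
proof (cases "finite J")
  case True
  show ?thesis
  proof (rule degree_sum_le[OF True])
    fix j assume "j \<in> J"
    then show "degree (x j * y j) \<le> D"
      using assms[of j] degree_mult_le[of "x j" "y j"] by (cases "x j = 0 \<or> y j = 0") auto
  qed
qed simp

lemma col_reversal_const_mult:
  fixes L :: "'a::field poly mat"
  assumes C: "C \<in> carrier_mat n p" and L: "L \<in> carrier_mat p r"
  shows "col_reversal k (map_mat (\<lambda>c. [:c:]) C * L) = map_mat (\<lambda>c. [:c:]) C * col_reversal k L"
  by (intro eq_matI)
     (use C L in \<open>auto simp: col_reversal_def scalar_prod_def rev_poly_eq_homog homog_sum homog_smult\<close>)

lemma degree_const_mult_le:
  fixes L :: "'a::field poly mat"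
  assumes C: "C \<in> carrier_mat n p" and L: "L \<in> carrier_mat p r" and ij: "i < n" "j < r"
    and deg: "\<And>i. i < p \<Longrightarrow> degree (L $$ (i,j)) \<le> k"
  shows "degree ((map_mat (\<lambda>c. [:c:]) C * L) $$ (i,j)) \<le> k"
  using assms by (auto simp: scalar_prod_def intro!: degree_sum_le order.trans[OF degree_smult_le])

text \<open>Sufficient criterion for minimality. The existence of \<open>X\<close> and \<open>q\<close> says that the leading column
  coefficients are linearly independent. Let \<open>C\<close> be the value of \<open>X\<close> at \<open>0\<close>. Then \<open>det (C * L)\<close> has the largest
  conceivable degree, the sum of \<open>ks\<close>. Any other polynomial basis is \<open>M = L * G\<close> with \<open>G\<close> polynomial, because
  of the left inverse \<open>Y\<close>, so \<open>det (C * M)\<close> has at least this degree, while the order of \<open>M\<close> bounds it from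
  above.\<close>

lemma minimal_basis_matI:
  fixes L :: "'a::field poly mat"
  assumes L: "L \<in> carrier_mat p (length ks)"
    and Y: "Y \<in> carrier_mat (length ks) p" "Y * L = 1\<^sub>m (length ks)"
    and X: "X \<in> carrier_mat (length ks) p" "X * col_reversal ((!) ks) L = q \<cdot>\<^sub>m 1\<^sub>m (length ks)"
    and q: "poly q 0 \<noteq> 0"
    and deg: "\<And>i j. i < p \<Longrightarrow> j < length ks \<Longrightarrow> degree (L $$ (i,j)) \<le> ks ! j"
  shows "minimal_basis_mat p (rational_span L) ks L"
proof -
  let ?r = "length ks" and ?e = "\<lambda>p::'a poly. poly p 0"
  let ?H = "col_reversal ((!) ks) L"
  have H: "?H \<in> carrier_mat p ?r" using L by simp
  define C where "C = map_mat ?e X"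
  let ?C = "map_mat (\<lambda>c. [:c:]) C"
  have C: "C \<in> carrier_mat ?r p" unfolding C_def using X by simp
  have b: "basis_mat p ?r (rational_span L) L"
    unfolding basis_mat_def using L full_col_rank_left_inverse[OF L Y] by simp
  have H0: "poly (?H $$ (i,j)) 0 = coeff (L $$ (i,j)) (ks ! j)" if "i < p" "j < ?r" for i j
    using that L by (simp add: col_reversal_def poly_0_rev_poly)
  have degcol: "vec_degree (col L j) = ks ! j" if j: "j < ?r" for j
  proof (rule antisym)
    show "vec_degree (col L j) \<le> ks ! j" using deg j L by (auto simp: vec_degree_le_iff)
    show "ks ! j \<le> vec_degree (col L j)"
    proof (rule ccontr)
      assume "\<not> ks ! j \<le> vec_degree (col L j)"
      then have less: "degree (L $$ (i,j)) < ks ! j" if "i < p" for i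
        using vec_degree_le_iff[of "col L j" "vec_degree (col L j)"] that j L
        by (auto dest!: spec[of _ i])
      have "poly ((X * ?H) $$ (j,j)) 0 = (\<Sum>i<p. poly (X $$ (j,i)) 0 * poly (?H $$ (i,j)) 0)"
        using X(1) H j by (simp add: scalar_prod_def poly_sum atLeast0LessThan del: col_reversal_dim)
      also have "\<dots> = 0" using H0 j less by (intro sum.neutral) (auto simp: coeff_eq_0)
      finally show False using X q j by simp
    qed
  qed
  have CX: "map_mat ?e (?C * ?H) = map_mat ?e (X * ?H)"
    by (intro eq_matI) (use C X(1) H in \<open>auto simp: scalar_prod_def poly_sum C_def\<close>)
  have "poly (det (?C * ?H)) 0 = det (map_mat ?e (q \<cdot>\<^sub>m 1\<^sub>m ?r))" unfolding poly_det CX X ..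
  also have "\<dots> = poly (det (q \<cdot>\<^sub>m 1\<^sub>m ?r)) 0" unfolding poly_det ..
  also have "\<dots> \<noteq> 0" using q by simp
  finally have nz: "poly (det (?C * ?H)) 0 \<noteq> 0" .
  let ?CL = "?C * L"
  have CLc: "?CL \<in> carrier_mat ?r ?r" using C L by simp
  have rv: "col_reversal ((!) ks) ?CL = ?C * ?H" by (rule col_reversal_const_mult[OF C L])
  have degCL: "degree (?CL $$ (i,j)) \<le> ks ! j" if "i < ?r" "j < ?r" for i j
    by (rule degree_const_mult_le[OF C L that]) (use deg that in auto)
  have nzCL: "det ?CL \<noteq> 0" using degree_det_col_reversal(1)[OF CLc degCL] rv nz by auto
  have "order 0 (det (?C * ?H)) = 0" using nz by (rule order_0I)
  then have dCL: "degree (det ?CL) = sum_list ks"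
    using degree_det_col_reversal(2)[OF CLc degCL nzCL] rv by (simp add: sum_list_sum_nth atLeast0LessThan)
  have "sum_list ks \<le> (\<Sum>i<?r. vec_degree (col M i))" if M: "basis_mat p ?r (rational_span L) M" for M
  proof -
    have Mc: "M \<in> carrier_mat p ?r" and fM: "full_col_rank M" and sM: "rational_span M = rational_span L"
      using M unfolding basis_mat_def by auto
    define G where "G = Y * M"
    have G: "G \<in> carrier_mat ?r ?r" unfolding G_def using Y Mc by simp
    have MG: "M = L * G" unfolding G_def
      by (rule rational_span_coordinates[OF L Y Mc]) (use rational_span_col[OF Mc] sM in auto)
    have "det G \<noteq> 0"
    proof
      assume "det G = 0"
      then obtain v where v: "v \<in> carrier_vec ?r" "v \<noteq> 0\<^sub>v ?r" "G *\<^sub>v v = 0\<^sub>v ?r"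
        using det_0_iff_vec_prod_zero[OF G] by auto
      then have "M *\<^sub>v v = 0\<^sub>v p" unfolding MG using assoc_mult_mat_vec[OF L G v(1)] L
        by (simp add: mult_mat_vec_zero)
      then show False using fM v Mc unfolding full_col_rank_def by auto
    qed
    moreover have CMe: "?C * M = ?CL * G" unfolding MG by (rule assoc_mult_mat[symmetric]) (use C L G in auto)
    ultimately have nzCM: "det (?C * M) \<noteq> 0" and "degree (det (?C * M)) \<ge> sum_list ks"
      using nzCL det_mult[OF CLc G] dCL by (auto simp: degree_mult_eq)
    moreover have CMc: "?C * M \<in> carrier_mat ?r ?r" using C Mc by simp
    have "degree ((?C * M) $$ (i,j)) \<le> vec_degree (col M j)" if "i < ?r" "j < ?r" for i j
      by (rule degree_const_mult_le[OF C Mc that])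
         (use that Mc vec_degree_le_iff[of "col M j" "vec_degree (col M j)"] in auto)
    from degree_det_col_reversal(2)[OF CMc this nzCM]
    have "degree (det (?C * M)) \<le> (\<Sum>i<?r. vec_degree (col M i))" by simp
    ultimately show ?thesis by simp
  qed
  then show ?thesis unfolding minimal_basis_mat_def using b degcol by blast
qed

text \<open>The scalar \<open>q\<close> lets \<open>M\<close> be a rational transform of \<open>L\<close> while all matrices stay polynomial.\<close>

lemma basis_mat_transform:
  fixes L :: "'a::field poly mat"
  assumes b: "basis_mat p r W L" and M: "M \<in> carrier_mat p r" and G: "G \<in> carrier_mat r r"
    and dG: "det G \<noteq> 0" and q: "q \<noteq> 0" and eq: "q \<cdot>\<^sub>m M = L * G"
  shows "basis_mat p r W M"
proof -
  have L: "L \<in> carrier_mat p r" and f: "full_col_rank L" and W: "W = rational_span L"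
    using b unfolding basis_mat_def by auto
  have fM: "full_col_rank M" unfolding full_col_rank_def
  proof (intro ballI impI)
    fix x assume x: "x \<in> carrier_vec (dim_col M)" and 0: "M *\<^sub>v x = 0\<^sub>v (dim_row M)"
    then have xr: "x \<in> carrier_vec r" using M by simp
    have "L *\<^sub>v (G *\<^sub>v x) = (q \<cdot>\<^sub>m M) *\<^sub>v x" unfolding eq using assoc_mult_mat_vec[OF L G xr] by simp
    also have "\<dots> = q \<cdot>\<^sub>v (M *\<^sub>v x)" using xr M by (intro eq_vecI) auto
    also have "\<dots> = 0\<^sub>v p" unfolding 0 using M by (intro eq_vecI) auto
    finally have "G *\<^sub>v x = 0\<^sub>v r" using f L G xr unfolding full_col_rank_def by auto
    then show "x = 0\<^sub>v (dim_col M)" using det_0_iff_vec_prod_zero[OF G] dG xr M by auto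
  qed
  have sub1: "rational_span M \<subseteq> rational_span L"
  proof
    fix y assume "y \<in> rational_span M"
    then obtain x where x: "x \<in> carrier_vec r" "y = fract_mat M *\<^sub>v x" unfolding rational_span_def using M by auto
    define z where "z = inverse (to_fract q) \<cdot>\<^sub>v x"
    have z: "z \<in> carrier_vec r" unfolding z_def using x by simp
    have "fract_mat (q \<cdot>\<^sub>m M) *\<^sub>v z = y"
      unfolding x(2) z_def fract_mat_def
      by (rule eq_vecI) (use M x q in \<open>auto simp: scalar_prod_def sum_distrib_left intro!: sum.cong\<close>)
    then have "y \<in> rational_span (L * G)" unfolding rational_span_def eq[symmetric] using z M by force
    then show "y \<in> rational_span L" using rational_span_mult_subset[OF L G] by blast
  qed
  have sub2: "rational_span L \<subseteq> rational_span M"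
  proof
    fix y assume "y \<in> rational_span L"
    then obtain x where x: "x \<in> carrier_vec r" "y = fract_mat L *\<^sub>v x" unfolding rational_span_def using L by auto
    define z where "z = inverse (to_fract (det G)) \<cdot>\<^sub>v x"
    have z: "z \<in> carrier_vec r" unfolding z_def using x by simp
    have aG: "adj_mat G \<in> carrier_mat r r" using adj_mat[OF G] by auto
    have "q \<cdot>\<^sub>m (M * adj_mat G) = L * (G * adj_mat G)"
      using mult_smult_assoc_mat[OF M aG, of q] eq assoc_mult_mat[OF L G aG] by simp
    also have "\<dots> = det G \<cdot>\<^sub>m L" using adj_mat[OF G] mult_smult_distrib[OF L one_carrier_mat] L by simp
    also have "q \<cdot>\<^sub>m (M * adj_mat G) = M * (q \<cdot>\<^sub>m adj_mat G)" using mult_smult_distrib[OF M aG] by simp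
    finally have e: "det G \<cdot>\<^sub>m L = M * (q \<cdot>\<^sub>m adj_mat G)" by simp
    have "fract_mat (det G \<cdot>\<^sub>m L) *\<^sub>v z = y"
      unfolding x(2) z_def fract_mat_def
      by (rule eq_vecI) (use L x dG in \<open>auto simp: scalar_prod_def sum_distrib_left intro!: sum.cong\<close>)
    then have "y \<in> rational_span (M * (q \<cdot>\<^sub>m adj_mat G))" unfolding rational_span_def e[symmetric] using z L by force
    then show "y \<in> rational_span M" using rational_span_mult_subset[OF M, of "q \<cdot>\<^sub>m adj_mat G" r] aG by auto
  qed
  show ?thesis unfolding basis_mat_def W using M fM sub1 sub2 by auto
qed

text \<open>The polynomial vector \<open>v\<close> is a rational combination of the columns that involves column \<open>i\<close>, so
  replacing this column by \<open>v\<close> gives another basis, whose order cannot be smaller.\<close>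

lemma minimal_basis_mat_exchange:
  fixes L :: "'a::field poly mat"
  assumes min: "minimal_basis_mat p W ks L" and x: "x \<in> carrier_vec (length ks)"
    and v: "v \<in> carrier_vec p" and q: "q \<noteq> 0" and eq: "L *\<^sub>v x = q \<cdot>\<^sub>v v"
    and i: "i < length ks" and xi: "x $ i \<noteq> 0"
  shows "ks ! i \<le> vec_degree v"
proof -
  let ?r = "length ks"
  have b: "basis_mat p ?r W L" using min unfolding minimal_basis_mat_def by auto
  then have L: "L \<in> carrier_mat p ?r" unfolding basis_mat_def by auto
  define M where "M = mat p ?r (\<lambda>(a,j). if j = i then v $ a else L $$ (a,j))"
  define G where "G = mat ?r ?r (\<lambda>(a,j). if j = i then x $ a else if a = j then q else 0)"
  have M: "M \<in> carrier_mat p ?r" and G: "G \<in> carrier_mat ?r ?r" by (auto simp: M_def G_def)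
  have "q \<cdot>\<^sub>m M = L * G"
  proof (rule eq_matI)
    fix a j assume "a < dim_row (L * G)" "j < dim_col (L * G)"
    then have a: "a < p" and j: "j < ?r" using L G by auto
    show "(q \<cdot>\<^sub>m M) $$ (a,j) = (L * G) $$ (a,j)"
    proof (cases "j = i")
      case True
      then have "col G j = x" using x j by (auto simp: G_def)
      then have "(L * G) $$ (a,j) = (L *\<^sub>v x) $ a" using a j L G by simp
      then show ?thesis using eq a j True v by (simp add: M_def)
    next
      case False
      then have "col G j = q \<cdot>\<^sub>v unit_vec ?r j" using j by (auto simp: G_def)
      then show ?thesis using a j L G False by (simp add: M_def)
    qed
  qed (use L G M in auto)
  moreover have "det G \<noteq> 0"
  proof
    assume "det G = 0"
    then obtain y where y: "y \<in> carrier_vec ?r" "y \<noteq> 0\<^sub>v ?r" "G *\<^sub>v y = 0\<^sub>v ?r"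
      using det_0_iff_vec_prod_zero[OF G] by auto
    have row: "(\<Sum>j<?r. G $$ (a,j) * y $ j) = 0" if "a < ?r" for a
      using arg_cong[OF y(3), of "\<lambda>w. w $ a"] that y(1) G by (simp add: scalar_prod_def atLeast0LessThan)
    have "(\<Sum>j<?r. G $$ (i,j) * y $ j) = x $ i * y $ i"
      using i by (subst sum.remove[of _ i]) (auto simp: G_def intro!: sum.neutral)
    then have yi: "y $ i = 0" using row[OF i] xi by simp
    have "y $ a = 0" if a: "a < ?r" for a
    proof (cases "a = i")
      case False
      have "(\<Sum>j<?r. G $$ (a,j) * y $ j) = q * y $ a"
        using a False yi by (subst sum.remove[of _ a]) (auto simp: G_def intro!: sum.neutral split: if_splits)
      then show ?thesis using row[OF a] q by simp
    qed (use yi in simp)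
    then show False using y by (auto intro!: eq_vecI)
  qed
  ultimately have "basis_mat p ?r W M" using basis_mat_transform[OF b M G _ q] by blast
  then have "sum_list ks \<le> (\<Sum>j<?r. vec_degree (col M j))" using min unfolding minimal_basis_mat_def by auto
  also have "\<dots> = vec_degree (col M i) + (\<Sum>j\<in>{..<?r}-{i}. vec_degree (col M j))"
    using i by (subst sum.remove[of _ i]) auto
  also have "col M i = v" using i v by (auto simp: M_def)
  also have "(\<Sum>j\<in>{..<?r}-{i}. vec_degree (col M j)) = (\<Sum>j\<in>{..<?r}-{i}. ks ! j)"
  proof (rule sum.cong)
    fix j assume j: "j \<in> {..<?r}-{i}"
    then have "col M j = col L j" using L by (auto simp: M_def)
    then show "vec_degree (col M j) = ks ! j" using min j unfolding minimal_basis_mat_def by auto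
  qed simp
  also have "sum_list ks = ks ! i + (\<Sum>j\<in>{..<?r}-{i}. ks ! j)"
    using i by (subst sum.remove[of _ i, symmetric]) (auto simp: sum_list_sum_nth atLeast0LessThan)
  finally show ?thesis by simp
qed

text \<open>A Smith form of \<open>L\<close> together with the inverses of its transforming matrices. The last two facts say that
  \<open>V'\<close> inverts \<open>V\<close> and that \<open>L\<close> maps column \<open>i\<close> of \<open>V'\<close> to \<open>\<delta> i\<close> times column \<open>i\<close> of \<open>U\<close>.\<close>

lemma diagonal_form:
  fixes L :: "'a::field poly mat"
  assumes L: "L \<in> carrier_mat p r"
  obtains U V U' V' \<delta> where "unimodular p U" "unimodular p U'" "unimodular r V" "unimodular r V'"
    "L = U * rect_diag p r \<delta> * V" "U' * U = 1\<^sub>m p" "V * V' = 1\<^sub>m r"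
    "\<forall>i<r. L *\<^sub>v col V' i = (if i < p then \<delta> i \<cdot>\<^sub>v col U i else 0\<^sub>v p)"
    "\<forall>i<r. V *\<^sub>v col V' i = unit_vec r i"
proof -
  obtain \<delta> where "unimodular_equivalent p r L (rect_diag p r \<delta>)" using Smith_form_exists[OF L] by blast
  then obtain U V where UV: "unimodular p U" "unimodular r V" "U * rect_diag p r \<delta> * V = L"
    using unimodular_equivalent_sym unfolding unimodular_equivalent_def by blast
  obtain U' where U: "U \<in> carrier_mat p p" "U' \<in> carrier_mat p p" "U' * U = 1\<^sub>m p" "unimodular p U'"
    using UV(1) by (metis unimodularE)
  obtain V' where V: "V \<in> carrier_mat r r" "V' \<in> carrier_mat r r" "V * V' = 1\<^sub>m r" "V' * V = 1\<^sub>m r" "unimodular r V'"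
    using UV(2) by (metis unimodularE)
  let ?D = "rect_diag p r \<delta>"
  have LV: "L * V' = U * ?D"
    unfolding UV(3)[symmetric] using U V by (simp add: mult_mat_assoc_dim rect_diag_def del: assoc_mult_mat)
  have c: "L *\<^sub>v col V' i = (if i < p then \<delta> i \<cdot>\<^sub>v col U i else 0\<^sub>v p)" if i: "i < r" for i
  proof -
    have "L *\<^sub>v col V' i = U *\<^sub>v col ?D i"
      using arg_cong[OF LV, of "\<lambda>M. col M i"] col_mult2[OF L V(2) i] col_mult2[OF U(1) rect_diag_carrier i] by simp
    also have "col ?D i = (if i < p then \<delta> i \<cdot>\<^sub>v unit_vec p i else 0\<^sub>v p)"
      using i by (auto simp: rect_diag_def)
    also have "U *\<^sub>v \<dots> = (if i < p then \<delta> i \<cdot>\<^sub>v col U i else 0\<^sub>v p)"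
      using U mult_mat_smult_vec[OF U(1), of "unit_vec p i" "\<delta> i"] mult_unit_vec[OF U(1)]
      by (simp add: mult_mat_vec_zero)
    finally show ?thesis .
  qed
  have "V *\<^sub>v col V' i = unit_vec r i" if "i < r" for i
    using col_mult2[OF V(1,2) that] V(3) that by simp
  then show thesis using that[OF UV(1) U(4) UV(2) V(5) UV(3)[symmetric] U(3) V(3)] c by auto
qed

lemma full_col_rank_diagonal_form:
  fixes L :: "'a::field poly mat"
  assumes L: "L \<in> carrier_mat p r" and f: "full_col_rank L"
  obtains U V U' V' \<delta> where "r \<le> p" "unimodular p U" "unimodular p U'" "unimodular r V" "unimodular r V'"
    "L = U * rect_diag p r \<delta> * V" "U' * U = 1\<^sub>m p" "V * V' = 1\<^sub>m r" "\<forall>i<r. \<delta> i \<noteq> 0"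
    "\<forall>i<r. L *\<^sub>v col V' i = \<delta> i \<cdot>\<^sub>v col U i"
    "\<forall>i<r. V *\<^sub>v col V' i = unit_vec r i"
proof -
  obtain U V U' V' \<delta> where UV: "unimodular p U" "unimodular p U'" "unimodular r V" "unimodular r V'"
    "L = U * rect_diag p r \<delta> * V" "U' * U = 1\<^sub>m p" "V * V' = 1\<^sub>m r"
    and c0: "\<forall>i<r. L *\<^sub>v col V' i = (if i < p then \<delta> i \<cdot>\<^sub>v col U i else 0\<^sub>v p)"
    and VV0: "\<forall>i<r. V *\<^sub>v col V' i = unit_vec r i" by (rule diagonal_form[OF L]) (rule that; assumption)
  note c = c0[rule_format] and VV = VV0[rule_format]
  note U = UV(1)[THEN unimodular_carrier] and V = UV(3,4)[THEN unimodular_carrier]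
  have nz: "L *\<^sub>v col V' i \<noteq> 0\<^sub>v p" if i: "i < r" for i
  proof
    assume "L *\<^sub>v col V' i = 0\<^sub>v p"
    moreover have vc: "col V' i \<in> carrier_vec r" using V by auto
    ultimately have "col V' i = 0\<^sub>v r" using f L unfolding full_col_rank_def by auto
    then have "V *\<^sub>v col V' i = 0\<^sub>v r" using V by (simp add: mult_mat_vec_zero)
    then show False using i VV[OF i] by (metis index_unit_vec(1) index_zero_vec(1) zero_neq_one)
  qed
  have lt: "i < p" if "i < r" for i using nz[OF that] c[OF that] by (auto split: if_splits)
  then have rp: "r \<le> p" by (meson leI less_irrefl)
  have "\<delta> i \<noteq> 0" if "i < r" for i
  proof
    assume "\<delta> i = 0"
    then have "\<delta> i \<cdot>\<^sub>v col U i = 0\<^sub>v p" using U by (intro eq_vecI) auto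
    then show False using nz[OF that] c[OF that] lt[OF that] by simp
  qed
  then show thesis using that[OF rp UV(1-7)] c lt VV by auto
qed

lemma left_inverse_of_diagonal_form:
  fixes L :: "'a::comm_ring_1 mat"
  assumes "r \<le> p" "U \<in> carrier_mat p p" "U' \<in> carrier_mat p p" "V \<in> carrier_mat r r" "V' \<in> carrier_mat r r"
    and L: "L = U * rect_diag p r \<delta> * V" and inv: "U' * U = 1\<^sub>m p" "V * V' = 1\<^sub>m r"
  obtains X where "X \<in> carrier_mat r p" "X * L = (\<Prod>i<r. \<delta> i) \<cdot>\<^sub>m 1\<^sub>m r"
proof -
  define D where "D = rect_diag r p (\<lambda>i. \<Prod>j\<in>{..<r}-{i}. \<delta> j)"
  have D: "D \<in> carrier_mat r p" unfolding D_def by simp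
  have V'V: "V' * V = 1\<^sub>m r" using left_inverse_imp_right_inverse[OF assms(4,5) inv(2)] .
  have DD: "D * rect_diag p r \<delta> = (\<Prod>i<r. \<delta> i) \<cdot>\<^sub>m 1\<^sub>m r"
  proof (rule eq_matI)
    fix i j assume "i < dim_row ((\<Prod>i<r. \<delta> i) \<cdot>\<^sub>m 1\<^sub>m r)" "j < dim_col ((\<Prod>i<r. \<delta> i) \<cdot>\<^sub>m 1\<^sub>m r)"
    then have ij: "i < r" "j < r" by auto
    have "(D * rect_diag p r \<delta>) $$ (i,j) = (\<Sum>a<p. D $$ (i,a) * rect_diag p r \<delta> $$ (a,j))"
      using ij D by (simp add: scalar_prod_def atLeast0LessThan rect_diag_def)
    also have "\<dots> = D $$ (i,i) * rect_diag p r \<delta> $$ (i,j)"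
      using ij assms(1) by (subst sum.remove[of _ i]) (auto simp: D_def rect_diag_def intro!: sum.neutral)
    also have "\<dots> = (if i = j then \<delta> i * (\<Prod>j\<in>{..<r}-{i}. \<delta> j) else 0)"
      using ij assms(1) by (auto simp: D_def rect_diag_def mult.commute)
    also have "\<dots> = (if i = j then (\<Prod>i<r. \<delta> i) else 0)" using ij prod.remove[of "{..<r}" i \<delta>] by simp
    finally show "(D * rect_diag p r \<delta>) $$ (i,j) = ((\<Prod>i<r. \<delta> i) \<cdot>\<^sub>m 1\<^sub>m r) $$ (i,j)" using ij by simp
  qed (auto simp: D_def rect_diag_def)
  let ?R = "rect_diag p r \<delta>"
  have "V' * (D * U') * L = V' * (D * (U' * (U * (?R * V))))"
    unfolding L using assms D by (simp add: mult_mat_assoc_dim rect_diag_def del: assoc_mult_mat)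
  also have "U' * (U * (?R * V)) = ?R * V"
    by (rule mult_inverse_cancel[OF inv(1)]) (use assms in \<open>auto simp: rect_diag_def\<close>)
  also have "D * (?R * V) = (D * ?R) * V"
    by (rule assoc_mult_mat[symmetric]) (use D assms in auto)
  also have "V' * \<dots> = (\<Prod>i<r. \<delta> i) \<cdot>\<^sub>m 1\<^sub>m r"
    unfolding DD using assms V'V mult_smult_assoc_mat[OF one_carrier_mat assms(4)] mult_smult_distrib[OF assms(5,4)] by simp
  finally show thesis using that[of "V' * (D * U')"] assms D by auto
qed

lemma finite_argmax:
  fixes f :: "'i \<Rightarrow> nat"
  assumes "finite J" "J \<noteq> {}"
  obtains j where "j \<in> J" "\<And>i. i \<in> J \<Longrightarrow> f i \<le> f j"
proof -
  have "Max (f ` J) \<in> f ` J" using assms by (intro Max_in) auto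
  then obtain j where "j \<in> J" "Max (f ` J) = f j" by auto
  then show thesis using that[of j] assms by (metis Max_ge finite_imageI image_eqI)
qed

lemma minimal_basis_mat_degree_le:
  assumes "minimal_basis_mat p W ks L" "i < p" "j < length ks"
  shows "degree (L $$ (i,j)) \<le> ks ! j"
proof -
  have "L \<in> carrier_mat p (length ks)" "vec_degree (col L j) = ks ! j"
    using assms unfolding minimal_basis_mat_def basis_mat_def by auto
  then show ?thesis using vec_degree_le_iff[of "col L j" "ks ! j"] assms by auto
qed

text \<open>All invariant factors of a minimal basis are units. If \<open>\<delta> i\<close> had positive degree, some combination of the
  columns, with coefficients not all divisible by \<open>\<delta> i\<close>, would be divisible by \<open>\<delta> i\<close>. Reducing the
  coefficients modulo \<open>\<delta> i\<close> and dividing gives a vector of smaller degree than the largest column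
  involved, which contradicts \<open>minimal_basis_mat_exchange\<close>.\<close>

lemma minimal_basis_left_inverse:
  fixes L :: "'a::field poly mat"
  assumes min: "minimal_basis_mat p W ks L"
  obtains Y where "Y \<in> carrier_mat (length ks) p" "Y * L = 1\<^sub>m (length ks)"
proof -
  let ?r = "length ks"
  have L: "L \<in> carrier_mat p ?r" and f: "full_col_rank L"
    using min unfolding minimal_basis_mat_def basis_mat_def by auto
  obtain U V U' V' \<delta> where rp: "?r \<le> p" and UV: "unimodular p U" "unimodular p U'" "unimodular ?r V" "unimodular ?r V'"
    "L = U * rect_diag p ?r \<delta> * V" "U' * U = 1\<^sub>m p" "V * V' = 1\<^sub>m ?r"
    and nz0: "\<forall>i<?r. \<delta> i \<noteq> 0"
    and c0: "\<forall>i<?r. L *\<^sub>v col V' i = \<delta> i \<cdot>\<^sub>v col U i"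
    and VV0: "\<forall>i<?r. V *\<^sub>v col V' i = unit_vec ?r i"
    by (rule full_col_rank_diagonal_form[OF L f]) (rule that; assumption)
  note nz = nz0[rule_format] and c = c0[rule_format] and VV = VV0[rule_format]
  note car = UV(1-4)[THEN unimodular_carrier]
  have unit: "\<delta> i dvd 1" if i: "i < ?r" for i
  proof (rule ccontr)
    assume nu: "\<not> \<delta> i dvd 1"
    then have d1: "1 \<le> degree (\<delta> i)" using nz[OF i] by (metis One_nat_def Suc_leI is_unit_iff_degree neq0_conv)
    \<comment> \<open>\<open>L\<close> maps \<open>w\<close> to a multiple of \<open>\<delta> i\<close>, and \<open>v\<close> is the image of the reduced vector \<open>x\<close> divided by \<open>\<delta> i\<close>.\<close>
    define w where "w = col V' i"
    define x where "x = vec ?r (\<lambda>j. w $ j mod \<delta> i)"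
    define u where "u = vec ?r (\<lambda>j. w $ j div \<delta> i)"
    define v where "v = col U i - L *\<^sub>v u"
    have w: "w \<in> carrier_vec ?r" and x: "x \<in> carrier_vec ?r" and u: "u \<in> carrier_vec ?r"
      using car col_dim[of V' i] by (auto simp: w_def x_def u_def)
    have v: "v \<in> carrier_vec p" unfolding v_def using L car u by auto
    have xw: "x = w - \<delta> i \<cdot>\<^sub>v u"
      by (intro eq_vecI) (use w in \<open>auto simp: x_def u_def minus_mult_div_eq_mod\<close>)
    have "L *\<^sub>v x = L *\<^sub>v w - L *\<^sub>v (\<delta> i \<cdot>\<^sub>v u)"
      unfolding xw by (rule mult_minus_distrib_mat_vec[OF L w]) (use u in simp)
    also have "\<dots> = \<delta> i \<cdot>\<^sub>v v"
      unfolding v_def w_def c[OF i] mult_mat_smult_vec[OF L u] using car L by (intro eq_vecI) (auto simp: algebra_simps)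
    finally have Lx: "L *\<^sub>v x = \<delta> i \<cdot>\<^sub>v v" .
    define J where "J = {j. j < ?r \<and> x $ j \<noteq> 0}"
    have finJ: "finite J" unfolding J_def by simp
    have "J \<noteq> {}"
    proof
      assume "J = {}"
      then have "w = \<delta> i \<cdot>\<^sub>v u" using w x u xw unfolding J_def
        by (intro eq_vecI) (auto simp: x_def u_def)
      then have "V *\<^sub>v w = \<delta> i \<cdot>\<^sub>v (V *\<^sub>v u)" using mult_mat_smult_vec[OF car(3) u] by simp
      then have "(\<delta> i \<cdot>\<^sub>v (V *\<^sub>v u)) $ i = unit_vec ?r i $ i" using VV[OF i] unfolding w_def by simp
      then have "\<delta> i * (V *\<^sub>v u) $ i = 1" using i car by simp
      then show False using nu by (metis dvd_triv_left)
    qed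
    from finite_argmax[OF finJ this, of "(!) ks"] obtain j where
      j: "j \<in> J" and jmax: "\<And>l. l \<in> J \<Longrightarrow> ks ! l \<le> ks ! j" by blast
    have jr: "j < ?r" "x $ j \<noteq> 0" using j unfolding J_def by auto
    have le: "ks ! j \<le> vec_degree v"
      by (rule minimal_basis_mat_exchange[OF min x v nz[OF i] Lx jr])
    have vd: "degree (v $ a) < ks ! j" if a: "a < p" "v $ a \<noteq> 0" for a
    proof -
      have "(L *\<^sub>v x) $ a = (\<Sum>l<?r. x $ l * L $$ (a,l))"
        using a L x by (simp add: scalar_prod_def atLeast0LessThan mult.commute)
      also have "degree \<dots> \<le> (degree (\<delta> i) - 1) + ks ! j"
      proof (rule degree_sum_mult_le)
        fix l assume l: "l \<in> {..<?r}" "x $ l \<noteq> 0" "L $$ (a,l) \<noteq> 0"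
        then have "l \<in> J" unfolding J_def by auto
        have "degree (x $ l) < degree (\<delta> i)"
          using l degree_mod_less[OF nz[OF i], of "w $ l"] by (auto simp: x_def)
        moreover have "degree (L $$ (a,l)) \<le> ks ! j"
          using minimal_basis_mat_degree_le[OF min a(1), of l] jmax[OF \<open>l \<in> J\<close>] l by auto
        ultimately show "degree (x $ l) + degree (L $$ (a,l)) \<le> (degree (\<delta> i) - 1) + ks ! j" by linarith
      qed
      finally have "degree (\<delta> i * v $ a) \<le> (degree (\<delta> i) - 1) + ks ! j" unfolding Lx using a v by simp
      then show ?thesis using nz[OF i] a d1 by (simp add: degree_mult_eq)
    qed
    have "\<exists>a<p. v $ a \<noteq> 0"
    proof (rule ccontr)
      assume "\<not> (\<exists>a<p. v $ a \<noteq> 0)"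
      then have "L *\<^sub>v x = 0\<^sub>v p" unfolding Lx using v by (intro eq_vecI) auto
      then have "x = 0\<^sub>v ?r" using f x L unfolding full_col_rank_def by auto
      then show False using jr by simp
    qed
    then have kj: "0 < ks ! j" using vd by fastforce
    have "vec_degree v \<le> ks ! j - 1" unfolding vec_degree_le_iff
    proof (intro allI impI)
      fix a assume "a < dim_vec v"
      then show "degree (v $ a) \<le> ks ! j - 1" using vd[of a] v by (cases "v $ a = 0") auto
    qed
    then show False using le kj by linarith
  qed
  obtain X where X: "X \<in> carrier_mat ?r p" "X * L = (\<Prod>i<?r. \<delta> i) \<cdot>\<^sub>m 1\<^sub>m ?r"
    using left_inverse_of_diagonal_form[OF rp car(1,2,3,4) UV(5,6,7)] by blast
  have "(\<Prod>i<?r. \<delta> i) dvd (\<Prod>i<?r. 1)" by (rule prod_dvd_prod) (use unit in auto)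
  then obtain e where e: "(\<Prod>i<?r. \<delta> i) * e = 1" by (auto elim: dvdE)
  have "(e \<cdot>\<^sub>m X) * L = 1\<^sub>m ?r"
    unfolding mult_smult_assoc_mat[OF X(1) L] X(2) by (intro eq_matI) (use e in \<open>auto simp: mult.commute\<close>)
  then show thesis using that[of "e \<cdot>\<^sub>m X"] X by simp
qed

text \<open>The leading column coefficients of a minimal basis are independent. If \<open>\<delta> i\<close> vanished at \<open>0\<close>, the values at
  \<open>0\<close> of column \<open>i\<close> of \<open>V'\<close> would give a linear relation between the leading coefficients. Shifting the columns
  to the largest degree involved turns it into a polynomial combination whose top coefficients cancel,
  against \<open>minimal_basis_mat_exchange\<close>.\<close>

lemma minimal_basis_reversal_diagonal_form:
  fixes L :: "'a::field poly mat"
  assumes min: "minimal_basis_mat p W ks L"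
  obtains U V U' V' \<delta> where "length ks \<le> p" "unimodular p U" "unimodular p U'"
    "unimodular (length ks) V" "unimodular (length ks) V'"
    "col_reversal ((!) ks) L = U * rect_diag p (length ks) \<delta> * V" "U' * U = 1\<^sub>m p" "V * V' = 1\<^sub>m (length ks)"
    "\<forall>i<length ks. poly (\<delta> i) 0 \<noteq> 0"
proof -
  let ?r = "length ks" and ?H = "col_reversal ((!) ks) L"
  have L: "L \<in> carrier_mat p ?r" and f: "full_col_rank L"
    using min unfolding minimal_basis_mat_def basis_mat_def by auto
  have rp: "?r \<le> p" by (rule full_col_rank_diagonal_form[OF L f])
  have H: "?H \<in> carrier_mat p ?r" using L by simp
  obtain U V U' V' \<delta> where UV: "unimodular p U" "unimodular p U'" "unimodular ?r V" "unimodular ?r V'"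
    "?H = U * rect_diag p ?r \<delta> * V" "U' * U = 1\<^sub>m p" "V * V' = 1\<^sub>m ?r"
    and c0: "\<forall>i<?r. ?H *\<^sub>v col V' i = (if i < p then \<delta> i \<cdot>\<^sub>v col U i else 0\<^sub>v p)"
    and VV0: "\<forall>i<?r. V *\<^sub>v col V' i = unit_vec ?r i"
    by (rule diagonal_form[OF H]) (rule that; assumption)
  note c = c0[rule_format] and VV = VV0[rule_format]
  note car = UV(1-4)[THEN unimodular_carrier]
  have "poly (\<delta> i) 0 \<noteq> 0" if i: "i < ?r" for i
  proof
    assume d0: "poly (\<delta> i) 0 = 0"
    define w where "w = col V' i"
    have w: "w \<in> carrier_vec ?r" using car col_dim[of V' i] by (auto simp: w_def)
    define e where "e j = poly (w $ j) 0" for j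
    have z: "(\<Sum>j<?r. e j * coeff (L $$ (a,j)) (ks ! j)) = 0" if a: "a < p" for a
    proof -
      have "(?H *\<^sub>v w) $ a = \<delta> i * U $$ (a,i)" using c[OF i] i rp a car by (auto simp: w_def)
      then have "poly ((?H *\<^sub>v w) $ a) 0 = 0" using d0 by simp
      moreover have "(?H *\<^sub>v w) $ a = (\<Sum>j<?r. w $ j * rev_poly (ks ! j) (L $$ (a,j)))"
        using a L w by (simp add: scalar_prod_def atLeast0LessThan mult.commute col_reversal_def)
      ultimately show ?thesis by (simp add: poly_sum poly_0_rev_poly e_def)
    qed
    define J where "J = {j. j < ?r \<and> e j \<noteq> 0}"
    have finJ: "finite J" unfolding J_def by simp
    have "J \<noteq> {}"
    proof
      assume J: "J = {}"
      have "(V *\<^sub>v w) $ i = 1" using VV[OF i] i unfolding w_def by simp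
      moreover have "(V *\<^sub>v w) $ i = (\<Sum>j<?r. V $$ (i,j) * w $ j)"
        using i car w by (simp add: scalar_prod_def atLeast0LessThan)
      moreover have "poly (\<Sum>j<?r. V $$ (i,j) * w $ j) 0 = 0"
        using J by (auto simp: poly_sum J_def e_def intro!: sum.neutral)
      ultimately show False by simp
    qed
    from finite_argmax[OF finJ this, of "(!) ks"] obtain j where
      j: "j \<in> J" and jmax: "\<And>l. l \<in> J \<Longrightarrow> ks ! l \<le> ks ! j" by blast
    define x where "x = vec ?r (\<lambda>l. monom (e l) (ks ! j - ks ! l))"
    define v where "v = L *\<^sub>v x"
    have x: "x \<in> carrier_vec ?r" and v: "v \<in> carrier_vec p" using L by (auto simp: x_def v_def)
    have jr: "j < ?r" "x $ j \<noteq> 0" using j unfolding J_def x_def by auto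
    have le: "ks ! j \<le> vec_degree v"
      by (rule minimal_basis_mat_exchange[OF min x v one_neq_zero _ jr]) (simp add: v_def)
    have vd: "degree (v $ a) < ks ! j" if a: "a < p" "v $ a \<noteq> 0" for a
    proof -
      have va: "v $ a = (\<Sum>l<?r. x $ l * L $$ (a,l))"
        using a L x unfolding v_def by (simp add: scalar_prod_def atLeast0LessThan mult.commute)
      have "degree (v $ a) \<le> ks ! j" unfolding va
      proof (rule degree_sum_mult_le)
        fix l assume l: "l \<in> {..<?r}" "x $ l \<noteq> 0" "L $$ (a,l) \<noteq> 0"
        then have "e l \<noteq> 0" "l \<in> J" unfolding J_def x_def by auto
        then show "degree (x $ l) + degree (L $$ (a,l)) \<le> ks ! j"
          using minimal_basis_mat_degree_le[OF min a(1), of l] jmax[of l] l by (auto simp: x_def degree_monom_eq)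
      qed
      moreover have "coeff (v $ a) (ks ! j) = (\<Sum>l<?r. e l * coeff (L $$ (a,l)) (ks ! l))"
        unfolding va coeff_sum
      proof (rule sum.cong[OF refl])
        fix l assume l: "l \<in> {..<?r}"
        show "coeff (x $ l * L $$ (a,l)) (ks ! j) = e l * coeff (L $$ (a,l)) (ks ! l)"
        proof (cases "e l = 0")
          case False
          then have "ks ! l \<le> ks ! j" using jmax[of l] l unfolding J_def by auto
          then show ?thesis using l by (simp add: x_def coeff_monom_mult)
        qed (use l in \<open>simp add: x_def\<close>)
      qed
      ultimately show ?thesis using z[OF a(1)] a(2) by (metis eq_zero_or_degree_less)
    qed
    have "\<exists>a<p. v $ a \<noteq> 0"
    proof (rule ccontr)
      assume "\<not> (\<exists>a<p. v $ a \<noteq> 0)"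
      then have "L *\<^sub>v x = 0\<^sub>v p" using v L unfolding v_def by (intro eq_vecI) auto
      then have "x = 0\<^sub>v ?r" using f x L unfolding full_col_rank_def by auto
      then show False using jr by simp
    qed
    then have kj: "0 < ks ! j" using vd by fastforce
    have "vec_degree v \<le> ks ! j - 1" unfolding vec_degree_le_iff
    proof (intro allI impI)
      fix a assume "a < dim_vec v"
      then show "degree (v $ a) \<le> ks ! j - 1" using vd[of a] v by (cases "v $ a = 0") auto
    qed
    then show False using le kj by linarith
  qed
  then show thesis using that[OF rp UV] by blast
qed

text \<open>A left inverse of the reversal, up to a denominator \<open>q\<close> that is invertible at \<open>0\<close>. Only the behaviour at
  \<open>0\<close> matters for multiplicities of infinity.\<close>

lemma minimal_basis_reversal_left_inverse:
  fixes L :: "'a::field poly mat"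
  assumes min: "minimal_basis_mat p W ks L"
  obtains X q where "X \<in> carrier_mat (length ks) p"
    "X * col_reversal ((!) ks) L = q \<cdot>\<^sub>m 1\<^sub>m (length ks)" "poly q 0 \<noteq> 0"
proof -
  let ?r = "length ks"
  obtain U V U' V' \<delta> where rp: "?r \<le> p" and UV: "unimodular p U" "unimodular p U'"
    "unimodular ?r V" "unimodular ?r V'"
    "col_reversal ((!) ks) L = U * rect_diag p ?r \<delta> * V" "U' * U = 1\<^sub>m p" "V * V' = 1\<^sub>m ?r"
    and nz0: "\<forall>i<?r. poly (\<delta> i) 0 \<noteq> 0"
    by (rule minimal_basis_reversal_diagonal_form[OF min]) (rule that; assumption)
  note nz = nz0[rule_format]
  note car = UV(1-4)[THEN unimodular_carrier]
  obtain X where "X \<in> carrier_mat ?r p" "X * col_reversal ((!) ks) L = (\<Prod>i<?r. \<delta> i) \<cdot>\<^sub>m 1\<^sub>m ?r"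
    using left_inverse_of_diagonal_form[OF rp car UV(5,6,7)] by blast
  moreover have "poly (\<Prod>i<?r. \<delta> i) 0 \<noteq> 0" using nz by (simp add: poly_prod)
  ultimately show thesis using that by blast
qed

text \<open>The order of a minimal basis of a subspace bounds from below the order of any polynomial basis of
  its orthogonal complement. Constant columns \<open>Z\<close> are chosen so that \<open>(N Z)\<close> has a determinant of degree
  \<open>sum_list vs\<close>. With a left inverse \<open>Y\<close> of \<open>N\<close>, the product of \<open>(N Z)\<^sup>T\<close> and \<open>(Y\<^sup>T L)\<close> is block triangular, so
  this determinant divides \<open>det (Z\<^sup>T * L)\<close>, whose degree is at most the order of \<open>L\<close>.\<close>

lemma minimal_basis_dual_order_le:
  fixes N :: "'a::field poly mat"
  assumes min: "minimal_basis_mat p W vs N" and L: "L \<in> carrier_mat p r" and f: "full_col_rank L"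
    and orth: "N\<^sup>T * L = 0\<^sub>m (length vs) r" and dim: "length vs + r = p"
  shows "sum_list vs \<le> (\<Sum>i<r. vec_degree (col L i))"
proof -
  let ?q = "length vs"
  have N: "N \<in> carrier_mat p ?q" using min unfolding minimal_basis_mat_def basis_mat_def by auto
  obtain Y where Y: "Y \<in> carrier_mat ?q p" "Y * N = 1\<^sub>m ?q" using minimal_basis_left_inverse[OF min] by blast
  obtain U V U' V' \<delta> where UV: "unimodular p U" "unimodular p U'" "unimodular ?q V" "unimodular ?q V'"
    "col_reversal ((!) vs) N = U * rect_diag p ?q \<delta> * V" "U' * U = 1\<^sub>m p" "V * V' = 1\<^sub>m ?q"
    and nz0: "\<forall>i<?q. poly (\<delta> i) 0 \<noteq> 0"
    by (rule minimal_basis_reversal_diagonal_form[OF min]) (rule that; assumption)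
  note nz = nz0[rule_format]
  note car = UV(1-4)[THEN unimodular_carrier]
  let ?e = "\<lambda>p::'a poly. poly p 0"
  let ?E = "mat p r (\<lambda>(i,j). if i = ?q + j then 1 else 0) :: 'a poly mat"
  \<comment> \<open>The last \<open>r\<close> columns of \<open>U\<close> complete the reversal of \<open>N\<close> at the point \<open>0\<close>; only their values there are kept
    in the constant matrix \<open>Z\<close>.\<close>
  define Z0 where "Z0 = U * ?E"
  define C where "C = map_mat ?e Z0\<^sup>T"
  define Z where "Z = (map_mat (\<lambda>c. [:c:]) C)\<^sup>T"
  have Z0: "Z0 \<in> carrier_mat p r" and C: "C \<in> carrier_mat r p" and Z: "Z \<in> carrier_mat p r"
    unfolding Z0_def C_def Z_def using car by auto
  define NZ where "NZ = four_block_mat N Z (0\<^sub>m 0 ?q) (0\<^sub>m 0 r)"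
  have NZ: "NZ \<in> carrier_mat p p" unfolding NZ_def using N Z dim four_block_carrier_mat[of N p ?q "0\<^sub>m 0 r" 0 r] by simp
  define m where "m j = (if j < ?q then vs ! j else 0)" for j
  let ?H = "col_reversal ((!) vs) N"
  have degNZ: "degree (NZ $$ (i,j)) \<le> m j" if "i < p" "j < p" for i j
    using that N Z dim minimal_basis_mat_degree_le[OF min, of i j]
    by (auto simp: NZ_def m_def Z_def)
  have rvNZ: "map_mat ?e (col_reversal m NZ) = map_mat ?e (four_block_mat ?H Z0 (0\<^sub>m 0 ?q) (0\<^sub>m 0 r))"
    by (intro eq_matI)
      (use N Z Z0 dim in \<open>auto simp: col_reversal_def NZ_def m_def poly_0_rev_poly Z_def C_def\<close>)
  have H0: "det (four_block_mat ?H Z0 (0\<^sub>m 0 ?q) (0\<^sub>m 0 r)) = det U * ((\<Prod>i<?q. \<delta> i) * det V)"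
  proof -
    have DD: "mat_diag ?q \<delta> * V = mat ?q ?q (\<lambda>(i,j). \<delta> i * V $$ (i,j))" by (rule mat_diag_mult_left[OF car(3)])
    have R: "rect_diag p ?q \<delta> = four_block_mat (mat_diag ?q \<delta>) (0\<^sub>m ?q 0) (0\<^sub>m r ?q) (0\<^sub>m r 0)"
      by (intro eq_matI) (use dim in \<open>auto simp: rect_diag_def mat_diag_def\<close>)
    have RV: "rect_diag p ?q \<delta> * V = four_block_mat (mat_diag ?q \<delta> * V) (0\<^sub>m ?q 0) (0\<^sub>m r ?q) (0\<^sub>m r 0)"
    proof (rule eq_matI, goal_cases)
      case (1 i j)
      then have ij: "i < p" "j < ?q" using dim car by (auto simp: mat_diag_def)
      have "(rect_diag p ?q \<delta> * V) $$ (i,j) = (\<Sum>a<?q. rect_diag p ?q \<delta> $$ (i,a) * V $$ (a,j))"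
        using ij car by (simp add: scalar_prod_def atLeast0LessThan rect_diag_def)
      also have "\<dots> = (if i < ?q then \<delta> i * V $$ (i,j) else 0)"
      proof (cases "i < ?q")
        case True
        then show ?thesis using ij by (subst sum.remove[of _ i]) (auto simp: rect_diag_def intro!: sum.neutral)
      next
        case False
        then show ?thesis using ij by (auto simp: rect_diag_def intro!: sum.neutral)
      qed
      finally show ?case using ij dim car unfolding DD by auto
    qed (use dim car in \<open>auto simp: mat_diag_def rect_diag_def\<close>)
    define B where "B = four_block_mat (mat_diag ?q \<delta> * V) (0\<^sub>m ?q r) (0\<^sub>m r ?q) (1\<^sub>m r)"
    have B: "B \<in> carrier_mat p p" unfolding B_def using dim car by (intro carrier_matI) (auto simp: mat_diag_def)
    have "four_block_mat ?H Z0 (0\<^sub>m 0 ?q) (0\<^sub>m 0 r) = U * B"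
    proof (rule eq_matI, goal_cases)
      case (1 i j)
      then have ij: "i < p" "j < p" using car B by auto
      show ?case
      proof (cases "j < ?q")
        case True
        have "col B j = col (rect_diag p ?q \<delta> * V) j"
          unfolding RV B_def using True dim car by (intro eq_vecI) (auto simp: mat_diag_def)
        moreover have "?H $$ (i,j) = (U * (rect_diag p ?q \<delta> * V)) $$ (i,j)"
          unfolding UV(5) using car by (simp add: mult_mat_assoc_dim rect_diag_def del: assoc_mult_mat)
        ultimately show ?thesis using True ij car B N Z0 dim
          by (simp add: rect_diag_def)
      next
        case False
        have "col B j = col ?E (j - ?q)"
          using False ij dim car unfolding B_def by (intro eq_vecI) (auto simp: mat_diag_def)
        then show ?thesis using False ij car B N Z0 dim by (auto simp: Z0_def)
      qed
    qed (use N Z0 dim car B in auto)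
    moreover have "det B = (\<Prod>i<?q. \<delta> i) * det V"
    proof -
      have dd: "det (mat_diag ?q \<delta>) = (\<Prod>i<?q. \<delta> i)"
        by (subst det_upper_triangular[of _ ?q]) (auto simp: mat_diag_def prod_list_diag_prod atLeast0LessThan)
      have "det B = det (mat_diag ?q \<delta> * V) * det (1\<^sub>m r)"
        unfolding B_def by (rule det_four_block_mat_upper_right_zero[OF mult_carrier_mat[OF mat_diag_dim car(3)]]) auto
      then show ?thesis using det_mult[OF mat_diag_dim car(3)] dd by simp
    qed
    ultimately show ?thesis using det_mult[OF car(1) B] by simp
  qed
  have unz: "poly (det M) 0 \<noteq> 0" if "unimodular n M" for n and M :: "'a poly mat"
    using unimodular_det_dvd_1[OF that] by (metis dvd_def mult_zero_left poly_1 poly_mult zero_neq_one)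
  have "poly (det (col_reversal m NZ)) 0 \<noteq> 0"
    unfolding poly_det rvNZ unfolding poly_det[symmetric] H0
    using nz unz[OF UV(1)] unz[OF UV(3)] by (simp add: poly_prod)
  then have "order 0 (det (col_reversal m NZ)) = 0" "det (col_reversal m NZ) \<noteq> 0" by (auto intro: order_0I)
  with degree_det_col_reversal[OF NZ degNZ] have nzNZ: "det NZ \<noteq> 0" and "degree (det NZ) = (\<Sum>j<p. m j)" by auto
  moreover have "(\<Sum>j<p. m j) = (\<Sum>j<?q. vs ! j)"
    unfolding m_def using dim by (intro sum.mono_neutral_cong_right) auto
  ultimately have degdet: "degree (det NZ) = sum_list vs" by (simp add: sum_list_sum_nth atLeast0LessThan)
  define YL where "YL = four_block_mat Y\<^sup>T L (0\<^sub>m 0 ?q) (0\<^sub>m 0 r)"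
  have YL: "YL \<in> carrier_mat p p" unfolding YL_def using L Y dim four_block_carrier_mat[of "Y\<^sup>T" p ?q "0\<^sub>m 0 r" 0 r] by simp
  have NY: "N\<^sup>T * Y\<^sup>T = 1\<^sub>m ?q" using transpose_mult[OF Y(1) N] Y(2) by simp
  have NZT: "NZ\<^sup>T = four_block_mat N\<^sup>T (0\<^sub>m ?q 0) Z\<^sup>T (0\<^sub>m r 0)"
    unfolding NZ_def using transpose_four_block_mat[OF N Z, of "0\<^sub>m 0 ?q" 0 "0\<^sub>m 0 r"] by simp
  have prod: "NZ\<^sup>T * YL = four_block_mat (1\<^sub>m ?q) (0\<^sub>m ?q r) (Z\<^sup>T * Y\<^sup>T) (Z\<^sup>T * L)"
    unfolding NZT YL_def
    by (subst mult_four_block_mat[of _ ?q p _ 0 _ r _ _ ?q _ r])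
       (use N Z L Y NY orth in \<open>auto simp: left_mult_zero_mat[of _ 0]\<close>)
  have det1: "det NZ * det YL = det (Z\<^sup>T * L)"
  proof -
    have "det (NZ\<^sup>T * YL) = det (1\<^sub>m ?q) * det (Z\<^sup>T * L)"
      unfolding prod by (rule det_four_block_mat_upper_right_zero) (use Z Y L in auto)
    then show ?thesis using det_mult[of "NZ\<^sup>T" p YL] NZ YL det_transpose[OF NZ] by simp
  qed
  have "det YL \<noteq> 0"
  proof
    assume "det YL = 0"
    then obtain v where v: "v \<in> carrier_vec p" "v \<noteq> 0\<^sub>v p" "YL *\<^sub>v v = 0\<^sub>v p"
      using det_0_iff_vec_prod_zero[OF YL] by auto
    define a where "a = vec_first v ?q"
    define b where "b = vec_last v r"
    have ab: "a \<in> carrier_vec ?q" "b \<in> carrier_vec r" "v = a @\<^sub>v b"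
      unfolding a_def b_def using v dim by (auto simp: vec_first_last_append)
    have "YL *\<^sub>v v = (Y\<^sup>T *\<^sub>v a + L *\<^sub>v b) @\<^sub>v (0\<^sub>m 0 ?q *\<^sub>v a + 0\<^sub>m 0 r *\<^sub>v b)"
      unfolding YL_def ab(3) by (rule four_block_mat_mult_vec) (use Y L ab in auto)
    also have "\<dots> = Y\<^sup>T *\<^sub>v a + L *\<^sub>v b" by (intro eq_vecI) (use Y L in auto)
    finally have 0: "Y\<^sup>T *\<^sub>v a + L *\<^sub>v b = 0\<^sub>v p" using v by simp
    have "N\<^sup>T *\<^sub>v (Y\<^sup>T *\<^sub>v a + L *\<^sub>v b) = N\<^sup>T *\<^sub>v (Y\<^sup>T *\<^sub>v a) + N\<^sup>T *\<^sub>v (L *\<^sub>v b)"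
      by (rule mult_add_distrib_mat_vec[of _ ?q p]) (use N Y L ab in auto)
    also have "\<dots> = (N\<^sup>T * Y\<^sup>T) *\<^sub>v a + (N\<^sup>T * L) *\<^sub>v b"
      using N Y L ab by (simp add: assoc_mult_mat_vec[of _ ?q p _ ?q] assoc_mult_mat_vec[of _ ?q p _ r])
    also have "\<dots> = a" unfolding NY orth using ab by (intro eq_vecI) auto
    finally have a0: "a = 0\<^sub>v ?q" unfolding 0 using N by (simp add: mult_mat_vec_zero[of _ ?q])
    then have "L *\<^sub>v b = 0\<^sub>v p" using 0 Y L ab by (simp add: mult_mat_vec_zero[of _ p])
    then have "b = 0\<^sub>v r" using f ab L unfolding full_col_rank_def by auto
    then have "v = 0\<^sub>v p" unfolding ab(3) a0 using dim by (intro eq_vecI) auto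
    then show False using v by simp
  qed
  then have nzZL: "det (Z\<^sup>T * L) \<noteq> 0" and "degree (det NZ) \<le> degree (det (Z\<^sup>T * L))"
    using det1 nzNZ by (auto simp: degree_mult_eq simp flip: det1)
  moreover have "degree (det (Z\<^sup>T * L)) \<le> (\<Sum>i<r. vec_degree (col L i))"
  proof -
    have ZT: "Z\<^sup>T = map_mat (\<lambda>c. [:c:]) C" unfolding Z_def by simp
    have c: "Z\<^sup>T * L \<in> carrier_mat r r" using Z L by simp
    have "degree ((Z\<^sup>T * L) $$ (i,j)) \<le> vec_degree (col L j)" if "i < r" "j < r" for i j
      unfolding ZT by (rule degree_const_mult_le[OF C L that])
        (use that L vec_degree_le_iff[of "col L j" "vec_degree (col L j)"] in auto)
    from degree_det_col_reversal(2)[OF c this nzZL] show ?thesis by simp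
  qed
  ultimately show ?thesis using degdet by simp
qed

section \<open>Minors of large weight\<close>

text \<open>The zero block has \<open>r - i0\<close> rows and \<open>i0 + 1\<close> columns, together more than \<open>r\<close>, so every permutation hits it.\<close>

lemma det_zero_block:
  fixes A :: "'a::comm_ring_1 mat"
  assumes A: "A \<in> carrier_mat r r" and i0: "i0 < r"
    and zero: "\<And>i j. i0 \<le> i \<Longrightarrow> i < r \<Longrightarrow> r - 1 - i0 \<le> j \<Longrightarrow> j < r \<Longrightarrow> A $$ (i,j) = 0"
  shows "det A = 0"
  unfolding det_def'[OF A]
proof (intro sum.neutral ballI)
  fix p assume "p \<in> {p. p permutes {0..<r}}"
  then have p: "p permutes {0..<r}" by simp
  have "\<exists>i. i0 \<le> i \<and> i < r \<and> r - 1 - i0 \<le> p i"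
  proof (rule ccontr)
    assume "\<not> ?thesis"
    then have "p ` {i0..<r} \<subseteq> {..<r - 1 - i0}" by (auto simp: not_le)
    then have "card (p ` {i0..<r}) \<le> r - 1 - i0" by (metis card_lessThan card_mono finite_lessThan)
    moreover have "card (p ` {i0..<r}) = r - i0"
      using permutes_inj[OF p] by (simp add: card_image inj_on_def inj_def)
    ultimately show False using i0 by linarith
  qed
  then obtain i where i: "i0 \<le> i" "i < r" "r - 1 - i0 \<le> p i" by blast
  have "p i < r" using permutes_in_image[OF p, of i] i by simp
  then have "A $$ (i, p i) = 0" using zero i by simp
  then have "(\<Prod>i=0..<r. A $$ (i, p i)) = 0" using i by (intro prod_zero) auto
  then show "signof p * (\<Prod>i=0..<r. A $$ (i, p i)) = 0" by simp
qed

text \<open>Rows and columns are selected by arbitrary functions, so that selections compose and permutations are a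
  special case.\<close>

definition minor_mat :: "nat \<Rightarrow> (nat \<Rightarrow> nat) \<Rightarrow> (nat \<Rightarrow> nat) \<Rightarrow> 'a mat \<Rightarrow> 'a mat" where
  "minor_mat j I J A = mat j j (\<lambda>(a,b). A $$ (I a, J b))"

text \<open>Pair row \<open>r - 1 - i\<close> with column \<open>i\<close>. A nonzero minor whose weight is at least that of
  the pairs in \<open>T\<close> is obtained by deleting, for each index \<open>i0\<close> outside \<open>T\<close>, a row and a column that are at least as
  late as \<open>r - 1 - i0\<close> and \<open>i0\<close>, hence not heavier. A row and a column with these properties and nonzero
  cofactor exist, since otherwise the adjugate would contain a zero block too large for a nonsingular matrix.\<close>

lemma heavy_minor_exists:
  fixes E :: "'a::idom mat" and k l :: "nat \<Rightarrow> nat"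
  assumes "E \<in> carrier_mat r r" "det E \<noteq> 0" "T \<subseteq> {..<r}"
    and "\<And>i j. i \<le> j \<Longrightarrow> j < r \<Longrightarrow> k j \<le> k i" "\<And>i j. i \<le> j \<Longrightarrow> j < r \<Longrightarrow> l j \<le> l i"
  shows "\<exists>I J. (\<forall>a<card T. I a < r \<and> J a < r) \<and> det (minor_mat (card T) I J E) \<noteq> 0 \<and>
     (\<Sum>i\<in>T. k (r - 1 - i) + l i) \<le> (\<Sum>a<card T. k (I a) + l (J a))"
  using assms
proof (induction r arbitrary: E T k l)
  case 0
  then show ?case by (auto simp: minor_mat_def)
next
  case (Suc r E T k l)
  note E = Suc.prems(1) and dE = Suc.prems(2) and T = Suc.prems(3) and k = Suc.prems(4) and l = Suc.prems(5)
  show ?case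
  proof (cases "T = {..<Suc r}")
    case True
    have "minor_mat (Suc r) (\<lambda>a. a) (\<lambda>a. a) E = E" using E by (intro eq_matI) (auto simp: minor_mat_def)
    moreover have "(\<Sum>i<Suc r. k (r - i)) = (\<Sum>i<Suc r. k i)"
      using sum.nat_diff_reindex[of k "Suc r"] by simp
    ultimately show ?thesis using True dE
      by (intro exI[of _ "\<lambda>a. a"]) (auto simp: sum.distrib simp del: sum.lessThan_Suc)
  next
    case False
    then obtain i0 where i0: "i0 < Suc r" "i0 \<notin> T" using T by auto
    have "\<exists>p c. r - i0 \<le> p \<and> p < Suc r \<and> i0 \<le> c \<and> c < Suc r \<and> det (mat_delete E p c) \<noteq> 0"
    proof (rule ccontr)
      assume n: "\<not> ?thesis"
      have "det (adj_mat E) = 0"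
      proof (rule det_zero_block[OF adj_mat(1)[OF E] i0(1)])
        fix i j assume "i0 \<le> i" "i < Suc r" "Suc r - 1 - i0 \<le> j" "j < Suc r"
        then show "adj_mat E $$ (i,j) = 0" using n E by (auto simp: adj_mat_def cofactor_def)
      qed
      moreover have "det (adj_mat E) * det E = det E ^ Suc r"
        using det_mult[OF adj_mat(1)[OF E] E, symmetric] adj_mat(3)[OF E] by (simp only: det_smult det_one) simp
      ultimately show False using dE by simp
    qed
    then obtain p c where p: "r - i0 \<le> p" "p < Suc r" and c: "i0 \<le> c" "c < Suc r"
      and dD: "det (mat_delete E p c) \<noteq> 0" by blast
    define E' where "E' = mat_delete E p c"
    have E': "E' \<in> carrier_mat r r" unfolding E'_def using mat_delete_carrier[OF E, of p c] by simp
    \<comment> \<open>\<open>sp\<close> and \<open>sc\<close> embed the remaining row and column indices; \<open>del\<close> renumbers \<open>T\<close> after the removal of \<open>i0\<close>.\<close>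
    define sp where "sp i = (if i < p then i else Suc i)" for i
    define sc where "sc i = (if i < c then i else Suc i)" for i
    have E'e: "E' $$ (i,j) = E $$ (sp i, sc j)" if "i < r" "j < r" for i j
      using that E by (simp add: E'_def mat_delete_def sp_def sc_def)
    define del where "del i = (if i < i0 then i else i - 1)" for i
    define T' where "T' = del ` T"
    have inj: "inj_on del T"
    proof (rule inj_onI)
      fix x y assume "x \<in> T" "y \<in> T" and e: "del x = del y"
      then have xy: "x \<noteq> i0" "y \<noteq> i0" using i0 by auto
      show "x = y" using e xy unfolding del_def by (cases "x < i0"; cases "y < i0"; simp; arith)
    qed
    have cT: "card T' = card T" unfolding T'_def using inj by (rule card_image)
    have T': "T' \<subseteq> {..<r}"
    proof
      fix y assume "y \<in> T'"
      then obtain x where x: "x \<in> T" "y = del x" unfolding T'_def by auto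
      have "x < Suc r" "x \<noteq> i0" using x T i0 by auto
      then show "y \<in> {..<r}" using x i0 by (auto simp: del_def)
    qed
    have k': "k (sp j) \<le> k (sp i)" if "i \<le> j" "j < r" for i j
      by (rule k) (use that in \<open>auto simp: sp_def\<close>)
    have l': "l (sc j) \<le> l (sc i)" if "i \<le> j" "j < r" for i j
      by (rule l) (use that in \<open>auto simp: sc_def\<close>)
    have "\<exists>I J. (\<forall>a<card T'. I a < r \<and> J a < r) \<and> det (minor_mat (card T') I J E') \<noteq> 0 \<and>
      (\<Sum>i\<in>T'. k (sp (r - 1 - i)) + l (sc i)) \<le> (\<Sum>a<card T'. k (sp (I a)) + l (sc (J a)))"
      by (rule Suc.IH[where k = "\<lambda>i. k (sp i)" and l = "\<lambda>i. l (sc i)", OF E' dD[folded E'_def] T'])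
         (use k' l' in auto)
    then obtain I J where IJ: "\<forall>a<card T'. I a < r \<and> J a < r" "det (minor_mat (card T') I J E') \<noteq> 0"
      "(\<Sum>i\<in>T'. k (sp (r - 1 - i)) + l (sc i)) \<le> (\<Sum>a<card T'. k (sp (I a)) + l (sc (J a)))"
      by blast
    have "minor_mat (card T) (\<lambda>a. sp (I a)) (\<lambda>a. sc (J a)) E = minor_mat (card T') I J E'"
      using IJ(1) cT by (intro eq_matI) (auto simp: minor_mat_def E'e)
    moreover have "(\<Sum>i\<in>T. k (Suc r - 1 - i) + l i) \<le> (\<Sum>i\<in>T'. k (sp (r - 1 - i)) + l (sc i))"
      unfolding T'_def sum.reindex[OF inj] o_def
    proof (rule sum_mono)
      fix i assume i: "i \<in> T"
      then have ir: "i < Suc r" "i \<noteq> i0" using T i0 by auto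
      have "k (r - i) \<le> k (sp (r - 1 - del i))"
        by (rule k) (use ir p i0 in \<open>auto simp: sp_def del_def\<close>)
      moreover have "l i \<le> l (sc (del i))"
        by (rule l) (use ir c i0 in \<open>auto simp: sc_def del_def\<close>)
      ultimately show "k (Suc r - 1 - i) + l i \<le> k (sp (r - 1 - del i)) + l (sc (del i))" by simp
    qed
    moreover have "sp i < Suc r" "sc i < Suc r" if "i < r" for i using that by (auto simp: sp_def sc_def)
    ultimately have "(\<forall>a<card T. sp (I a) < Suc r \<and> sc (J a) < Suc r) \<and>
        det (minor_mat (card T) (\<lambda>a. sp (I a)) (\<lambda>a. sc (J a)) E) \<noteq> 0 \<and>
        (\<Sum>i\<in>T. k (Suc r - 1 - i) + l i) \<le> (\<Sum>a<card T. k (sp (I a)) + l (sc (J a)))"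
      using IJ cT by auto
    then show ?thesis by (rule exI[where x = "\<lambda>a. sp (I a)", OF exI[where x = "\<lambda>a. sc (J a)"]])
  qed
qed

section \<open>The compressed square factor\<close>

text \<open>The entry \<open>(i, j)\<close> is reversed in degree \<open>d - k i - l j\<close>, the largest degree that keeps the product with
  factors of column degrees \<open>k\<close> and \<open>l\<close> within degree \<open>d\<close>.\<close>

definition weighted_reversal :: "nat \<Rightarrow> (nat \<Rightarrow> nat) \<Rightarrow> (nat \<Rightarrow> nat) \<Rightarrow> 'a::field poly mat \<Rightarrow> 'a poly mat" where
  "weighted_reversal d k l E = mat (dim_row E) (dim_col E) (\<lambda>(i,j). rev_poly (d - k i - l j) (E $$ (i,j)))"

lemma weighted_reversal_carrier [simp]:
  "weighted_reversal d k l E \<in> carrier_mat m n \<longleftrightarrow> E \<in> carrier_mat m n"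
  unfolding weighted_reversal_def carrier_mat_def by simp

lemma rev_poly_0 [simp]: "rev_poly N 0 = 0"
  unfolding rev_poly_eq_homog by simp

lemma mult_mat_index3:
  fixes L :: "'a::comm_semiring_0 mat"
  assumes "L \<in> carrier_mat m r" "E \<in> carrier_mat r s" "R \<in> carrier_mat n s" "a < m" "b < n"
  shows "(L * E * R\<^sup>T) $$ (a,b) = (\<Sum>i<r. \<Sum>j<s. L $$ (a,i) * E $$ (i,j) * R $$ (b,j))"
proof -
  have "(L * E * R\<^sup>T) $$ (a,b) = (\<Sum>j<s. (\<Sum>i<r. L $$ (a,i) * E $$ (i,j)) * R $$ (b,j))"
    using assms by (simp add: scalar_prod_def atLeast0LessThan del: assoc_mult_mat)
  also have "\<dots> = (\<Sum>j<s. \<Sum>i<r. L $$ (a,i) * E $$ (i,j) * R $$ (b,j))" by (simp add: sum_distrib_right)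
  also have "\<dots> = (\<Sum>i<r. \<Sum>j<s. L $$ (a,i) * E $$ (i,j) * R $$ (b,j))" by (rule sum.swap)
  finally show ?thesis .
qed

lemma rev_product:
  fixes L :: "'a::field poly mat"
  assumes L: "L \<in> carrier_mat m r" and E: "E \<in> carrier_mat r s" and R: "R \<in> carrier_mat n s"
    and dL: "\<And>i j. i < m \<Longrightarrow> j < r \<Longrightarrow> degree (L $$ (i,j)) \<le> k j"
    and dR: "\<And>i j. i < n \<Longrightarrow> j < s \<Longrightarrow> degree (R $$ (i,j)) \<le> l j"
    and dE: "\<And>i j. i < r \<Longrightarrow> j < s \<Longrightarrow> E $$ (i,j) \<noteq> 0 \<Longrightarrow> degree (E $$ (i,j)) + k i + l j \<le> d"
  shows "map_mat (rev_poly d) (L * E * R\<^sup>T) = col_reversal k L * weighted_reversal d k l E * (col_reversal l R)\<^sup>T"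
    and "\<And>a b. a < m \<Longrightarrow> b < n \<Longrightarrow> degree ((L * E * R\<^sup>T) $$ (a,b)) \<le> d"
proof -
  have t: "rev_poly d (L $$ (a,i) * E $$ (i,j) * R $$ (b,j)) =
     rev_poly (k i) (L $$ (a,i)) * rev_poly (d - k i - l j) (E $$ (i,j)) * rev_poly (l j) (R $$ (b,j))"
    if "a < m" "b < n" "i < r" "j < s" for a b i j
  proof (cases "E $$ (i,j) = 0")
    case False
    have e: "degree (E $$ (i,j)) \<le> d - k i - l j" "d = k i + (d - k i - l j) + l j" using dE[OF that(3,4) False] by auto
    have "degree (L $$ (a,i) * E $$ (i,j)) \<le> k i + (d - k i - l j)"
      using degree_mult_le[of "L $$ (a,i)" "E $$ (i,j)"] dL[OF that(1,3)] e by linarith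
    let ?e = "d - k i - l j"
    have "rev_poly (k i + ?e + l j) (L $$ (a,i) * E $$ (i,j) * R $$ (b,j)) =
       rev_poly (k i + ?e) (L $$ (a,i) * E $$ (i,j)) * rev_poly (l j) (R $$ (b,j))"
      unfolding rev_poly_eq_homog by (rule homog_mult) (fact, rule dR[OF that(2,4)])
    also have "rev_poly (k i + ?e) (L $$ (a,i) * E $$ (i,j)) = rev_poly (k i) (L $$ (a,i)) * rev_poly ?e (E $$ (i,j))"
      unfolding rev_poly_eq_homog by (rule homog_mult[OF dL[OF that(1,3)] e(1)])
    finally show ?thesis unfolding e(2)[symmetric] .
  qed simp
  show "map_mat (rev_poly d) (L * E * R\<^sup>T) = col_reversal k L * weighted_reversal d k l E * (col_reversal l R)\<^sup>T"
  proof (rule eq_matI, goal_cases)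
    case (1 a b)
    then have ab: "a < m" "b < n" using L R by auto
    have "(col_reversal k L * weighted_reversal d k l E * (col_reversal l R)\<^sup>T) $$ (a,b) =
      (\<Sum>i<r. \<Sum>j<s. col_reversal k L $$ (a,i) * weighted_reversal d k l E $$ (i,j) * col_reversal l R $$ (b,j))"
      by (rule mult_mat_index3) (use L E R ab in auto)
    also have "\<dots> = (\<Sum>i<r. \<Sum>j<s. rev_poly d (L $$ (a,i) * E $$ (i,j) * R $$ (b,j)))"
      using t[OF ab] L E R ab by (intro sum.cong) (auto simp: col_reversal_def weighted_reversal_def)
    also have "\<dots> = rev_poly d (\<Sum>i<r. \<Sum>j<s. L $$ (a,i) * E $$ (i,j) * R $$ (b,j))"
      unfolding rev_poly_eq_homog homog_sum ..
    finally show ?case using mult_mat_index3[OF L E R ab] L R ab by (simp del: index_mult_mat(1))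
  qed (use L R in auto)
  show "degree ((L * E * R\<^sup>T) $$ (a,b)) \<le> d" if ab: "a < m" "b < n" for a b
    unfolding mult_mat_index3[OF L E R ab]
  proof (intro degree_sum_le finite_lessThan)
    fix i j assume ij: "i \<in> {..<r}" "j \<in> {..<s}"
    show "degree (L $$ (a,i) * E $$ (i,j) * R $$ (b,j)) \<le> d"
    proof (cases "E $$ (i,j) = 0")
      case False
      then show ?thesis using dE[of i j] dL[OF ab(1), of i] dR[OF ab(2), of j] ij
          degree_mult_le[of "L $$ (a,i)" "E $$ (i,j)"]
          degree_mult_le[of "L $$ (a,i) * E $$ (i,j)" "R $$ (b,j)"] by auto
    qed simp
  qed
qed

lemma sandwich_smult:
  fixes L :: "'a::comm_ring_1 mat"
  assumes X: "X \<in> carrier_mat r m" "X * L = q \<cdot>\<^sub>m 1\<^sub>m r" and X': "X' \<in> carrier_mat s n" "X' * R = q' \<cdot>\<^sub>m 1\<^sub>m s"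
    and L: "L \<in> carrier_mat m r" and R: "R \<in> carrier_mat n s" and E: "E \<in> carrier_mat r s"
  shows "X * (L * E * R\<^sup>T) * X'\<^sup>T = (q * q') \<cdot>\<^sub>m E"
proof -
  have "R\<^sup>T * X'\<^sup>T = q' \<cdot>\<^sub>m 1\<^sub>m s" using transpose_mult[OF X'(1) R] X'(2)
    by (metis index_transpose_mat(1) transpose_one smult_mat_def map_mat_transpose)
  moreover have "X * (L * E * R\<^sup>T) * X'\<^sup>T = (X * L) * E * (R\<^sup>T * X'\<^sup>T)"
    using X(1) X'(1) L R E by (simp add: mult_mat_assoc_dim del: assoc_mult_mat)
  ultimately have "X * (L * E * R\<^sup>T) * X'\<^sup>T = (q \<cdot>\<^sub>m 1\<^sub>m r) * E * (q' \<cdot>\<^sub>m 1\<^sub>m s)" using X by simp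
  also have "\<dots> = (q * q') \<cdot>\<^sub>m E"
    using E by (simp add: mult_smult_assoc_mat[of _ r r _ s] mult_smult_distrib[of _ r s _ s])
      (auto intro!: eq_matI simp: mult_ac)
  finally show ?thesis .
qed

text \<open>The predictable degree property, on both sides: no cancellation of leading terms can occur in
  \<open>L * E * R\<^sup>T\<close>, because the reversals of \<open>L\<close> and \<open>R\<close> are left invertible at \<open>0\<close>.\<close>

lemma degree_compressed_factor:
  fixes L :: "'a::field poly mat"
  assumes L: "minimal_basis_mat m W ks L" and R: "minimal_basis_mat n W' ls R"
    and E: "E \<in> carrier_mat (length ks) (length ls)"
    and deg: "\<And>a b. a < m \<Longrightarrow> b < n \<Longrightarrow> degree ((L * E * R\<^sup>T) $$ (a,b)) \<le> d"
    and ij: "i < length ks" "j < length ls" "E $$ (i,j) \<noteq> 0"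
  shows "degree (E $$ (i,j)) + ks ! i + ls ! j \<le> d"
proof -
  let ?r = "length ks" and ?s = "length ls" and ?X = "[:0,1:] :: 'a poly"
  have Lc: "L \<in> carrier_mat m ?r" and Rc: "R \<in> carrier_mat n ?s"
    using L R unfolding minimal_basis_mat_def basis_mat_def by auto
  obtain X q where X: "X \<in> carrier_mat ?r m" "X * col_reversal ((!) ks) L = q \<cdot>\<^sub>m 1\<^sub>m ?r" "poly q 0 \<noteq> 0"
    using minimal_basis_reversal_left_inverse[OF L] by blast
  obtain X' q' where X': "X' \<in> carrier_mat ?s n" "X' * col_reversal ((!) ls) R = q' \<cdot>\<^sub>m 1\<^sub>m ?s" "poly q' 0 \<noteq> 0"
    using minimal_basis_reversal_left_inverse[OF R] by blast
  obtain N where N: "\<And>i j. i < ?r \<Longrightarrow> j < ?s \<Longrightarrow> degree (E $$ (i,j)) \<le> N"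
    using mat_degree_bound_exists[of E] E by auto
  let ?A = "L * E * R\<^sup>T"
  have Ac: "?A \<in> carrier_mat m n" using Lc E Rc by auto
  \<comment> \<open>In the large common degree D, every entry of E satisfies the bound, and the reversal of A in
    degree D differs from the one in degree d by a power of the variable.\<close>
  define D where "D = d + N + sum_list ks + sum_list ls"
  have dE: "degree (E $$ (i,j)) + ks ! i + ls ! j \<le> D" if "i < ?r" "j < ?s" for i j
    using N[OF that] elem_le_sum_list[of i ks] elem_le_sum_list[of j ls] that unfolding D_def by linarith
  let ?H = "weighted_reversal D ((!) ks) ((!) ls) E"
  have rp: "map_mat (rev_poly D) ?A = col_reversal ((!) ks) L * ?H * (col_reversal ((!) ls) R)\<^sup>T"
    by (rule rev_product(1)[OF Lc E Rc])
       (use minimal_basis_mat_degree_le[OF L] minimal_basis_mat_degree_le[OF R] dE in auto)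
  have "X * map_mat (rev_poly D) ?A * X'\<^sup>T = (q * q') \<cdot>\<^sub>m ?H"
    unfolding rp by (rule sandwich_smult) (use X X' Lc Rc E in auto)
  moreover have "map_mat (rev_poly D) ?A = ?X ^ (D - d) \<cdot>\<^sub>m map_mat (rev_poly d) ?A"
  proof (rule eq_matI, goal_cases)
    case (1 a b)
    then have ab: "a < m" "b < n" using Ac by auto
    show ?case using homog_raise[OF deg[OF ab], of 1 ?X "D - d"] ab Lc Rc E
      by (simp add: rev_poly_eq_homog D_def mult.commute add.assoc del: index_mult_mat(1))
  qed (use Ac in auto)
  ultimately have "?X ^ (D - d) \<cdot>\<^sub>m (X * map_mat (rev_poly d) ?A * X'\<^sup>T) = (q * q') \<cdot>\<^sub>m ?H"
    using X(1) X'(1) Ac by (simp add: mult_smult_assoc_mat[of _ ?r n _ ?s] mult_smult_distrib[of _ ?r m _ n])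
  from arg_cong[OF this, of "\<lambda>M. M $$ (i,j)"]
  have eq: "?X ^ (D - d) * (X * map_mat (rev_poly d) ?A * X'\<^sup>T) $$ (i,j)
     = q * q' * rev_poly (D - ks ! i - ls ! j) (E $$ (i,j))"
    using ij X(1) X'(1) E by (simp add: weighted_reversal_def del: index_mult_mat(1))
  have dEij: "degree (E $$ (i,j)) \<le> D - ks ! i - ls ! j" using dE[OF ij(1,2)] by linarith
  have q0: "q * q' \<noteq> 0" "order 0 (q * q') = 0" using X(3) X'(3) by (auto intro: order_0I)
  have nz: "rev_poly (D - ks ! i - ls ! j) (E $$ (i,j)) \<noteq> 0" using rev_poly_eq_0_iff[OF dEij] ij by simp
  then have "order 0 (q * q' * rev_poly (D - ks ! i - ls ! j) (E $$ (i,j))) = D - ks ! i - ls ! j - degree (E $$ (i,j))"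
    using q0 order_rev_poly[OF dEij ij(3)] by (subst order_mult) auto
  moreover have "D - d \<le> order 0 (q * q' * rev_poly (D - ks ! i - ls ! j) (E $$ (i,j)))"
  proof -
    have "[:- 0, 1:] ^ (D - d) dvd q * q' * rev_poly (D - ks ! i - ls ! j) (E $$ (i,j))"
      unfolding eq[symmetric] by simp
    moreover have "q * q' * rev_poly (D - ks ! i - ls ! j) (E $$ (i,j)) \<noteq> 0" using q0 nz by (metis no_zero_divisors)
    ultimately show ?thesis using order_divides by blast
  qed
  ultimately show ?thesis using dE[OF ij(1,2)] unfolding D_def by linarith
qed

lemma minor_mat_sandwich:
  fixes E :: "'a::comm_semiring_1 mat"
  assumes "E \<in> carrier_mat r s" "\<And>a. a < j \<Longrightarrow> I a < r \<and> J a < s"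
  shows "minor_mat j I J E =
    mat j r (\<lambda>(a,i). if i = I a then 1 else 0) * E * (mat j s (\<lambda>(a,i). if i = J a then 1 else 0))\<^sup>T"
proof (rule eq_matI, goal_cases)
  case (1 a b)
  then have ab: "a < j" "b < j" by auto
  let ?P = "mat j r (\<lambda>(a,i). if i = I a then 1 else 0) :: 'a mat" and ?Q = "mat j s (\<lambda>(a,i). if i = J a then 1 else 0) :: 'a mat"
  have "(?P * E * ?Q\<^sup>T) $$ (a,b) = (\<Sum>i<r. \<Sum>l<s. ?P $$ (a,i) * E $$ (i,l) * ?Q $$ (b,l))"
    by (rule mult_mat_index3) (use assms ab in auto)
  also have "\<dots> = (\<Sum>i<r. \<Sum>l<s. if i = I a then if l = J b then E $$ (i,l) else 0 else 0)"
    using ab by (intro sum.cong) auto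
  also have "\<dots> = (\<Sum>i<r. if i = I a then E $$ (i, J b) else 0)"
    using assms(2)[OF ab(2)] by (intro sum.cong) auto
  also have "\<dots> = E $$ (I a, J b)" using assms(2)[OF ab(1)] by simp
  finally show ?case using ab by (simp add: minor_mat_def)
qed (use assms in \<open>auto simp: minor_mat_def\<close>)

text \<open>The diagonal matrix of a Smith form factors through its square part, which brings invariant factors into
  the shape required by \<open>minor_dvd\<close>.\<close>

lemma rect_diag_factor:
  fixes \<alpha> :: "'a::comm_semiring_1 list"
  assumes "length \<alpha> \<le> m" "length \<alpha> \<le> n"
  shows "mat m n (\<lambda>(i,j). if i = j \<and> i < length \<alpha> then \<alpha> ! i else 0) =
     mat m (length \<alpha>) (\<lambda>(i,j). if i = j then 1 else 0) * mat_diag (length \<alpha>) ((!) \<alpha>)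
       * (mat n (length \<alpha>) (\<lambda>(i,j). if i = j then 1 else 0))\<^sup>T"
proof (rule eq_matI, goal_cases)
  case (1 a b)
  let ?P = "\<lambda>m. mat m (length \<alpha>) (\<lambda>(i,j). if i = j then 1 else 0) :: 'a mat"
  have ab: "a < m" "b < n" using 1 by auto
  have "(?P m * mat_diag (length \<alpha>) ((!) \<alpha>) * (?P n)\<^sup>T) $$ (a,b) =
     (\<Sum>i<length \<alpha>. \<Sum>l<length \<alpha>. ?P m $$ (a,i) * mat_diag (length \<alpha>) ((!) \<alpha>) $$ (i,l) * ?P n $$ (b,l))"
    by (rule mult_mat_index3) (use ab in auto)
  also have "\<dots> = (\<Sum>i<length \<alpha>. \<Sum>l<length \<alpha>. if i = a then if l = b then if i = l then \<alpha> ! i else 0 else 0 else 0)"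
    using ab by (intro sum.cong) (auto simp: mat_diag_def)
  also have "\<dots> = (\<Sum>i<length \<alpha>. if i = a then if a = b then \<alpha> ! a else 0 else 0)"
  proof (intro sum.cong refl)
    fix i assume i: "i \<in> {..<length \<alpha>}"
    show "(\<Sum>l<length \<alpha>. if i = a then if l = b then if i = l then \<alpha> ! i else 0 else 0 else 0) =
       (if i = a then if a = b then \<alpha> ! a else 0 else 0)"
    proof (cases "i = a \<and> a = b")
      case True
      then have "(if i = a then if l = b then if i = l then \<alpha> ! i else 0 else 0 else 0) = (if l = b then \<alpha> ! b else 0)" for l
        by auto
      then show ?thesis using True i by simp
    qed (auto intro!: sum.neutral)
  qed
  also have "\<dots> = (if a = b \<and> a < length \<alpha> then \<alpha> ! a else 0)" by simp
  finally show ?case using ab by simp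
qed auto

section \<open>Necessity\<close>

lemma order_le_of_dvd:
  fixes p q :: "'a::idom poly"
  assumes "p dvd q" "q \<noteq> 0" shows "order a p \<le> order a q"
  using assms order_1[of a p] order_divides[of a "order a p" q] dvd_trans by blast

lemma order_prod_eq_sum:
  fixes g :: "'b \<Rightarrow> 'a::idom poly"
  assumes "finite S" "\<And>i. i \<in> S \<Longrightarrow> g i \<noteq> 0"
  shows "order a (prod g S) = (\<Sum>i\<in>S. order a (g i))"
  using assms by (induction S rule: finite_induct) (auto simp: order_mult order_0I)

lemma has_invariant_factorsE:
  fixes A :: "'a::field poly mat"
  assumes h: "has_invariant_factors A \<alpha>" and A: "A \<in> carrier_mat m n"
    and "length \<alpha> \<le> m" "length \<alpha> \<le> n"
  obtains P Q where "P \<in> carrier_mat m (length \<alpha>)" "Q \<in> carrier_mat n (length \<alpha>)"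
    "A = P * mat_diag (length \<alpha>) ((!) \<alpha>) * Q\<^sup>T"
    "\<exists>X\<in>carrier_mat (length \<alpha>) m. \<exists>X'\<in>carrier_mat (length \<alpha>) n. X * P = 1\<^sub>m (length \<alpha>) \<and> X' * Q = 1\<^sub>m (length \<alpha>)"
proof -
  let ?r = "length \<alpha>" and ?D = "mat_diag (length \<alpha>) ((!) \<alpha>)"
  let ?P = "\<lambda>m. mat m ?r (\<lambda>(i,j). if i = j then 1 else 0) :: 'a poly mat"
  obtain U V where UV: "unimodular m U" "unimodular n V"
    "U * A * V = mat m n (\<lambda>(i, j). if i = j \<and> i < ?r then \<alpha> ! i else 0)"
    using h A unfolding has_invariant_factors_def by (auto simp: unimodular_iff_invertible_mat)
  obtain U' where U: "U \<in> carrier_mat m m" "U' \<in> carrier_mat m m" "U' * U = 1\<^sub>m m" "U * U' = 1\<^sub>m m"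
    using UV(1) by (metis unimodularE)
  obtain V' where V: "V \<in> carrier_mat n n" "V' \<in> carrier_mat n n" "V * V' = 1\<^sub>m n" "V' * V = 1\<^sub>m n"
    using UV(2) by (metis unimodularE)
  have S: "U * A * V = ?P m * ?D * (?P n)\<^sup>T" unfolding UV(3) using rect_diag_factor[OF assms(3,4)] .
  have PP: "(?P m)\<^sup>T * ?P m = 1\<^sub>m ?r" if "?r \<le> m" for m
  proof (rule eq_matI, goal_cases)
    case (1 i j)
    then have ij: "i < ?r" "j < ?r" by auto
    have "((?P m)\<^sup>T * ?P m) $$ (i,j) = (\<Sum>a<m. (if a = i then 1 else 0) * (if a = j then 1 else 0))"
      using ij by (simp add: scalar_prod_def atLeast0LessThan)
    also have "\<dots> = (\<Sum>a<m. if a = i then if a = j then 1 else 0 else 0)" by (intro sum.cong) auto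
    finally show ?case using ij that by simp
  qed auto
  have e: "A = (U' * ?P m) * ?D * (V'\<^sup>T * ?P n)\<^sup>T"
  proof -
    have "A = U' * (U * A * V) * V'"
    proof -
      have "U' * (U * (A * (V * V'))) = A * (V * V')" by (rule mult_inverse_cancel[OF U(3)]) (use U A V in auto)
      then show ?thesis using U(1,2) V A by (simp add: mult_mat_assoc_dim del: assoc_mult_mat)
    qed
    also have "\<dots> = U' * ?P m * ?D * ((?P n)\<^sup>T * V')"
      unfolding S using U(2) V(2) by (simp add: mult_mat_assoc_dim mat_diag_def del: assoc_mult_mat)
    also have "(?P n)\<^sup>T * V' = (V'\<^sup>T * ?P n)\<^sup>T"
      using V transpose_mult[of "V'\<^sup>T" n n "?P n" ?r] by simp
    finally show ?thesis .
  qed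
  have c1: "((?P m)\<^sup>T * U) * (U' * ?P m) = 1\<^sub>m ?r"
  proof -
    have "U * (U' * ?P m) = ?P m" by (rule mult_inverse_cancel[OF U(4)]) (use U in auto)
    then show ?thesis using U(1,2) PP[OF assms(3)] by (simp add: mult_mat_assoc_dim del: assoc_mult_mat)
  qed
  have VT: "V\<^sup>T * V'\<^sup>T = 1\<^sub>m n" using transpose_mult[OF V(2,1)] V(4) by simp
  have c2: "((?P n)\<^sup>T * V\<^sup>T) * (V'\<^sup>T * ?P n) = 1\<^sub>m ?r"
  proof -
    have "V\<^sup>T * (V'\<^sup>T * ?P n) = ?P n" by (rule mult_inverse_cancel[OF VT]) (use V in auto)
    then show ?thesis using V(1,2) PP[OF assms(4)] by (simp add: mult_mat_assoc_dim del: assoc_mult_mat)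
  qed
  show thesis
    by (rule that[OF _ _ e], (use U V in auto)[2])
       (rule bexI[of _ "(?P m)\<^sup>T * U"], rule bexI[of _ "(?P n)\<^sup>T * V\<^sup>T"], use U V c1 c2 in auto)
qed

lemma invariant_factors_dvd_minor:
  fixes A :: "'a::field poly mat"
  assumes h: "has_invariant_factors A \<alpha>" and A: "A \<in> carrier_mat m n"
    and l: "length \<alpha> \<le> m" "length \<alpha> \<le> n" and X: "X \<in> carrier_mat j m" "X' \<in> carrier_mat j n"
  shows "(\<Prod>i<j. \<alpha> ! i) dvd det (X * A * X'\<^sup>T)"
proof -
  obtain P Q where PQ: "P \<in> carrier_mat m (length \<alpha>)" "Q \<in> carrier_mat n (length \<alpha>)"
    "A = P * mat_diag (length \<alpha>) ((!) \<alpha>) * Q\<^sup>T"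
    using has_invariant_factorsE[OF h A l] by metis
  have "X * A * X'\<^sup>T = (X * P) * mat_diag (length \<alpha>) ((!) \<alpha>) * (Q\<^sup>T * X'\<^sup>T)"
    unfolding PQ(3) using PQ(1,2) X by (simp add: mult_mat_assoc_dim mat_diag_def del: assoc_mult_mat)
  moreover have "(\<Prod>i<j. \<alpha> ! i) dvd det ((X * P) * mat_diag (length \<alpha>) ((!) \<alpha>) * (Q\<^sup>T * X'\<^sup>T))"
    by (rule minor_dvd) (use h PQ X in \<open>auto simp: has_invariant_factors_def\<close>)
  ultimately show ?thesis by simp
qed

text \<open>The Smith form of \<open>A\<close> exhibits the square diagonal matrix of its invariant factors as a product in which
  \<open>E\<close> is one factor.\<close>

lemma det_dvd_invariant_factors:
  fixes A :: "'a::field poly mat"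
  assumes h: "has_invariant_factors A \<alpha>" and l: "length \<alpha> \<le> m" "length \<alpha> \<le> n"
    and L: "L \<in> carrier_mat m (length \<alpha>)" and E: "E \<in> carrier_mat (length \<alpha>) (length \<alpha>)"
    and R: "R \<in> carrier_mat n (length \<alpha>)" and A: "A = L * E * R\<^sup>T"
  shows "det E dvd (\<Prod>i<length \<alpha>. \<alpha> ! i)"
proof -
  let ?r = "length \<alpha>" and ?D = "mat_diag (length \<alpha>) ((!) \<alpha>)"
  have Ac: "A \<in> carrier_mat m n" unfolding A using L E R by auto
  obtain P Q X X' where PQ: "P \<in> carrier_mat m ?r" "Q \<in> carrier_mat n ?r" "A = P * ?D * Q\<^sup>T"
    and X: "X \<in> carrier_mat ?r m" "X' \<in> carrier_mat ?r n" "X * P = 1\<^sub>m ?r" "X' * Q = 1\<^sub>m ?r"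
    using has_invariant_factorsE[OF h Ac l] by metis
  have QX: "Q\<^sup>T * X'\<^sup>T = 1\<^sub>m ?r" using transpose_mult[OF X(2) PQ(2)] X(4) by simp
  have "X * A * X'\<^sup>T = (X * P) * ?D * (Q\<^sup>T * X'\<^sup>T)"
    unfolding PQ(3) using PQ(1,2) X(1,2) by (simp add: mult_mat_assoc_dim mat_diag_def del: assoc_mult_mat)
  also have "\<dots> = ?D"
    unfolding X(3) QX left_mult_one_mat[OF mat_diag_dim] right_mult_one_mat[OF mat_diag_dim] ..
  finally have "?D = (X * L) * E * (R\<^sup>T * X'\<^sup>T)"
    unfolding A using L E R X(1,2) by (simp add: mult_mat_assoc_dim del: assoc_mult_mat)
  then have "det ?D = det (X * L) * det E * det (R\<^sup>T * X'\<^sup>T)"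
    using det_mult[of "X * L" ?r E] det_mult[of "X * L * E" ?r "R\<^sup>T * X'\<^sup>T"] X L E R by simp
  moreover have "det ?D = (\<Prod>i<?r. \<alpha> ! i)"
    by (subst det_upper_triangular[of _ ?r]) (auto simp: mat_diag_def prod_list_diag_prod atLeast0LessThan)
  ultimately show ?thesis by (metis dvd_triv_left mult.assoc mult.commute)
qed

lemma rational_span_factor:
  fixes A :: "'a::field poly mat"
  assumes A: "A \<in> carrier_mat m n" and L: "L \<in> carrier_mat m r" and sub: "rational_span L \<subseteq> rational_span A"
  obtains Z where "Z \<in> carrier_mat n r" "fract_mat L = fract_mat A * Z"
proof -
  have "\<forall>j<r. \<exists>z\<in>carrier_vec n. fract_vec (col L j) = fract_mat A *\<^sub>v z"
    using rational_span_col[OF L] sub A unfolding rational_span_def by fastforce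
  then obtain z where z: "\<And>j. j < r \<Longrightarrow> z j \<in> carrier_vec n \<and> fract_vec (col L j) = fract_mat A *\<^sub>v z j" by metis
  define Z where "Z = mat n r (\<lambda>(i,j). z j $ i)"
  have Z: "Z \<in> carrier_mat n r" unfolding Z_def by simp
  have "fract_mat L = fract_mat A * Z"
  proof (rule eq_matI, goal_cases)
    case (1 i j)
    then have ij: "i < m" "j < r" using A Z by auto
    have "col Z j = z j" using z[OF ij(2)] ij by (auto simp: Z_def)
    then have "(fract_mat A * Z) $$ (i,j) = (fract_mat A *\<^sub>v z j) $ i" using ij A Z by simp
    also have "\<dots> = fract_vec (col L j) $ i" using z[OF ij(2)] by simp
    finally show ?case using ij L by (simp add: fract_vec_def fract_mat_def)
  qed (use A L Z in auto)
  then show thesis using that Z by blast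
qed

text \<open>Over the rational functions the kernel is the orthogonal complement of the column space, so each of the two
  minimal bases bounds the order of the other.\<close>

lemma dual_minimal_indices_sum:
  fixes A :: "'a::field poly mat"
  assumes A: "A \<in> carrier_mat m n"
    and L: "minimal_basis_mat m (rational_span A) ks L"
    and N: "minimal_basis_mat m (mat_kernel (fract_mat A)\<^sup>T) vs N"
    and dim: "length ks + length vs = m"
  shows "sum_list vs = sum_list ks"
proof -
  let ?r = "length ks" and ?q = "length vs"
  have Lc: "L \<in> carrier_mat m ?r" "full_col_rank L" "rational_span L = rational_span A"
    and Nc: "N \<in> carrier_mat m ?q" "full_col_rank N" "rational_span N = mat_kernel (fract_mat A)\<^sup>T"
    using L N unfolding minimal_basis_mat_def basis_mat_def by auto
  obtain Z where Z: "Z \<in> carrier_mat n ?r" "fract_mat L = fract_mat A * Z"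
    using rational_span_factor[OF A Lc(1)] Lc(3) by auto
  have fA: "(fract_mat A)\<^sup>T \<in> carrier_mat n m" using A by simp
  have AN: "(fract_mat A)\<^sup>T * fract_mat N = 0\<^sub>m n ?q"
  proof (rule eq_matI, goal_cases)
    case (1 i j)
    then have ij: "i < n" "j < ?q" by auto
    have "fract_vec (col N j) \<in> mat_kernel (fract_mat A)\<^sup>T" using rational_span_col[OF Nc(1) ij(2)] Nc(3) by simp
    then have "(fract_mat A)\<^sup>T *\<^sub>v fract_vec (col N j) = 0\<^sub>v n" using mat_kernelD[OF fA] by blast
    moreover have "fract_vec (col N j) = col (fract_mat N) j"
      using Nc(1) ij by (auto simp: fract_vec_def fract_mat_def intro!: eq_vecI)
    moreover have "((fract_mat A)\<^sup>T * fract_mat N) $$ (i,j) = ((fract_mat A)\<^sup>T *\<^sub>v col (fract_mat N) j) $ i"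
      using A Nc(1) ij by simp
    ultimately show ?case using ij by simp
  qed (use A Nc in auto)
  have "fract_mat (N\<^sup>T * L) = (fract_mat N)\<^sup>T * (fract_mat A * Z)"
    using fract_mat_mult[of "N\<^sup>T" ?q m L ?r] Nc(1) Lc(1) Z(2) by simp
  also have "\<dots> = ((fract_mat N)\<^sup>T * fract_mat A) * Z" using Nc(1) A Z(1) by (simp add: mult_mat_assoc_dim del: assoc_mult_mat)
  also have "(fract_mat N)\<^sup>T * fract_mat A = ((fract_mat A)\<^sup>T * fract_mat N)\<^sup>T"
    using transpose_mult[of "(fract_mat A)\<^sup>T" n m "fract_mat N" ?q] A Nc(1) by simp
  also have "\<dots> * Z = fract_mat (0\<^sub>m ?q ?r)" unfolding AN using Z(1) by simp
  finally have NL: "N\<^sup>T * L = 0\<^sub>m ?q ?r" by (rule fract_mat_inj)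
  have LN: "L\<^sup>T * N = 0\<^sub>m ?r ?q" using transpose_mult[of "N\<^sup>T" ?q m L ?r] NL Nc(1) Lc(1) by simp
  have s: "(\<Sum>i<length ws. vec_degree (col M i)) = sum_list ws" if "minimal_basis_mat m W ws M" for W ws M
    using that unfolding minimal_basis_mat_def by (simp add: sum_list_sum_nth atLeast0LessThan)
  show ?thesis
  proof (rule antisym)
    show "sum_list vs \<le> sum_list ks"
      using minimal_basis_dual_order_le[OF N Lc(1,2) NL] dim s[OF L] by simp
    show "sum_list ks \<le> sum_list vs"
      using minimal_basis_dual_order_le[OF L Nc(1,2) LN] dim s[OF N] by simp
  qed
qed

lemma rev_mat_carrier [simp]: "rev_mat A \<in> carrier_mat m n \<longleftrightarrow> A \<in> carrier_mat m n"
  unfolding rev_mat_def by simp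

lemma weighted_reversal_rev:
  fixes p :: "'a::field poly"
  assumes "p \<noteq> 0 \<Longrightarrow> degree p + k + l \<le> d"
  shows "[:0,1:] ^ k * rev_poly (d - k - l) p * [:0,1:] ^ l = rev_poly d p"
proof (cases "p = 0")
  case False
  then have "degree p \<le> d - k - l" "d = (d - k - l) + (k + l)" using assms by auto
  then show ?thesis using homog_raise[of p "d - k - l" 1 "[:0,1:]" "k + l"]
    by (simp add: rev_poly_eq_homog power_add mult_ac)
qed simp

lemma prod_monic:
  fixes \<alpha> :: "'a::field poly list"
  assumes "\<forall>a\<in>set \<alpha>. lead_coeff a = 1" "j \<le> length \<alpha>"
  shows "(\<Prod>i<j. \<alpha> ! i) \<noteq> 0" "degree (\<Prod>i<j. \<alpha> ! i) = (\<Sum>i<j. degree (\<alpha> ! i))"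
proof -
  have nz: "\<alpha> ! i \<noteq> 0" if "i < j" for i using assms that by (metis leading_coeff_0_iff nth_mem order_less_le_trans zero_neq_one)
  then show "(\<Prod>i<j. \<alpha> ! i) \<noteq> 0" by simp
  show "degree (\<Prod>i<j. \<alpha> ! i) = (\<Sum>i<j. degree (\<alpha> ! i))" using nz by (subst degree_prod_eq_sum_degree) auto
qed

lemma partition_nth: "is_partition xs \<Longrightarrow> i \<le> j \<Longrightarrow> j < length xs \<Longrightarrow> xs ! j \<le> xs ! i"
  unfolding is_partition_def sorted_wrt_iff_nth_less by (cases "i = j") auto

locale structured_matrix =
  fixes A :: "'a::field poly mat" and m n r d :: nat and \<alpha> :: "'a poly list" and f k l ds vs :: "nat list"
  assumes A: "A \<in> carrier_mat m n" and data: "has_structural_data A r d \<alpha> f k l ds vs"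
    and r: "0 < r" "r \<le> m" "r \<le> n"
    and len: "length \<alpha> = r" "length f = r" "length k = r" "length l = r" "length ds = n - r" "length vs = m - r"
    and part: "is_partition k" "is_partition l"
begin

lemma col_basis: obtains L where "minimal_basis_mat m (rational_span A) k L"
proof -
  have "has_minimal_indices m (rational_span A) k"
    using data A col_space_fract_mat[OF A] unfolding has_structural_data_def has_col_span_minimal_indices_def by simp
  moreover have "submodule class_ring (rational_span A) (module_vec TYPE('a poly fract) m)"
    using submodule_col_space[of "fract_mat A" m n] col_space_fract_mat[OF A] A by simp
  ultimately show thesis using has_minimal_indicesD that by blast
qed

lemma row_basis: obtains R where "minimal_basis_mat n (rational_span A\<^sup>T) l R"
proof -
  have AT: "A\<^sup>T \<in> carrier_mat n m" using A by simp
  have rs: "vec_space.row_space n (fract_mat A) = rational_span A\<^sup>T"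
    using vec_space.row_space_eq_col_space_transpose[of n "fract_mat A"] col_space_fract_mat[OF AT] by simp
  have "has_minimal_indices n (rational_span A\<^sup>T) l"
    using data A rs unfolding has_structural_data_def has_row_span_minimal_indices_def by simp
  moreover have "submodule class_ring (rational_span A\<^sup>T) (module_vec TYPE('a poly fract) n)"
    using submodule_col_space[of "fract_mat A\<^sup>T" n m] col_space_fract_mat[OF AT] AT by simp
  ultimately show thesis using has_minimal_indicesD that by blast
qed

lemma condition_a: "sum_list vs = sum_list k" "sum_list ds = sum_list l"
proof -
  have AT: "A\<^sup>T \<in> carrier_mat n m" using A by simp
  obtain L where L: "minimal_basis_mat m (rational_span A) k L" by (rule col_basis)
  have "has_minimal_indices m (mat_kernel (fract_mat A)\<^sup>T) vs"
    using data A unfolding has_structural_data_def has_left_minimal_indices_def left_kernel_eq by simp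
  then obtain N where "minimal_basis_mat m (mat_kernel (fract_mat A)\<^sup>T) vs N"
    using has_minimal_indicesD submodule_mat_kernel[of "(fract_mat A)\<^sup>T" n m] A by (metis fract_mat_carrier transpose_carrier_mat)
  then show "sum_list vs = sum_list k" using dual_minimal_indices_sum[OF A L] len r by simp
  obtain R where R: "minimal_basis_mat n (rational_span A\<^sup>T) l R" by (rule row_basis)
  have "has_minimal_indices n (mat_kernel (fract_mat A)) ds"
    using data A unfolding has_structural_data_def has_right_minimal_indices_def by simp
  then obtain N' where "minimal_basis_mat n (mat_kernel (fract_mat A\<^sup>T)\<^sup>T) ds N'"
    using has_minimal_indicesD submodule_mat_kernel[of "fract_mat A" m n] A
    by (metis fract_mat_carrier fract_mat_transpose transpose_transpose)
  then show "sum_list ds = sum_list l" using dual_minimal_indices_sum[OF AT R] len r by simp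
qed

text \<open>The left inverses of both bases yield \<open>E\<close>. It is nonsingular because \<open>L\<close>, and hence the identity, is
  obtained from \<open>A\<close> by a rational matrix.\<close>

lemma compressed_factor:
  obtains L R E Y Y' where "minimal_basis_mat m (rational_span A) k L" "minimal_basis_mat n (rational_span A\<^sup>T) l R"
    "E \<in> carrier_mat r r" "A = L * E * R\<^sup>T" "det E \<noteq> 0"
    "Y \<in> carrier_mat r m" "Y' \<in> carrier_mat r n" "E = Y * A * Y'\<^sup>T"
proof -
  have AT: "A\<^sup>T \<in> carrier_mat n m" using A by simp
  obtain L where L: "minimal_basis_mat m (rational_span A) k L" by (rule col_basis)
  obtain R where R: "minimal_basis_mat n (rational_span A\<^sup>T) l R" by (rule row_basis)
  have Lc: "L \<in> carrier_mat m r" "rational_span L = rational_span A"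
    and Rc: "R \<in> carrier_mat n r" "rational_span R = rational_span A\<^sup>T"
    using L R len unfolding minimal_basis_mat_def basis_mat_def by auto
  obtain Y where Y: "Y \<in> carrier_mat r m" "Y * L = 1\<^sub>m r" using minimal_basis_left_inverse[OF L] len by auto
  obtain Y' where Y': "Y' \<in> carrier_mat r n" "Y' * R = 1\<^sub>m r" using minimal_basis_left_inverse[OF R] len by auto
  define E where "E = Y * A * Y'\<^sup>T"
  have E: "E \<in> carrier_mat r r" unfolding E_def using Y Y' A by simp
  have A1: "A = L * (Y * A)"
    by (rule rational_span_coordinates[OF Lc(1) Y A]) (use rational_span_col[OF A] Lc(2) in auto)
  have "A\<^sup>T = R * (Y' * A\<^sup>T)"
    by (rule rational_span_coordinates[OF Rc(1) Y' AT]) (use rational_span_col[OF AT] Rc(2) in auto)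
  then have "A = (R * (Y' * A\<^sup>T))\<^sup>T" by (metis transpose_transpose)
  also have "\<dots> = A * Y'\<^sup>T * R\<^sup>T"
    using transpose_mult[OF Rc(1), of "Y' * A\<^sup>T" m] transpose_mult[OF Y'(1) AT] Y'(1) AT by simp
  finally have A2: "A * Y'\<^sup>T * R\<^sup>T = A" by simp
  have "L * E * R\<^sup>T = L * (Y * (A * Y'\<^sup>T * R\<^sup>T))"
    unfolding E_def using Lc(1) Rc(1) Y(1) Y'(1) A by (simp add: mult_mat_assoc_dim del: assoc_mult_mat)
  then have AE: "A = L * E * R\<^sup>T" unfolding A2 using A1 by simp
  obtain Z where Z: "Z \<in> carrier_mat n r" "fract_mat L = fract_mat A * Z"
    using rational_span_factor[OF A Lc(1)] Lc(2) by auto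
  have "Y * A = (Y * L) * (E * R\<^sup>T)"
    using AE Lc(1) Rc(1) Y(1) E by (simp add: mult_mat_assoc_dim del: assoc_mult_mat)
  then have YA: "Y * A = E * R\<^sup>T" unfolding Y(2) using E Rc(1) by simp
  have "1\<^sub>m r = fract_mat Y * (fract_mat A * Z)" using fract_mat_mult[OF Y(1) Lc(1)] Y(2) Z(2) by simp
  also have "\<dots> = fract_mat (Y * A) * Z"
    using fract_mat_mult[OF Y(1) A] assoc_mult_mat[of "fract_mat Y" r m "fract_mat A" n Z r] Y(1) A Z(1) by simp
  also have "\<dots> = fract_mat E * (fract_mat R\<^sup>T * Z)"
    unfolding YA using fract_mat_mult[of E r r "R\<^sup>T" n] assoc_mult_mat[of "fract_mat E" r r "(fract_mat R)\<^sup>T" n Z r] E Rc(1) Z(1)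
    by simp
  finally have "det (fract_mat E) * det (fract_mat R\<^sup>T * Z) = 1"
    using det_mult[of "fract_mat E" r "fract_mat R\<^sup>T * Z"] E Rc(1) Z(1) by (metis det_one fract_mat_carrier mult_carrier_mat transpose_carrier_mat)
  then have "det E \<noteq> 0" unfolding fract_mat_def fract_hom.hom_det by auto
  then show thesis using that[OF L R E AE _ Y(1) Y'(1) E_def] by blast
qed

text \<open>Otherwise \<open>X\<close> divides the first invariant factor of the reversal, hence all its entries. But these have
  as values at \<open>0\<close> the coefficients of degree \<open>d\<close> of the entries of \<open>A\<close>, and one of them is nonzero.\<close>

lemma condition_b: "f ! 0 = 0"
proof (rule ccontr)
  assume f0: "f ! 0 \<noteq> 0"
  obtain \<beta> where b: "has_invariant_factors (rev_mat A) \<beta>" "f = map (order 0) \<beta>"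
    using data unfolding has_structural_data_def has_infinite_partial_multiplicities_def by blast
  have lb: "length \<beta> = r" using b len by simp
  have "order 0 (\<beta> ! 0) \<noteq> 0" using f0 b lb r by simp
  then have dv0: "[:0,1:] dvd \<beta> ! 0" using order_1[of 0 "\<beta> ! 0"]
    by (metis dvd_power dvd_trans minus_zero neq0_conv)
  have dm: "mat_degree A = d" using data unfolding has_structural_data_def by simp
  have z: "coeff (A $$ (i,j)) d = 0" if ij: "i < m" "j < n" for i j
  proof -
    have "(\<Prod>i<1. \<beta> ! i) dvd det (mat 1 m (\<lambda>(a,b). if b = i then 1 else 0) * rev_mat A * (mat 1 n (\<lambda>(a,b). if b = j then 1 else 0))\<^sup>T)"
      by (rule invariant_factors_dvd_minor[OF b(1), of m n]) (use A r lb in auto)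
    also have "mat 1 m (\<lambda>(a,b). if b = i then 1 else 0) * rev_mat A * (mat 1 n (\<lambda>(a,b). if b = j then 1 else 0))\<^sup>T
       = minor_mat 1 (\<lambda>_. i) (\<lambda>_. j) (rev_mat A)"
      by (rule minor_mat_sandwich[symmetric]) (use A ij in auto)
    also have "det \<dots> = rev_poly d (A $$ (i,j))"
      using det_single[of "minor_mat 1 (\<lambda>_. i) (\<lambda>_. j) (rev_mat A)"] A ij dm by (simp add: minor_mat_def rev_mat_def)
    finally have "[:0,1:] dvd rev_poly d (A $$ (i,j))" using dv0 dvd_trans by auto
    then have "poly (rev_poly d (A $$ (i,j))) 0 = 0" using poly_eq_0_iff_dvd[of _ "0::'a"] by auto
    then show ?thesis by (simp add: poly_0_rev_poly)
  qed
  have dA: "degree (A $$ (i,j)) \<le> d" if "i < m" "j < n" for i j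
    using mat_degree_le_iff[of A d] dm that A by auto
  have *: "A $$ (i,j) = 0 \<or> degree (A $$ (i,j)) < d" if "i < m" "j < n" for i j
    using eq_zero_or_degree_less[OF dA z] that by blast
  show False
  proof (cases d)
    case 0
    then have A0: "A = 0\<^sub>m m n" using * A by (intro eq_matI) auto
    obtain E Y Y' where E: "E \<in> carrier_mat r r" "det E \<noteq> 0"
      "Y \<in> carrier_mat r m" "Y' \<in> carrier_mat r n" "E = Y * A * Y'\<^sup>T" by (rule compressed_factor)
    have "E = 0\<^sub>m r r" unfolding E(5) A0 using E(3,4) by simp
    then show False using E(2) r by simp
  next
    case (Suc d')
    have "mat_degree A \<le> d'" unfolding mat_degree_le_iff using * A Suc
      by (metis carrier_matD degree_0 less_Suc_eq_le zero_le)
    then show False using dm Suc by simp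
  qed
qed

text \<open>A heavy minor of \<open>E\<close> gives the inequality for \<open>T\<close>. For \<open>T = {..<r}\<close> it is an equality, because
  \<open>det E\<close> and \<open>det H\<close> in turn divide the products of all invariant factors of \<open>A\<close> and of its reversal.\<close>

lemma condition_c:
  shows "T \<subseteq> {..<r} \<Longrightarrow>
      (\<Sum>i<card T. int (degree (\<alpha> ! i)) + int (f ! i)) \<le> (\<Sum>i\<in>T. int d - int (k ! (r - 1 - i)) - int (l ! i))"
    and "(\<Sum>i<r. int (degree (\<alpha> ! i)) + int (f ! i)) = (\<Sum>i<r. int d - int (k ! (r - 1 - i)) - int (l ! i))"
proof -
  obtain L R E Y Y' where L: "minimal_basis_mat m (rational_span A) k L" and R: "minimal_basis_mat n (rational_span A\<^sup>T) l R"
    and E: "E \<in> carrier_mat r r" "A = L * E * R\<^sup>T" "det E \<noteq> 0"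
    and Y: "Y \<in> carrier_mat r m" "Y' \<in> carrier_mat r n" "E = Y * A * Y'\<^sup>T" by (rule compressed_factor)
  have Lc: "L \<in> carrier_mat m r" and Rc: "R \<in> carrier_mat n r"
    using L R len unfolding minimal_basis_mat_def basis_mat_def by auto
  have dm: "mat_degree A = d" and ha: "has_invariant_factors A \<alpha>"
    using data unfolding has_structural_data_def by simp_all
  obtain \<beta> where b: "has_invariant_factors (rev_mat A) \<beta>" "f = map (order 0) \<beta>"
    using data unfolding has_structural_data_def has_infinite_partial_multiplicities_def by blast
  have lb: "length \<beta> = r" using b len by simp
  have monic: "\<forall>a\<in>set \<alpha>. lead_coeff a = 1" "\<forall>a\<in>set \<beta>. lead_coeff a = 1"
    using ha b unfolding has_invariant_factors_def by auto
  have dA: "degree ((L * E * R\<^sup>T) $$ (i,j)) \<le> d" if "i < m" "j < n" for i j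
    using mat_degree_le_iff[of A d] dm that A unfolding E(2)[symmetric] by auto
  have dE: "degree (E $$ (i,j)) + k ! i + l ! j \<le> d" if "i < r" "j < r" "E $$ (i,j) \<noteq> 0" for i j
    by (rule degree_compressed_factor[OF L R _ dA]) (use E that len in auto)
  define H where "H = weighted_reversal d ((!) k) ((!) l) E"
  have H: "H \<in> carrier_mat r r" unfolding H_def using E by simp
  let ?L = "col_reversal ((!) k) L" and ?R = "col_reversal ((!) l) R"
  have rA: "rev_mat A = ?L * H * ?R\<^sup>T"
    unfolding rev_mat_def dm H_def using rev_product(1)[OF Lc E(1) Rc, of "(!) k" "(!) l" d] dE
      minimal_basis_mat_degree_le[OF L] minimal_basis_mat_degree_le[OF R] len E(2) by auto
  obtain X q where X: "X \<in> carrier_mat r m" "X * ?L = q \<cdot>\<^sub>m 1\<^sub>m r" "poly q 0 \<noteq> 0"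
    using minimal_basis_reversal_left_inverse[OF L] len by metis
  obtain X' q' where X': "X' \<in> carrier_mat r n" "X' * ?R = q' \<cdot>\<^sub>m 1\<^sub>m r" "poly q' 0 \<noteq> 0"
    using minimal_basis_reversal_left_inverse[OF R] len by metis
  have qH: "X * rev_mat A * X'\<^sup>T = (q * q') \<cdot>\<^sub>m H"
    unfolding rA by (rule sandwich_smult) (use X X' Lc Rc H in auto)
  have q0: "q * q' \<noteq> 0" "order 0 (q * q') = 0" using X(3) X'(3) by (auto intro: order_0I)
  have rev: "[:0,1:] ^ (k ! i) * H $$ (i,j) * [:0,1:] ^ (l ! j) = rev_poly d (E $$ (i,j))" if "i < r" "j < r" for i j
    using weighted_reversal_rev[of "E $$ (i,j)" "k ! i" "l ! j" d] dE[OF that] that E(1) by (simp add: H_def weighted_reversal_def)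
  have dEd: "degree (E $$ (i,j)) \<le> d" if "i < r" "j < r" for i j using dE[OF that] by (cases "E $$ (i,j) = 0") auto
  have fo: "order 0 (\<Prod>i<j. \<beta> ! i) = (\<Sum>i<j. f ! i)" if "j \<le> r" for j
  proof -
    have "\<beta> ! i \<noteq> 0" if "i < r" for i using monic(2) that lb by (metis leading_coeff_0_iff nth_mem zero_neq_one)
    then have "order 0 (\<Prod>i<j. \<beta> ! i) = (\<Sum>i<j. order 0 (\<beta> ! i))" using that by (intro order_prod_eq_sum) auto
    also have "\<dots> = (\<Sum>i<j. f ! i)" using that lb b by (intro sum.cong) auto
    finally show ?thesis .
  qed
  show ineq: "(\<Sum>i<card T. int (degree (\<alpha> ! i)) + int (f ! i)) \<le> (\<Sum>i\<in>T. int d - int (k ! (r - 1 - i)) - int (l ! i))"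
    if T: "T \<subseteq> {..<r}" for T
  proof -
    let ?j = "card T"
    have jr: "?j \<le> r" using T by (metis card_lessThan card_mono finite_lessThan)
    obtain I J where IJ: "\<forall>a<?j. I a < r \<and> J a < r" and nz: "det (minor_mat ?j I J E) \<noteq> 0"
      and heavy: "(\<Sum>i\<in>T. k ! (r - 1 - i) + l ! i) \<le> (\<Sum>a<?j. k ! I a + l ! J a)"
      using heavy_minor_exists[OF E(1,3) T, of "(!) k" "(!) l"] partition_nth[OF part(1)] partition_nth[OF part(2)] len by auto
    let ?M = "minor_mat ?j I J E" and ?H = "minor_mat ?j I J H"
    let ?P = "mat ?j r (\<lambda>(a,i). if i = I a then 1 else 0) :: 'a poly mat"
    let ?Q = "mat ?j r (\<lambda>(a,i). if i = J a then 1 else 0) :: 'a poly mat"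
    have Mc: "?M \<in> carrier_mat ?j ?j" and Hc: "?H \<in> carrier_mat ?j ?j" unfolding minor_mat_def by auto
    have deg: "degree (?M $$ (a,b)) \<le> d" if "a < ?j" "b < ?j" for a b
      using that IJ dEd by (simp add: minor_mat_def)
    have rv: "[:0,1:] ^ (k ! I a) * ?H $$ (a,b) * [:0,1:] ^ (l ! J b) = rev_poly d (?M $$ (a,b))" if "a < ?j" "b < ?j" for a b
      using that IJ rev by (simp add: minor_mat_def)
    note do = degree_det_plus_order[where a = "\<lambda>a. k ! I a" and b = "\<lambda>b. l ! J b", OF Mc Hc deg rv]
    have nzH: "det ?H \<noteq> 0" using do(1) nz by simp
    have M: "?M = (?P * Y) * A * (?Q * Y')\<^sup>T"
    proof -
      have "?M = ?P * E * ?Q\<^sup>T" by (rule minor_mat_sandwich) (use E IJ in auto)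
      then show ?thesis unfolding Y(3) using Y(1,2) A transpose_mult[of ?Q ?j r Y' n]
        by (simp add: mult_mat_assoc_dim del: assoc_mult_mat)
    qed
    have "(\<Prod>i<?j. \<alpha> ! i) dvd det ?M"
      unfolding M by (rule invariant_factors_dvd_minor[OF ha A]) (use len r Y in auto)
    then have "degree (\<Prod>i<?j. \<alpha> ! i) \<le> degree (det ?M)" using nz by (rule dvd_imp_degree_le)
    then have 1: "(\<Sum>i<?j. degree (\<alpha> ! i)) \<le> degree (det ?M)" using prod_monic(2)[OF monic(1)] jr len by simp
    have HM: "(q * q') \<cdot>\<^sub>m ?H = (?P * X) * rev_mat A * (?Q * X')\<^sup>T"
    proof -
      have "(q * q') \<cdot>\<^sub>m ?H = minor_mat ?j I J ((q * q') \<cdot>\<^sub>m H)" using IJ H by (intro eq_matI) (auto simp: minor_mat_def)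
      also have "\<dots> = ?P * (X * rev_mat A * X'\<^sup>T) * ?Q\<^sup>T" unfolding qH by (rule minor_mat_sandwich) (use H IJ in auto)
      finally show ?thesis using X(1) X'(1) A rev_mat_carrier[of A m n] transpose_mult[of ?Q ?j r X' n]
        by (simp add: mult_mat_assoc_dim del: assoc_mult_mat)
    qed
    have "(\<Prod>i<?j. \<beta> ! i) dvd det ((q * q') \<cdot>\<^sub>m ?H)"
      unfolding HM by (rule invariant_factors_dvd_minor[OF b(1), of m n]) (use lb r X X' A in auto)
    then have "(\<Prod>i<?j. \<beta> ! i) dvd (q * q') ^ ?j * det ?H" using Hc by (simp add: det_smult)
    then have "order 0 (\<Prod>i<?j. \<beta> ! i) \<le> order 0 ((q * q') ^ ?j * det ?H)"
      by (rule order_le_of_dvd) (use q0 nzH in auto)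
    also have "\<dots> = order 0 (det ?H)"
    proof -
      have "order 0 ((q * q') ^ ?j) = 0" using X(3) X'(3) by (intro order_0I) simp
      then show ?thesis using q0 nzH by (subst order_mult) auto
    qed
    finally have 2: "(\<Sum>i<?j. f ! i) \<le> order 0 (det ?H)" using fo[OF jr] by simp
    have "(\<Sum>i<?j. int (degree (\<alpha> ! i)) + int (f ! i)) \<le> int (degree (det ?M)) + int (order 0 (det ?H))"
      using 1 2 by (simp add: sum.distrib flip: of_nat_sum)
    also have "\<dots> = (\<Sum>a<?j. int d - int (k ! I a) - int (l ! J a))" using do(2) nz by simp
    also have "\<dots> = int ?j * int d - int (\<Sum>a<?j. k ! I a + l ! J a)" by (simp add: sum_subtractf sum.distrib)
    also have "\<dots> \<le> int ?j * int d - int (\<Sum>i\<in>T. k ! (r - 1 - i) + l ! i)" using heavy by linarith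
    also have "\<dots> = (\<Sum>i\<in>T. int d - int (k ! (r - 1 - i)) - int (l ! i))" by (simp add: sum_subtractf sum.distrib)
    finally show ?thesis .
  qed
  show "(\<Sum>i<r. int (degree (\<alpha> ! i)) + int (f ! i)) = (\<Sum>i<r. int d - int (k ! (r - 1 - i)) - int (l ! i))"
  proof (rule antisym)
    show "(\<Sum>i<r. int (degree (\<alpha> ! i)) + int (f ! i)) \<le> (\<Sum>i<r. int d - int (k ! (r - 1 - i)) - int (l ! i))"
      using ineq[of "{..<r}"] by simp
    note do = degree_det_plus_order[where a = "(!) k" and b = "(!) l", OF E(1) H dEd rev]
    have "det E dvd (\<Prod>i<r. \<alpha> ! i)"
      using det_dvd_invariant_factors[OF ha, of m n L E R] len r Lc Rc E by simp
    then have 1: "degree (det E) \<le> (\<Sum>i<r. degree (\<alpha> ! i))"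
      using dvd_imp_degree_le[of "det E" "\<Prod>i<r. \<alpha> ! i"] prod_monic[OF monic(1), of r] len by simp
    have "det H dvd (\<Prod>i<r. \<beta> ! i)"
      using det_dvd_invariant_factors[OF b(1), of m n ?L H ?R] lb r Lc Rc H rA by simp
    then have 2: "order 0 (det H) \<le> (\<Sum>i<r. f ! i)"
      using order_le_of_dvd[of "det H" "\<Prod>i<r. \<beta> ! i" 0] prod_monic(1)[OF monic(2), of r] lb fo[of r] by simp
    have "(\<Sum>i<r. int d - int (k ! (r - 1 - i)) - int (l ! i)) = (\<Sum>i<r. int d - int (k ! i) - int (l ! i))"
      using sum.nat_diff_reindex[of "\<lambda>i. int (k ! i)" r] by (simp add: sum_subtractf)
    also have "\<dots> = int (degree (det E)) + int (order 0 (det H))" using do(2) E(3) by simp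
    also have "\<dots> \<le> (\<Sum>i<r. int (degree (\<alpha> ! i)) + int (f ! i))"
      using 1 2 by (simp add: sum.distrib flip: of_nat_sum)
    finally show "(\<Sum>i<r. int d - int (k ! (r - 1 - i)) - int (l ! i)) \<le> (\<Sum>i<r. int (degree (\<alpha> ! i)) + int (f ! i))" .
  qed
qed

end

section \<open>Dual pairs of minimal bases with prescribed degrees\<close>

text \<open>Entry functions are used instead of matrices because the construction adds one row and one column at a
  time.\<close>

definition left_invertible :: "nat \<Rightarrow> nat \<Rightarrow> (nat \<Rightarrow> nat \<Rightarrow> 'a::comm_ring_1) \<Rightarrow> bool" where
  "left_invertible p r M \<longleftrightarrow>
     (\<exists>Y. \<forall>i<r. \<forall>j<r. (\<Sum>a<p. Y i a * M a j) = (if i = j then 1 else 0))"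

text \<open>Bases \<open>L\<close> and \<open>N\<close> of a space and of its orthogonal complement, with the degrees \<open>ks\<close> and \<open>vs\<close>. They and
  their reversals are left invertible, so both are minimal. The first rows are normalized in order that
  pairs can be enlarged one vector at a time; the two normal forms are exchanged by reversal.\<close>

definition dual_pair ::
  "nat list \<Rightarrow> nat list \<Rightarrow> (nat \<Rightarrow> nat \<Rightarrow> 'a::field poly) \<Rightarrow> (nat \<Rightarrow> nat \<Rightarrow> 'a poly) \<Rightarrow> bool" where
  "dual_pair ks vs L N \<longleftrightarrow> (let r = length ks; q = length vs; p = r + q in
     (\<forall>a<p. \<forall>j<r. degree (L a j) \<le> ks ! j) \<and> (\<forall>a<p. \<forall>j<q. degree (N a j) \<le> vs ! j) \<and>
     (\<forall>i<q. \<forall>j<r. (\<Sum>a<p. N a i * L a j) = 0) \<and>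
     left_invertible p r L \<and> left_invertible p q N \<and>
     left_invertible p r (\<lambda>a j. rev_poly (ks ! j) (L a j)) \<and>
     left_invertible p q (\<lambda>a j. rev_poly (vs ! j) (N a j)) \<and>
     (\<forall>j<r. L 0 j = (if j = 0 then 1 else 0)) \<and>
     (\<forall>j<q. N 0 j = (if j = 0 then [:0,1:] ^ (vs ! 0) else 0)))"

lemma dual_pairD:
  assumes "dual_pair ks vs L N"
  shows "\<And>a j. a < length ks + length vs \<Longrightarrow> j < length ks \<Longrightarrow> degree (L a j) \<le> ks ! j"
    and "\<And>a j. a < length ks + length vs \<Longrightarrow> j < length vs \<Longrightarrow> degree (N a j) \<le> vs ! j"
    and "\<And>i j. i < length vs \<Longrightarrow> j < length ks \<Longrightarrow> (\<Sum>a<length ks + length vs. N a i * L a j) = 0"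
    and "left_invertible (length ks + length vs) (length ks) L"
    and "left_invertible (length ks + length vs) (length vs) N"
    and "left_invertible (length ks + length vs) (length ks) (\<lambda>a j. rev_poly (ks ! j) (L a j))"
    and "left_invertible (length ks + length vs) (length vs) (\<lambda>a j. rev_poly (vs ! j) (N a j))"
    and "\<And>j. j < length ks \<Longrightarrow> L 0 j = (if j = 0 then 1 else 0)"
    and "\<And>j. j < length vs \<Longrightarrow> N 0 j = (if j = 0 then [:0,1:] ^ (vs ! 0) else 0)"
  using assms unfolding dual_pair_def Let_def by simp_all

lemma rev_poly_1 [simp]: "rev_poly N 1 = [:0,1:] ^ N"
  unfolding rev_poly_eq_homog by simp

lemma rev_poly_rev_poly: "degree p \<le> N \<Longrightarrow> rev_poly N (rev_poly N p) = p"
  by (rule poly_eqI) (auto simp: coeff_rev_poly coeff_eq_0)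

lemma degree_rev_poly_le: "degree (rev_poly N p) \<le> N"
  by (rule degree_le) (simp add: coeff_rev_poly)

lemma rev_poly_X_power [simp]: "rev_poly N ([:0,1:] ^ N) = 1"
  using rev_poly_rev_poly[of 1 N] by simp

lemma rev_poly_add_mult:
  "degree p \<le> N \<Longrightarrow> degree q \<le> M \<Longrightarrow> rev_poly (N + M) (p * q) = rev_poly N p * rev_poly M q"
  unfolding rev_poly_eq_homog by (rule homog_mult)

lemma rev_poly_raise: "degree p \<le> N \<Longrightarrow> rev_poly (M + N) p = [:0,1:] ^ M * rev_poly N p"
  unfolding rev_poly_eq_homog using homog_raise[of p N 1 "[:0,1:]" M] by (simp add: add.commute mult.commute)

lemma rev_orthogonal:
  fixes L N :: "nat \<Rightarrow> nat \<Rightarrow> 'a::field poly"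
  assumes "\<And>a. a < p \<Longrightarrow> degree (N a i) \<le> v" "\<And>a. a < p \<Longrightarrow> degree (L a j) \<le> k"
    and "(\<Sum>a<p. N a i * L a j) = 0"
  shows "(\<Sum>a<p. rev_poly v (N a i) * rev_poly k (L a j)) = 0"
proof -
  have "(\<Sum>a<p. rev_poly v (N a i) * rev_poly k (L a j)) = (\<Sum>a<p. rev_poly (v + k) (N a i * L a j))"
    using assms(1,2) by (intro sum.cong) (auto simp: rev_poly_add_mult)
  also have "\<dots> = rev_poly (v + k) (\<Sum>a<p. N a i * L a j)" unfolding rev_poly_eq_homog homog_sum ..
  finally show ?thesis using assms(3) by simp
qed

text \<open>Reversal exchanges the two normal forms of the first row, so the two lists of degrees play symmetric
  roles.\<close>

lemma dual_pair_swap: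
  assumes "dual_pair ks vs L N"
  shows "dual_pair vs ks (\<lambda>a j. rev_poly (vs ! j) (N a j)) (\<lambda>a j. rev_poly (ks ! j) (L a j))"
proof -
  let ?r = "length ks" and ?q = "length vs" let ?p = "?r + ?q"
  note d = dual_pairD[OF assms]
  have o: "(\<Sum>a<?q + ?r. rev_poly (ks ! i) (L a i) * rev_poly (vs ! j) (N a j)) = 0" if "i < ?r" "j < ?q" for i j
    using rev_orthogonal[of ?p N j "vs ! j" L i "ks ! i"] d(1-3) that by (simp add: mult.commute add.commute)
  have r1: "left_invertible (?q + ?r) ?r (\<lambda>a j. rev_poly (ks ! j) (rev_poly (ks ! j) (L a j)))"
  proof -
    obtain Y where Y: "\<forall>i<?r. \<forall>j<?r. (\<Sum>a<?p. Y i a * L a j) = (if i = j then 1 else 0)"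
      using d(4) unfolding left_invertible_def by blast
    have "(\<Sum>a<?q + ?r. Y i a * rev_poly (ks ! j) (rev_poly (ks ! j) (L a j))) = (\<Sum>a<?p. Y i a * L a j)" if "j < ?r" for i j
      using d(1,2) that by (intro sum.cong) (auto simp: rev_poly_rev_poly add.commute)
    then show ?thesis using Y unfolding left_invertible_def by (intro exI[of _ Y]) auto
  qed
  have r2: "left_invertible (?q + ?r) ?q (\<lambda>a j. rev_poly (vs ! j) (rev_poly (vs ! j) (N a j)))"
  proof -
    obtain Y where Y: "\<forall>i<?q. \<forall>j<?q. (\<Sum>a<?p. Y i a * N a j) = (if i = j then 1 else 0)"
      using d(5) unfolding left_invertible_def by blast
    have "(\<Sum>a<?q + ?r. Y i a * rev_poly (vs ! j) (rev_poly (vs ! j) (N a j))) = (\<Sum>a<?p. Y i a * N a j)" if "j < ?q" for i j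
      using d(1,2) that by (intro sum.cong) (auto simp: rev_poly_rev_poly add.commute)
    then show ?thesis using Y unfolding left_invertible_def by (intro exI[of _ Y]) auto
  qed
  have LLr: "left_invertible (?q + ?r) ?r (\<lambda>a j. rev_poly (ks ! j) (L a j))"
    and LNr: "left_invertible (?q + ?r) ?q (\<lambda>a j. rev_poly (vs ! j) (N a j))"
    using d(6,7) by (simp_all only: add.commute)
  have t1: "rev_poly (vs ! j) (N 0 j) = (if j = 0 then 1 else 0)" if "j < ?q" for j using d(8,9) that by simp
  have t2: "rev_poly (ks ! j) (L 0 j) = (if j = 0 then [:0,1:] ^ (ks ! 0) else 0)" if "j < ?r" for j
    using d(8,9) that by simp
  show ?thesis unfolding dual_pair_def Let_def
    by (intro conjI allI impI) (simp_all add: degree_rev_poly_le o r1 r2 LLr LNr t1 t2)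
qed

text \<open>A new first row that is a unit vector can absorb the entries \<open>c\<close> of the new column.\<close>

lemma left_invertible_border:
  fixes M :: "nat \<Rightarrow> nat \<Rightarrow> 'a::comm_ring_1"
  assumes "left_invertible p r M"
  shows "left_invertible (Suc p) (Suc r)
     (\<lambda>a j. case a of 0 \<Rightarrow> (if j = 0 then 1 else 0) | Suc a \<Rightarrow> (case j of 0 \<Rightarrow> c a | Suc j \<Rightarrow> M a j))"
proof -
  obtain Y where Y: "\<And>i j. i < r \<Longrightarrow> j < r \<Longrightarrow> (\<Sum>a<p. Y i a * M a j) = (if i = j then 1 else 0)"
    using assms unfolding left_invertible_def by blast
  define Z where "Z i a = (case i of 0 \<Rightarrow> (if a = 0 then 1 else 0) |
      Suc i \<Rightarrow> (case a of 0 \<Rightarrow> - (\<Sum>b<p. Y i b * c b) | Suc a \<Rightarrow> Y i a))" for i a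
  show ?thesis unfolding left_invertible_def
  proof (rule exI[of _ Z], intro allI impI)
    fix i j assume "i < Suc r" "j < Suc r"
    then show "(\<Sum>a<Suc p. Z i a * (case a of 0 \<Rightarrow> (if j = 0 then 1 else 0) |
        Suc a \<Rightarrow> (case j of 0 \<Rightarrow> c a | Suc j \<Rightarrow> M a j))) = (if i = j then 1 else 0)"
      by (cases i; cases j) (simp_all add: Z_def Y sum.lessThan_Suc_shift del: sum.lessThan_Suc)
  qed
qed

text \<open>Here the new first row is of no use, and a relation \<open>w\<close> of the old columns that detects the new column takes
  over. In the application \<open>w\<close> is a reversed vector of the orthogonal complement.\<close>

lemma left_invertible_border_dual:
  fixes M :: "nat \<Rightarrow> nat \<Rightarrow> 'a::comm_ring_1"
  assumes "left_invertible p r M" and w: "\<And>j. j < r \<Longrightarrow> (\<Sum>a<p. w a * M a j) = 0" "(\<Sum>a<p. w a * c a) = 1"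
  shows "left_invertible (Suc p) (Suc r)
     (\<lambda>a j. case a of 0 \<Rightarrow> (if j = 0 then x else 0) | Suc a \<Rightarrow> (case j of 0 \<Rightarrow> c a | Suc j \<Rightarrow> M a j))"
proof -
  obtain Y where Y: "\<And>i j. i < r \<Longrightarrow> j < r \<Longrightarrow> (\<Sum>a<p. Y i a * M a j) = (if i = j then 1 else 0)"
    using assms unfolding left_invertible_def by blast
  define e where "e i = (\<Sum>b<p. Y i b * c b)" for i
  define Z where "Z i a = (case a of 0 \<Rightarrow> 0 | Suc a \<Rightarrow> (case i of 0 \<Rightarrow> w a | Suc i \<Rightarrow> Y i a - e i * w a))" for i a
  have 1: "(\<Sum>a<p. (Y i a - e i * w a) * M a j) = (if i = j then 1 else 0)" if "i < r" "j < r" for i j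
  proof -
    have "(\<Sum>a<p. (Y i a - e i * w a) * M a j) = (\<Sum>a<p. Y i a * M a j) - e i * (\<Sum>a<p. w a * M a j)"
      by (simp add: left_diff_distrib sum_subtractf sum_distrib_left mult.assoc)
    then show ?thesis using Y[OF that] w(1)[OF that(2)] by simp
  qed
  have 2: "(\<Sum>a<p. (Y i a - e i * w a) * c a) = 0" for i
  proof -
    have "(\<Sum>a<p. (Y i a - e i * w a) * c a) = (\<Sum>a<p. Y i a * c a) - e i * (\<Sum>a<p. w a * c a)"
      by (simp add: left_diff_distrib sum_subtractf sum_distrib_left mult.assoc)
    then show ?thesis using w(2) by (simp add: e_def)
  qed
  show ?thesis unfolding left_invertible_def
  proof (rule exI[of _ Z], intro allI impI)
    fix i j assume "i < Suc r" "j < Suc r"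
    then show "(\<Sum>a<Suc p. Z i a * (case a of 0 \<Rightarrow> (if j = 0 then x else 0) |
        Suc a \<Rightarrow> (case j of 0 \<Rightarrow> c a | Suc j \<Rightarrow> M a j))) = (if i = j then 1 else 0)"
      by (cases i; cases j) (simp_all add: Z_def 1 2 w sum.lessThan_Suc_shift del: sum.lessThan_Suc)
  qed
qed

lemma left_invertible_add_row:
  fixes M :: "nat \<Rightarrow> nat \<Rightarrow> 'a::comm_ring_1"
  assumes "left_invertible p r M"
  shows "left_invertible (Suc p) r (\<lambda>a j. case a of 0 \<Rightarrow> b j | Suc a \<Rightarrow> M a j)"
proof -
  obtain Y where Y: "\<And>i j. i < r \<Longrightarrow> j < r \<Longrightarrow> (\<Sum>a<p. Y i a * M a j) = (if i = j then 1 else 0)"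
    using assms unfolding left_invertible_def by blast
  show ?thesis unfolding left_invertible_def
    by (rule exI[of _ "\<lambda>i a. case a of 0 \<Rightarrow> 0 | Suc a \<Rightarrow> Y i a"])
       (auto simp: Y sum.lessThan_Suc_shift simp del: sum.lessThan_Suc)
qed

lemma left_invertible_tail:
  fixes M :: "nat \<Rightarrow> nat \<Rightarrow> 'a::comm_ring_1"
  assumes "left_invertible p (Suc r) M" shows "left_invertible p r (\<lambda>a j. M a (Suc j))"
proof -
  obtain Y where Y: "\<And>i j. i < Suc r \<Longrightarrow> j < Suc r \<Longrightarrow> (\<Sum>a<p. Y i a * M a j) = (if i = j then 1 else 0)"
    using assms unfolding left_invertible_def by blast
  show ?thesis unfolding left_invertible_def
    by (rule exI[of _ "\<lambda>i. Y (Suc i)"]) (simp add: Y)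
qed

lemma left_invertible_cong:
  assumes "left_invertible p r M" "\<And>a j. a < p \<Longrightarrow> j < r \<Longrightarrow> M a j = M' a j"
  shows "left_invertible p r M'"
proof -
  obtain Y where Y: "\<And>i j. i < r \<Longrightarrow> j < r \<Longrightarrow> (\<Sum>a<p. Y i a * M a j) = (if i = j then 1 else 0)"
    using assms unfolding left_invertible_def by blast
  have "(\<Sum>a<p. Y i a * M' a j) = (\<Sum>a<p. Y i a * M a j)" if "j < r" for i j
    using assms(2) that by (intro sum.cong) auto
  then show ?thesis unfolding left_invertible_def using Y by (intro exI[of _ Y]) simp
qed

text \<open>A new vector \<open>(1, - X^k, 0, ..., 0)\<close> of degree \<open>k\<close> is added to \<open>L\<close>, and a new coordinate is put in front.
  Orthogonality forces the new coordinate of the first vector of \<open>N\<close> to be \<open>X^k * X^v\<close>, which raises its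
  degree from \<open>v\<close> to \<open>k + v\<close>; the other vectors of \<open>N\<close> vanish in the first coordinate and keep theirs.\<close>

lemma dual_pair_extend:
  fixes L N :: "nat \<Rightarrow> nat \<Rightarrow> 'a::field poly"
  assumes dp: "dual_pair ks (v # vs) L N" and ks: "ks \<noteq> []"
  shows "\<exists>L' N' :: nat \<Rightarrow> nat \<Rightarrow> 'a poly. dual_pair (k # ks) ((k + v) # vs) L' N'"
proof -
  let ?r = "length ks" and ?q = "length (v # vs)" let ?p = "?r + ?q"
  let ?X = "[:0,1:] :: 'a poly"
  have dL: "\<And>a j. a < ?p \<Longrightarrow> j < ?r \<Longrightarrow> degree (L a j) \<le> ks ! j"
    and dN: "\<And>a j. a < ?p \<Longrightarrow> j < ?q \<Longrightarrow> degree (N a j) \<le> (v # vs) ! j"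
    and orth: "\<And>i j. i < ?q \<Longrightarrow> j < ?r \<Longrightarrow> (\<Sum>a<?p. N a i * L a j) = 0"
    and LL: "left_invertible ?p ?r L" and LN: "left_invertible ?p ?q N"
    and LLr: "left_invertible ?p ?r (\<lambda>a j. rev_poly (ks ! j) (L a j))"
    and LNr: "left_invertible ?p ?q (\<lambda>a j. rev_poly ((v # vs) ! j) (N a j))"
    and N0: "\<And>j. j < ?q \<Longrightarrow> N 0 j = (if j = 0 then ?X ^ v else 0)"
    using dual_pairD[OF dp] by simp_all
  define c where "c a = (if a = 0 then - (?X ^ k) else 0)" for a :: nat
  define L' where "L' a j = (case a of 0 \<Rightarrow> (if j = 0 then 1 else 0) |
      Suc a \<Rightarrow> (case j of 0 \<Rightarrow> c a | Suc j \<Rightarrow> L a j))" for a j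
  define N' where "N' a j = (case a of 0 \<Rightarrow> (if j = 0 then ?X ^ (k + v) else 0) | Suc a \<Rightarrow> N a j)" for a j
  have p: "length (k # ks) + length ((k + v) # vs) = Suc ?p" by simp
  have degL: "degree (L' a j) \<le> (k # ks) ! j" if "a < Suc ?p" "j < Suc ?r" for a j
    using dL that by (cases a; cases j) (auto simp: L'_def c_def degree_power_eq)
  have degN: "degree (N' a j) \<le> ((k + v) # vs) ! j" if a: "a < Suc ?p" and j: "j < ?q" for a j
  proof (cases a)
    case 0 then show ?thesis by (auto simp: N'_def degree_power_eq)
  next
    case (Suc a')
    have "degree (N a' j) \<le> (v # vs) ! j" using dN[of a' j] Suc a j by simp
    also have "\<dots> \<le> ((k + v) # vs) ! j" by (cases j) auto
    finally show ?thesis using Suc by (simp add: N'_def)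
  qed
  have p0: "0 < ?p" by simp
  have orth': "(\<Sum>a<Suc ?p. N' a i * L' a j) = 0" if i: "i < ?q" and j: "j < Suc ?r" for i j
  proof (cases j)
    case 0
    have "(\<Sum>a<?p. N a i * c a) = (\<Sum>a<?p. if a = 0 then N 0 i * - (?X ^ k) else 0)"
      by (intro sum.cong) (auto simp: c_def)
    also have "\<dots> = N 0 i * - (?X ^ k)" using p0 by simp
    finally show ?thesis using 0 N0[OF i]
      by (simp add: sum.lessThan_Suc_shift L'_def N'_def power_add del: sum.lessThan_Suc)
  next
    case (Suc j')
    then show ?thesis using orth[OF i, of j'] j
      by (simp add: sum.lessThan_Suc_shift L'_def N'_def del: sum.lessThan_Suc)
  qed
  have I1: "left_invertible (Suc ?p) (Suc ?r) L'"
    unfolding L'_def by (rule left_invertible_border[OF LL])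
  have I2: "left_invertible (Suc ?p) ?q N'"
    unfolding N'_def by (rule left_invertible_add_row[OF LN])
  have I3: "left_invertible (Suc ?p) (Suc ?r) (\<lambda>a j. rev_poly ((k # ks) ! j) (L' a j))"
  proof -
    let ?w = "\<lambda>a. - rev_poly v (N a 0)"
    have w1: "(\<Sum>a<?p. ?w a * rev_poly (ks ! j) (L a j)) = 0" if "j < ?r" for j
      using rev_orthogonal[of ?p N 0 v L j "ks ! j"] dN[of _ 0] dL[of _ j] orth[of 0 j] that
      by (simp add: sum_negf)
    have w2: "(\<Sum>a<?p. ?w a * (if a = 0 then - 1 else 0)) = 1"
    proof -
      have "(\<Sum>a<?p. ?w a * (if a = 0 then - 1 else 0)) = (\<Sum>a<?p. if a = 0 then rev_poly v (N 0 0) else 0)"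
        by (intro sum.cong) auto
      then show ?thesis using p0 N0[of 0] by simp
    qed
    have r: "rev_poly k (- (?X ^ k)) = - 1"
      using homog_uminus[of 1 ?X k "?X ^ k"] rev_poly_X_power[of k] by (simp add: rev_poly_eq_homog)
    show ?thesis
      by (rule left_invertible_cong[OF left_invertible_border_dual[OF LLr w1 w2, of "?X ^ k"]])
         (auto simp: L'_def c_def r split: nat.splits)
  qed
  have I4: "left_invertible (Suc ?p) ?q (\<lambda>a j. rev_poly (((k + v) # vs) ! j) (N' a j))"
  proof -
    have "left_invertible ?p (length vs) (\<lambda>a j. rev_poly (vs ! j) (N a (Suc j)))"
      using left_invertible_tail[of ?p "length vs" "\<lambda>a j. rev_poly ((v # vs) ! j) (N a j)"] LNr by simp
    from left_invertible_border[OF this, of "\<lambda>a. ?X ^ k * rev_poly v (N a 0)"]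
    have "left_invertible (Suc ?p) ?q (\<lambda>a j. case a of 0 \<Rightarrow> (if j = 0 then 1 else 0)
       | Suc a \<Rightarrow> (case j of 0 \<Rightarrow> ?X ^ k * rev_poly v (N a 0) | Suc j \<Rightarrow> rev_poly (vs ! j) (N a (Suc j))))" by simp
    then show ?thesis
    proof (rule left_invertible_cong)
      fix a j assume "a < Suc ?p" "j < ?q"
      then show "(case a of 0 \<Rightarrow> (if j = 0 then 1 else 0)
       | Suc a \<Rightarrow> (case j of 0 \<Rightarrow> ?X ^ k * rev_poly v (N a 0) | Suc j \<Rightarrow> rev_poly (vs ! j) (N a (Suc j))))
        = rev_poly (((k + v) # vs) ! j) (N' a j)"
        using dN[of "a - 1" 0] by (auto simp: N'_def rev_poly_raise split: nat.splits)
    qed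
  qed
  have "dual_pair (k # ks) ((k + v) # vs) L' N'"
    unfolding dual_pair_def Let_def p using degL degN orth' I1 I2 I3 I4 by (auto simp: L'_def N'_def)
  then show ?thesis by blast
qed

text \<open>The smaller of the two leading degrees is subtracted from the other, as in merging two partitions of one
  total into a common refinement. In the base case the pair is \<open>(1, - X^k)\<close> and \<open>(X^k, 1)\<close>.\<close>

lemma dual_pair_exists:
  assumes "sum_list ks = sum_list vs" "ks \<noteq> []" "vs \<noteq> []"
  shows "\<exists>L N :: nat \<Rightarrow> nat \<Rightarrow> 'a::field poly. dual_pair ks vs L N"
  using assms
proof (induction "length ks + length vs" arbitrary: ks vs rule: less_induct)
  case (less ks vs)
  obtain k ks' where ks: "ks = k # ks'" using less.prems by (cases ks) auto
  obtain v vs' where vs: "vs = v # vs'" using less.prems by (cases vs) auto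
  consider "ks' = []" "vs' = []" | "ks' \<noteq> []" "k \<le> v" | "vs' \<noteq> []" "v \<le> k"
    using less.prems nat_le_linear[of k v] unfolding ks vs by (cases "ks' = []"; cases "vs' = []") auto
  then show ?case
  proof cases
    case 1
    then have kv: "v = k" using less.prems ks vs by simp
    let ?X = "[:0,1:] :: 'a poly"
    let ?L = "\<lambda>a j :: nat. if a = 0 then 1 else - (?X ^ k)"
    let ?N = "\<lambda>a j :: nat. if a = 0 then ?X ^ k else 1"
    have r: "rev_poly k (- (?X ^ k)) = - 1"
      using homog_uminus[of 1 ?X k "?X ^ k"] rev_poly_X_power[of k] by (simp add: rev_poly_eq_homog)
    have two: "{..<2} = {0, 1 :: nat}" by auto
    have "dual_pair [k] [k] ?L ?N"
      unfolding dual_pair_def Let_def left_invertible_def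
      by (auto simp: degree_power_eq two r numeral_2_eq_2[symmetric]
          intro: exI[of _ "\<lambda>i a. if a = 0 then 1 else 0"] exI[of _ "\<lambda>i a. if a = 0 then 0 else 1"]
           exI[of _ "\<lambda>i a. if a = 0 then 0 else - 1"])
    then show ?thesis unfolding ks vs 1 kv by blast
  next
    case 2
    have "\<exists>L N :: nat \<Rightarrow> nat \<Rightarrow> 'a poly. dual_pair ks' ((v - k) # vs') L N"
      by (rule less.hyps) (use less.prems ks vs 2 in auto)
    then show ?thesis using dual_pair_extend[of ks' "v - k" vs' _ _ k] 2 unfolding ks vs by auto
  next
    case 3
    have "\<exists>L N :: nat \<Rightarrow> nat \<Rightarrow> 'a poly. dual_pair ((k - v) # ks') vs' L N"
      by (rule less.hyps) (use less.prems ks vs 3 in auto)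
    then obtain L N :: "nat \<Rightarrow> nat \<Rightarrow> 'a poly" where LN: "dual_pair vs' ((k - v) # ks') L N"
      using dual_pair_swap by blast
    obtain L' N' :: "nat \<Rightarrow> nat \<Rightarrow> 'a poly" where "dual_pair (v # vs') ((v + (k - v)) # ks') L' N'"
      using dual_pair_extend[OF LN 3(1)] by blast
    then have "dual_pair (v # vs') (k # ks') L' N'" using 3 by simp
    then show ?thesis unfolding ks vs using dual_pair_swap by blast
  qed
qed

definition corner_one :: "nat \<Rightarrow> nat \<Rightarrow> 'a::{zero,one} mat" where
  "corner_one p r = mat p r (\<lambda>(i,j). if i = j then 1 else 0)"

lemma corner_one_carrier [simp]: "corner_one p r \<in> carrier_mat p r"
  unfolding corner_one_def by simp

text \<open>The columns of \<open>L\<close> extend to a unimodular matrix, namely the inverse of \<open>Q\<close>.\<close>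

definition completable :: "nat \<Rightarrow> nat \<Rightarrow> 'a::comm_ring_1 mat \<Rightarrow> bool" where
  "completable p r L \<longleftrightarrow> L \<in> carrier_mat p r \<and> (\<exists>Q. unimodular p Q \<and> Q * L = corner_one p r)"

text \<open>Stacking \<open>Y\<close> on \<open>N\<^sup>T\<close> works: multiplied by the matrix with blocks \<open>L\<close> and \<open>X\<^sup>T\<close> it becomes block triangular with
  identities on the diagonal.\<close>

lemma completableI:
  fixes L N :: "'a::comm_ring_1 mat"
  assumes L: "L \<in> carrier_mat p r" and N: "N \<in> carrier_mat p q" and p: "p = r + q"
    and Y: "Y \<in> carrier_mat r p" "Y * L = 1\<^sub>m r" and X: "X \<in> carrier_mat q p" "X * N = 1\<^sub>m q"
    and orth: "N\<^sup>T * L = 0\<^sub>m q r"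
  shows "completable p r L"
proof -
  define Q where "Q = four_block_mat Y (0\<^sub>m r 0) N\<^sup>T (0\<^sub>m q 0)"
  define P where "P = four_block_mat L X\<^sup>T (0\<^sub>m 0 r) (0\<^sub>m 0 q)"
  have Q: "Q \<in> carrier_mat p p" unfolding Q_def using Y N p four_block_carrier_mat[of Y r p "0\<^sub>m q 0" q 0] by simp
  have P: "P \<in> carrier_mat p p" unfolding P_def using L X p four_block_carrier_mat[of L p r "0\<^sub>m 0 q" 0 q] by simp
  have NX: "N\<^sup>T * X\<^sup>T = 1\<^sub>m q" using transpose_mult[OF X(1) N] X(2) by simp
  have "Q * P = four_block_mat (1\<^sub>m r) (Y * X\<^sup>T) (0\<^sub>m q r) (1\<^sub>m q)"
    unfolding Q_def P_def
    by (subst mult_four_block_mat[of _ r p _ 0 _ q _ _ r _ q]) (use L N X Y NX orth in auto)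
  moreover have "unimodular (r + q) (four_block_mat (1\<^sub>m r) (Y * X\<^sup>T) (0\<^sub>m q r) (1\<^sub>m q))"
    by (rule unimodular_block_upper) (use X Y in auto)
  ultimately have "unimodular p (Q * P)" using p by simp
  then obtain W where W: "W \<in> carrier_mat p p" "(Q * P) * W = 1\<^sub>m p" unfolding unimodular_def by blast
  have "Q * (P * W) = 1\<^sub>m p" using W Q P assoc_mult_mat[OF Q P W(1)] by simp
  then have uQ: "unimodular p Q" by (intro unimodularI[OF Q]) (use P W in auto)
  have "Q * L = corner_one p r"
  proof (rule eq_matI, goal_cases)
    case (1 i j)
    then have ij: "i < p" "j < r" by (auto simp: corner_one_def)
    have "(Q * L) $$ (i,j) = row Q i \<bullet> col L j" using ij Q L by simp
    also have "\<dots> = (if i < r then (Y * L) $$ (i,j) else (N\<^sup>T * L) $$ (i - r, j))"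
    proof -
      have "row Q i = (if i < r then row Y i else row N\<^sup>T (i - r))"
        unfolding Q_def using ij N Y p by (intro eq_vecI) auto
      then show ?thesis using ij L Y(1) N p by auto
    qed
    finally show ?case unfolding Y(2) orth using ij p by (auto simp: corner_one_def)
  qed (use Q L in \<open>auto simp: corner_one_def\<close>)
  then show ?thesis unfolding completable_def using L uQ by blast
qed

lemma completable_left_inverse:
  fixes L :: "'a::comm_ring_1 mat"
  assumes "completable p r L" "r \<le> p"
  obtains Y where "Y \<in> carrier_mat r p" "Y * L = 1\<^sub>m r"
proof -
  obtain Q where Q: "unimodular p Q" "Q * L = corner_one p r" and L: "L \<in> carrier_mat p r"
    using assms unfolding completable_def by blast
  have Qc: "Q \<in> carrier_mat p p" using Q unimodular_carrier by blast
  have "corner_one r p * corner_one p r = (1\<^sub>m r :: 'a mat)"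
  proof (rule eq_matI, goal_cases)
    case (1 i j)
    then have ij: "i < r" "j < r" by auto
    have "(corner_one r p * corner_one p r :: 'a mat) $$ (i,j) =
        (\<Sum>a<p. (if i = a then 1 else 0) * (if a = j then 1 else 0))"
      using ij by (simp add: corner_one_def scalar_prod_def atLeast0LessThan)
    also have "\<dots> = (\<Sum>a<p. if a = i then if i = j then 1 else 0 else 0)" by (intro sum.cong) auto
    finally show ?case using ij assms by simp
  qed (auto simp: corner_one_def)
  then have "(corner_one r p * Q) * L = 1\<^sub>m r"
    using assoc_mult_mat[of "corner_one r p" r p Q p L r] Qc L Q(2) by simp
  then show thesis using that[OF mult_carrier_mat[OF corner_one_carrier Qc]] by simp
qed

text \<open>If \<open>vs\<close> is empty, all \<open>ks\<close> are zero and the identity matrix is the basis; otherwise a dual pair is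
  translated into matrices. That \<open>N\<close> spans the whole kernel follows from the nonsingular matrix with blocks
  \<open>L\<close> and \<open>X\<^sup>T\<close>, where \<open>X\<close> is a left inverse of \<open>N\<close>.\<close>

lemma dual_bases_exist:
  assumes s: "sum_list ks = sum_list vs" and ne: "ks \<noteq> []"
  obtains L N :: "'a::field poly mat" where
    "completable (length ks + length vs) (length ks) L"
    "completable (length ks + length vs) (length ks) (col_reversal ((!) ks) L)"
    "\<forall>i<length ks + length vs. \<forall>j<length ks. degree (L $$ (i,j)) \<le> ks ! j"
    "minimal_basis_mat (length ks + length vs) (rational_span L) ks L"
    "minimal_basis_mat (length ks + length vs) (mat_kernel (fract_mat L)\<^sup>T) vs N"
proof -
  let ?r = "length ks" and ?q = "length vs" let ?p = "?r + ?q"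
  define \<Phi> :: "'a poly mat \<Rightarrow> 'a poly mat \<Rightarrow> 'a poly mat \<Rightarrow> 'a poly mat \<Rightarrow> 'a poly mat \<Rightarrow> 'a poly mat \<Rightarrow> bool"
    where "\<Phi> L N Y X Y' X' \<longleftrightarrow> L \<in> carrier_mat ?p ?r \<and> N \<in> carrier_mat ?p ?q \<and>
    (\<forall>i<?p. \<forall>j<?r. degree (L $$ (i,j)) \<le> ks ! j) \<and> (\<forall>i<?p. \<forall>j<?q. degree (N $$ (i,j)) \<le> vs ! j) \<and>
    N\<^sup>T * L = (0\<^sub>m ?q ?r :: 'a poly mat) \<and> (col_reversal ((!) vs) N)\<^sup>T * col_reversal ((!) ks) L = 0\<^sub>m ?q ?r \<and>
    Y \<in> carrier_mat ?r ?p \<and> Y * L = 1\<^sub>m ?r \<and> X \<in> carrier_mat ?q ?p \<and> X * N = 1\<^sub>m ?q \<and>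
    Y' \<in> carrier_mat ?r ?p \<and> Y' * col_reversal ((!) ks) L = 1\<^sub>m ?r \<and>
    X' \<in> carrier_mat ?q ?p \<and> X' * col_reversal ((!) vs) N = 1\<^sub>m ?q" for L N Y X Y' X'
  have "\<exists>L N Y X Y' X'. \<Phi> L N Y X Y' X'"
  proof (cases "vs = []")
    case True
    then have "ks ! i = 0" if "i < ?r" for i using s that by (metis list.sel sum_list.Nil sum_list_eq_0_iff nth_mem)
    then have "col_reversal ((!) ks) (1\<^sub>m ?r) = (1\<^sub>m ?r :: 'a poly mat)"
      by (intro eq_matI) (auto simp: col_reversal_def)
    then have "\<Phi> (1\<^sub>m ?r) (0\<^sub>m ?r 0) (1\<^sub>m ?r) (0\<^sub>m 0 ?r) (1\<^sub>m ?r) (0\<^sub>m 0 ?r)"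
      unfolding \<Phi>_def using True by auto
    then show ?thesis by blast
  next
    case False
    obtain Lf Nf :: "nat \<Rightarrow> nat \<Rightarrow> 'a poly" where "dual_pair ks vs Lf Nf" using dual_pair_exists[OF s ne False] by blast
    note d = dual_pairD[OF this]
    have inv: "\<exists>Y\<in>carrier_mat r ?p. Y * mat ?p r (\<lambda>(a,j). M a j) = 1\<^sub>m r" if M: "left_invertible ?p r M"
      for r and M :: "nat \<Rightarrow> nat \<Rightarrow> 'a poly"
    proof -
      obtain Y where Y: "\<And>i j. i < r \<Longrightarrow> j < r \<Longrightarrow> (\<Sum>a<?p. Y i a * M a j) = (if i = j then 1 else 0)"
        using M unfolding left_invertible_def by blast
      show ?thesis
        by (rule bexI[of _ "mat r ?p (\<lambda>(i,a). Y i a)"])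
           (auto intro!: eq_matI simp: scalar_prod_def atLeast0LessThan Y)
    qed
    let ?L = "mat ?p ?r (\<lambda>(a,j). Lf a j)" and ?N = "mat ?p ?q (\<lambda>(a,j). Nf a j)"
    have rL: "col_reversal ((!) ks) ?L = mat ?p ?r (\<lambda>(a,j). rev_poly (ks ! j) (Lf a j))"
      and rN: "col_reversal ((!) vs) ?N = mat ?p ?q (\<lambda>(a,j). rev_poly (vs ! j) (Nf a j))"
      by (auto intro!: eq_matI simp: col_reversal_def)
    have o1: "?N\<^sup>T * ?L = 0\<^sub>m ?q ?r"
      by (intro eq_matI) (use d(3) in \<open>auto simp: scalar_prod_def atLeast0LessThan\<close>)
    have o2: "(col_reversal ((!) vs) ?N)\<^sup>T * col_reversal ((!) ks) ?L = 0\<^sub>m ?q ?r"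
    proof (rule eq_matI, goal_cases)
      case (1 i j)
      then have ij: "i < ?q" "j < ?r" by auto
      have "(\<Sum>a<?p. rev_poly (vs ! i) (Nf a i) * rev_poly (ks ! j) (Lf a j)) = 0"
        by (rule rev_orthogonal) (use d(1-3) ij in auto)
      then show ?case using ij unfolding rL rN by (simp add: scalar_prod_def atLeast0LessThan)
    qed auto
    obtain Y where "Y \<in> carrier_mat ?r ?p" "Y * ?L = 1\<^sub>m ?r" using inv[OF d(4)] by blast
    moreover obtain X where "X \<in> carrier_mat ?q ?p" "X * ?N = 1\<^sub>m ?q" using inv[OF d(5)] by blast
    moreover obtain Y' where "Y' \<in> carrier_mat ?r ?p" "Y' * col_reversal ((!) ks) ?L = 1\<^sub>m ?r" unfolding rL using inv[OF d(6)] by blast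
    moreover obtain X' where "X' \<in> carrier_mat ?q ?p" "X' * col_reversal ((!) vs) ?N = 1\<^sub>m ?q" unfolding rN using inv[OF d(7)] by blast
    moreover have "\<forall>i<?p. \<forall>j<?r. degree (?L $$ (i,j)) \<le> ks ! j" "\<forall>i<?p. \<forall>j<?q. degree (?N $$ (i,j)) \<le> vs ! j" using d(1,2) by auto
    moreover have "?L \<in> carrier_mat ?p ?r" "?N \<in> carrier_mat ?p ?q" by auto
    ultimately have "\<Phi> ?L ?N Y X Y' X'" unfolding \<Phi>_def using o1 o2 by (intro conjI)
    then show ?thesis by blast
  qed
  then obtain L N Y X Y' X' where "\<Phi> L N Y X Y' X'" by blast
  then have L: "L \<in> carrier_mat ?p ?r" and N: "N \<in> carrier_mat ?p ?q"
    and degL: "\<forall>i<?p. \<forall>j<?r. degree (L $$ (i,j)) \<le> ks ! j" and degN: "\<forall>i<?p. \<forall>j<?q. degree (N $$ (i,j)) \<le> vs ! j"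
    and o1: "N\<^sup>T * L = 0\<^sub>m ?q ?r" and o2: "(col_reversal ((!) vs) N)\<^sup>T * col_reversal ((!) ks) L = 0\<^sub>m ?q ?r"
    and Y: "Y \<in> carrier_mat ?r ?p" "Y * L = 1\<^sub>m ?r" and X: "X \<in> carrier_mat ?q ?p" "X * N = 1\<^sub>m ?q"
    and Y': "Y' \<in> carrier_mat ?r ?p" "Y' * col_reversal ((!) ks) L = 1\<^sub>m ?r"
    and X': "X' \<in> carrier_mat ?q ?p" "X' * col_reversal ((!) vs) N = 1\<^sub>m ?q" unfolding \<Phi>_def by simp_all
  have smult1: "(1 :: 'a poly) \<cdot>\<^sub>m 1\<^sub>m n = 1\<^sub>m n" for n by (intro eq_matI) auto
  have mL: "minimal_basis_mat ?p (rational_span L) ks L"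
    by (rule minimal_basis_matI[OF L Y Y'(1), where q = 1]) (use Y'(2) degL in \<open>auto simp: smult1\<close>)
  have mN: "minimal_basis_mat ?p (rational_span N) vs N"
    by (rule minimal_basis_matI[OF N X X'(1), where q = 1]) (use X'(2) degN in \<open>auto simp: smult1\<close>)
  have c1: "completable ?p ?r L" by (rule completableI[OF L N refl Y X o1])
  have c2: "completable ?p ?r (col_reversal ((!) ks) L)"
    by (rule completableI[OF _ _ refl Y' X' o2]) (use L N in auto)
  have span: "rational_span N = mat_kernel (fract_mat L)\<^sup>T"
  proof
    have LN: "L\<^sup>T * N = 0\<^sub>m ?r ?q" using transpose_mult[of "N\<^sup>T" ?q ?p L ?r] o1 N L by simp
    have fLN: "(fract_mat L)\<^sup>T * fract_mat N = 0\<^sub>m ?r ?q"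
      using fract_mat_mult[of "L\<^sup>T" ?r ?p N ?q] L N LN by simp
    have fL: "(fract_mat L)\<^sup>T \<in> carrier_mat ?r ?p" using L by simp
    show "rational_span N \<subseteq> mat_kernel (fract_mat L)\<^sup>T"
    proof
      fix y assume "y \<in> rational_span N"
      then obtain x where x: "x \<in> carrier_vec ?q" "y = fract_mat N *\<^sub>v x" unfolding rational_span_def using N by auto
      have "(fract_mat L)\<^sup>T *\<^sub>v y = ((fract_mat L)\<^sup>T * fract_mat N) *\<^sub>v x"
        unfolding x(2) by (rule assoc_mult_mat_vec[symmetric]) (use L N x in auto)
      also have "\<dots> = 0\<^sub>v ?r" unfolding fLN using x by (intro eq_vecI) auto
      finally show "y \<in> mat_kernel (fract_mat L)\<^sup>T" using x N by (intro mat_kernelI[OF fL]) auto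
    qed
    show "mat_kernel (fract_mat L)\<^sup>T \<subseteq> rational_span N"
    proof
      fix y assume "y \<in> mat_kernel (fract_mat L)\<^sup>T"
      then have y: "y \<in> carrier_vec ?p" "(fract_mat L)\<^sup>T *\<^sub>v y = 0\<^sub>v ?r" using mat_kernelD[OF fL] by auto
      \<comment> \<open>Subtracting its projection to the span of \<open>N\<close> from \<open>y\<close> leaves a vector that is annihilated by both
        \<open>L\<^sup>T\<close> and \<open>X\<close>, hence zero.\<close>
      define z where "z = fract_mat X *\<^sub>v y"
      have zc: "z \<in> carrier_vec ?q" unfolding z_def using X y by simp
      define w where "w = y - fract_mat N *\<^sub>v z"
      have w: "w \<in> carrier_vec ?p" unfolding w_def using y N zc by simp
      have Lw: "(fract_mat L)\<^sup>T *\<^sub>v w = 0\<^sub>v ?r"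
      proof -
        have "(fract_mat L)\<^sup>T *\<^sub>v w = (fract_mat L)\<^sup>T *\<^sub>v y - (fract_mat L)\<^sup>T *\<^sub>v (fract_mat N *\<^sub>v z)"
          unfolding w_def by (rule mult_minus_distrib_mat_vec[OF fL y(1)]) (use N zc in simp)
        also have "(fract_mat L)\<^sup>T *\<^sub>v (fract_mat N *\<^sub>v z) = ((fract_mat L)\<^sup>T * fract_mat N) *\<^sub>v z"
          by (rule assoc_mult_mat_vec[symmetric]) (use L N zc in auto)
        also have "\<dots> = 0\<^sub>v ?r" unfolding fLN using zc by (intro eq_vecI) auto
        finally show ?thesis using y by simp
      qed
      have Xw: "fract_mat X *\<^sub>v w = 0\<^sub>v ?q"
      proof -
        have "fract_mat X *\<^sub>v w = fract_mat X *\<^sub>v y - fract_mat X *\<^sub>v (fract_mat N *\<^sub>v z)"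
          unfolding w_def by (rule mult_minus_distrib_mat_vec[of _ ?q ?p]) (use X y N zc in auto)
        also have "fract_mat X *\<^sub>v (fract_mat N *\<^sub>v z) = (fract_mat X * fract_mat N) *\<^sub>v z"
          by (rule assoc_mult_mat_vec[symmetric]) (use X N zc in auto)
        also have "\<dots> = z" unfolding fract_mat_mult[OF X(1) N, symmetric] X(2) using zc by simp
        finally show ?thesis unfolding z_def using X y by simp
      qed
      define P where "P = four_block_mat L X\<^sup>T (0\<^sub>m 0 ?r) (0\<^sub>m 0 ?q)"
      have P: "P \<in> carrier_mat ?p ?p" unfolding P_def using L X four_block_carrier_mat[of L ?p ?r "0\<^sub>m 0 ?q" 0 ?q] by simp
      have "det P \<noteq> 0"
      proof -
        define Q where "Q = four_block_mat Y (0\<^sub>m ?r 0) N\<^sup>T (0\<^sub>m ?q 0)"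
        have Q: "Q \<in> carrier_mat ?p ?p" unfolding Q_def using Y N four_block_carrier_mat[of Y ?r ?p "0\<^sub>m ?q 0" ?q 0] by simp
        have NX: "N\<^sup>T * X\<^sup>T = 1\<^sub>m ?q" using transpose_mult[OF X(1) N] X(2) by simp
        have "Q * P = four_block_mat (1\<^sub>m ?r) (Y * X\<^sup>T) (0\<^sub>m ?q ?r) (1\<^sub>m ?q)"
          unfolding Q_def P_def
          by (subst mult_four_block_mat[of _ ?r ?p _ 0 _ ?q _ _ ?r _ ?q]) (use L N X Y NX o1 in auto)
        moreover have "det (four_block_mat (1\<^sub>m ?r) (Y * X\<^sup>T) (0\<^sub>m ?q ?r) (1\<^sub>m ?q)) = det (1\<^sub>m ?r :: 'a poly mat) * det (1\<^sub>m ?q :: 'a poly mat)"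
          by (rule det_four_block_mat_lower_left_zero) (use X Y in auto)
        ultimately have "det Q * det P = 1" using det_mult[OF Q P] by simp
        then show ?thesis by auto
      qed
      then have dP: "det (fract_mat P)\<^sup>T \<noteq> 0"
        using P det_transpose[of "fract_mat P" ?p] by (simp add: fract_mat_def)
      have "(fract_mat P)\<^sup>T *\<^sub>v w = 0\<^sub>v ?p"
      proof (rule eq_vecI)
        fix i assume "i < dim_vec (0\<^sub>v ?p :: 'a poly fract vec)"
        then have i: "i < ?p" by simp
        have c: "col P i = (if i < ?r then col L i else col X\<^sup>T (i - ?r))"
          unfolding P_def using i L X by (intro eq_vecI) auto
        have cf: "col (fract_mat M) j = fract_vec (col M j)" if "M \<in> carrier_mat ?p s" "j < s" for M :: "'a poly mat" and s j
          using that by (intro eq_vecI) (auto simp: fract_mat_def fract_vec_def)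
        have "((fract_mat P)\<^sup>T *\<^sub>v w) $ i = fract_vec (col P i) \<bullet> w" using i P cf[OF P i] by simp
        also have "\<dots> = (if i < ?r then ((fract_mat L)\<^sup>T *\<^sub>v w) $ i else (fract_mat X *\<^sub>v w) $ (i - ?r))"
        proof (cases "i < ?r")
          case True
          then show ?thesis unfolding c using cf[OF L True] L by simp
        next
          case False
          then have "i - ?r < ?q" using i by simp
          then show ?thesis unfolding c using False cf[of "X\<^sup>T" ?q "i - ?r"] X by simp
        qed
        finally show "((fract_mat P)\<^sup>T *\<^sub>v w) $ i = 0\<^sub>v ?p $ i" unfolding Lw Xw using i by simp
      qed (use P in simp)
      then have "w = 0\<^sub>v ?p" using det_0_iff_vec_prod_zero[of "(fract_mat P)\<^sup>T" ?p] dP P w by auto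
      then have "y = fract_mat N *\<^sub>v z"
        unfolding w_def using y(1) N by (intro eq_vecI) (auto simp: vec_eq_iff)
      then show "y \<in> rational_span N" unfolding rational_span_def using zc N by auto
    qed
  qed
  show thesis using that[OF c1 c2 degL mL] mN unfolding span by blast
qed

section \<open>Products with completable factors\<close>

lemma corner_one_dim [simp]: "dim_row (corner_one p r) = p" "dim_col (corner_one p r) = r"
  unfolding corner_one_def by simp_all

text \<open>A left inverse of \<open>R\<close> and the nonsingularity of \<open>E\<close> recover the span of \<open>L\<close> from the product.\<close>

lemma product_rational_span:
  fixes E :: "'a::field poly mat"
  assumes L: "completable m r L" and R: "completable n r R" and rm: "r \<le> m" "r \<le> n"
    and E: "E \<in> carrier_mat r r" "det E \<noteq> 0"
  shows "basis_mat m r (rational_span (L * E * R\<^sup>T)) L" "rational_span (L * E * R\<^sup>T) = rational_span L"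
proof -
  have Lc: "L \<in> carrier_mat m r" and Rc: "R \<in> carrier_mat n r" using L R unfolding completable_def by auto
  obtain Y where Y: "Y \<in> carrier_mat r m" "Y * L = 1\<^sub>m r" using completable_left_inverse[OF L rm(1)] by blast
  obtain Y' where Y': "Y' \<in> carrier_mat r n" "Y' * R = 1\<^sub>m r" using completable_left_inverse[OF R rm(2)] by blast
  have bL: "basis_mat m r (rational_span L) L" unfolding basis_mat_def using Lc full_col_rank_left_inverse[OF Lc Y] by simp
  have "1 \<cdot>\<^sub>m (L * E) = L * E" by (intro eq_matI) auto
  then have "basis_mat m r (rational_span L) (L * E)"
    by (intro basis_mat_transform[OF bL _ E(1,2), where q = 1]) (use Lc E in auto)
  then have s: "rational_span (L * E) = rational_span L" unfolding basis_mat_def by simp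
  have "R\<^sup>T * Y'\<^sup>T = 1\<^sub>m r" using transpose_mult[OF Y'(1) Rc] Y'(2) by simp
  then have LE: "L * E * R\<^sup>T * Y'\<^sup>T = L * E"
    using Lc E(1) Rc Y'(1) by (simp add: mult_mat_assoc_dim del: assoc_mult_mat)
  have "rational_span (L * E * R\<^sup>T * Y'\<^sup>T) \<subseteq> rational_span (L * E * R\<^sup>T)"
    by (rule rational_span_mult_subset) (use Lc E(1) Rc Y'(1) in auto)
  then have "rational_span (L * E) \<subseteq> rational_span (L * E * R\<^sup>T)" by (simp only: LE)
  moreover have "L * E * R\<^sup>T = L * (E * R\<^sup>T)" by (rule assoc_mult_mat) (use Lc E Rc in auto)
  then have "rational_span (L * E * R\<^sup>T) \<subseteq> rational_span L"
    using rational_span_mult_subset[OF Lc, of "E * R\<^sup>T" n] E(1) Rc by simp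
  ultimately show eq: "rational_span (L * E * R\<^sup>T) = rational_span L" using s by auto
  show "basis_mat m r (rational_span (L * E * R\<^sup>T)) L" unfolding eq by (rule bL)
qed

lemma mult_mat_regroup:
  fixes A :: "'a::semiring_0 mat"
  assumes "X \<in> carrier_mat m m" "Q \<in> carrier_mat m m" "A \<in> carrier_mat m n" "Q' \<in> carrier_mat n n" "V \<in> carrier_mat n n"
  shows "(X * Q) * A * (Q' * V) = X * (Q * A * Q') * V"
  using assms by (simp add: mult_mat_assoc_dim del: assoc_mult_mat)

text \<open>The completions of \<open>L\<close> and \<open>R\<close> are unimodular and bring the product to \<open>E\<close> bordered by zeros.\<close>

lemma product_invariant_factors:
  fixes E :: "'a::field poly mat"
  assumes L: "completable m r L" and R: "completable n r R" and rm: "r \<le> m" "r \<le> n"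
    and eq: "unimodular_equivalent r r E (mat_diag r ((!) \<gamma>))"
    and len: "length \<gamma> = r" and monic: "\<forall>a\<in>set \<gamma>. lead_coeff a = 1"
    and chain: "\<forall>i. Suc i < r \<longrightarrow> \<gamma> ! i dvd \<gamma> ! Suc i"
  shows "has_invariant_factors (L * E * R\<^sup>T) \<gamma>" "poly_mat_rank (L * E * R\<^sup>T) = r" "det E \<noteq> 0"
proof -
  let ?A = "L * E * R\<^sup>T"
  have Lc: "L \<in> carrier_mat m r" and Rc: "R \<in> carrier_mat n r" using L R unfolding completable_def by auto
  have E: "E \<in> carrier_mat r r" using unimodular_equivalent_carrier[OF eq] by auto
  have A: "?A \<in> carrier_mat m n" using Lc E Rc by auto
  obtain U V where UV: "unimodular r U" "unimodular r V" "U * E * V = mat_diag r ((!) \<gamma>)"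
    using eq unfolding unimodular_equivalent_def by blast
  note car = UV(1,2)[THEN unimodular_carrier]
  have "det (mat_diag r ((!) \<gamma>)) = (\<Prod>i<r. \<gamma> ! i)"
    by (subst det_upper_triangular[of _ r]) (auto simp: mat_diag_def prod_list_diag_prod atLeast0LessThan)
  moreover have "det (U * E * V) = det U * det E * det V"
    using det_mult[OF mult_carrier_mat[OF car(1) E] car(2)] det_mult[OF car(1) E] by simp
  ultimately show dE: "det E \<noteq> 0" using prod_monic(1)[OF monic, of r] len UV(3) by auto
  show rank: "poly_mat_rank ?A = r"
    by (rule poly_mat_rank_eq[OF A product_rational_span(1)[OF L R rm E dE]])
  obtain Q where Q: "unimodular m Q" "Q * L = corner_one m r" using L unfolding completable_def by blast
  obtain Q' where Q': "unimodular n Q'" "Q' * R = corner_one n r" using R unfolding completable_def by blast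
  note carQ = Q(1)[THEN unimodular_carrier] Q'(1)[THEN unimodular_carrier]
  have "Q * ?A * Q'\<^sup>T = (Q * L) * E * (R\<^sup>T * Q'\<^sup>T)"
    using carQ Lc E Rc by (simp add: mult_mat_assoc_dim del: assoc_mult_mat)
  also have "R\<^sup>T * Q'\<^sup>T = (corner_one n r)\<^sup>T" using transpose_mult[OF carQ(2) Rc] Q'(2) by simp
  also have "(Q * L) * E * (corner_one n r)\<^sup>T = four_block_mat E (0\<^sub>m r (n - r)) (0\<^sub>m (m - r) r) (0\<^sub>m (m - r) (n - r))"
    unfolding Q(2)
  proof (rule eq_matI, goal_cases)
    case (1 a b)
    then have ab: "a < m" "b < n" using E rm by auto
    have "(corner_one m r * E * (corner_one n r)\<^sup>T) $$ (a,b) =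
       (\<Sum>i<r. \<Sum>j<r. corner_one m r $$ (a,i) * E $$ (i,j) * corner_one n r $$ (b,j))"
      by (rule mult_mat_index3) (use E ab in auto)
    also have "\<dots> = (\<Sum>i<r. \<Sum>j<r. if i = a then if j = b then E $$ (i,j) else 0 else 0)"
      using ab by (intro sum.cong) (auto simp: corner_one_def)
    also have "\<dots> = (\<Sum>i<r. if i = a then if b < r then E $$ (i,b) else 0 else 0)" by (intro sum.cong) auto
    also have "\<dots> = (if a < r \<and> b < r then E $$ (a,b) else 0)" by simp
    finally show ?case using ab E by auto
  qed (use E rm in auto)
  finally have B: "Q * ?A * Q'\<^sup>T = four_block_mat E (0\<^sub>m r (n - r)) (0\<^sub>m (m - r) r) (0\<^sub>m (m - r) (n - r))" .
  let ?U = "four_block_mat U (0\<^sub>m r (m - r)) (0\<^sub>m (m - r) r) (1\<^sub>m (m - r))"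
  let ?V = "four_block_mat V (0\<^sub>m r (n - r)) (0\<^sub>m (n - r) r) (1\<^sub>m (n - r))"
  have uU: "unimodular m ?U" using unimodular_four_block_diag[OF UV(1) unimodular_one[of "m - r"]] rm by simp
  have uV: "unimodular n ?V" using unimodular_four_block_diag[OF UV(2) unimodular_one[of "n - r"]] rm by simp
  have "?U * (Q * ?A * Q'\<^sup>T) = four_block_mat (U * E) (0\<^sub>m r (n - r)) (0\<^sub>m (m - r) r) (0\<^sub>m (m - r) (n - r))"
    unfolding B by (subst mult_four_block_mat[of _ r r _ "m - r" _ "m - r" _ _ r _ "n - r"]) (use car E in auto)
  then have "?U * (Q * ?A * Q'\<^sup>T) * ?V = four_block_mat (U * E * V) (0\<^sub>m r (n - r)) (0\<^sub>m (m - r) r) (0\<^sub>m (m - r) (n - r))"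
    by (simp only:, subst mult_four_block_mat[of _ r r _ "n - r" _ "m - r" _ _ r _ "n - r"]) (use car E in auto)
  also have "\<dots> = mat m n (\<lambda>(i,j). if i = j \<and> i < length \<gamma> then \<gamma> ! i else 0)"
    unfolding UV(3) by (intro eq_matI) (use rm len in \<open>auto simp: mat_diag_def\<close>)
  finally have "(?U * Q) * ?A * (Q'\<^sup>T * ?V) = mat m n (\<lambda>(i,j). if i = j \<and> i < length \<gamma> then \<gamma> ! i else 0)"
    unfolding mult_mat_regroup[OF unimodular_carrier[OF uU] carQ(1) A transpose_carrier_mat[THEN iffD2, OF carQ(2)] unimodular_carrier[OF uV]] .
  moreover have "unimodular m (?U * Q)" "unimodular n (Q'\<^sup>T * ?V)"
    using unimodular_mult[OF uU Q(1)] unimodular_mult[OF unimodular_transpose[OF Q'(1)] uV] by auto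
  ultimately have "\<exists>U V. unimodular m U \<and> unimodular n V \<and>
      U * ?A * V = mat m n (\<lambda>(i,j). if i = j \<and> i < length \<gamma> then \<gamma> ! i else 0)" by blast
  moreover have "dim_row ?A = m" "dim_col ?A = n" using Lc Rc by auto
  ultimately show "has_invariant_factors ?A \<gamma>"
    unfolding has_invariant_factors_def rank using len monic chain
    by (simp only: unimodular_iff_invertible_mat) blast
qed

text \<open>With nonzero determinant, the diagonal entries are nonzero and can be divided by their leading
  coefficients.\<close>

lemma monic_Smith_form_exists:
  fixes E :: "'a::field poly mat"
  assumes E: "E \<in> carrier_mat r r" and dE: "det E \<noteq> 0"
  obtains \<gamma> where "length \<gamma> = r" "\<forall>a\<in>set \<gamma>. lead_coeff a = 1" "\<forall>i. Suc i < r \<longrightarrow> \<gamma> ! i dvd \<gamma> ! Suc i"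
    "unimodular_equivalent r r E (mat_diag r ((!) \<gamma>))"
proof -
  have rd: "rect_diag r r \<gamma> = mat_diag r \<gamma>" for \<gamma> :: "nat \<Rightarrow> 'a poly" unfolding rect_diag_def mat_diag_def by (rule cong_mat) auto
  obtain \<delta> where d: "unimodular_equivalent r r E (mat_diag r \<delta>)" and ch: "\<forall>i. Suc i < r \<longrightarrow> \<delta> i dvd \<delta> (Suc i)"
    using Smith_form_exists[OF E] unfolding rd by auto
  obtain U V where UV: "unimodular r U" "unimodular r V" "U * mat_diag r \<delta> * V = E"
    using unimodular_equivalent_sym[OF d] unfolding unimodular_equivalent_def by blast
  note car = UV(1,2)[THEN unimodular_carrier]
  have "det (mat_diag r \<delta>) = (\<Prod>i<r. \<delta> i)"
    by (subst det_upper_triangular[of _ r]) (auto simp: mat_diag_def prod_list_diag_prod atLeast0LessThan)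
  then have "det E = det U * (\<Prod>i<r. \<delta> i) * det V"
    unfolding UV(3)[symmetric] using det_mult[OF mult_carrier_mat[OF car(1) mat_diag_dim] car(2)] det_mult[OF car(1) mat_diag_dim] by simp
  then have nz: "\<delta> i \<noteq> 0" if "i < r" for i using dE that by auto
  define e where "e i = [:inverse (lead_coeff (\<delta> i)):]" for i
  define \<gamma> where "\<gamma> = map (\<lambda>i. e i * \<delta> i) [0..<r]"
  have "unimodular r (mat_diag r e)"
  proof (rule unimodularI)
    show "mat_diag r e * mat_diag r (\<lambda>i. [:lead_coeff (\<delta> i):]) = 1\<^sub>m r"
      unfolding mat_diag_diag using nz by (auto simp: e_def mat_diag_def intro!: eq_matI)
  qed auto
  from unimodular_equivalent_left[OF mat_diag_dim this, of \<delta>]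
  have ed: "unimodular_equivalent r r (mat_diag r \<delta>) (mat_diag r (\<lambda>i. e i * \<delta> i))"
    unfolding mat_diag_diag .
  have "unimodular_equivalent r r (mat_diag r \<delta>) (mat_diag r ((!) \<gamma>))"
  proof -
    have "mat_diag r (\<lambda>i. e i * \<delta> i) = mat_diag r ((!) \<gamma>)"
      unfolding mat_diag_def by (rule cong_mat) (auto simp: \<gamma>_def)
    then show ?thesis using ed by simp
  qed
  then have "unimodular_equivalent r r E (mat_diag r ((!) \<gamma>))" using d unimodular_equivalent_trans by blast
  moreover have "\<forall>a\<in>set \<gamma>. lead_coeff a = 1" using nz by (auto simp: \<gamma>_def e_def)
  moreover have "\<forall>i. Suc i < r \<longrightarrow> \<gamma> ! i dvd \<gamma> ! Suc i" using ch nz by (auto simp: \<gamma>_def e_def smult_dvd_iff dvd_smult)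
  ultimately show thesis using that[of \<gamma>] by (simp add: \<gamma>_def)
qed

section \<open>Triangular matrices with prescribed Smith form and diagonal degrees\<close>

text \<open>Linear factors are split off one at a time. This is the main use of algebraic closedness: over other fields
  the degrees of the divisors of a polynomial can have gaps.\<close>

lemma divisor_of_degree:
  fixes w :: "'a::field poly"
  assumes ac: "\<And>p :: 'a poly. 0 < degree p \<Longrightarrow> \<exists>x. poly p x = 0"
    and "w \<noteq> 0" "n \<le> degree w"
  shows "\<exists>c. c dvd w \<and> degree c = n"
  using assms(2,3)
proof (induction n arbitrary: w)
  case 0
  then show ?case by (intro exI[of _ 1]) auto
next
  case (Suc n)
  obtain x where "poly w x = 0" using ac[of w] Suc.prems by auto
  then obtain v where v: "w = [:-x,1:] * v" by (meson dvdE poly_eq_0_iff_dvd)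
  have vn: "v \<noteq> 0" using v Suc.prems by auto
  have "degree w = Suc (degree v)" unfolding v using vn by (subst degree_mult_eq) auto
  then obtain c where c: "c dvd v" "degree c = n" using Suc.IH[OF vn] Suc.prems by auto
  have "c \<noteq> 0" using c vn by auto
  then have "degree ([:-x,1:] * c) = Suc n" using c by (subst degree_mult_eq) auto
  moreover have "[:-x,1:] * c dvd w" unfolding v by (rule mult_dvd_mono) (use c in auto)
  ultimately show ?case by blast
qed

text \<open>Division with remainder by the diagonal entries, from the last row upwards, since column \<open>j\<close> of \<open>T\<close> only
  affects the rows up to \<open>j\<close>.\<close>

lemma reduce_modulo_triangular:
  fixes T :: "'a::field poly mat" and x :: "nat \<Rightarrow> 'a poly"
  assumes low: "\<And>i j. i < r \<Longrightarrow> j < i \<Longrightarrow> T $$ (i,j) = 0" and nz: "\<And>i. i < r \<Longrightarrow> T $$ (i,i) \<noteq> 0"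
  shows "\<exists>z. \<forall>i<r. x i + (\<Sum>j<r. T $$ (i,j) * z j) = 0 \<or>
      degree (x i + (\<Sum>j<r. T $$ (i,j) * z j)) < degree (T $$ (i,i))"
proof -
  have "\<exists>z. (\<forall>j<r - t. z j = 0) \<and> (\<forall>i<r. r - t \<le> i \<longrightarrow> x i + (\<Sum>j<r. T $$ (i,j) * z j) = 0 \<or>
      degree (x i + (\<Sum>j<r. T $$ (i,j) * z j)) < degree (T $$ (i,i)))" if "t \<le> r" for t
    using that
  proof (induction t)
    case 0
    then show ?case by (intro exI[of _ "\<lambda>_. 0"]) auto
  next
    case (Suc t)
    then obtain z where z: "\<forall>j<r - t. z j = 0" "\<forall>i<r. r - t \<le> i \<longrightarrow> x i + (\<Sum>j<r. T $$ (i,j) * z j) = 0 \<or>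
      degree (x i + (\<Sum>j<r. T $$ (i,j) * z j)) < degree (T $$ (i,i))" by auto
    define s where "s = r - Suc t"
    have s: "s < r" "s < r - t" "\<And>i. s < i \<Longrightarrow> r - t \<le> i" using Suc.prems by (auto simp: s_def)
    define y where "y = x s + (\<Sum>j<r. T $$ (s,j) * z j)"
    define z' where "z' = z(s := - (y div T $$ (s,s)))"
    have sum: "(\<Sum>j<r. T $$ (i,j) * z' j) = (\<Sum>j<r. T $$ (i,j) * z j) - T $$ (i,s) * (y div T $$ (s,s))" if "i < r" for i
    proof -
      have "(\<Sum>j<r. T $$ (i,j) * z' j) = (\<Sum>j<r. T $$ (i,j) * z j + (if j = s then - (T $$ (i,s) * (y div T $$ (s,s))) else 0))"
        using z(1) s by (intro sum.cong) (auto simp: z'_def)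
      then show ?thesis using s by (simp add: sum.distrib)
    qed
    have "x i + (\<Sum>j<r. T $$ (i,j) * z' j) = 0 \<or> degree (x i + (\<Sum>j<r. T $$ (i,j) * z' j)) < degree (T $$ (i,i))"
      if i: "i < r" "s \<le> i" for i
    proof (cases "i = s")
      case True
      have "x s + (\<Sum>j<r. T $$ (s,j) * z' j) = y mod T $$ (s,s)"
        unfolding sum[OF s(1)] y_def by (simp add: minus_mult_div_eq_mod[symmetric] algebra_simps)
      then show ?thesis unfolding True using degree_mod_less[OF nz[OF s(1)], of y] by simp
    next
      case False
      then have "T $$ (i,s) = 0" using low i by simp
      then show ?thesis using z(2) i False s sum[OF i(1)] by simp
    qed
    moreover have "\<forall>j<r - Suc t. z' j = 0" using z(1) by (auto simp: z'_def s_def)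
    ultimately show ?case unfolding s_def by (intro exI[of _ z']) auto
  qed
  from this[of r] show ?thesis by auto
qed

lemma unimodular_selection:
  fixes \<rho> :: "nat \<Rightarrow> nat"
  assumes "inj_on \<rho> {..<n}" "\<And>a. a < n \<Longrightarrow> \<rho> a < n"
  shows "unimodular n (mat n n (\<lambda>(a,i). if i = \<rho> a then 1 else 0) :: 'a::comm_ring_1 mat)"
proof (rule unimodularI)
  let ?P = "mat n n (\<lambda>(a,i). if i = \<rho> a then 1 else 0) :: 'a mat"
  show "?P * ?P\<^sup>T = 1\<^sub>m n"
  proof (rule eq_matI, goal_cases)
    case (1 a b)
    then have ab: "a < n" "b < n" by auto
    have "(?P * ?P\<^sup>T) $$ (a,b) = (\<Sum>i<n. (if i = \<rho> a then 1 else 0) * (if i = \<rho> b then 1 else 0))"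
      using ab by (simp add: scalar_prod_def atLeast0LessThan)
    also have "\<dots> = (\<Sum>i<n. if i = \<rho> a then if \<rho> a = \<rho> b then 1 else 0 else 0)" by (intro sum.cong) auto
    also have "\<dots> = (if a = b then 1 else 0)" using assms ab by (auto simp: inj_on_def)
    finally show ?case using ab by simp
  qed auto
qed auto

lemma unimodular_equivalent_selection:
  fixes M :: "'a::comm_ring_1 mat"
  assumes M: "M \<in> carrier_mat n n" and "inj_on \<rho> {..<n}" "\<And>a. a < n \<Longrightarrow> \<rho> a < n"
    and "inj_on \<kappa> {..<n}" "\<And>a. a < n \<Longrightarrow> \<kappa> a < n"
  shows "unimodular_equivalent n n M (minor_mat n \<rho> \<kappa> M)"
  by (rule unimodular_equivalentI[OF M unimodular_selection[of \<rho>] unimodular_transpose[OF unimodular_selection[of \<kappa>]]])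
     (use assms in \<open>auto simp: minor_mat_sandwich[OF M]\<close>)

text \<open>The diagonal entries \<open>\<alpha> i\<close> and \<open>\<alpha> (Suc i) = \<alpha> i * w * b\<close> are traded for \<open>\<gamma> = \<alpha> i * w\<close> in position \<open>i\<close> and
  \<open>\<alpha> i * b\<close> in the last position, the latter up to sign, with the off-diagonal entry \<open>\<alpha> i\<close> restoring the first
  invariant factor of the pair. The degrees of the traded entries are intermediate with the same sum.\<close>

lemma trade_diagonal_entries:
  fixes \<alpha> :: "nat \<Rightarrow> 'a::field poly"
  assumes i: "i < r" and g: "\<gamma> = \<alpha> i * w" and a: "\<alpha> (Suc i) = \<gamma> * b"
  shows "unimodular_equivalent (Suc r) (Suc r)
     (four_block_mat (mat_diag r (\<lambda>x. if x < i then \<alpha> x else if x = i then \<gamma> else \<alpha> (Suc x)))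
        (mat r 1 (\<lambda>(x,_). if x = i then \<alpha> i else 0)) (0\<^sub>m 1 r) (mat 1 1 (\<lambda>_. - (\<alpha> i * b))))
     (mat_diag (Suc r) \<alpha>)"
proof -
  let ?\<alpha> = "\<lambda>x. if x < i then \<alpha> x else if x = i then \<gamma> else \<alpha> (Suc x)"
  let ?y = "mat r 1 (\<lambda>(x,_). if x = i then \<alpha> i else 0)" and ?e = "mat 1 1 (\<lambda>_. - (\<alpha> i * b))"
  let ?C = "mat 1 r (\<lambda>(_,x). if x = i then - w else 0)" and ?B = "mat 1 r (\<lambda>(_,x). if x = i then b else 0)"
  let ?M = "four_block_mat (mat_diag r ?\<alpha>) ?y (0\<^sub>m 1 r) ?e"
  let ?V = "four_block_mat (1\<^sub>m r) (0\<^sub>m r 1) ?C (1\<^sub>m 1)" and ?U = "four_block_mat (1\<^sub>m r) (0\<^sub>m r 1) ?B (1\<^sub>m 1)"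
  let ?D = "mat_diag r (\<lambda>x. if x = i then 0 else ?\<alpha> x)"
  let ?C' = "mat 1 r (\<lambda>(_,x). if x = i then \<alpha> (Suc i) else 0)"
  let ?N = "four_block_mat ?D ?y ?C' (0\<^sub>m 1 1)"
  have uV: "unimodular (Suc r) ?V" using unimodular_block_lower[of ?C 1 r] by simp
  have uU: "unimodular (Suc r) ?U" using unimodular_block_lower[of ?B 1 r] by simp
  have "?M \<in> carrier_mat (r + 1) (r + 1)" by (rule four_block_carrier_mat[OF mat_diag_dim]) simp
  then have M: "?M \<in> carrier_mat (Suc r) (Suc r)" by simp
  have "?N \<in> carrier_mat (r + 1) (r + 1)" by (rule four_block_carrier_mat[OF mat_diag_dim]) simp
  then have N: "?N \<in> carrier_mat (Suc r) (Suc r)" by simp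
  have yC: "mat_diag r ?\<alpha> + ?y * ?C = ?D"
    by (intro eq_matI) (auto simp: mat_diag_def scalar_prod_def g)
  have eC: "?e * ?C = ?C'" by (intro eq_matI) (auto simp: scalar_prod_def a g mult_ac)
  have MV: "?M * ?V = four_block_mat ?D ?y ?C' ?e"
  proof -
    have "?M * ?V = four_block_mat (mat_diag r ?\<alpha> * 1\<^sub>m r + ?y * ?C) (mat_diag r ?\<alpha> * 0\<^sub>m r 1 + ?y * 1\<^sub>m 1)
        (0\<^sub>m 1 r * 1\<^sub>m r + ?e * ?C) (0\<^sub>m 1 r * 0\<^sub>m r 1 + ?e * 1\<^sub>m 1)"
      by (rule mult_four_block_mat[of _ r r _ 1 _ 1 _ _ r _ 1]) (auto simp: mat_diag_dim)
    also have "mat_diag r ?\<alpha> * 1\<^sub>m r + ?y * ?C = ?D" using yC right_mult_one_mat[OF mat_diag_dim, of r ?\<alpha>] by simp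
    also have "mat_diag r ?\<alpha> * 0\<^sub>m r 1 + ?y * 1\<^sub>m 1 = ?y"
      using right_mult_zero_mat[OF mat_diag_dim, of r ?\<alpha> 1] by (intro eq_matI) auto
    also have "0\<^sub>m 1 r * 1\<^sub>m r + ?e * ?C = ?C'" using eC by (intro eq_matI) auto
    also have "0\<^sub>m 1 r * 0\<^sub>m r 1 + ?e * 1\<^sub>m 1 = ?e" by (intro eq_matI) auto
    finally show ?thesis .
  qed
  have BD: "?B * ?D = 0\<^sub>m 1 r" by (intro eq_matI) (auto simp: scalar_prod_def mat_diag_def intro!: sum.neutral)
  have By: "?B * ?y = mat 1 1 (\<lambda>_. \<alpha> i * b)"
  proof (rule eq_matI, goal_cases)
    case (1 x y)
    have "(?B * ?y) $$ (x,y) = (\<Sum>a<r. (if a = i then b else 0) * (if a = i then \<alpha> i else 0))"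
      using 1 by (simp add: scalar_prod_def atLeast0LessThan)
    also have "\<dots> = (\<Sum>a<r. if a = i then b * \<alpha> i else 0)" by (intro sum.cong) auto
    finally show ?case using 1 i by (simp add: mult.commute)
  qed auto
  have "?U * (?M * ?V) = ?N"
  proof -
    have "?U * (?M * ?V) = four_block_mat (1\<^sub>m r * ?D + 0\<^sub>m r 1 * ?C') (1\<^sub>m r * ?y + 0\<^sub>m r 1 * ?e)
        (?B * ?D + 1\<^sub>m 1 * ?C') (?B * ?y + 1\<^sub>m 1 * ?e)"
      unfolding MV by (rule mult_four_block_mat[of _ r r _ 1 _ 1 _ _ r _ 1]) (auto simp: mat_diag_dim)
    also have "1\<^sub>m r * ?D + 0\<^sub>m r 1 * ?C' = ?D" using left_mult_one_mat[of ?D r r] by (intro eq_matI) auto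
    also have "1\<^sub>m r * ?y + 0\<^sub>m r 1 * ?e = ?y" by (intro eq_matI) auto
    also have "?B * ?D + 1\<^sub>m 1 * ?C' = ?C'" unfolding BD by (intro eq_matI) auto
    also have "?B * ?y + 1\<^sub>m 1 * ?e = 0\<^sub>m 1 1" unfolding By by (intro eq_matI) auto
    finally show ?thesis .
  qed
  then have "?U * ?M * ?V = ?N"
    using assoc_mult_mat[OF unimodular_carrier[OF uU] M unimodular_carrier[OF uV]] by simp
  then have 1: "unimodular_equivalent (Suc r) (Suc r) ?M ?N" using unimodular_equivalentI[OF M uU uV] by blast
  define \<rho> where "\<rho> t = (if t \<le> i then t else if t = Suc i then r else t - 1)" for t
  define \<kappa> where "\<kappa> t = (if t < i then t else if t = i then r else t - 1)" for t
  have inj: "inj_on \<rho> {..<Suc r}" "inj_on \<kappa> {..<Suc r}"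
    using i by (auto simp: inj_on_def \<rho>_def \<kappa>_def split: if_splits)
  have lt: "\<rho> t < Suc r" "\<kappa> t < Suc r" if "t < Suc r" for t using that i by (auto simp: \<rho>_def \<kappa>_def)
  have "minor_mat (Suc r) \<rho> \<kappa> ?N = mat_diag (Suc r) \<alpha>"
  proof (rule eq_matI, goal_cases)
    case (1 s t)
    then have st: "s < Suc r" "t < Suc r" by (auto simp: mat_diag_def)
    have e: "?N $$ (x, y) = (if x < r then if y < r then if x = y \<and> x \<noteq> i then if x < i then \<alpha> x else \<alpha> (Suc x) else 0
        else if x = i then \<alpha> i else 0 else if y < r \<and> y = i then \<alpha> (Suc i) else 0)" if "x < Suc r" "y < Suc r" for x y
      using that by (auto simp: mat_diag_def)
    define x y where "x = \<rho> s" and "y = \<kappa> t"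
    have xy: "x < Suc r" "y < Suc r" using lt st by (auto simp: x_def y_def)
    have "s < i \<or> s = i \<or> s = Suc i \<or> (\<exists>s'. s = Suc s' \<and> i < s')" by (cases s) auto
    then have S: "s < i \<and> x = s \<or> s = i \<and> x = i \<or> s = Suc i \<and> x = r \<or> (\<exists>s'. s = Suc s' \<and> i < s' \<and> x = s')"
      unfolding x_def \<rho>_def by auto
    have "t < i \<or> t = i \<or> t = Suc i \<or> (\<exists>t'. t = Suc t' \<and> i < t')" by (cases t) auto
    then have T: "t < i \<and> y = t \<or> t = i \<and> y = r \<or> t = Suc i \<and> y = i \<or> (\<exists>t'. t = Suc t' \<and> i < t' \<and> y = t')"
      unfolding y_def \<kappa>_def by auto
    have "?N $$ (x, y) = (if s = t then \<alpha> s else 0)"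
      unfolding e[OF xy] using S
    proof (elim disjE conjE exE, goal_cases)
      case 1 then show ?case using T st i by (elim disjE conjE exE) simp_all
    next
      case 2 then show ?case using T st i by (elim disjE conjE exE) simp_all
    next
      case 3 then show ?case using T st i by (elim disjE conjE exE) simp_all
    next
      case (4 s') then show ?case using T st i by (elim disjE conjE exE) simp_all
    qed
    then have "?N $$ (\<rho> s, \<kappa> t) = (if s = t then \<alpha> s else 0)" unfolding x_def y_def .
    then show ?case using st unfolding minor_mat_def by (simp add: mat_diag_def)
  qed (auto simp: minor_mat_def mat_diag_def)
  then have "unimodular_equivalent (Suc r) (Suc r) ?N (mat_diag (Suc r) \<alpha>)"
    using unimodular_equivalent_selection[OF N inj(1) lt(1) inj(2) lt(2)] by simp
  then show ?thesis using 1 unimodular_equivalent_trans by blast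
qed

text \<open>Induction on \<open>r\<close>. The last prescribed degree \<open>\<delta> r\<close> lies between the degrees of two consecutive invariant
  factors \<open>\<alpha> i\<close> and \<open>\<alpha> (Suc i)\<close>. These are traded for an entry of degree \<open>\<delta> r\<close>, which becomes the last
  diagonal entry, and for one \<open>\<gamma>\<close> that fits between them in the divisibility chain. The shorter chain still
  satisfies the inequalities: for sets of at most \<open>i\<close> elements nothing has changed, and for larger sets the
  inequality for \<open>insert r S\<close> applies. Finally the new column is reduced modulo the diagonal entries, which
  gives the bounds on the entries above the diagonal.\<close>

lemma triangular_form_exists:
  fixes \<alpha> :: "nat \<Rightarrow> 'a::field poly" and \<delta> :: "nat \<Rightarrow> nat"
  assumes ac: "\<And>p :: 'a poly. 0 < degree p \<Longrightarrow> \<exists>x. poly p x = 0"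
    and "\<And>i. Suc i < r \<Longrightarrow> \<alpha> i dvd \<alpha> (Suc i)" "\<And>i. i < r \<Longrightarrow> \<alpha> i \<noteq> 0"
    and "\<And>S. S \<subseteq> {..<r} \<Longrightarrow> (\<Sum>i<card S. degree (\<alpha> i)) \<le> (\<Sum>i\<in>S. \<delta> i)"
    and "(\<Sum>i<r. degree (\<alpha> i)) = (\<Sum>i<r. \<delta> i)"
  shows "\<exists>T. unimodular_equivalent r r T (mat_diag r \<alpha>) \<and> (\<forall>i<r. T $$ (i,i) \<noteq> 0 \<and> degree (T $$ (i,i)) = \<delta> i) \<and>
     (\<forall>i<r. \<forall>j<i. T $$ (i,j) = 0) \<and> (\<forall>i<r. \<forall>j<r. i < j \<longrightarrow> T $$ (i,j) = 0 \<or> degree (T $$ (i,j)) < \<delta> i)"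
  using assms(2-)
proof (induction r arbitrary: \<alpha>)
  case 0
  show ?case by (rule exI[of _ "mat_diag 0 \<alpha>"]) (auto intro: unimodular_equivalent_refl)
next
  case (Suc r \<alpha>)
  note ch = Suc.prems(1) and nz = Suc.prems(2) and maj = Suc.prems(3) and tot = Suc.prems(4)
  show ?case
  proof (cases "r = 0")
    case True
    then show ?thesis using nz tot
      by (intro exI[of _ "mat_diag 1 \<alpha>"]) (auto intro: unimodular_equivalent_refl simp: mat_diag_def)
  next
    case False
    have lo: "degree (\<alpha> 0) \<le> \<delta> r" using maj[of "{r}"] by simp
    have hi: "\<delta> r \<le> degree (\<alpha> r)" using maj[of "{..<r}"] tot by simp
    define i where "i = Max {x. x < r \<and> degree (\<alpha> x) \<le> \<delta> r}"
    have ne: "{x. x < r \<and> degree (\<alpha> x) \<le> \<delta> r} \<noteq> {}" using lo False by auto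
    have "i \<in> {x. x < r \<and> degree (\<alpha> x) \<le> \<delta> r}" unfolding i_def using ne by (intro Max_in) auto
    then have i: "i < r" "degree (\<alpha> i) \<le> \<delta> r" by auto
    have i2: "\<delta> r \<le> degree (\<alpha> (Suc i))"
    proof (cases "Suc i < r")
      case True
      show ?thesis
      proof (rule ccontr)
        assume "\<not> ?thesis"
        then have "Suc i \<in> {x. x < r \<and> degree (\<alpha> x) \<le> \<delta> r}" using True by simp
        then have "Suc i \<le> Max {x. x < r \<and> degree (\<alpha> x) \<le> \<delta> r}" by (intro Max_ge) auto
        then show False unfolding i_def[symmetric] by simp
      qed
    next
      case False
      then have "Suc i = r" using i by simp
      then show ?thesis using hi by simp
    qed
    obtain w0 where w0: "\<alpha> (Suc i) = \<alpha> i * w0" using ch[of i] i by auto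
    have w0n: "w0 \<noteq> 0" using nz[of "Suc i"] w0 i by auto
    have dw0: "degree (\<alpha> (Suc i)) = degree (\<alpha> i) + degree w0" unfolding w0 using nz[of i] w0n i by (simp add: degree_mult_eq)
    have "degree (\<alpha> (Suc i)) - \<delta> r \<le> degree w0" using dw0 i by linarith
    from divisor_of_degree[OF ac w0n this]
    obtain w where w: "w dvd w0" "degree w = degree (\<alpha> (Suc i)) - \<delta> r" by blast
    obtain b where b: "w0 = w * b" using w by blast
    define \<gamma> where "\<gamma> = \<alpha> i * w"
    have g1: "\<alpha> (Suc i) = \<gamma> * b" unfolding w0 b \<gamma>_def by (simp add: mult.assoc)
    have wn: "w \<noteq> 0" "b \<noteq> 0" using b w0n by auto
    have gn: "\<gamma> \<noteq> 0" unfolding \<gamma>_def using wn nz[of i] i by simp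
    have dg: "degree \<gamma> + \<delta> r = degree (\<alpha> i) + degree (\<alpha> (Suc i))"
      unfolding \<gamma>_def using wn nz[of i] i w(2) i2 by (simp add: degree_mult_eq)
    have db: "degree (\<alpha> i * b) = \<delta> r"
    proof -
      have "degree (\<alpha> (Suc i)) = degree \<gamma> + degree b" unfolding g1 using gn wn by (simp add: degree_mult_eq)
      then show ?thesis using dg nz[of i] i wn by (simp add: degree_mult_eq)
    qed
    define \<alpha>' where "\<alpha>' x = (if x < i then \<alpha> x else if x = i then \<gamma> else \<alpha> (Suc x))" for x
    have ch': "\<alpha>' x dvd \<alpha>' (Suc x)" if "Suc x < r" for x
    proof -
      consider "Suc x < i" | "Suc x = i" | "x = i" | "i < x" by linarith
      then show ?thesis
      proof cases
        case 2
        then show ?thesis using ch[of x] that by (auto simp: \<alpha>'_def \<gamma>_def)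
      next
        case 3
        have "\<gamma> dvd \<alpha> (Suc i)" unfolding g1 by simp
        then show ?thesis using 3 ch[of "Suc i"] that dvd_trans by (auto simp: \<alpha>'_def)
      qed (use ch that in \<open>auto simp: \<alpha>'_def\<close>)
    qed
    have nz': "\<alpha>' x \<noteq> 0" if "x < r" for x using that nz gn by (auto simp: \<alpha>'_def)
    have s1: "(\<Sum>x<j. degree (\<alpha>' x)) = (\<Sum>x<j. degree (\<alpha> x))" if "j \<le> i" for j
      using that by (intro sum.cong) (auto simp: \<alpha>'_def)
    have s2: "(\<Sum>x<j. degree (\<alpha>' x)) + \<delta> r = (\<Sum>x<Suc j. degree (\<alpha> x))" if "Suc i \<le> j" for j
      using that
    proof (induction j rule: dec_induct)
      case base
      then show ?case using dg s1[of i] by (simp add: \<alpha>'_def)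
    next
      case (step j)
      then show ?case by (simp add: \<alpha>'_def)
    qed
    have maj': "(\<Sum>x<card S. degree (\<alpha>' x)) \<le> (\<Sum>x\<in>S. \<delta> x)" if S: "S \<subseteq> {..<r}" for S
    proof (cases "card S \<le> i")
      case True
      have "S \<subseteq> {..<Suc r}" using S by auto
      then show ?thesis using s1[OF True] maj[of S] by simp
    next
      case False
      have fin: "finite S" "r \<notin> S" using S finite_subset by auto
      have "(\<Sum>x<card (insert r S). degree (\<alpha> x)) \<le> (\<Sum>x\<in>insert r S. \<delta> x)" by (rule maj) (use S in auto)
      then have "(\<Sum>x<Suc (card S). degree (\<alpha> x)) \<le> \<delta> r + (\<Sum>x\<in>S. \<delta> x)" using fin by simp
      then show ?thesis using s2[of "card S"] False by simp
    qed
    have tot': "(\<Sum>x<r. degree (\<alpha>' x)) = (\<Sum>x<r. \<delta> x)" using s2[of r] i tot by simp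
    obtain T where T: "unimodular_equivalent r r T (mat_diag r \<alpha>')"
      and Td: "\<forall>i<r. T $$ (i,i) \<noteq> 0 \<and> degree (T $$ (i,i)) = \<delta> i" and Tl: "\<forall>i<r. \<forall>j<i. T $$ (i,j) = 0"
      and Tu: "\<forall>i<r. \<forall>j<r. i < j \<longrightarrow> T $$ (i,j) = 0 \<or> degree (T $$ (i,j)) < \<delta> i"
      using Suc.IH[OF ch' nz' maj' tot'] by blast
    have Tc: "T \<in> carrier_mat r r" using unimodular_equivalent_carrier[OF T] by auto
    obtain U V where UV: "unimodular r U" "unimodular r V" "U * T * V = mat_diag r \<alpha>'"
      using T unfolding unimodular_equivalent_def by blast
    obtain U' where U: "U \<in> carrier_mat r r" "U' \<in> carrier_mat r r" "U * U' = 1\<^sub>m r" using UV(1) unfolding unimodular_def by blast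
    have V: "V \<in> carrier_mat r r" using UV(2) unimodular_carrier by blast
    let ?y = "mat r 1 (\<lambda>(x,_). if x = i then \<alpha> i else 0)" and ?e = "mat 1 1 (\<lambda>_. - (\<alpha> i * b))"
    define x0 where "x0 = U' * ?y"
    have x0: "x0 \<in> carrier_mat r 1" unfolding x0_def using U by simp
    obtain z where z: "\<forall>i<r. x0 $$ (i,0) + (\<Sum>j<r. T $$ (i,j) * z j) = 0 \<or>
      degree (x0 $$ (i,0) + (\<Sum>j<r. T $$ (i,j) * z j)) < degree (T $$ (i,i))"
      using reduce_modulo_triangular[of r T "\<lambda>i. x0 $$ (i,0)"] Tl Td by blast
    define Z where "Z = mat r 1 (\<lambda>(j,_). z j)"
    define x1 where "x1 = x0 + T * Z"
    have Z: "Z \<in> carrier_mat r 1" and x1: "x1 \<in> carrier_mat r 1" unfolding Z_def x1_def using Tc by auto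
    have x1e: "x1 $$ (i,0) = x0 $$ (i,0) + (\<Sum>j<r. T $$ (i,j) * z j)" if "i < r" for i
      using that Tc x0 by (simp add: x1_def Z_def scalar_prod_def atLeast0LessThan)
    define T' where "T' = four_block_mat T x1 (0\<^sub>m 1 r) ?e"
    have T'c: "T' \<in> carrier_mat (Suc r) (Suc r)" unfolding T'_def using Tc by auto
    let ?T0 = "four_block_mat T x0 (0\<^sub>m 1 r) ?e" and ?M = "four_block_mat (mat_diag r \<alpha>') ?y (0\<^sub>m 1 r) ?e"
    have T0c: "?T0 \<in> carrier_mat (Suc r) (Suc r)" using Tc by auto
    let ?W = "four_block_mat (1\<^sub>m r) Z (0\<^sub>m 1 r) (1\<^sub>m 1)"
    have uW: "unimodular (Suc r) ?W" using unimodular_block_upper[of Z r 1] Z by simp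
    have TW: "?T0 * ?W = T'"
    proof -
      have "?T0 * ?W = four_block_mat (T * 1\<^sub>m r + x0 * 0\<^sub>m 1 r) (T * Z + x0 * 1\<^sub>m 1)
          (0\<^sub>m 1 r * 1\<^sub>m r + ?e * 0\<^sub>m 1 r) (0\<^sub>m 1 r * Z + ?e * 1\<^sub>m 1)"
        by (rule mult_four_block_mat[of _ r r _ 1 _ 1 _ _ r _ 1]) (use Tc x0 Z in auto)
      also have "T * 1\<^sub>m r + x0 * 0\<^sub>m 1 r = T" using Tc x0 by (intro eq_matI) auto
      also have "T * Z + x0 * 1\<^sub>m 1 = x1" unfolding x1_def right_mult_one_mat[OF x0] using x0 Tc Z by (intro comm_add_mat) auto
      also have "0\<^sub>m 1 r * 1\<^sub>m r + ?e * 0\<^sub>m 1 r = 0\<^sub>m 1 r" by (intro eq_matI) auto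
      also have "0\<^sub>m 1 r * Z + ?e * 1\<^sub>m 1 = ?e" using Z by (intro eq_matI) auto
      finally show ?thesis unfolding T'_def .
    qed
    have e1: "unimodular_equivalent (Suc r) (Suc r) ?T0 T'"
      using unimodular_equivalent_right[OF T0c uW] unfolding TW .
    let ?U = "four_block_mat U (0\<^sub>m r 1) (0\<^sub>m 1 r) (1\<^sub>m 1)" and ?V = "four_block_mat V (0\<^sub>m r 1) (0\<^sub>m 1 r) (1\<^sub>m 1)"
    have uU: "unimodular (Suc r) ?U" "unimodular (Suc r) ?V"
      using unimodular_four_block_diag[OF UV(1) unimodular_one[of 1]] unimodular_four_block_diag[OF UV(2) unimodular_one[of 1]] by auto
    have Ux0: "U * x0 = ?y" unfolding x0_def by (rule mult_inverse_cancel[OF U(3)]) (use U in auto)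
    have "?U * ?T0 = four_block_mat (U * T) ?y (0\<^sub>m 1 r) ?e"
    proof -
      have "?U * ?T0 = four_block_mat (U * T + 0\<^sub>m r 1 * 0\<^sub>m 1 r) (U * x0 + 0\<^sub>m r 1 * ?e)
          (0\<^sub>m 1 r * T + 1\<^sub>m 1 * 0\<^sub>m 1 r) (0\<^sub>m 1 r * x0 + 1\<^sub>m 1 * ?e)"
        by (rule mult_four_block_mat[of _ r r _ 1 _ 1 _ _ r _ 1]) (use Tc x0 U in auto)
      also have "U * T + 0\<^sub>m r 1 * 0\<^sub>m 1 r = U * T" using Tc U by (intro eq_matI) auto
      also have "U * x0 + 0\<^sub>m r 1 * ?e = ?y" unfolding Ux0 by (intro eq_matI) auto
      also have "0\<^sub>m 1 r * T + 1\<^sub>m 1 * 0\<^sub>m 1 r = 0\<^sub>m 1 r" using Tc by (intro eq_matI) auto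
      also have "0\<^sub>m 1 r * x0 + 1\<^sub>m 1 * ?e = ?e" using x0 by (intro eq_matI) auto
      finally show ?thesis .
    qed
    then have "?U * ?T0 * ?V = four_block_mat (U * T) ?y (0\<^sub>m 1 r) ?e * ?V" by simp
    also have "\<dots> = four_block_mat (U * T * V + ?y * 0\<^sub>m 1 r) (U * T * 0\<^sub>m r 1 + ?y * 1\<^sub>m 1)
          (0\<^sub>m 1 r * V + ?e * 0\<^sub>m 1 r) (0\<^sub>m 1 r * 0\<^sub>m r 1 + ?e * 1\<^sub>m 1)"
      by (rule mult_four_block_mat[of _ r r _ 1 _ 1 _ _ r _ 1]) (use Tc V U in auto)
    also have "U * T * V + ?y * 0\<^sub>m 1 r = mat_diag r \<alpha>'" unfolding UV(3) by (intro eq_matI) (auto simp: mat_diag_def)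
    also have "U * T * 0\<^sub>m r 1 + ?y * 1\<^sub>m 1 = ?y" using U Tc by (intro eq_matI) auto
    also have "0\<^sub>m 1 r * V + ?e * 0\<^sub>m 1 r = 0\<^sub>m 1 r" using V by (intro eq_matI) auto
    also have "0\<^sub>m 1 r * 0\<^sub>m r 1 + ?e * 1\<^sub>m 1 = ?e" by (intro eq_matI) auto
    finally have e2: "unimodular_equivalent (Suc r) (Suc r) ?T0 ?M"
      by (rule unimodular_equivalentI[OF T0c uU])
    have e3: "unimodular_equivalent (Suc r) (Suc r) ?M (mat_diag (Suc r) \<alpha>)"
      using trade_diagonal_entries[OF i(1) \<gamma>_def g1] unfolding \<alpha>'_def .
    have "unimodular_equivalent (Suc r) (Suc r) T' (mat_diag (Suc r) \<alpha>)"
      using unimodular_equivalent_trans[OF unimodular_equivalent_sym[OF e1] unimodular_equivalent_trans[OF e2 e3]] .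
    moreover have "T' $$ (j,j) \<noteq> 0 \<and> degree (T' $$ (j,j)) = \<delta> j" if "j < Suc r" for j
    proof (cases "j = r")
      case True
      then show ?thesis using Tc x1 db nz[of i] i wn by (simp add: T'_def)
    next
      case False
      then show ?thesis using that Td Tc x1 by (simp add: T'_def)
    qed
    moreover have "T' $$ (a,j) = 0" if "a < Suc r" "j < a" for a j
      using that Tl Tc x1 by (cases "a = r") (auto simp: T'_def)
    moreover have "T' $$ (a,j) = 0 \<or> degree (T' $$ (a,j)) < \<delta> a" if "a < Suc r" "j < Suc r" "a < j" for a j
    proof (cases "j = r")
      case True
      then have "T' $$ (a,j) = x1 $$ (a,0)" using that Tc x1 by (simp add: T'_def)
      then show ?thesis using x1e[of a] z Td True that by auto
    next
      case False
      then show ?thesis using that Tu Tc x1 by (simp add: T'_def)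
    qed
    ultimately show ?thesis by (intro exI[of _ T']) auto
  qed
qed

section \<open>Smith forms under a change of the projective coordinate\<close>

text \<open>Stronger in general than the absence of common divisors, and free of the assumption that greatest common
  divisors are given by an operation of the type.\<close>

definition comaximal :: "'a::comm_ring_1 \<Rightarrow> 'a \<Rightarrow> bool" where
  "comaximal a b \<longleftrightarrow> (\<exists>x y. x * a + y * b = 1)"

lemma comaximal_mult:
  assumes "comaximal a c" "comaximal b c" shows "comaximal (a * b) c"
proof -
  obtain x y where 1: "x * a + y * c = 1" using assms(1) unfolding comaximal_def by blast
  obtain u v where 2: "u * b + v * c = 1" using assms(2) unfolding comaximal_def by blast
  have "(x * u) * (a * b) + (x * a * v + y * u * b + y * c * v) * c = (x * a + y * c) * (u * b + v * c)"
    by (simp add: algebra_simps)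
  also have "\<dots> = 1" unfolding 1 2 by simp
  finally show ?thesis unfolding comaximal_def by blast
qed

lemma comaximal_1: "comaximal 1 c"
  unfolding comaximal_def by (intro exI[of _ 1] exI[of _ 0]) simp

lemma comaximal_sym: "comaximal a b \<Longrightarrow> comaximal b a"
  unfolding comaximal_def by (metis add.commute)

lemma comaximal_power: "comaximal a c \<Longrightarrow> comaximal (a ^ n) c"
  by (induction n) (auto intro: comaximal_1 comaximal_mult)

lemma comaximal_prod: "(\<And>i. i \<in> S \<Longrightarrow> comaximal (h i) c) \<Longrightarrow> comaximal (prod h S) c"
  by (induction S rule: infinite_finite_induct) (auto intro: comaximal_1 comaximal_mult)

lemma comaximal_dvd:
  assumes "comaximal a c" "b dvd a" shows "comaximal b c"
proof -
  obtain x y where "x * a + y * c = 1" using assms(1) unfolding comaximal_def by blast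
  moreover obtain e where "a = b * e" using assms(2) by blast
  ultimately have "(x * e) * b + y * c = 1" by (simp add: mult_ac)
  then show ?thesis unfolding comaximal_def by blast
qed

lemma comaximal_unit: "a dvd 1 \<Longrightarrow> comaximal a c"
  by (rule comaximal_dvd[OF comaximal_1])

lemma comaximal_dvd_cancel:
  assumes "comaximal a c" "a dvd c ^ n * b" shows "a dvd b"
proof -
  obtain x y where "x * a + y * c ^ n = 1"
    using comaximal_sym[OF comaximal_power[OF comaximal_sym[OF assms(1)], of n]] unfolding comaximal_def by blast
  then have "b = (x * a + y * c ^ n) * b" by simp
  also have "\<dots> = a * (x * b) + y * (c ^ n * b)" by (simp add: algebra_simps)
  finally have b: "b = a * (x * b) + y * (c ^ n * b)" .
  show ?thesis by (subst b) (intro dvd_add dvd_mult dvd_triv_left assms(2))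
qed

text \<open>Modulo \<open>\<nu>\<close> the homogenization is the leading coefficient times a power of \<open>\<mu>\<close>. Hence the new point at
  infinity, the zero of \<open>\<nu>\<close>, carries no factor if \<open>p\<close> is homogenized in its exact degree.\<close>

lemma comaximal_homog:
  fixes p :: "'a::field poly"
  assumes c: "comaximal \<mu> \<nu>" and p: "p \<noteq> 0"
  shows "comaximal (homog \<mu> \<nu> (degree p) p) \<nu>"
proof -
  define w where "w = (\<Sum>i<degree p. Polynomial.smult (coeff p i) (\<mu> ^ i * \<nu> ^ (degree p - i - 1)))"
  have "homog \<mu> \<nu> (degree p) p = (\<Sum>i<degree p. Polynomial.smult (coeff p i) (\<mu> ^ i * \<nu> ^ (degree p - i)))
      + Polynomial.smult (lead_coeff p) (\<mu> ^ degree p)"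
    unfolding homog_def lessThan_Suc_atMost[symmetric] by simp
  also have "(\<Sum>i<degree p. Polynomial.smult (coeff p i) (\<mu> ^ i * \<nu> ^ (degree p - i))) = \<nu> * w"
    unfolding w_def sum_distrib_left
  proof (intro sum.cong refl)
    fix i assume "i \<in> {..<degree p}"
    then have "degree p - i = Suc (degree p - i - 1)" by simp
    then have "\<nu> ^ (degree p - i) = \<nu> * \<nu> ^ (degree p - i - 1)" by (metis power_Suc)
    then show "Polynomial.smult (coeff p i) (\<mu> ^ i * \<nu> ^ (degree p - i)) = \<nu> * Polynomial.smult (coeff p i) (\<mu> ^ i * \<nu> ^ (degree p - i - 1))"
      by (simp add: mult.left_commute)
  qed
  finally have h: "homog \<mu> \<nu> (degree p) p = \<nu> * w + Polynomial.smult (lead_coeff p) (\<mu> ^ degree p)" .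
  obtain x y where xy: "x * \<mu> ^ degree p + y * \<nu> = 1" using comaximal_power[OF c] unfolding comaximal_def by blast
  let ?e = "[:inverse (lead_coeff p):]"
  have e: "?e * Polynomial.smult (lead_coeff p) q = q" for q using p by simp
  have "(x * ?e) * homog \<mu> \<nu> (degree p) p + (y - x * ?e * w) * \<nu>
      = x * (?e * Polynomial.smult (lead_coeff p) (\<mu> ^ degree p)) + y * \<nu>"
    unfolding h by (simp only: algebra_simps)
  also have "\<dots> = 1" unfolding e by (rule xy)
  finally show ?thesis unfolding comaximal_def by blast
qed

text \<open>A transitive relation that says that \<open>A\<close> divides \<open>B\<close> away from the zeros of \<open>\<nu>\<close>. Homogenizing unimodular
  matrices gives matrices that are invertible only up to powers of \<open>\<nu>\<close>, and mutual divisibility in this sense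
  is what survives of unimodular equivalence.\<close>

definition divides_upto :: "'a::comm_ring_1 \<Rightarrow> nat \<Rightarrow> 'a mat \<Rightarrow> 'a mat \<Rightarrow> bool" where
  "divides_upto \<nu> r A B \<longleftrightarrow> (\<exists>X Y c. X \<in> carrier_mat r r \<and> Y \<in> carrier_mat r r \<and> X * A * Y = \<nu> ^ c \<cdot>\<^sub>m B)"

lemma divides_uptoI:
  "X \<in> carrier_mat r r \<Longrightarrow> Y \<in> carrier_mat r r \<Longrightarrow> X * A * Y = \<nu> ^ c \<cdot>\<^sub>m B \<Longrightarrow> divides_upto \<nu> r A B"
  unfolding divides_upto_def by blast

lemma divides_upto_trans:
  assumes car: "A \<in> carrier_mat r r" "B \<in> carrier_mat r r" "C \<in> carrier_mat r r"
    and "divides_upto \<nu> r A B" "divides_upto \<nu> r B C"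
  shows "divides_upto \<nu> r A C"
proof -
  obtain X Y c where 1: "X \<in> carrier_mat r r" "Y \<in> carrier_mat r r" "X * A * Y = \<nu> ^ c \<cdot>\<^sub>m B"
    using assms(4) unfolding divides_upto_def by blast
  obtain X' Y' c' where 2: "X' \<in> carrier_mat r r" "Y' \<in> carrier_mat r r" "X' * B * Y' = \<nu> ^ c' \<cdot>\<^sub>m C"
    using assms(5) unfolding divides_upto_def by blast
  have "(X' * X) * A * (Y * Y') = X' * (X * A * Y) * Y'" by (rule mult_mat_regroup) (use 1 2 car in auto)
  also have "\<dots> = \<nu> ^ c \<cdot>\<^sub>m (X' * B * Y')"
    unfolding 1(3) using mult_smult_distrib[OF 2(1) car(2), of "\<nu> ^ c"] mult_smult_assoc_mat[OF mult_carrier_mat[OF 2(1) car(2)] 2(2), of "\<nu> ^ c"]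
    by simp
  also have "\<dots> = \<nu> ^ (c + c') \<cdot>\<^sub>m C" unfolding 2(3) by (intro eq_matI) (auto simp: power_add mult.assoc)
  finally show ?thesis using 1 2 by (intro divides_uptoI[of "X' * X" r "Y * Y'"]) auto
qed

lemma unimodular_equivalent_divides_upto:
  assumes "unimodular_equivalent r r A B" shows "divides_upto \<nu> r A B"
proof -
  obtain U V where UV: "unimodular r U" "unimodular r V" "U * A * V = B" using assms unfolding unimodular_equivalent_def by blast
  moreover have "\<nu> ^ 0 \<cdot>\<^sub>m B = B" by (intro eq_matI) auto
  ultimately show ?thesis using unimodular_carrier by (intro divides_uptoI[of U r V _ _ 0]) auto
qed

lemma diag_sandwich:
  fixes A :: "'a::comm_ring_1 mat"
  assumes "A \<in> carrier_mat r r" "i < r" "j < r"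
  shows "(mat_diag r a * A * mat_diag r b) $$ (i,j) = a i * A $$ (i,j) * b j"
proof -
  have "mat_diag r a * A * mat_diag r b = mat r r (\<lambda>(i,j). a i * A $$ (i,j)) * mat_diag r b"
    using mat_diag_mult_left[OF assms(1), of a] by simp
  also have "\<dots> = mat r r (\<lambda>(i,j). mat r r (\<lambda>(i,j). a i * A $$ (i,j)) $$ (i,j) * b j)"
    by (rule mat_diag_mult_right) simp
  finally show ?thesis using assms by simp
qed

lemma divides_upto_diag_prod:
  fixes \<gamma> \<omega> :: "nat \<Rightarrow> 'a::comm_ring_1"
  assumes d: "divides_upto \<nu> r (mat_diag r \<gamma>) (mat_diag r \<omega>)"
    and ch: "\<And>i. Suc i < r \<Longrightarrow> \<gamma> i dvd \<gamma> (Suc i)" and j: "j \<le> r"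
  shows "\<exists>c. (\<Prod>i<j. \<gamma> i) dvd \<nu> ^ c * (\<Prod>i<j. \<omega> i)"
proof -
  obtain X Y c where XY: "X \<in> carrier_mat r r" "Y \<in> carrier_mat r r" "X * mat_diag r \<gamma> * Y = \<nu> ^ c \<cdot>\<^sub>m mat_diag r \<omega>"
    using d unfolding divides_upto_def by blast
  define S :: "'a mat" where "S = mat j r (\<lambda>(a,i). if i = a then 1 else 0)"
  have S: "S \<in> carrier_mat j r" unfolding S_def by simp
  have "minor_mat j id id (\<nu> ^ c \<cdot>\<^sub>m mat_diag r \<omega>) = S * (X * mat_diag r \<gamma> * Y) * S\<^sup>T"
    unfolding XY(3) S_def using minor_mat_sandwich[of "\<nu> ^ c \<cdot>\<^sub>m mat_diag r \<omega>" r r j id id] j mat_diag_dim[of r \<omega>] by simp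
  also have "\<dots> = (S * X) * mat_diag r \<gamma> * (Y * S\<^sup>T)"
  proof -
    have "mat_diag r \<gamma> \<in> carrier_mat r r" by (rule mat_diag_dim)
    moreover then have "dim_row (mat_diag r \<gamma>) = r" "dim_col (mat_diag r \<gamma>) = r" by (auto simp: mat_diag_def)
    ultimately show ?thesis using S XY(1,2) by (simp add: mult_mat_assoc_dim del: assoc_mult_mat)
  qed
  finally have "(\<Prod>i<j. \<gamma> i) dvd det (minor_mat j id id (\<nu> ^ c \<cdot>\<^sub>m mat_diag r \<omega>))"
    using minor_dvd[of r \<gamma> "S * X" j "Y * S\<^sup>T"] ch mult_carrier_mat[OF S XY(1)]
      mult_carrier_mat[OF XY(2) transpose_carrier_mat[THEN iffD2, OF S]] by simp
  also have "minor_mat j id id (\<nu> ^ c \<cdot>\<^sub>m mat_diag r \<omega>) = mat_diag j (\<lambda>i. \<nu> ^ c * \<omega> i)"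
    using j by (intro eq_matI) (auto simp: minor_mat_def mat_diag_def)
  also have "det (mat_diag j (\<lambda>i. \<nu> ^ c * \<omega> i)) = (\<nu> ^ c) ^ j * (\<Prod>i<j. \<omega> i)"
    by (subst det_upper_triangular[of _ j]) (auto simp: mat_diag_def prod_list_diag_prod atLeast0LessThan prod.distrib)
  finally show ?thesis unfolding power_mult[symmetric] by blast
qed

text \<open>Mutual divisibility of all initial products allows cancelling the product of the preceding entries.\<close>

lemma diag_dvd_from_products:
  fixes \<gamma> \<omega> :: "nat \<Rightarrow> 'a::idom"
  assumes "\<And>j. j \<le> r \<Longrightarrow> (\<Prod>i<j. \<gamma> i) dvd (\<Prod>i<j. \<omega> i)" "\<And>j. j \<le> r \<Longrightarrow> (\<Prod>i<j. \<omega> i) dvd (\<Prod>i<j. \<gamma> i)"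
    and nz: "\<And>i. i < r \<Longrightarrow> \<gamma> i \<noteq> 0" and i: "i < r"
  shows "\<gamma> i dvd \<omega> i"
proof -
  have "(\<Prod>i<i. \<gamma> i) * \<gamma> i dvd (\<Prod>i<i. \<omega> i) * \<omega> i" using assms(1)[of "Suc i"] i by simp
  also have "\<dots> dvd (\<Prod>i<i. \<gamma> i) * \<omega> i" using assms(2)[of i] i by (simp add: mult_dvd_mono)
  finally show ?thesis using nz i by simp
qed

text \<open>Away from the zeros of \<open>\<nu>\<close> the change of coordinate is invertible, and the homogenized transforming matrices
  show that \<open>E\<close> and the diagonal matrix of the homogenized \<open>\<alpha> i\<close> divide each other. By \<open>minor_dvd\<close>, the
  initial products of their diagonal entries agree up to powers of \<open>\<nu>\<close>. At the zeros of \<open>\<nu>\<close> both matrices are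
  invertible: the diagonal one by \<open>comaximal_homog\<close> and \<open>E\<close> because \<open>det E\<close> is a product of homogenized diagonal
  entries of \<open>T\<close>, each in its exact degree by the hypothesis on the diagonal.\<close>

lemma homogenized_Smith_form:
  fixes T :: "'a::field poly mat" and k l :: "nat \<Rightarrow> nat"
  assumes T: "unimodular_equivalent r r T (mat_diag r \<alpha>)"
    and ch: "\<And>i. Suc i < r \<Longrightarrow> \<alpha> i dvd \<alpha> (Suc i)" and nz: "\<And>i. i < r \<Longrightarrow> \<alpha> i \<noteq> 0"
    and up: "\<And>i j. i < r \<Longrightarrow> j < i \<Longrightarrow> T $$ (i,j) = 0"
    and deg: "\<And>i j. i < r \<Longrightarrow> j < r \<Longrightarrow> T $$ (i,j) \<noteq> 0 \<Longrightarrow> degree (T $$ (i,j)) + k i + l j \<le> d"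
    and diag: "\<And>i. i < r \<Longrightarrow> T $$ (i,i) \<noteq> 0" "\<And>i. i < r \<Longrightarrow> degree (T $$ (i,i)) + k i + l i = d"
    and c: "comaximal \<mu> \<nu>" and hnz: "\<And>p. p \<noteq> 0 \<Longrightarrow> homog \<mu> \<nu> (degree p) p \<noteq> 0"
    and E_def: "E = mat r r (\<lambda>(i,j). homog \<mu> \<nu> (d - k i - l j) (T $$ (i,j)))"
  obtains \<gamma> where "length \<gamma> = r" "\<forall>a\<in>set \<gamma>. lead_coeff a = 1" "\<forall>i. Suc i < r \<longrightarrow> \<gamma> ! i dvd \<gamma> ! Suc i"
    "unimodular_equivalent r r E (mat_diag r ((!) \<gamma>))"
    "\<forall>i<r. \<gamma> ! i dvd homog \<mu> \<nu> (degree (\<alpha> i)) (\<alpha> i) \<and> homog \<mu> \<nu> (degree (\<alpha> i)) (\<alpha> i) dvd \<gamma> ! i"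
proof -
  define \<omega> where "\<omega> i = homog \<mu> \<nu> (degree (\<alpha> i)) (\<alpha> i)" for i
  have E: "E \<in> carrier_mat r r" unfolding E_def by simp
  have Tc: "T \<in> carrier_mat r r" using unimodular_equivalent_carrier[OF T] by auto
  have "det E = (\<Prod>i<r. E $$ (i,i))"
    by (subst det_upper_triangular[OF _ E]) (use up E in \<open>auto simp: E_def prod_list_diag_prod atLeast0LessThan\<close>)
  also have "\<dots> = (\<Prod>i<r. homog \<mu> \<nu> (degree (T $$ (i,i))) (T $$ (i,i)))"
  proof (rule prod.cong, goal_cases)
    case (2 i)
    then have "d - k i - l i = degree (T $$ (i,i))" using diag(2)[of i] by simp
    then show ?case using 2 by (simp add: E_def)
  qed simp
  finally have dE: "det E = (\<Prod>i<r. homog \<mu> \<nu> (degree (T $$ (i,i))) (T $$ (i,i)))" .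
  have dE0: "det E \<noteq> 0" unfolding dE using hnz diag(1) by simp
  have dEc: "comaximal (det E) \<nu>" unfolding dE by (rule comaximal_prod) (use comaximal_homog[OF c] diag(1) in auto)
  obtain \<gamma> where g: "length \<gamma> = r" "\<forall>a\<in>set \<gamma>. lead_coeff a = 1" "\<forall>i. Suc i < r \<longrightarrow> \<gamma> ! i dvd \<gamma> ! Suc i"
    and gE: "unimodular_equivalent r r E (mat_diag r ((!) \<gamma>))"
    by (rule monic_Smith_form_exists[OF E dE0])
  have gc: "comaximal (\<Prod>i<j. \<gamma> ! i) \<nu>" if "j \<le> r" for j
  proof -
    obtain U V where UV: "unimodular r U" "unimodular r V" "U * E * V = mat_diag r ((!) \<gamma>)"
      using gE unfolding unimodular_equivalent_def by blast
    note car = UV(1,2)[THEN unimodular_carrier]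
    have "det (mat_diag r ((!) \<gamma>)) = (\<Prod>i<r. \<gamma> ! i)"
      by (subst det_upper_triangular[of _ r]) (auto simp: mat_diag_def prod_list_diag_prod atLeast0LessThan)
    then have "(\<Prod>i<r. \<gamma> ! i) = det U * det E * det V"
      using det_mult[OF mult_carrier_mat[OF car(1) E] car(2)] det_mult[OF car(1) E] UV(3) by simp
    then have "comaximal (\<Prod>i<r. \<gamma> ! i) \<nu>"
      using comaximal_mult[OF comaximal_mult[OF comaximal_unit[OF unimodular_det_dvd_1[OF UV(1)]] dEc]
          comaximal_unit[OF unimodular_det_dvd_1[OF UV(2)]]] by simp
    moreover have "(\<Prod>i<j. \<gamma> ! i) dvd (\<Prod>i<r. \<gamma> ! i)" using that by (intro prod_dvd_prod_subset) auto
    ultimately show ?thesis by (rule comaximal_dvd)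
  qed
  have oc: "comaximal (\<Prod>i<j. \<omega> i) \<nu>" if "j \<le> r" for j
    by (rule comaximal_prod) (use comaximal_homog[OF c] nz that in \<open>auto simp: \<omega>_def\<close>)
  have och: "\<omega> i dvd \<omega> (Suc i)" if "Suc i < r" for i
    unfolding \<omega>_def by (rule homog_dvd) (use ch nz that in auto)
  define H where "H = map_mat (homog \<mu> \<nu> d) T"
  have H: "H \<in> carrier_mat r r" unfolding H_def using Tc by simp
  have degT: "degree (T $$ (i,j)) \<le> d" if "i < r" "j < r" for i j
    using deg[OF that] by (cases "T $$ (i,j) = 0") auto
  have Hij: "\<nu> ^ k i * E $$ (i,j) * \<nu> ^ l j = H $$ (i,j)" if ij: "i < r" "j < r" for i j
  proof (cases "T $$ (i,j) = 0")
    case True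
    then show ?thesis using ij Tc by (simp add: E_def H_def)
  next
    case False
    then have "degree (T $$ (i,j)) \<le> d - k i - l j" "d = (d - k i - l j) + (k i + l j)" using deg[OF ij] by auto
    then have "homog \<mu> \<nu> d (T $$ (i,j)) = homog \<mu> \<nu> (d - k i - l j) (T $$ (i,j)) * \<nu> ^ (k i + l j)"
      using homog_raise by metis
    then show ?thesis using ij Tc by (simp add: E_def H_def power_add mult_ac)
  qed
  \<comment> \<open>\<open>H\<close> homogenizes all entries in the same degree, which is compatible with matrix products; it
    differs from \<open>E\<close> by powers of \<open>\<nu>\<close> in the rows and columns.\<close>
  have EH: "divides_upto \<nu> r E H"
  proof (rule divides_uptoI[of "mat_diag r (\<lambda>i. \<nu> ^ k i)" _ "mat_diag r (\<lambda>j. \<nu> ^ l j)" _ _ 0])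
    show "mat_diag r (\<lambda>i. \<nu> ^ k i) * E * mat_diag r (\<lambda>j. \<nu> ^ l j) = \<nu> ^ 0 \<cdot>\<^sub>m H"
    proof (rule eq_matI, goal_cases)
      case (1 i j)
      then have "i < r" "j < r" using H by auto
      then show ?case using diag_sandwich[OF E] Hij H by simp
    qed (use H in \<open>auto simp: mat_diag_def\<close>)
  qed (rule mat_diag_dim)+
  define K where "K = (\<Sum>i<r. k i + l i)"
  have K: "k i \<le> K" "l i \<le> K" if "i < r" for i
    unfolding K_def using member_le_sum[of i "{..<r}" "\<lambda>i. k i + l i"] that by auto
  have HE: "divides_upto \<nu> r H E"
  proof (rule divides_uptoI[of "mat_diag r (\<lambda>i. \<nu> ^ (K - k i))" _ "mat_diag r (\<lambda>j. \<nu> ^ (K - l j))" _ _ "K + K"])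
    show "mat_diag r (\<lambda>i. \<nu> ^ (K - k i)) * H * mat_diag r (\<lambda>j. \<nu> ^ (K - l j)) = \<nu> ^ (K + K) \<cdot>\<^sub>m E"
    proof (rule eq_matI, goal_cases)
      case (1 i j)
      then have ij: "i < r" "j < r" using E by auto
      have p: "\<nu> ^ (K - k i) * \<nu> ^ k i = \<nu> ^ K" "\<nu> ^ l j * \<nu> ^ (K - l j) = \<nu> ^ K"
        using K ij by (simp_all flip: power_add)
      have "\<nu> ^ (K - k i) * (\<nu> ^ k i * E $$ (i,j) * \<nu> ^ l j) * \<nu> ^ (K - l j)
          = (\<nu> ^ (K - k i) * \<nu> ^ k i) * E $$ (i,j) * (\<nu> ^ l j * \<nu> ^ (K - l j))" by (simp only: mult.assoc)
      also have "\<dots> = \<nu> ^ (K + K) * E $$ (i,j)" unfolding p by (simp add: power_add mult_ac)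
      finally show ?case using ij E by (simp add: diag_sandwich[OF H] Hij)
    qed (use E in \<open>auto simp: mat_diag_def\<close>)
  qed (rule mat_diag_dim)+
  obtain U V where UV: "unimodular r U" "unimodular r V" "U * T * V = mat_diag r \<alpha>"
    using T unfolding unimodular_equivalent_def by blast
  obtain U' V' where UV': "unimodular r U'" "unimodular r V'" "U' * mat_diag r \<alpha> * V' = T"
    using unimodular_equivalent_sym[OF T] unfolding unimodular_equivalent_def by blast
  note car = UV(1,2)[THEN unimodular_carrier] and car' = UV'(1,2)[THEN unimodular_carrier]
  obtain N where N: "\<And>i j. i < r \<Longrightarrow> j < r \<Longrightarrow> degree (U $$ (i,j)) \<le> N \<and> degree (V $$ (i,j)) \<le> N
      \<and> degree (U' $$ (i,j)) \<le> N \<and> degree (V' $$ (i,j)) \<le> N" and Na: "\<And>i. i < r \<Longrightarrow> degree (\<alpha> i) \<le> N"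
  proof -
    have "\<exists>N. \<forall>i<r. \<forall>j<r. degree (M $$ (i,j)) \<le> N" if "M \<in> carrier_mat r r" for M :: "'a poly mat"
      using mat_degree_bound_exists[of M] that by auto
    then obtain b where b: "\<And>M i j. M \<in> carrier_mat r r \<Longrightarrow> i < r \<Longrightarrow> j < r \<Longrightarrow> degree ((M :: 'a poly mat) $$ (i,j)) \<le> b M"
      by metis
    let ?N = "b U + b V + b U' + b V' + (\<Sum>i<r. degree (\<alpha> i))"
    have "degree (\<alpha> i) \<le> ?N" if "i < r" for i
      using member_le_sum[of i "{..<r}" "\<lambda>i. degree (\<alpha> i)"] that by simp
    moreover have "degree (U $$ (i,j)) \<le> ?N \<and> degree (V $$ (i,j)) \<le> ?N \<and> degree (U' $$ (i,j)) \<le> ?N \<and> degree (V' $$ (i,j)) \<le> ?N"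
      if "i < r" "j < r" for i j
      using b[OF car(1) that] b[OF car(2) that] b[OF car'(1) that] b[OF car'(2) that] by linarith
    ultimately show thesis using that by blast
  qed
  define M where "M = N + d + N"
  have NaM: "degree (\<alpha> i) \<le> M" if "i < r" for i using Na[OF that] unfolding M_def by linarith
  define D where "D = map_mat (homog \<mu> \<nu> M) (mat_diag r \<alpha>)"
  have D: "D \<in> carrier_mat r r" unfolding D_def by (simp add: mat_diag_dim)
  have D': "D = mat_diag r (\<lambda>i. \<omega> i * \<nu> ^ (M - degree (\<alpha> i)))"
  proof (rule eq_matI, goal_cases)
    case (1 i j)
    then have ij: "i < r" "j < r" by (auto simp: mat_diag_def)
    have "homog \<mu> \<nu> M (\<alpha> i) = homog \<mu> \<nu> (degree (\<alpha> i) + (M - degree (\<alpha> i))) (\<alpha> i)" using Na[OF ij(1)] by (simp add: M_def)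
    then have "homog \<mu> \<nu> M (\<alpha> i) = \<omega> i * \<nu> ^ (M - degree (\<alpha> i))" unfolding \<omega>_def by (simp add: homog_raise)
    then show ?case using ij by (auto simp: D_def mat_diag_def)
  qed (auto simp: D_def mat_diag_def)
  have degM: "degree ((A * B) $$ (i,j)) \<le> a + b"
    if "A \<in> carrier_mat r r" "B \<in> carrier_mat r r" "\<And>i j. i < r \<Longrightarrow> j < r \<Longrightarrow> degree (A $$ (i,j)) \<le> a"
      "\<And>i j. i < r \<Longrightarrow> j < r \<Longrightarrow> degree (B $$ (i,j)) \<le> b" "i < r" "j < r"
    for A B :: "'a poly mat" and a b i j
    using that by (auto simp: scalar_prod_def intro!: degree_sum_le order.trans[OF degree_mult_le] add_mono)
  have triple: "map_mat (homog \<mu> \<nu> (N + b + N)) (A * B * C)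
      = map_mat (homog \<mu> \<nu> N) A * map_mat (homog \<mu> \<nu> b) B * map_mat (homog \<mu> \<nu> N) C"
    if "A \<in> carrier_mat r r" "B \<in> carrier_mat r r" "C \<in> carrier_mat r r" "\<And>i j. i < r \<Longrightarrow> j < r \<Longrightarrow> degree (A $$ (i,j)) \<le> N"
      "\<And>i j. i < r \<Longrightarrow> j < r \<Longrightarrow> degree (B $$ (i,j)) \<le> b" "\<And>i j. i < r \<Longrightarrow> j < r \<Longrightarrow> degree (C $$ (i,j)) \<le> N"
    for A B C :: "'a poly mat" and b
  proof -
    have "map_mat (homog \<mu> \<nu> (N + b + N)) (A * B * C) = map_mat (homog \<mu> \<nu> (N + b)) (A * B) * map_mat (homog \<mu> \<nu> N) C"
      by (rule homog_mat_mult[OF mult_carrier_mat[OF that(1,2)] that(3) degM[OF that(1,2,4,5)] that(6)])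
    also have "map_mat (homog \<mu> \<nu> (N + b)) (A * B) = map_mat (homog \<mu> \<nu> N) A * map_mat (homog \<mu> \<nu> b) B"
      by (rule homog_mat_mult[OF that(1,2,4,5)])
    finally show ?thesis .
  qed
  have "D = map_mat (homog \<mu> \<nu> N) U * H * map_mat (homog \<mu> \<nu> N) V"
    unfolding D_def H_def UV(3)[symmetric] M_def by (rule triple) (use car Tc N degT in auto)
  then have HD: "divides_upto \<nu> r H D"
    using car by (intro divides_uptoI[of "map_mat (homog \<mu> \<nu> N) U" _ "map_mat (homog \<mu> \<nu> N) V" _ _ 0]) (auto intro!: eq_matI)
  have "map_mat (homog \<mu> \<nu> (N + M + N)) T = map_mat (homog \<mu> \<nu> N) U' * D * map_mat (homog \<mu> \<nu> N) V'"
    unfolding D_def UV'(3)[symmetric]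
    by (rule triple) (use car' N NaM mat_diag_dim[of r \<alpha>] in \<open>auto simp: mat_diag_def\<close>)
  moreover have "map_mat (homog \<mu> \<nu> (N + M + N)) T = \<nu> ^ (4 * N) \<cdot>\<^sub>m H"
  proof (rule eq_matI, goal_cases)
    case (1 i j)
    then have ij: "i < r" "j < r" using H by auto
    have M4: "N + M + N = d + 4 * N" by (simp add: M_def)
    have "homog \<mu> \<nu> (N + M + N) (T $$ (i,j)) = \<nu> ^ (4 * N) * homog \<mu> \<nu> d (T $$ (i,j))"
      unfolding M4 homog_raise[OF degT[OF ij]] by (rule mult.commute)
    then show ?case using ij Tc by (simp add: H_def)
  qed (auto simp: H_def)
  ultimately have DH: "divides_upto \<nu> r D H"
    using car' by (intro divides_uptoI[of "map_mat (homog \<mu> \<nu> N) U'" _ "map_mat (homog \<mu> \<nu> N) V'" _ _ "4 * N"]) auto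
  have D\<omega>: "divides_upto \<nu> r D (mat_diag r \<omega>)"
  proof (rule divides_uptoI[of "1\<^sub>m r" _ "mat_diag r (\<lambda>i. \<nu> ^ degree (\<alpha> i))" _ _ M])
    have "\<nu> ^ (M - degree (\<alpha> i)) * \<nu> ^ degree (\<alpha> i) = \<nu> ^ M" if "i < r" for i
      using Na[OF that] by (simp add: M_def flip: power_add)
    then have "mat_diag r (\<lambda>i. \<omega> i * \<nu> ^ (M - degree (\<alpha> i)) * \<nu> ^ degree (\<alpha> i)) = \<nu> ^ M \<cdot>\<^sub>m mat_diag r \<omega>"
      by (intro eq_matI) (auto simp: mat_diag_def mult.assoc)
    then show "1\<^sub>m r * D * mat_diag r (\<lambda>i. \<nu> ^ degree (\<alpha> i)) = \<nu> ^ M \<cdot>\<^sub>m mat_diag r \<omega>"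
      unfolding left_mult_one_mat[OF D] unfolding D' mat_diag_diag .
  qed (auto simp: mat_diag_dim)
  have \<omega>D: "divides_upto \<nu> r (mat_diag r \<omega>) D"
  proof (rule divides_uptoI[of "1\<^sub>m r" _ "mat_diag r (\<lambda>i. \<nu> ^ (M - degree (\<alpha> i)))" _ _ 0])
    show "1\<^sub>m r * mat_diag r \<omega> * mat_diag r (\<lambda>i. \<nu> ^ (M - degree (\<alpha> i))) = \<nu> ^ 0 \<cdot>\<^sub>m D"
      unfolding left_mult_one_mat[OF mat_diag_dim] mat_diag_diag D' by (intro eq_matI) (auto simp: mat_diag_def)
  qed (auto simp: mat_diag_dim)
  note tr = divides_upto_trans
  have g\<omega>: "divides_upto \<nu> r (mat_diag r ((!) \<gamma>)) (mat_diag r \<omega>)"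
    by (rule tr[OF mat_diag_dim E mat_diag_dim unimodular_equivalent_divides_upto[OF unimodular_equivalent_sym[OF gE]]
         tr[OF E H mat_diag_dim EH tr[OF H D mat_diag_dim HD D\<omega>]]])
  have \<omega>g: "divides_upto \<nu> r (mat_diag r \<omega>) (mat_diag r ((!) \<gamma>))"
    by (rule tr[OF mat_diag_dim D mat_diag_dim \<omega>D
         tr[OF D H mat_diag_dim DH tr[OF H E mat_diag_dim HE unimodular_equivalent_divides_upto[OF gE]]]])
  have p1: "(\<Prod>i<j. \<gamma> ! i) dvd (\<Prod>i<j. \<omega> i)" if j: "j \<le> r" for j
  proof -
    obtain c where "(\<Prod>i<j. \<gamma> ! i) dvd \<nu> ^ c * (\<Prod>i<j. \<omega> i)"
      using divides_upto_diag_prod[OF g\<omega> _ j] g(3) by blast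
    then show ?thesis by (rule comaximal_dvd_cancel[OF gc[OF j]])
  qed
  have p2: "(\<Prod>i<j. \<omega> i) dvd (\<Prod>i<j. \<gamma> ! i)" if j: "j \<le> r" for j
  proof -
    obtain c where "(\<Prod>i<j. \<omega> i) dvd \<nu> ^ c * (\<Prod>i<j. \<gamma> ! i)"
      using divides_upto_diag_prod[OF \<omega>g och j] by blast
    then show ?thesis by (rule comaximal_dvd_cancel[OF oc[OF j]])
  qed
  have "\<gamma> ! i dvd \<omega> i \<and> \<omega> i dvd \<gamma> ! i" if i: "i < r" for i
  proof
    show "\<gamma> ! i dvd \<omega> i" by (rule diag_dvd_from_products[OF p1 p2 _ i]) (use g in \<open>auto dest!: nth_mem\<close>)
    show "\<omega> i dvd \<gamma> ! i" by (rule diag_dvd_from_products[OF p2 p1 _ i]) (use hnz nz in \<open>auto simp: \<omega>_def\<close>)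
  qed
  then show thesis using that[OF g gE] unfolding \<omega>_def by blast
qed

section \<open>Existence of matrices with prescribed structural data\<close>

lemma homog_eq_pcompose: "homog 1 \<nu> N p = pcompose (rev_poly N p) \<nu>"
proof -
  have "pcompose ([:0,1:] ^ n) \<nu> = \<nu> ^ n" for n
    by (induction n) (auto simp: pcompose_mult pcompose_pCons pcompose_1)
  then show ?thesis
    unfolding rev_poly_def homog_def pcompose_sum by (simp add: monom_altdef pcompose_smult)
qed

lemma rev_poly_linear_power: "rev_poly N ([:-c,1:] ^ N) = [:1,-c:] ^ N"
proof (induction N)
  case 0
  show ?case by (simp add: rev_poly_def)
next
  case (Suc N)
  have d: "degree [:-c,1:] \<le> 1" "degree ([:-c,1:] ^ N) \<le> N" using degree_power_le[of "[:-c,1:]" N] by auto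
  have "rev_poly 1 [:-c,1:] = [:1,-c:]" by (simp add: rev_poly_def monom_altdef)
  then show ?case using homog_mult[OF d, of 1 "[:0,1:]"] Suc by (simp add: rev_poly_eq_homog)
qed

text \<open>A matrix in the coordinate \<open>1 / (s - c)\<close> is moved to \<open>s\<close> by the pair \<open>(1, s - c)\<close> and to \<open>t = 1 / s\<close> by the pair
  \<open>(t, 1 - c * t)\<close>. The two results are reversals of each other.\<close>

lemma rev_poly_homog:
  "rev_poly N (homog 1 [:-c,1:] N p) = homog [:0,1:] [:1,-c:] N p" "degree (homog 1 [:-c,1:] N p) \<le> N"
proof -
  have d: "degree ([:-c,1:] ^ n) \<le> n" for n using degree_power_le[of "[:-c,1:]" n] by auto
  have "rev_poly N ([:-c,1:] ^ (N - i)) = [:0,1:] ^ i * [:1,-c:] ^ (N - i)" if "i \<le> N" for i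
    using rev_poly_raise[OF d[of "N - i"], of i] that by (simp add: rev_poly_linear_power)
  then show "rev_poly N (homog 1 [:-c,1:] N p) = homog [:0,1:] [:1,-c:] N p"
    unfolding rev_poly_eq_homog homog_def[of _ _ _ p] homog_sum homog_smult by (intro sum.cong) auto
  show "degree (homog 1 [:-c,1:] N p) \<le> N"
    unfolding homog_def
    by (intro degree_sum_le order.trans[OF degree_smult_le]) (use d in \<open>auto intro: order.trans[OF d diff_le_self]\<close>)
qed

text \<open>At a zero of \<open>\<nu>\<close> only the leading term survives.\<close>

lemma homog_nonzero:
  assumes "p \<noteq> 0" "poly \<mu> x \<noteq> 0" "poly \<nu> x = 0"
  shows "homog \<mu> \<nu> (degree p) p \<noteq> 0"
proof -
  have "poly (homog \<mu> \<nu> (degree p) p) x = (\<Sum>i\<le>degree p. if i = degree p then lead_coeff p * poly \<mu> x ^ degree p else 0)"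
    unfolding homog_def poly_sum by (intro sum.cong) (use assms(3) in auto)
  then have "poly (homog \<mu> \<nu> (degree p) p) x \<noteq> 0" using assms by simp
  then show ?thesis by auto
qed

text \<open>The kernel of the transpose is the orthogonal complement of the span, so it only depends on the span.\<close>

lemma kernel_eq_of_span:
  fixes A L :: "'a::field poly mat"
  assumes A: "A \<in> carrier_mat m n" and L: "L \<in> carrier_mat m r" and eq: "rational_span A = rational_span L"
  shows "mat_kernel (fract_mat A)\<^sup>T = mat_kernel (fract_mat L)\<^sup>T"
proof -
  have sub: "mat_kernel (fract_mat M)\<^sup>T \<subseteq> mat_kernel (fract_mat M')\<^sup>T"
    if M: "M \<in> carrier_mat m a" and M': "M' \<in> carrier_mat m b" and s: "rational_span M' \<subseteq> rational_span M"
    for M M' :: "'a poly mat" and a b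
  proof
    obtain Z where Z: "Z \<in> carrier_mat a b" "fract_mat M' = fract_mat M * Z" by (rule rational_span_factor[OF M M' s])
    have fM: "(fract_mat M)\<^sup>T \<in> carrier_mat a m" and fM': "(fract_mat M')\<^sup>T \<in> carrier_mat b m" using M M' by auto
    fix x assume x: "x \<in> mat_kernel (fract_mat M)\<^sup>T"
    note x = mat_kernelD[OF fM x]
    have "(fract_mat M')\<^sup>T *\<^sub>v x = (Z\<^sup>T * (fract_mat M)\<^sup>T) *\<^sub>v x"
      using transpose_mult[of "fract_mat M" m a Z b] M Z by simp
    also have "\<dots> = Z\<^sup>T *\<^sub>v ((fract_mat M)\<^sup>T *\<^sub>v x)" by (rule assoc_mult_mat_vec) (use Z fM x in auto)
    also have "\<dots> = 0\<^sub>v b" unfolding x(2) using Z by (intro eq_vecI) auto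
    finally show "x \<in> mat_kernel (fract_mat M')\<^sup>T" by (intro mat_kernelI[OF fM']) (use x in auto)
  qed
  show ?thesis using sub[OF A L] sub[OF L A] eq by auto
qed

lemma product_minimal_indices:
  fixes E :: "'a::field poly mat"
  assumes L: "completable m r L" and R: "completable n r R" and rm: "r \<le> m" "r \<le> n"
    and E: "E \<in> carrier_mat r r" "det E \<noteq> 0"
    and k: "minimal_basis_mat m (rational_span L) k L" "is_partition k"
    and vs: "minimal_basis_mat m (mat_kernel (fract_mat L)\<^sup>T) vs N" "is_partition vs"
  shows "has_col_span_minimal_indices (L * E * R\<^sup>T) k" "has_left_minimal_indices (L * E * R\<^sup>T) vs"
proof -
  let ?A = "L * E * R\<^sup>T"
  have Lc: "L \<in> carrier_mat m r" and Rc: "R \<in> carrier_mat n r" using L R unfolding completable_def by auto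
  have A: "?A \<in> carrier_mat m n" using Lc E(1) Rc by auto
  note s = product_rational_span(2)[OF L R rm E]
  have sub: "submodule class_ring (rational_span ?A) (module_vec TYPE('a poly fract) m)"
    using submodule_col_space[of "fract_mat ?A" m n] col_space_fract_mat[OF A] A by simp
  have dr: "dim_row ?A = m" using A by blast
  show "has_col_span_minimal_indices ?A k"
    unfolding has_col_span_minimal_indices_def dr col_space_fract_mat[OF A] 
    by (rule has_minimal_indicesI[OF sub _ k(2)]) (use k(1) s in simp)
  have ke: "mat_kernel (fract_mat ?A)\<^sup>T = mat_kernel (fract_mat L)\<^sup>T"
    by (rule kernel_eq_of_span[OF A Lc s])
  have "submodule class_ring (mat_kernel (fract_mat L)\<^sup>T) (module_vec TYPE('a poly fract) m)"
    using submodule_mat_kernel[of "(fract_mat L)\<^sup>T" r m] Lc by simp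
  from has_minimal_indicesI[OF this vs]
  show "has_left_minimal_indices ?A vs"
    unfolding has_left_minimal_indices_def dr left_kernel_eq ke .
qed

lemma transposed_minimal_indices:
  fixes A :: "'a::field poly mat"
  assumes A: "A \<in> carrier_mat m n"
  shows "has_col_span_minimal_indices A\<^sup>T l \<Longrightarrow> has_row_span_minimal_indices A l"
    and "has_left_minimal_indices A\<^sup>T ds \<Longrightarrow> has_right_minimal_indices A ds"
proof -
  have dc: "dim_col A = n" using A by blast
  show "has_col_span_minimal_indices A\<^sup>T l \<Longrightarrow> has_row_span_minimal_indices A l"
    unfolding has_col_span_minimal_indices_def has_row_span_minimal_indices_def
    using vec_space.row_space_eq_col_space_transpose[of n "fract_mat A"] dc by simp
  show "has_left_minimal_indices A\<^sup>T ds \<Longrightarrow> has_right_minimal_indices A ds"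
    unfolding has_left_minimal_indices_def has_right_minimal_indices_def left_kernel_eq by simp
qed

text \<open>If \<open>q\<close> is not constant, a root of \<open>q + 1\<close> is a point where \<open>q\<close> takes the value \<open>- 1\<close>. This avoids the
  separate fact that algebraically closed fields are infinite.\<close>

lemma nonvanishing_point:
  fixes q :: "'a::field poly"
  assumes ac: "\<And>p :: 'a poly. 0 < degree p \<Longrightarrow> \<exists>x. poly p x = 0" and q: "q \<noteq> 0"
  obtains c where "poly q c \<noteq> 0"
proof (cases "degree q = 0")
  case True
  then obtain a where "q = [:a:]" by (metis degree_eq_zeroE)
  then have "poly q 0 \<noteq> 0" using q by simp
  then show thesis by (rule that)
next
  case False
  then have "degree (q + 1) = degree q" by (intro degree_add_eq_left) simp
  then obtain x where "poly (q + 1) x = 0" using ac[of "q + 1"] False by auto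
  then have "poly q x + 1 = 0" by simp
  then have "poly q x \<noteq> 0" by (metis add_0 one_neq_zero)
  then show thesis by (rule that)
qed

lemma monic_dvd_antisym:
  fixes p q :: "'a::field poly"
  assumes "lead_coeff p = 1" "lead_coeff q = 1" "p dvd q" "q dvd p"
  shows "p = q"
proof -
  have "p \<noteq> 0" "q \<noteq> 0" using assms(1,2) by auto
  then have dd: "degree p = degree q" using assms(3,4) by (meson antisym dvd_imp_degree_le)
  obtain w where w: "q = p * w" using assms(3) by blast
  then have "w \<noteq> 0" using \<open>q \<noteq> 0\<close> by auto
  then have "degree w = 0" using dd w \<open>p \<noteq> 0\<close> by (simp add: degree_mult_eq)
  then obtain a where a: "w = [:a:]" by (rule degree_eq_zeroE)
  have "lead_coeff p * lead_coeff w = 1" using assms(2) unfolding w lead_coeff_mult .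
  then show ?thesis using assms(1) a w by simp
qed

text \<open>The polynomial \<open>\<alpha>' i\<close> is \<open>u^(f i + deg (\<alpha> i))\<close> times the value of \<open>\<alpha> i\<close> at \<open>c + 1 / u\<close>, in the coordinate
  \<open>u = 1 / (s - c)\<close>. As \<open>\<alpha> i\<close> does not vanish at \<open>c\<close>, it has the full degree \<open>f i + deg (\<alpha> i)\<close>. A triangular matrix
  with these invariant factors is moved to \<open>s\<close> and to \<open>1 / s\<close>, and the results are put between bases with the
  prescribed degrees.\<close>

lemma structured_matrix_exists:
  fixes \<alpha> :: "'a::field poly list"
  assumes ac: "\<And>p :: 'a poly. 0 < degree p \<Longrightarrow> \<exists>x. poly p x = 0"
    and r: "0 < r" "r \<le> m" "r \<le> n"
    and len: "length \<alpha> = r" "length f = r" "length k = r" "length l = r" "length ds = n - r" "length vs = m - r"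
    and part: "is_partition (rev f)" "is_partition k" "is_partition l" "is_partition ds" "is_partition vs"
    and monic: "\<forall>a\<in>set \<alpha>. lead_coeff a = 1" and chain: "\<forall>i. Suc i < r \<longrightarrow> \<alpha> ! i dvd \<alpha> ! Suc i"
    and a: "sum_list vs = sum_list k" "sum_list ds = sum_list l" and b: "f ! 0 = 0"
    and c1: "\<And>T. T \<subseteq> {..<r} \<Longrightarrow>
      (\<Sum>i<card T. int (degree (\<alpha> ! i)) + int (f ! i)) \<le> (\<Sum>i\<in>T. int d - int (k ! (r - 1 - i)) - int (l ! i))"
    and c2: "(\<Sum>i<r. int (degree (\<alpha> ! i)) + int (f ! i)) = (\<Sum>i<r. int d - int (k ! (r - 1 - i)) - int (l ! i))"
  shows "\<exists>A\<in>carrier_mat m n. has_structural_data A r d \<alpha> f k l ds vs"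
proof -
  define k' where "k' i = k ! (r - 1 - i)" for i
  define \<delta> where "\<delta> i = d - k' i - l ! i" for i
  have kl: "k' i + l ! i \<le> d" if "i < r" for i
    using c1[of "{i}"] that unfolding k'_def[symmetric] by simp
  have \<delta>: "int (\<delta> i) = int d - int (k ! (r - 1 - i)) - int (l ! i)" if "i < r" for i
    using kl[OF that] unfolding \<delta>_def k'_def by linarith
  have nz: "\<alpha> ! i \<noteq> 0" if "i < r" for i using monic len that by (metis leading_coeff_0_iff nth_mem zero_neq_one)
  obtain c where c: "poly (\<alpha> ! (r - 1)) c \<noteq> 0" by (rule nonvanishing_point[OF ac nz[of "r - 1"]]) (use r in auto)
  have up: "\<alpha> ! i dvd \<alpha> ! (i + t)" if "i + t < r" for i t
    using that by (induction t) (use chain dvd_trans in auto)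
  have ac0: "poly (\<alpha> ! i) c \<noteq> 0" if i: "i < r" for i
  proof -
    have "\<alpha> ! i dvd \<alpha> ! (r - 1)" using up[of i "r - 1 - i"] i by simp
    then show ?thesis using c by (auto elim!: dvdE)
  qed
  define q where "q i = pcompose (\<alpha> ! i) [:c,1:]" for i
  define \<alpha>' where "\<alpha>' i = rev_poly (f ! i + degree (\<alpha> ! i)) (q i)" for i
  have dq: "degree (q i) = degree (\<alpha> ! i)" for i unfolding q_def by (simp add: degree_pcompose)
  have q0: "coeff (q i) 0 \<noteq> 0" if "i < r" for i
    using ac0[OF that] by (simp add: q_def poly_pcompose flip: poly_0_coeff_0)
  have \<alpha>'_q: "rev_poly (f ! i + degree (\<alpha> ! i)) (\<alpha>' i) = q i" for i
    unfolding \<alpha>'_def by (rule rev_poly_rev_poly) (simp add: dq)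
  have d\<alpha>': "degree (\<alpha>' i) = f ! i + degree (\<alpha> ! i)" if i: "i < r" for i
  proof (rule antisym)
    show "degree (\<alpha>' i) \<le> f ! i + degree (\<alpha> ! i)" unfolding \<alpha>'_def by (rule degree_rev_poly_le)
    show "f ! i + degree (\<alpha> ! i) \<le> degree (\<alpha>' i)" by (rule le_degree) (use q0[OF i] in \<open>simp add: \<alpha>'_def coeff_rev_poly\<close>)
  qed
  have \<alpha>'_nz: "\<alpha>' i \<noteq> 0" if "i < r" for i
    using q0[OF that] \<alpha>'_q[of i] by auto
  have \<alpha>'_chain: "\<alpha>' i dvd \<alpha>' (Suc i)" if i: "Suc i < r" for i
  proof -
    have e: "\<alpha>' i = [:0,1:] ^ (f ! i) * homog 1 [:0,1:] (degree (q i)) (q i)" for i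
      unfolding \<alpha>'_def dq[symmetric, of i] rev_poly_eq_homog[symmetric] by (simp add: rev_poly_raise)
    have "q (Suc i) \<noteq> 0" using q0[of "Suc i"] i by auto
    moreover have "q i dvd q (Suc i)" unfolding q_def using chain i by (auto elim!: dvdE simp: pcompose_mult)
    moreover have "f ! i \<le> f ! Suc i"
      using partition_nth[OF part(1), of "r - 1 - Suc i" "r - 1 - i"] i len by (simp add: rev_nth Suc_diff_Suc)
    ultimately show ?thesis unfolding e by (intro mult_dvd_mono le_imp_power_dvd homog_dvd)
  qed
  obtain T where T: "unimodular_equivalent r r T (mat_diag r \<alpha>')"
    and Td: "\<forall>i<r. T $$ (i,i) \<noteq> 0 \<and> degree (T $$ (i,i)) = \<delta> i" and Tl: "\<forall>i<r. \<forall>j<i. T $$ (i,j) = 0"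
    and Tu: "\<forall>i<r. \<forall>j<r. i < j \<longrightarrow> T $$ (i,j) = 0 \<or> degree (T $$ (i,j)) < \<delta> i"
  proof -
    have "(\<Sum>i<card S. degree (\<alpha>' i)) \<le> (\<Sum>i\<in>S. \<delta> i)" if S: "S \<subseteq> {..<r}" for S
    proof -
      have "card S \<le> r" using card_mono[OF _ S] by simp
      then have "int (\<Sum>i<card S. degree (\<alpha>' i)) = (\<Sum>i<card S. int (degree (\<alpha> ! i)) + int (f ! i))"
        unfolding of_nat_sum by (intro sum.cong) (auto simp: d\<alpha>')
      also have "\<dots> \<le> (\<Sum>i\<in>S. int d - int (k ! (r - 1 - i)) - int (l ! i))" by (rule c1[OF S])
      also have "\<dots> = int (\<Sum>i\<in>S. \<delta> i)" unfolding of_nat_sum by (intro sum.cong) (use S \<delta> in auto)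
      finally show ?thesis unfolding of_nat_le_iff .
    qed
    moreover have "(\<Sum>i<r. degree (\<alpha>' i)) = (\<Sum>i<r. \<delta> i)"
    proof -
      have "int (\<Sum>i<r. degree (\<alpha>' i)) = (\<Sum>i<r. int (degree (\<alpha> ! i)) + int (f ! i))"
        unfolding of_nat_sum by (intro sum.cong) (auto simp: d\<alpha>')
      also have "\<dots> = int (\<Sum>i<r. \<delta> i)" unfolding c2 of_nat_sum by (intro sum.cong) (use \<delta> in auto)
      finally show ?thesis unfolding of_nat_eq_iff .
    qed
    ultimately have "\<exists>T. unimodular_equivalent r r T (mat_diag r \<alpha>') \<and> (\<forall>i<r. T $$ (i,i) \<noteq> 0 \<and> degree (T $$ (i,i)) = \<delta> i) \<and>
      (\<forall>i<r. \<forall>j<i. T $$ (i,j) = 0) \<and> (\<forall>i<r. \<forall>j<r. i < j \<longrightarrow> T $$ (i,j) = 0 \<or> degree (T $$ (i,j)) < \<delta> i)"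
      by (intro triangular_form_exists ac \<alpha>'_chain \<alpha>'_nz)
    then show thesis using that by (elim exE conjE)
  qed
  have Tc: "T \<in> carrier_mat r r" using unimodular_equivalent_carrier[OF T] by auto
  have Tdeg: "degree (T $$ (i,j)) + k' i + l ! j \<le> d" if ij: "i < r" "j < r" "T $$ (i,j) \<noteq> 0" for i j
  proof -
    \<comment> \<open>For entries above the diagonal the bound needs \<open>l\<close> to be non-increasing: \<open>d - k' i - l ! j\<close> is then at least the
      degree of the diagonal entry in the same row.\<close>
    have "i \<le> j" using Tl ij by (meson not_le)
    then have "degree (T $$ (i,j)) \<le> \<delta> i" "l ! j \<le> l ! i"
    proof -
      show "l ! j \<le> l ! i" using partition_nth[OF part(3) \<open>i \<le> j\<close>] ij len by simp
      show "degree (T $$ (i,j)) \<le> \<delta> i"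
      proof (cases "i = j")
        case False
        then have "i < j" using \<open>i \<le> j\<close> by simp
        then have "T $$ (i,j) = 0 \<or> degree (T $$ (i,j)) < \<delta> i" using Tu ij(1,2) by blast
        then show ?thesis using ij(3) by simp
      qed (use Td ij in simp)
    qed
    then show ?thesis using kl[OF ij(1)] unfolding \<delta>_def by linarith
  qed
  have Tlow: "T $$ (i,j) = 0" if "i < r" "j < i" for i j using Tl that by simp
  have Tnz: "T $$ (i,i) \<noteq> 0" if "i < r" for i using Td that by simp
  have Tdd: "degree (T $$ (i,i)) + k' i + l ! i = d" if "i < r" for i
  proof -
    have "degree (T $$ (i,i)) = \<delta> i" using Td that by simp
    then show ?thesis using kl[OF that] unfolding \<delta>_def by linarith
  qed
  define E0 where "E0 = mat r r (\<lambda>(i,j). homog 1 [:-c,1:] (d - k' i - l ! j) (T $$ (i,j)))"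
  define F0 where "F0 = mat r r (\<lambda>(i,j). homog [:0,1:] [:1,-c:] (d - k' i - l ! j) (T $$ (i,j)))"
  \<comment> \<open>Condition (c) pairs \<open>k ! (r - 1 - i)\<close> with \<open>l ! i\<close>, so the rows of \<open>E0\<close> and \<open>F0\<close> are weighted by the reversed list
    \<open>k\<close>; turning them upside down restores the order of the columns of \<open>L\<close>.\<close>
  define E where "E = minor_mat r (\<lambda>i. r - 1 - i) (\<lambda>j. j) E0"
  define F where "F = minor_mat r (\<lambda>i. r - 1 - i) (\<lambda>j. j) F0"
  have E0c: "E0 \<in> carrier_mat r r" and F0c: "F0 \<in> carrier_mat r r" and Ec: "E \<in> carrier_mat r r"
    unfolding E0_def F0_def E_def minor_mat_def by auto
  have Eij: "E $$ (i,j) = homog 1 [:-c,1:] (d - k ! i - l ! j) (T $$ (r - 1 - i, j))"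
    "F $$ (i,j) = homog [:0,1:] [:1,-c:] (d - k ! i - l ! j) (T $$ (r - 1 - i, j))" if "i < r" "j < r" for i j
    using that by (simp_all add: E_def F_def E0_def F0_def minor_mat_def k'_def)
  have FE: "F = weighted_reversal d ((!) k) ((!) l) E"
  proof (rule eq_matI, goal_cases)
    case (1 i j)
    then have ij: "i < r" "j < r" using Ec by (auto simp: weighted_reversal_def)
    have "weighted_reversal d ((!) k) ((!) l) E $$ (i,j) = rev_poly (d - k ! i - l ! j) (E $$ (i,j))"
      using ij Ec by (simp add: weighted_reversal_def)
    then show ?case unfolding Eij(1)[OF ij] Eij(2)[OF ij] rev_poly_homog by simp
  qed (use Ec in \<open>auto simp: weighted_reversal_def F_def minor_mat_def\<close>)
  have inj: "inj_on (\<lambda>i. r - 1 - i) {..<r}" "inj_on (\<lambda>i::nat. i) {..<r}" by (auto simp: inj_on_def)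
  have selE: "unimodular_equivalent r r E0 E" "unimodular_equivalent r r F0 F"
    unfolding E_def F_def
    by (intro unimodular_equivalent_selection E0c F0c inj; simp)+
  have hnz: "homog 1 [:-c,1:] (degree p) p \<noteq> 0" if "p \<noteq> 0" for p
    by (rule homog_nonzero[OF that, of _ c]) auto
  obtain \<gamma> where g: "length \<gamma> = r" "\<forall>a\<in>set \<gamma>. lead_coeff a = 1" "\<forall>i. Suc i < r \<longrightarrow> \<gamma> ! i dvd \<gamma> ! Suc i"
    "unimodular_equivalent r r E0 (mat_diag r ((!) \<gamma>))"
    and g\<omega>: "\<forall>i<r. \<gamma> ! i dvd homog 1 [:-c,1:] (degree (\<alpha>' i)) (\<alpha>' i) \<and> homog 1 [:-c,1:] (degree (\<alpha>' i)) (\<alpha>' i) dvd \<gamma> ! i"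
    by (rule homogenized_Smith_form[of r T \<alpha>' k' "(!) l" d 1 "[:-c,1:]" E0])
      (rule T, rule \<alpha>'_chain, assumption, rule \<alpha>'_nz, assumption, rule Tlow, assumption+, rule Tdeg, assumption+,
       rule Tnz, assumption, rule Tdd, assumption, rule comaximal_1, rule hnz, assumption, rule E0_def, rule that, assumption+)
  have \<omega>: "homog 1 [:-c,1:] (degree (\<alpha>' i)) (\<alpha>' i) = \<alpha> ! i" if "i < r" for i
    unfolding d\<alpha>'[OF that] homog_eq_pcompose \<alpha>'_q q_def by (simp add: pcompose_assoc[symmetric] pcompose_pCons)
  have "\<gamma> = \<alpha>"
  proof (rule nth_equalityI)
    show "length \<gamma> = length \<alpha>" using g len by simp
    fix i assume "i < length \<gamma>"
    then have i: "i < r" using g by simp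
    have "lead_coeff (\<gamma> ! i) = 1" "lead_coeff (\<alpha> ! i) = 1" using g(1,2) monic i len by auto
    moreover have "\<gamma> ! i dvd \<alpha> ! i" "\<alpha> ! i dvd \<gamma> ! i" using g\<omega> \<omega>[OF i] i by auto
    ultimately show "\<gamma> ! i = \<alpha> ! i" by (rule monic_dvd_antisym)
  qed
  then have eqE: "unimodular_equivalent r r E (mat_diag r ((!) \<alpha>))"
    using g(4) unimodular_equivalent_trans[OF unimodular_equivalent_sym[OF selE(1)]] by simp
  have com: "comaximal [:0,1:] [:1,-c:]"
    unfolding comaximal_def by (intro exI[of _ "[:c:]"] exI[of _ 1]) simp
  have hnz': "homog [:0,1:] [:1,-c:] (degree p) p \<noteq> 0" if p: "p \<noteq> 0" for p
  proof (cases "c = 0")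
    case True
    have "rev_poly (degree p) (homog 1 [:-c,1:] (degree p) p) = p"
      unfolding True homog_eq_pcompose by (simp add: rev_poly_rev_poly pcompose_idR)
    then show ?thesis unfolding rev_poly_homog using p by simp
  next
    case False
    then show ?thesis by (intro homog_nonzero[OF p, of _ "1 / c"]) auto
  qed
  obtain \<beta> where h: "length \<beta> = r" "\<forall>a\<in>set \<beta>. lead_coeff a = 1" "\<forall>i. Suc i < r \<longrightarrow> \<beta> ! i dvd \<beta> ! Suc i"
    "unimodular_equivalent r r F0 (mat_diag r ((!) \<beta>))"
    and h\<omega>: "\<forall>i<r. \<beta> ! i dvd homog [:0,1:] [:1,-c:] (degree (\<alpha>' i)) (\<alpha>' i) \<and> homog [:0,1:] [:1,-c:] (degree (\<alpha>' i)) (\<alpha>' i) dvd \<beta> ! i"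
    by (rule homogenized_Smith_form[of r T \<alpha>' k' "(!) l" d "[:0,1:]" "[:1,-c:]" F0])
      (rule T, rule \<alpha>'_chain, assumption, rule \<alpha>'_nz, assumption, rule Tlow, assumption+, rule Tdeg, assumption+,
       rule Tnz, assumption, rule Tdd, assumption, rule com, rule hnz', assumption, rule F0_def, rule that, assumption+)
  have ord: "order 0 (\<beta> ! i) = f ! i" if i: "i < r" for i
  proof -
    let ?w = "homog [:0,1:] [:1,-c:] (degree (\<alpha>' i)) (\<alpha>' i)"
    have "?w = rev_poly (f ! i + degree (\<alpha> ! i)) (\<alpha> ! i)"
      using rev_poly_homog(1)[of "degree (\<alpha>' i)" c "\<alpha>' i"] unfolding \<omega>[OF i] unfolding d\<alpha>'[OF i] by simp
    also have "\<dots> = [:0,1:] ^ (f ! i) * rev_poly (degree (\<alpha> ! i)) (\<alpha> ! i)" by (simp add: rev_poly_raise)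
    finally have w: "?w = [:0,1:] ^ (f ! i) * rev_poly (degree (\<alpha> ! i)) (\<alpha> ! i)" .
    have p0: "poly (rev_poly (degree (\<alpha> ! i)) (\<alpha> ! i)) 0 \<noteq> 0" using nz[OF i] by (simp add: poly_0_rev_poly)
    then have wn: "rev_poly (degree (\<alpha> ! i)) (\<alpha> ! i) \<noteq> 0" by auto
    have ow: "order 0 ?w = f ! i" unfolding w order_X_power_mult[OF wn] using order_0I[OF p0] by simp
    have "?w \<noteq> 0" unfolding w using wn by simp
    moreover have "\<beta> ! i \<noteq> 0" using h(1,2) i by (metis leading_coeff_0_iff nth_mem zero_neq_one)
    ultimately show ?thesis using order_le_of_dvd[of "\<beta> ! i" ?w 0] order_le_of_dvd[of ?w "\<beta> ! i" 0] h\<omega> i ow by auto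
  qed
  have eqF: "unimodular_equivalent r r F (mat_diag r ((!) \<beta>))"
    using h(4) unimodular_equivalent_trans[OF unimodular_equivalent_sym[OF selE(2)]] by simp
  have rv: "r + length vs = m" and rd: "r + length ds = n" using len r by auto
  have ne: "k \<noteq> []" "l \<noteq> []" using r len by auto
  obtain L N :: "'a poly mat" where L: "completable m r L" "completable m r (col_reversal ((!) k) L)" "\<forall>i<m. \<forall>j<r. degree (L $$ (i,j)) \<le> k ! j"
    "minimal_basis_mat m (rational_span L) k L" "minimal_basis_mat m (mat_kernel (fract_mat L)\<^sup>T) vs N"
    by (rule dual_bases_exist[OF a(1)[symmetric] ne(1), unfolded len(3) rv]) (rule that, assumption+)
  obtain R N' :: "'a poly mat" where R: "completable n r R" "completable n r (col_reversal ((!) l) R)" "\<forall>i<n. \<forall>j<r. degree (R $$ (i,j)) \<le> l ! j"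
    "minimal_basis_mat n (rational_span R) l R" "minimal_basis_mat n (mat_kernel (fract_mat R)\<^sup>T) ds N'"
    by (rule dual_bases_exist[OF a(2)[symmetric] ne(2), unfolded len(4) rd]) (rule that, assumption+)
  have Lc: "L \<in> carrier_mat m r" and Rc: "R \<in> carrier_mat n r" using L(1) R(1) unfolding completable_def by auto
  define A where "A = L * E * R\<^sup>T"
  have A: "A \<in> carrier_mat m n" unfolding A_def using Lc Ec Rc by auto
  note invA = product_invariant_factors[OF L(1) R(1) r(2,3) eqE len(1) monic chain]
  note invF = product_invariant_factors[OF L(2) R(2) r(2,3) eqF h(1,2,3)]
  have dE: "degree (E $$ (i,j)) + k ! i + l ! j \<le> d" if ij: "i < r" "j < r" "E $$ (i,j) \<noteq> 0" for i j
  proof -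
    have "T $$ (r - 1 - i, j) \<noteq> 0" using ij Eij(1) by auto
    then have "k ! i + l ! j \<le> d" using Tdeg[of "r - 1 - i" j] ij unfolding k'_def by simp
    moreover have "degree (E $$ (i,j)) \<le> d - k ! i - l ! j" unfolding Eij(1)[OF ij(1,2)] by (rule rev_poly_homog)
    ultimately show ?thesis by linarith
  qed
  have rp: "map_mat (rev_poly d) A = col_reversal ((!) k) L * F * (col_reversal ((!) l) R)\<^sup>T"
    unfolding A_def FE by (rule rev_product(1)[OF Lc Ec Rc]) (use L(3) R(3) dE in auto)
  have dA: "degree (A $$ (i,j)) \<le> d" if "i < m" "j < n" for i j
    unfolding A_def by (rule rev_product(2)[OF Lc Ec Rc]) (use L(3) R(3) dE that in auto)
  \<comment> \<open>The degree is not smaller than \<open>d\<close> because \<open>f ! 0 = 0\<close>: otherwise \<open>X\<close> would divide the reversal in degree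
    \<open>d\<close>, and hence its first invariant factor.\<close>
  have "mat_degree A \<le> d" unfolding mat_degree_le_iff using dA A by auto
  moreover have "\<not> mat_degree A < d"
  proof
    assume lt: "mat_degree A < d"
    have dv: "[:0,1:] dvd map_mat (rev_poly d) A $$ (i,j)" if "i < m" "j < n" for i j
    proof -
      have "degree (A $$ (i,j)) \<le> mat_degree A" using mat_degree_le_iff[of A "mat_degree A"] that A by auto
      then have "degree (A $$ (i,j)) < d" using lt by linarith
      then have "poly (rev_poly d (A $$ (i,j))) 0 = 0" by (simp add: poly_0_rev_poly coeff_eq_0)
      then show ?thesis using that A poly_eq_0_iff_dvd[of "rev_poly d (A $$ (i,j))" 0] by simp
    qed
    have Ac: "map_mat (rev_poly d) A \<in> carrier_mat m n" using A by simp
    obtain U V where UV: "U \<in> carrier_mat m m" "V \<in> carrier_mat n n"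
      "U * map_mat (rev_poly d) A * V = mat m n (\<lambda>(i,j). if i = j \<and> i < r then \<beta> ! i else 0)"
      using invF(1) Ac h(1) unfolding rp[symmetric] has_invariant_factors_def by auto
    have "[:0,1:] dvd (U * map_mat (rev_poly d) A * V) $$ (0,0)"
      by (rule dvd_entries_mult[OF UV(1) Ac UV(2) dv]) (use r in auto)
    then have "[:0,1:] dvd \<beta> ! 0" unfolding UV(3) using r by simp
    then have "poly (\<beta> ! 0) 0 = 0" by (auto elim!: dvdE)
    moreover have "\<beta> ! 0 \<noteq> 0" using h(1,2) r by (metis leading_coeff_0_iff nth_mem zero_neq_one)
    ultimately show False using ord[of 0] b r by (simp add: order_root)
  qed
  ultimately have dA': "mat_degree A = d" by simp
  have ifA: "has_infinite_partial_multiplicities A f"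
    unfolding has_infinite_partial_multiplicities_def
  proof (intro exI conjI)
    show "has_invariant_factors (rev_mat A) \<beta>" unfolding rev_mat_def dA' rp by (rule invF(1))
    show "f = map (order 0) \<beta>" by (rule nth_equalityI) (use ord h(1) len in auto)
  qed
  have AT: "A\<^sup>T = R * E\<^sup>T * L\<^sup>T"
    unfolding A_def using transpose_mult[OF mult_carrier_mat[OF Lc Ec], of "R\<^sup>T" n] transpose_mult[OF Lc Ec] Lc Ec Rc
    by (simp add: mult_mat_assoc_dim del: assoc_mult_mat)
  have dET: "det E\<^sup>T \<noteq> 0" using det_transpose[OF Ec] invA(3) by simp
  have ETc: "E\<^sup>T \<in> carrier_mat r r" using Ec by simp
  have "has_structural_data A r d \<alpha> f k l ds vs"
    unfolding has_structural_data_def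
    using invA(1,2) dA' ifA product_minimal_indices[OF L(1) R(1) r(2,3) Ec invA(3) L(4) part(2) L(5) part(5)]
      transposed_minimal_indices[OF A] product_minimal_indices[OF R(1) L(1) r(3,2) ETc dET R(4) part(3) R(5) part(4)]
    unfolding AT[symmetric] by (simp add: A_def[symmetric])
  then show ?thesis using A by blast
qed

section \<open>Majorization in terms of subsets\<close>

lemma sum_le_initial_sum:
  fixes w :: "nat \<Rightarrow> int"
  assumes "finite S" "S \<subseteq> {..<r}" "\<And>i j. i \<le> j \<Longrightarrow> j < r \<Longrightarrow> w j \<le> w i"
  shows "(\<Sum>i\<in>S. w i) \<le> (\<Sum>i<card S. w i)"
  using assms(1,2)
proof (induction S rule: finite_linorder_max_induct)
  case (insert b S)
  have "S \<subseteq> {..<b}" using insert.hyps(2) by auto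
  then have "card S \<le> b" using card_mono[of "{..<b}" S] by simp
  moreover have "b < r" using insert.prems by simp
  ultimately have "w b \<le> w (card S)" by (intro assms(3))
  moreover have "b \<notin> S" using insert.hyps(2) by auto
  ultimately show ?case using insert.IH insert.prems insert.hyps(1) by simp
qed simp

lemma sum_list_take_nth: "j \<le> length xs \<Longrightarrow> sum_list (take j xs) = (\<Sum>i<j. xs ! i)"
  by (simp add: sum_list_sum_nth atLeast0LessThan)

text \<open>Majorization compares the sums of the \<open>j\<close> largest numbers on both sides, and the largest sum of \<open>w\<close> over
  a set of \<open>j\<close> indices is attained at these. The statement uses the complements of these sets: as the totals
  agree, upper bounds for the \<open>j\<close> largest are lower bounds for the remaining \<open>r - j\<close>. The list \<open>B\<close> is
  decreasing in the application, hence \<open>e\<close> is read backwards.\<close>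

lemma majorized_by_sort_iff:
  fixes H :: "nat list" and e w :: "nat \<Rightarrow> int" and B :: "int list"
  assumes H: "length H = r" and B: "length B = r" "\<And>i. i < r \<Longrightarrow> B ! i = e (r - 1 - i)"
    and w: "\<And>i. i < r \<Longrightarrow> w i = int d - int (H ! i)"
  shows "majorized_by (map (\<lambda>x. int d - int x) (sort H)) B \<longleftrightarrow>
    (\<forall>T. T \<subseteq> {..<r} \<longrightarrow> (\<Sum>i<card T. e i) \<le> (\<Sum>i\<in>T. w i)) \<and>
    (\<Sum>i<r. e i) = (\<Sum>i<r. w i)"
proof -
  let ?A = "map (\<lambda>x. int d - int x) (sort H)"
  have "mset (sort H) = mset H" by simp
  from permutation_Ex_bij[OF this] obtain \<pi>
    where \<pi>: "bij_betw \<pi> {..<r} {..<r}" and s\<pi>: "\<And>i. i < r \<Longrightarrow> sort H ! i = H ! \<pi> i"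
    using H by auto
  have A: "length ?A = r" "\<And>i. i < r \<Longrightarrow> ?A ! i = w (\<pi> i)" using H s\<pi> w bij_betwE[OF \<pi>] by auto
  have anti: "?A ! j \<le> ?A ! i" if "i \<le> j" "j < r" for i j
    using sorted_nth_mono[OF sorted_sort that(1), of H] that H by simp
  have totA: "sum_list ?A = (\<Sum>i<r. w i)"
    unfolding sum_list_sum_nth atLeast0LessThan A(1) using sum.reindex_bij_betw[OF \<pi>, of w] A(2) by simp
  have tB: "sum_list (take j B) = (\<Sum>i<r. e i) - (\<Sum>i<r - j. e i)" if j: "j \<le> r" for j
  proof -
    have "sum_list (take j B) = (\<Sum>i<j. e (r - 1 - i))" using sum_list_take_nth[of j B] B j by simp
    also have "\<dots> = (\<Sum>i\<in>{r - j..<r}. e i)"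
      by (rule sum.reindex_bij_witness[of _ "\<lambda>i. r - 1 - i" "\<lambda>i. r - 1 - i"]) (use j in auto)
    also have "\<dots> = (\<Sum>i<r. e i) - (\<Sum>i<r - j. e i)"
    proof -
      have u: "{..<r} = {..<r - j} \<union> {r - j..<r}" by auto
      have "(\<Sum>i<r. e i) = (\<Sum>i<r - j. e i) + (\<Sum>i\<in>{r - j..<r}. e i)"
        unfolding u by (rule sum.union_disjoint) auto
      then show ?thesis by simp
    qed
    finally show ?thesis .
  qed
  have totB: "sum_list B = (\<Sum>i<r. e i)" using tB[of r] B by simp
  have tA: "sum_list (take j ?A) = (\<Sum>i\<in>\<pi> ` {..<j}. w i)" "card (\<pi> ` {..<j}) = j" "\<pi> ` {..<j} \<subseteq> {..<r}" if j: "j \<le> r" for j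
  proof -
    have inj: "inj_on \<pi> {..<j}" using \<pi> j by (auto simp: bij_betw_def inj_on_def)
    have "sum_list (take j ?A) = (\<Sum>i<j. w (\<pi> i))" using sum_list_take_nth[of j ?A] A j by simp
    then show "sum_list (take j ?A) = (\<Sum>i\<in>\<pi> ` {..<j}. w i)" using sum.reindex[OF inj, of w] by simp
    show "card (\<pi> ` {..<j}) = j" using card_image[OF inj] by simp
    show "\<pi> ` {..<j} \<subseteq> {..<r}" using \<pi> j by (auto simp: bij_betw_def)
  qed
  have compl: "(\<Sum>i\<in>{..<r} - S. w i) = (\<Sum>i<r. w i) - (\<Sum>i\<in>S. w i)" "card ({..<r} - S) = r - card S" if "S \<subseteq> {..<r}" for S
    using that finite_subset[OF that] by (simp_all add: sum_diff card_Diff_subset)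
  \<comment> \<open>sorting \<open>H\<close> in ascending order puts the largest values of \<open>w\<close> first in \<open>?A\<close>\<close>
  have top: "(\<Sum>i\<in>S. w i) \<le> sum_list (take (card S) ?A)" if S: "S \<subseteq> {..<r}" for S
  proof -
    define S' where "S' = {i. i < r \<and> \<pi> i \<in> S}"
    have S': "S' \<subseteq> {..<r}" unfolding S'_def by auto
    have im: "\<pi> ` S' = S"
    proof
      show "\<pi> ` S' \<subseteq> S" unfolding S'_def by blast
      show "S \<subseteq> \<pi> ` S'"
      proof
        fix x assume x: "x \<in> S"
        then have "x \<in> \<pi> ` {..<r}" using S bij_betw_imp_surj_on[OF \<pi>] by blast
        then show "x \<in> \<pi> ` S'" using x unfolding S'_def by blast
      qed
    qed
    have inj: "inj_on \<pi> S'" using \<pi> S' by (auto simp: bij_betw_def intro: inj_on_subset)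
    have "(\<Sum>i\<in>S. w i) = (\<Sum>i\<in>S'. w (\<pi> i))" unfolding im[symmetric] by (simp add: sum.reindex[OF inj])
    also have "\<dots> = (\<Sum>i\<in>S'. ?A ! i)" by (intro sum.cong) (use S' A in auto)
    also have "\<dots> \<le> (\<Sum>i<card S'. ?A ! i)"
      by (rule sum_le_initial_sum[OF _ S']) (use S' finite_subset anti in auto)
    also have "card S' = card S" using card_image[OF inj] im by simp
    also have "(\<Sum>i<card S. ?A ! i) = sum_list (take (card S) ?A)"
      by (rule sum_list_take_nth[symmetric]) (use card_mono[OF _ S] H in simp)
    finally show ?thesis .
  qed
  show ?thesis
  proof (intro iffI conjI allI impI)
    assume m: "majorized_by ?A B"
    show tot: "(\<Sum>i<r. e i) = (\<Sum>i<r. w i)" using m totA totB unfolding majorized_by_def by simp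
    fix T assume T: "T \<subseteq> {..<r}"
    have cT: "card T \<le> r" using card_mono[OF _ T] by simp
    define j where "j = r - card T"
    have le: "sum_list (take j ?A) \<le> sum_list (take j B)"
    proof -
      consider "j = 0" | "j = r" | "j \<in> {1..length ?A - 1}" using A(1) unfolding j_def by fastforce
      then show ?thesis
      proof cases
        case 2
        then show ?thesis using tot totA totB A(1) B by simp
      next
        case 3
        then show ?thesis using m unfolding majorized_by_def by blast
      qed simp
    qed
    have "(\<Sum>i<r. w i) - (\<Sum>i\<in>T. w i) \<le> sum_list (take j ?A)"
      using top[of "{..<r} - T"] compl[OF T] unfolding j_def by auto
    moreover have "r - j = card T" using cT unfolding j_def by simp
    ultimately show "(\<Sum>i<card T. e i) \<le> (\<Sum>i\<in>T. w i)" using le tB[of j] tot unfolding j_def by simp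
  next
    assume R: "(\<forall>T. T \<subseteq> {..<r} \<longrightarrow> (\<Sum>i<card T. e i) \<le> (\<Sum>i\<in>T. w i)) \<and> (\<Sum>i<r. e i) = (\<Sum>i<r. w i)"
    have "sum_list (take j ?A) \<le> sum_list (take j B)" if j: "j \<le> r" for j
    proof -
      have "(\<Sum>i<r - j. e i) \<le> (\<Sum>i\<in>{..<r} - \<pi> ` {..<j}. w i)"
        using R[THEN conjunct1, rule_format, of "{..<r} - \<pi> ` {..<j}"] compl(2)[OF tA(3)[OF j]] tA(2)[OF j] by auto
      then show ?thesis using compl(1)[OF tA(3)[OF j]] tA(1)[OF j] tB[OF j] R by simp
    qed
    then show "majorized_by ?A B" unfolding majorized_by_def using R A(1) B(1) totA totB by auto
  qed
qed

theorem theorem5p5: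
  fixes m n r d :: nat
    and \<alpha> :: "'a::field poly list"
    and f k l ds vs g :: "nat list"
  assumes "0 < m" and "0 < n" and "0 < r" and "r \<le> min m n"
    and "length \<alpha> = r" and "\<forall>a\<in>set \<alpha>. lead_coeff a = 1"
    and "\<forall>i. Suc i < r \<longrightarrow> \<alpha> ! i dvd \<alpha> ! Suc i"
    and "length f = r" and "is_partition (rev f)"
    and "length k = r" and "is_partition k"
    and "length l = r" and "is_partition l"
    and "length ds = n - r" and "is_partition ds"
    and "length vs = m - r" and "is_partition vs"
    and "g = rev (sort (map2 (+) (rev k) l))"
  shows "let cond_a = (sum_list vs = sum_list k \<and> sum_list ds = sum_list l);
             cond_b = (f ! 0 = 0);
             cond_c = majorized_by
                        (map (\<lambda>x. int d - int x) (rev g))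
                        (map2 (\<lambda>a e. int (degree a) + int e) (rev \<alpha>) (rev f))
         in (\<forall>A\<in>carrier_mat m n. has_structural_data A r d \<alpha> f k l ds vs \<longrightarrow>
               cond_a \<and> cond_b \<and> cond_c) \<and>
            ((\<forall>p::'a poly. 0 < degree p \<longrightarrow> (\<exists>x. poly p x = 0)) \<longrightarrow>
               cond_a \<and> cond_b \<and> cond_c \<longrightarrow>
               (\<exists>A\<in>carrier_mat m n. has_structural_data A r d \<alpha> f k l ds vs))"
proof -
  have rm: "r \<le> m" "r \<le> n" using assms(4) by auto
  let ?H = "map2 (+) (rev k) l" and ?B = "map2 (\<lambda>a e. int (degree a) + int e) (rev \<alpha>) (rev f)"
  let ?e = "\<lambda>i. int (degree (\<alpha> ! i)) + int (f ! i)"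
  have Hi: "int d - int (?H ! i) = int d - int (k ! (r - 1 - i)) - int (l ! i)" if "i < r" for i
    using that assms by (simp add: rev_nth)
  have Bi: "?B ! i = ?e (r - 1 - i)" if "i < r" for i using that assms by (simp add: rev_nth)
  have maj: "majorized_by (map (\<lambda>x. int d - int x) (rev g)) ?B \<longleftrightarrow>
      (\<forall>T. T \<subseteq> {..<r} \<longrightarrow> (\<Sum>i<card T. ?e i) \<le> (\<Sum>i\<in>T. int d - int (k ! (r - 1 - i)) - int (l ! i))) \<and>
      (\<Sum>i<r. ?e i) = (\<Sum>i<r. int d - int (k ! (r - 1 - i)) - int (l ! i))"
  proof -
    have "rev g = sort ?H" using assms(18) by simp
    then show ?thesis
      by (simp only:, intro majorized_by_sort_iff) (use Bi Hi assms in auto)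
  qed
  show ?thesis
    unfolding Let_def maj
  proof (intro conjI ballI impI)
    fix A :: "'a poly mat" assume A: "A \<in> carrier_mat m n" and data: "has_structural_data A r d \<alpha> f k l ds vs"
    interpret structured_matrix A m n r d \<alpha> f k l ds vs
      by unfold_locales (use A data assms rm in auto)
    show "sum_list vs = sum_list k" "sum_list ds = sum_list l" by (rule condition_a)+
    show "f ! 0 = 0" by (rule condition_b)
    show "\<forall>T. T \<subseteq> {..<r} \<longrightarrow> (\<Sum>i<card T. ?e i) \<le> (\<Sum>i\<in>T. int d - int (k ! (r - 1 - i)) - int (l ! i))"
      using condition_c(1) by blast
    show "(\<Sum>i<r. ?e i) = (\<Sum>i<r. int d - int (k ! (r - 1 - i)) - int (l ! i))" by (rule condition_c(2))
  next
    assume ac: "\<forall>p::'a poly. 0 < degree p \<longrightarrow> (\<exists>x. poly p x = 0)"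
      and c: "(sum_list vs = sum_list k \<and> sum_list ds = sum_list l) \<and> f ! 0 = 0 \<and>
        (\<forall>T. T \<subseteq> {..<r} \<longrightarrow> (\<Sum>i<card T. ?e i) \<le> (\<Sum>i\<in>T. int d - int (k ! (r - 1 - i)) - int (l ! i))) \<and>
        (\<Sum>i<r. ?e i) = (\<Sum>i<r. int d - int (k ! (r - 1 - i)) - int (l ! i))"
    show "\<exists>A\<in>carrier_mat m n. has_structural_data A r d \<alpha> f k l ds vs"
    proof (rule structured_matrix_exists[OF _ assms(3) rm assms(5,8,10,12,14,16,9,11,13,15,17,6,7)])
      show "\<exists>x. poly p x = 0" if "0 < degree p" for p :: "'a poly" using ac that by blast
      show "sum_list vs = sum_list k" using c by blast
      show "sum_list ds = sum_list l" using c by blast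
      show "f ! 0 = 0" using c by blast
      show "(\<Sum>i<r. ?e i) = (\<Sum>i<r. int d - int (k ! (r - 1 - i)) - int (l ! i))" using c by blast
      show "(\<Sum>i<card T. ?e i) \<le> (\<Sum>i\<in>T. int d - int (k ! (r - 1 - i)) - int (l ! i))" if "T \<subseteq> {..<r}" for T
        using c[THEN conjunct2, THEN conjunct2, THEN conjunct1] that by blast
    qed
  qed
qed

end
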